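(* Let $\Delta$ be the $n$-simplex. (i) $\mathcal S_\star(\Delta)\subseteq\mathcal C_\star(\Delta)$ and $\mathcal S(\Delta)\subseteq\mathcal C(\Delta)$. (ii) $\mathcal C_\star(\Delta)\subseteq[\mathcal S_\star(\Delta)]$ and $\mathcal C(\Delta)\subseteq[\mathcal S(\Delta)]$, where $[\mathcal S_\star(\Delta)]$ is the domination closure in $\mathcal R_\star(\Delta)$ and $[\mathcal S(\Delta)]$ the domination closure in $\mathcal R(\Delta)$. In fact, for every $f\in\mathcal C_\star(\Delta)$ there is $g\in\mathcal C_\star(\Delta)$ such that $f\circ g$ is a composition of elementary selections or an identity map; and for every $f\in\mathcal C(\Delta)$ there is $g\in\mathcal C(\Delta)$ such that $f\circ g$ is a composition of elementary selections or an identity map.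
   Context: $\Delta=[\{0,\dots,n\}]$ is the complex of non-empty subsets of $\{0,\dots,n\}$. For complexes: $\beta C$ is the barycentric subdivision (vertices: faces of $C$; faces: non-empty chains), $\beta f(\sigma)=f_*(\sigma)$ for simplicial $f$; an elementary selection is $s\colon\beta C\to C$ with $s(\sigma)\in\sigma$. Stellar notions (moves, balls, spheres, manifolds, boundary $\partial M$ = faces whose link is not a stellar sphere) are the standard Alexander–Newman ones. A stellar $n$-simplex is a family $A=(A_X:X\in\Delta)$ of complexes with $A=A_{\{0,\dots,n\}}$ a stellar $n$-ball, each $A_X$ a stellar $(|X|-1)$-ball, $A_{X\cap Y}=A_X\cap A_Y$ ($A_\emptyset=\emptyset$), and $\partial A_X=\bigcup_{Z\subsetneq X}A_Z$; $\beta^kA=(\beta^kA_X)$, and $\beta^k\Delta$ is identified with $(\beta^k[X]:X\in\Delta)$. A face-preserving map $f\colon B\to A$ is a simplicial map with $f_*(B_X)=A_X$ for all $X$; $f_X$ is the restriction to $B_X$. $\mathcal R_\star(\Delta)$: all face-preserving maps between stellar $n$-simplexes; $\mathcal R(\Delta)$: its full subcategory on objects $\beta^k\Delta$. For a stellar $n$-simplex $A$, $\mathcal S(A)$ is the smallest family containing all elementary selections $\beta^{k+1}A\to\beta^kA$ and $1_A$, closed under composition and $f\mapsto\beta f$; $\mathcal S_\star(\Delta)=\bigcup_A\mathcal S(A)$, and $\mathcal S(\Delta)$ is the case $A=\Delta$. For simplicial $f\colon B\to A$ and $\sigma\in A$, $D(\sigma,f)=\{\{\tau_0\subseteq\dots\subseteq\tau_k\}\in\beta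 B:\sigma\subseteq f_*(\tau_0)\}$; a simplicial map $f\colon M\to N$ of stellar manifolds is cellular if each $D(\sigma,f)$, $\sigma\in N$, is a stellar ball. $\mathcal C_\star(\Delta)$: face-preserving maps between stellar $n$-simplexes with every $f_X$ cellular; $\mathcal C(\Delta)$: those between objects $\beta^k\Delta$. Domination: $\mathcal F$ is dominating in a set $X$ if $g\circ f\in X$ for composable $f\in\mathcal F$, $g\in X$, and for each $g'\in X$ there is $g''\in X$ with $g'\circ g''\in\mathcal F$; $[\mathcal F]$ (in an ambient category $\mathcal E$) is the union of all $X\subseteq\mathcal E$ in which $\mathcal F$ is dominating. *)

theory Defs
  imports "HOL-Library.FSet" "HOL-Library.FuncSet"
begin

section \<open>Abstract simplicial complexes\<close>

text \<open>A complex is the finite set of its non-empty faces; its vertex set is \<open>\<Union>K\<close>.\<close>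

definition abs_complex :: "'v set set \<Rightarrow> bool" where
  "abs_complex K \<longleftrightarrow> finite K \<and> (\<forall>\<sigma>\<in>K. finite \<sigma> \<and> \<sigma> \<noteq> {}) \<and>
     (\<forall>\<sigma>\<in>K. \<forall>\<tau>. \<tau> \<subseteq> \<sigma> \<and> \<tau> \<noteq> {} \<longrightarrow> \<tau> \<in> K)"

definition full_simplex :: "'v set \<Rightarrow> 'v set set" where
  "full_simplex V = {\<sigma>. \<sigma> \<subseteq> V \<and> finite \<sigma> \<and> \<sigma> \<noteq> {}}"

definition simplex_boundary :: "'v set \<Rightarrow> 'v set set" where
  "simplex_boundary V = full_simplex V - {V}"

definition link :: "'v set set \<Rightarrow> 'v set \<Rightarrow> 'v set set" where
  "link K \<sigma> = {\<tau> \<in> K. \<tau> \<inter> \<sigma> = {} \<and> \<tau> \<union> \<sigma> \<in> K}"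

text \<open>The empty set counts as a face in forming a join, so that joining with \<open>{}\<close> has no effect.\<close>

definition join :: "'v set set \<Rightarrow> 'v set set \<Rightarrow> 'v set set" where
  "join K L = {\<sigma> \<union> \<tau> | \<sigma> \<tau>. \<sigma> \<in> insert {} K \<and> \<tau> \<in> insert {} L} - {{}}"

definition simplicial_map :: "'v set set \<Rightarrow> 'w set set \<Rightarrow> ('v \<Rightarrow> 'w) \<Rightarrow> bool" where
  "simplicial_map K L f \<longleftrightarrow> (\<forall>\<sigma>\<in>K. f ` \<sigma> \<in> L)"

section \<open>Stellar theory\<close>

definition starring :: "'v set set \<Rightarrow> 'v set \<Rightarrow> 'v \<Rightarrow> 'v set set" where
  "starring K \<sigma> a = (K - {\<tau> \<in> K. \<sigma> \<subseteq> \<tau>}) \<union>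
     join (full_simplex {a}) (join (simplex_boundary \<sigma>) (link K \<sigma>))"

inductive stellar_move :: "'v set set \<Rightarrow> 'v set set \<Rightarrow> bool" where
  star: "abs_complex K \<Longrightarrow> \<sigma> \<in> K \<Longrightarrow> a \<notin> \<Union>K \<Longrightarrow> stellar_move K (starring K \<sigma> a)"
| iso: "abs_complex K \<Longrightarrow> inj_on f (\<Union>K) \<Longrightarrow> stellar_move K ((\<lambda>\<sigma>. f ` \<sigma>) ` K)"

definition stellar_equivalent :: "'v set set \<Rightarrow> 'v set set \<Rightarrow> bool" where
  "stellar_equivalent = equivclp stellar_move"

text \<open>Dimensions are integers: the empty complex is the sphere of dimension \<open>-1\<close>; balls have
  dimension at least \<open>0\<close>.\<close>

definition stellar_ball :: "int \<Rightarrow> 'v set set \<Rightarrow> bool" where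
  "stellar_ball d K \<longleftrightarrow> (\<exists>V. finite V \<and> V \<noteq> {} \<and> int (card V) = d + 1 \<and>
     stellar_equivalent (full_simplex V) K)"

definition stellar_sphere :: "int \<Rightarrow> 'v set set \<Rightarrow> bool" where
  "stellar_sphere d K \<longleftrightarrow> (\<exists>V. finite V \<and> V \<noteq> {} \<and> int (card V) = d + 2 \<and>
     stellar_equivalent (simplex_boundary V) K)"

definition stellar_manifold :: "int \<Rightarrow> 'v set set \<Rightarrow> bool" where
  "stellar_manifold d M \<longleftrightarrow> abs_complex M \<and>
     (\<forall>v\<in>\<Union>M. stellar_sphere (d - 1) (link M {v}) \<or> stellar_ball (d - 1) (link M {v}))"

definition manifold_boundary :: "'v set set \<Rightarrow> 'v set set" where
  "manifold_boundary M = {\<sigma> \<in> M. \<not> (\<exists>d. stellar_sphere d (link M \<sigma>))}"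

section \<open>Barycentric subdivision\<close>

text \<open>A universe of vertices closed under forming faces, so that barycentric subdivision can be
  iterated within one type: \<open>Pt i\<close> are the vertices of the standard simplex, \<open>Lab x\<close> are further
  arbitrary vertices, and \<open>Bary \<sigma>\<close> is the face \<open>\<sigma>\<close> regarded as a vertex.\<close>

datatype 'a vertex = Pt nat | Lab 'a | Bary (bary_face: "'a vertex fset")

definition bary :: "'a vertex set \<Rightarrow> 'a vertex" where
  "bary \<sigma> = Bary (Abs_fset \<sigma>)"

definition sd :: "'a vertex set set \<Rightarrow> 'a vertex set set" where
  "sd K = {bary ` c | c. c \<subseteq> K \<and> finite c \<and> c \<noteq> {} \<and> chain_subset c}"

definition sd_map :: "('a vertex \<Rightarrow> 'a vertex) \<Rightarrow> 'a vertex \<Rightarrow> 'a vertex" where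
  "sd_map f v = bary (f ` fset (bary_face v))"

definition elementary_selection :: "'a vertex set set \<Rightarrow> ('a vertex \<Rightarrow> 'a vertex) \<Rightarrow> bool" where
  "elementary_selection K s \<longleftrightarrow> simplicial_map (sd K) K s \<and> (\<forall>\<sigma>\<in>K. s (bary \<sigma>) \<in> \<sigma>)"

text \<open>\<open>\<Inter>c\<close> is the least element of the finite non-empty chain \<open>c\<close>.\<close>

definition dual_cell ::
  "'a vertex set \<Rightarrow> 'a vertex set set \<Rightarrow> ('a vertex \<Rightarrow> 'a vertex) \<Rightarrow> 'a vertex set set" where
  "dual_cell \<sigma> K f =
     {bary ` c | c. c \<subseteq> K \<and> finite c \<and> c \<noteq> {} \<and> chain_subset c \<and> \<sigma> \<subseteq> f ` (\<Inter>c)}"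

definition cellular ::
  "'a vertex set set \<Rightarrow> 'a vertex set set \<Rightarrow> ('a vertex \<Rightarrow> 'a vertex) \<Rightarrow> bool" where
  "cellular M N f \<longleftrightarrow> (\<exists>d. stellar_manifold d M) \<and> (\<exists>d. stellar_manifold d N) \<and>
     simplicial_map M N f \<and> (\<forall>\<sigma>\<in>N. \<exists>d. stellar_ball d (dual_cell \<sigma> M f))"

section \<open>Stellar simplexes\<close>

type_synonym 'v family = "nat set \<Rightarrow> 'v set set"

text \<open>Families indexed by the faces of the \<open>n\<close>-simplex take the value \<open>{}\<close> at every other index.
  In particular the value at the empty set is \<open>{}\<close>.\<close>

definition stellar_simplex :: "nat \<Rightarrow> 'v family \<Rightarrow> bool" where
  "stellar_simplex n A \<longleftrightarrow>
     (\<forall>X. X \<notin> full_simplex {0..n} \<longrightarrow> A X = {}) \<and>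
     (\<forall>X\<in>full_simplex {0..n}. stellar_ball (int (card X) - 1) (A X)) \<and>
     (\<forall>X\<in>full_simplex {0..n}. \<forall>Y\<in>full_simplex {0..n}. A (X \<inter> Y) = A X \<inter> A Y) \<and>
     (\<forall>X\<in>full_simplex {0..n}. manifold_boundary (A X) = (\<Union>Z\<in>{Z. Z \<subset> X}. A Z))"

text \<open>For a stellar \<open>n\<close>-simplex \<open>A\<close> this is \<open>A {0..n}\<close>, since \<open>A X = A X \<inter> A {0..n}\<close>.\<close>

definition total :: "'v family \<Rightarrow> 'v set set" where
  "total A = (\<Union>X. A X)"

definition sd_family :: "'a vertex family \<Rightarrow> 'a vertex family" where
  "sd_family A X = sd (A X)"

definition std_simplex :: "nat \<Rightarrow> 'a vertex family" where
  "std_simplex n X = (if X \<subseteq> {0..n} then full_simplex (Pt ` X) else {})"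

section \<open>Face-preserving maps\<close>

text \<open>An arrow is a vertex map together with its source and target; the vertex map is made
  unique by being extensional on the vertices of the source.\<close>

record 'v arrow =
  src :: "'v family"
  tgt :: "'v family"
  fn :: "'v \<Rightarrow> 'v"

definition arrow_comp :: "'v arrow \<Rightarrow> 'v arrow \<Rightarrow> 'v arrow"  (infixl \<open>\<odot>\<close> 70) where
  "g \<odot> f = \<lparr>src = src f, tgt = tgt g, fn = compose (\<Union>(total (src f))) (fn g) (fn f)\<rparr>"

definition composable :: "'v arrow \<Rightarrow> 'v arrow \<Rightarrow> bool" where
  "composable g f \<longleftrightarrow> src g = tgt f"

definition arrow_id :: "'v family \<Rightarrow> 'v arrow" where
  "arrow_id A = \<lparr>src = A, tgt = A, fn = restrict (\<lambda>v. v) (\<Union>(total A))\<rparr>"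

definition arrow_sd :: "'a vertex arrow \<Rightarrow> 'a vertex arrow" where
  "arrow_sd f = \<lparr>src = sd_family (src f), tgt = sd_family (tgt f),
     fn = restrict (sd_map (fn f)) (\<Union>(total (sd_family (src f))))\<rparr>"

definition R_star :: "nat \<Rightarrow> 'v arrow set" where
  "R_star n = {f. stellar_simplex n (src f) \<and> stellar_simplex n (tgt f) \<and>
     fn f \<in> extensional (\<Union>(total (src f))) \<and>
     simplicial_map (total (src f)) (total (tgt f)) (fn f) \<and>
     (\<forall>X\<in>full_simplex {0..n}. (\<lambda>\<sigma>. fn f ` \<sigma>) ` src f X = tgt f X)}"

definition std_objects :: "nat \<Rightarrow> 'a vertex family set" where
  "std_objects n = {(sd_family ^^ k) (std_simplex n) | k. True}"

definition R_std :: "nat \<Rightarrow> 'a vertex arrow set" where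
  "R_std n = {f \<in> R_star n. src f \<in> std_objects n \<and> tgt f \<in> std_objects n}"

definition C_star :: "nat \<Rightarrow> 'a vertex arrow set" where
  "C_star n = {f \<in> R_star n. \<forall>X\<in>full_simplex {0..n}. cellular (src f X) (tgt f X) (fn f)}"

definition C_std :: "nat \<Rightarrow> 'a vertex arrow set" where
  "C_std n = {f \<in> C_star n. src f \<in> std_objects n \<and> tgt f \<in> std_objects n}"

section \<open>Selections\<close>

text \<open>The elementary selections from the \<open>(k+1)\<close>-st to the \<open>k\<close>-th subdivision of \<open>A\<close>, for all \<open>k\<close>.\<close>

definition elem_selections :: "'a vertex family \<Rightarrow> 'a vertex arrow set" where
  "elem_selections A = {s. \<exists>k. src s = (sd_family ^^ Suc k) A \<and> tgt s = (sd_family ^^ k) A \<and>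
     fn s \<in> extensional (\<Union>(total (src s))) \<and> elementary_selection (total (tgt s)) (fn s)}"

inductive_set selections :: "'a vertex family \<Rightarrow> 'a vertex arrow set" for A where
  elem: "s \<in> elem_selections A \<Longrightarrow> s \<in> selections A"
| ident: "arrow_id A \<in> selections A"
| comp: "g \<in> selections A \<Longrightarrow> f \<in> selections A \<Longrightarrow> composable g f \<Longrightarrow> g \<odot> f \<in> selections A"
| sd: "f \<in> selections A \<Longrightarrow> arrow_sd f \<in> selections A"

inductive_set elem_selection_comps :: "'a vertex family \<Rightarrow> 'a vertex arrow set" for A where
  elem: "s \<in> elem_selections A \<Longrightarrow> s \<in> elem_selection_comps A"
| comp: "g \<in> elem_selection_comps A \<Longrightarrow> f \<in> elem_selection_comps A \<Longrightarrow> composable g f \<Longrightarrow>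
    g \<odot> f \<in> elem_selection_comps A"

definition S_star :: "nat \<Rightarrow> 'a vertex arrow set" where
  "S_star n = (\<Union>A\<in>{A. stellar_simplex n A}. selections A)"

definition S_std :: "nat \<Rightarrow> 'a vertex arrow set" where
  "S_std n = selections (std_simplex n)"

section \<open>Domination\<close>

definition dominating :: "'v arrow set \<Rightarrow> 'v arrow set \<Rightarrow> bool" where
  "dominating F X \<longleftrightarrow>
     (\<forall>f\<in>F. \<forall>g\<in>X. composable g f \<longrightarrow> g \<odot> f \<in> X) \<and>
     (\<forall>g'\<in>X. \<exists>g''\<in>X. composable g' g'' \<and> g' \<odot> g'' \<in> F)"

definition dom_closure :: "'v arrow set \<Rightarrow> 'v arrow set \<Rightarrow> 'v arrow set" where
  "dom_closure E F = \<Union>{X. X \<subseteq> E \<and> dominating F X}"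

end

theory Submission
  imports Defs "HOL-Combinatorics.Transposition" "HOL-Library.Infinite_Typeclass"
begin

text \<open>Let \<open>f : A \<rightarrow> B\<close> be cellular and face-preserving. The dual cells of \<open>f\<close>, one for every face \<open>X\<close> of the
simplex and every face of \<open>B\<^sub>X\<close>, decompose \<open>\<beta>A\<close> into balls whose boundaries are the unions of the smaller
cells. Replacing the cells by cones over their boundaries (Alexander's trick) turns \<open>\<beta>A\<close> into an order complex that depends
on \<open>B\<close> only, and doing the same for the identity of \<open>B\<close> gives a path of stellar moves from \<open>\<beta>B\<close> to
\<open>\<beta>A\<close> over \<open>\<beta>B\<close>. Its steps are retractions \<open>r\<close> that send the new vertex of a starred face to a vertex of that
face. Each \<open>r\<close> is cellular, and every path above gives closure of cellular maps under composition and \<open>\<beta>\<close> and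
cellularity of selections. For domination, follow the path: an inverse move composes the dominating map with
\<open>r\<close>; for a move \<open>K \<mapsto> K'\<close> one uses that an elementary selection \<open>\<beta>K \<rightarrow> K\<close> factors through a cellular map
\<open>\<beta>K \<rightarrow> K'\<close>, and that selections lift along simplicial maps.

The moves have to be carried out relative to the boundary of a cell. \<open>Gw K E\<close> says that, in every link at a face of
\<open>E\<close>, the complex can be moved to a cone over \<open>E\<close> without touching the faces of \<open>E\<close>; this is invariant under stellar moves and holds for a ball and
its boundary. Complexes are taken with the empty face.\<close>

section \<open>Complexes with the empty face\<close>

text \<open>The obstacle is the passage from one cell to a whole complex. A path that protects only
  the faces of a boundary \<open>E\<close> may star a face whose vertices all lie in
  \<open>E\<close> but which is not in \<open>E\<close>; in a larger complex that face may also
  occur outside the cell, and the move then changes more than the cell. \<open>cW\<close> removes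
  this: after forward moves that make \<open>E\<close> full, the path protects all sets of vertices
  of \<open>E\<close>. Collars produce such a path; they need re-coning in the links of boundary
  vertices, whence the condition on all links in \<open>Gw\<close> and the induction on dimension.
  Cellularity is expressed by labels. A vertex carries a stratum and a face of the target, coded as
  one set; a face carries the union of the labels of its vertices; the faces with label at most
  \<open>q\<close> form the cell of \<open>q\<close>. A star move that gives the new vertex the
  label of the starred face respects all cells at once, and the retraction to a vertex with the same
  target face commutes with the map read off from the labels. So cellularity travels along a path
  step by step, with and against the star moves.\<close>

definition cx :: "'v set set => bool" where
 "cx K \<longleftrightarrow> finite K & {} \<in> K & (\<forall>si\<in>K. finite si) & (\<forall>si\<in>K. \<forall>ta. ta <= si --> ta \<in> K)"

definition dn :: "'v set set => bool" where
 "dn S \<longleftrightarrow> (\<forall>si\<in>S. \<forall>ta. ta <= si --> ta \<in> S)"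

text \<open>Given by membership, without joins and links, so that equalities between iterated
  starrings reduce to a case distinction on a few special vertices. For \<open>a\<close> outside
  \<open>K\<close>, the faces through \<open>a\<close> are the sets \<open>insert a rh\<close> with
  \<open>rh\<close> in \<open>ob si K\<close>.\<close>

definition st :: "'v set => 'v => 'v set set => 'v set set" where
 "st si a K = {rh. ~ si <= rh & (if a \<in> rh then rh - {a} Un si \<in> K else rh \<in> K)}"

definition lk :: "'v set => 'v set set => 'v set set" where
 "lk A K = {rh. rh Int A = {} & rh Un A \<in> K}"

definition cst :: "'v set => 'v set set => 'v set set" where
 "cst A K = {rh. rh Un A \<in> K}"

text \<open>The join of the boundary of \<open>A\<close> with the link of \<open>A\<close> (see
  \<open>ob_jn\<close>): the part of the closed star that starring at \<open>A\<close> cones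
  off.\<close>

definition ob :: "'v set => 'v set set => 'v set set" where
 "ob A K = {rh. ~ A <= rh & rh Un A \<in> K}"

text \<open>Membership ignores \<open>b\<close>; this is the geometric cone with apex
  \<open>b\<close> when \<open>b\<close> is not a vertex of \<open>Q\<close>.\<close>

definition cone :: "'v => 'v set set => 'v set set" where
 "cone b Q = {rh. rh - {b} \<in> Q}"

text \<open>The join of complexes with disjoint vertex sets. Splitting a face by the vertices of
  \<open>J\<close> avoids existential quantifiers.\<close>

definition jn :: "'v set set => 'v set set => 'v set set" where
 "jn J K = {rh. rh Int \<Union>J \<in> J & rh - \<Union>J \<in> K}"

lemma cx_finite: "cx K ==> finite K"
 and cx_empty [simp]: "cx K ==> {} \<in> K"
 and cx_face_finite: "cx K ==> si \<in> K ==> finite si"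
 and cx_sub: "cx K ==> si \<in> K ==> ta <= si ==> ta \<in> K"
 by (auto simp: cx_def)

lemma cx_finite_vertices: "cx K ==> finite (\<Union>K)"
 by (auto simp: cx_def)

lemma cx_dn: "cx K ==> dn K"
 by (auto simp: cx_def dn_def)

lemma dn_sub: "dn S ==> si \<in> S ==> ta <= si ==> ta \<in> S"
 by (auto simp: dn_def)

lemma cxI:
 assumes "finite W" "\<And>si. si \<in> K ==> si <= W" "{} \<in> K" "\<And>si ta. si \<in> K ==> ta <= si ==> ta \<in> K"
 shows "cx K"
proof -
 have "K <= Pow W" using assms(2) by auto
 then have "finite K" using assms(1) by (meson finite_Pow_iff finite_subset)
 moreover have "\<forall>si\<in>K. finite si" using assms(1,2) finite_subset by blast
 ultimately show ?thesis using assms(3,4) by (auto simp: cx_def)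
qed

lemma cx_Un: "cx K ==> cx L ==> cx (K Un L)"
 by (auto simp: cx_def)

lemma dn_Un: "dn K ==> dn L ==> dn (K Un L)"
 by (auto simp: dn_def)

lemma dn_Pow [simp]: "dn (Pow V)"
 by (auto simp: dn_def)

lemma cx_Int: "cx K ==> dn L ==> {} \<in> L ==> cx (K Int L)"
 by (auto simp: cx_def dn_def)

lemma cx_Pow: "finite V ==> cx (Pow V)"
 by (auto simp: cx_def intro: finite_subset)

lemma cx_sub_insertD: "cx K ==> insert x si \<in> K ==> si \<in> K"
 by (erule cx_sub) auto

lemma not_in_vertex [simp]: "b ~: \<Union>K ==> insert b rh ~: K"
 by auto

lemma cx_vertex: "cx K ==> v \<in> \<Union>K \<longleftrightarrow> {v} \<in> K"
 by (auto intro: cx_sub)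

lemma cx_st:
 assumes "cx K" "si \<in> K" "si ~= {}"
 shows "cx (st si a K)"
proof (rule cxI[of "insert a (\<Union>K)"])
 show "finite (insert a (\<Union>K))" using cx_finite_vertices[OF assms(1)] by simp
 show "{} \<in> st si a K" using assms by (auto simp: st_def)
 fix rh assume r: "rh \<in> st si a K"
 then show "rh <= insert a (\<Union>K)" by (auto simp: st_def split: if_splits)
 fix ta assume t: "ta <= rh"
 show "ta \<in> st si a K"
 proof (cases "a \<in> rh")
  case True
  then have k: "rh - {a} Un si \<in> K" using r by (auto simp: st_def)
  have "ta - {a} Un si \<in> K" by (rule cx_sub[OF assms(1) k]) (use t in auto)
  moreover have "ta \<in> K" if "a ~: ta" by (rule cx_sub[OF assms(1) k]) (use t that in auto)
  ultimately show ?thesis using r t by (auto simp: st_def)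
 next
  case False
  then show ?thesis using r t cx_sub[OF assms(1)] by (auto simp: st_def)
 qed
qed

lemma st_vertices: "\<Union>(st si a K) <= insert a (\<Union>K)"
 by (auto simp: st_def split: if_splits)

lemma st_vertices':
 assumes "cx K" "si \<in> K" "si ~= {}" "a ~: \<Union>K"
 shows "\<Union>(st si a K) \<supseteq> \<Union>K - (if \<exists>v. si = {v} then si else {})" "a \<in> \<Union>(st si a K)"
proof -
 show "a \<in> \<Union>(st si a K)" using assms by (auto simp: st_def intro!: exI[of _ "{a}"])
 show "\<Union>(st si a K) \<supseteq> \<Union>K - (if \<exists>v. si = {v} then si else {})"
 proof
  fix v assume v: "v \<in> \<Union>K - (if \<exists>v. si = {v} then si else {})"
  then have "{v} \<in> K" using assms(1) cx_vertex by (metis DiffD1)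
  moreover have "~ si <= {v}" using v assms(3) by (auto split: if_splits)
  moreover have "v ~= a" using v assms(4) by auto
  ultimately have "{v} \<in> st si a K" by (auto simp: st_def)
  then show "v \<in> \<Union>(st si a K)" by blast
 qed
qed

lemma cx_lk: assumes "cx K" "A \<in> K" shows "cx (lk A K)"
proof (rule cxI[of "\<Union>K"])
 show "finite (\<Union>K)" using assms cx_finite_vertices by blast
 show "{} \<in> lk A K" using assms by (simp add: lk_def)
 fix rh assume r: "rh \<in> lk A K"
 then show "rh <= \<Union>K" by (auto simp: lk_def)
 fix ta assume t: "ta <= rh"
 have "ta Un A \<in> K" by (rule cx_sub[OF assms(1), of "rh Un A"]) (use r t in \<open>auto simp: lk_def\<close>)
 then show "ta \<in> lk A K" using r t by (auto simp: lk_def)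
qed

lemma cx_cst: assumes "cx K" "A \<in> K" shows "cx (cst A K)"
proof (rule cxI[of "\<Union>K"])
 show "finite (\<Union>K)" using assms cx_finite_vertices by blast
 show "{} \<in> cst A K" using assms by (simp add: cst_def)
 fix rh assume r: "rh \<in> cst A K"
 then show "rh <= \<Union>K" by (auto simp: cst_def)
 fix ta assume t: "ta <= rh"
 have "ta Un A \<in> K" by (rule cx_sub[OF assms(1), of "rh Un A"]) (use r t in \<open>auto simp: cst_def\<close>)
 then show "ta \<in> cst A K" by (auto simp: cst_def)
qed

lemma cx_ob: assumes "cx K" "A \<in> K" "A ~= {}" shows "cx (ob A K)"
proof -
 have "ob A K = cst A K Int {rh. ~ A <= rh}" by (auto simp: ob_def cst_def)
 moreover have "dn {rh. ~ A <= rh}" "{} \<in> {rh. ~ A <= rh}" using assms(3) by (auto simp: dn_def)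
 ultimately show ?thesis using cx_Int[OF cx_cst[OF assms(1,2)]] by simp
qed

lemma cx_cone: assumes "cx Q" shows "cx (cone b Q)"
proof (rule cxI[of "insert b (\<Union>Q)"])
 show "finite (insert b (\<Union>Q))" using assms cx_finite_vertices by auto
 show "{} \<in> cone b Q" using assms by (simp add: cone_def)
 fix rh assume r: "rh \<in> cone b Q"
 then show "rh <= insert b (\<Union>Q)" by (auto simp: cone_def)
 fix ta assume t: "ta <= rh"
 have "ta - {b} \<in> Q" by (rule cx_sub[OF assms(1), of "rh - {b}"]) (use r t in \<open>auto simp: cone_def\<close>)
 then show "ta \<in> cone b Q" by (auto simp: cone_def)
qed

lemma cx_jn: assumes "cx J" "cx K" shows "cx (jn J K)"
proof (rule cxI[of "\<Union>J Un \<Union>K"])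
 show "finite (\<Union>J Un \<Union>K)" using assms cx_finite_vertices by (metis finite_UnI)
 show "{} \<in> jn J K" using assms by (simp add: jn_def)
 fix rh assume r: "rh \<in> jn J K"
 then show "rh <= \<Union>J Un \<Union>K" by (auto simp: jn_def)
 fix ta assume t: "ta <= rh"
 have "ta Int \<Union>J \<in> J" by (rule cx_sub[OF assms(1), of "rh Int \<Union>J"]) (use r t in \<open>auto simp: jn_def\<close>)
 moreover have "ta - \<Union>J \<in> K" by (rule cx_sub[OF assms(2), of "rh - \<Union>J"]) (use r t in \<open>auto simp: jn_def\<close>)
 ultimately show "ta \<in> jn J K" by (auto simp: jn_def)
qed

lemma cone_vertices: "cx Q ==> \<Union>(cone b Q) = insert b (\<Union>Q)"
proof -
 assume q: "cx Q"
 have "insert b rh \<in> cone b Q" if "rh \<in> Q" for rh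
  using that cx_sub[OF q that, of "rh - {b}"] by (auto simp: cone_def)
 moreover have "{b} \<in> cone b Q" using q by (simp add: cone_def)
 ultimately have "insert b (\<Union>Q) <= \<Union>(cone b Q)" by blast
 then show ?thesis by (auto simp: cone_def)
qed

lemma cone_supset: "cx Q ==> Q <= cone b Q"
 by (auto simp: cone_def intro: cx_sub)

lemma cone_insert [simp]: "b ~: \<Union>Q ==> insert b rh \<in> cone b Q \<longleftrightarrow> rh - {b} \<in> Q"
 by (simp add: cone_def)

section \<open>Stellar moves relative to a protected family\<close>

text \<open>\<open>S\<close> is the family of protected faces. It may contain faces of a surrounding
  complex that are not in \<open>K\<close>, so the new vertex has to avoid the vertices of
  \<open>S\<close> as well as those of \<open>K\<close>.\<close>

definition smv :: "'v set set => 'v set set => 'v set set => bool" where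
 "smv S K K' \<longleftrightarrow> (\<exists>si a. cx K & si \<in> K & si ~= {} & si ~: S & a ~: \<Union>K & a ~: \<Union>S & K' = st si a K)"

abbreviation seq :: "'v set set => 'v set set => 'v set set => bool" where
 "seq S \<equiv> equivclp (smv S)"

lemma smvI:
 "cx K ==> si \<in> K ==> si ~= {} ==> si ~: S ==> a ~: \<Union>K ==> a ~: \<Union>S ==> smv S K (st si a K)"
 unfolding smv_def by blast

lemma smv_cx: "smv S K K' ==> cx K & cx K'"
 unfolding smv_def by (elim exE conjE) (simp add: cx_st)

lemma seq_refl [simp]: "seq S K K"
 by (simp add: equivclp_def)

lemma seq_sym: "seq S K K' ==> seq S K' K"
 by (rule equivclp_sym)

lemma seq_trans [trans]: "seq S K K' ==> seq S K' K'' ==> seq S K K''"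
 by (rule transpD[OF transp_equivclp])

lemma seq1: "smv S K K' ==> seq S K K'"
 by (simp add: r_into_equivclp)

lemma seq1': "smv S K' K ==> seq S K K'"
 by (simp add: seq1 seq_sym)

lemma fwd_seq: "(smv S)\<^sup>*\<^sup>* K K' ==> seq S K K'"
 by (rule predicate2D[OF rtranlcp_le_equivclp])

lemma seq_lift:
 assumes "seq S K K'" "\<And>K K'. smv S K K' ==> seq S' (f K) (f K')"
 shows "seq S' (f K) (f K')"
 using assms(1)
proof (induction rule: equivclp_induct)
 case base show ?case by simp
next
 case (step y z)
 from step(2) have "seq S' (f y) (f z)"
  using assms(2)[of y z] seq_sym[OF assms(2)[of z y]] by blast
 with step(3) show ?case by (rule seq_trans)
qed

lemma seq_cx: assumes "seq S K K'" shows "cx K \<longleftrightarrow> cx K'"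
 using assms by (induction rule: equivclp_induct) (auto dest: smv_cx)

lemma smv_mono: "S <= S' ==> smv S' K K' ==> smv S K K'"
 unfolding smv_def by blast

lemma seq_mono: "seq S' K K' ==> S <= S' ==> seq S K K'"
 by (erule seq_lift[where f = "%x. x"]) (rule seq1, erule (1) smv_mono)

lemma st_supset: assumes "E <= K" "dn E" "si ~: E" "a ~: \<Union>E" shows "E <= st si a K"
 using assms by (auto simp: st_def dest: dn_sub)

subsection \<open>Transport and renaming\<close>

abbreviation im :: "('v => 'w) => 'v set set => 'w set set" where
 "im p K \<equiv> (%si. p ` si) ` K"

lemma in_im: "bij p ==> rh \<in> im p K \<longleftrightarrow> inv p ` rh \<in> K"
proof
 assume p: "bij p"
 { assume "rh \<in> im p K"
  then obtain si where s: "si \<in> K" "rh = p ` si" by auto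
  then show "inv p ` rh \<in> K" using p by (simp add: bij_is_inj) }
 { assume k: "inv p ` rh \<in> K"
  have "rh = p ` (inv p ` rh)" using p by (simp add: bij_is_surj image_f_inv_f)
  then show "rh \<in> im p K" using k by blast }
qed

lemma im_im_inv: "bij p ==> im (inv p) (im p K) = K" "bij p ==> im p (im (inv p) K) = K"
 by (simp_all add: image_image bij_is_inj surj_f_inv_f[OF bij_is_surj])

lemma im_Un: "im p (K Un L) = im p K Un im p L"
 by blast

lemma Union_im: "\<Union>(im p K) = p ` \<Union>K"
 by blast

lemma cx_im: assumes "cx K" shows "cx (im p K)"
proof -
 have "ta \<in> im p K" if t: "ta <= p ` si" "si \<in> K" for si ta
 proof -
  have "ta = p ` (p -` ta Int si)" using t by auto
  moreover have "p -` ta Int si \<in> K" using assms t by (auto intro: cx_sub)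
  ultimately show ?thesis by blast
 qed
 then show ?thesis using assms by (auto simp: cx_def)
qed

lemma im_fix: assumes "\<And>v. v \<in> \<Union>K ==> p v = v" shows "im p K = K"
proof -
 have "p ` si = si" if "si \<in> K" for si using assms that by force
 then show ?thesis by simp
qed

lemma im_cong: assumes "\<And>v. v \<in> \<Union>K ==> p v = q v" shows "im p K = im q K"
proof -
 have "p ` si = q ` si" if "si \<in> K" for si using assms that by (intro image_cong) auto
 then show ?thesis by simp
qed

lemma im_comp: "im p (im q K) = im (p \<circ> q) K"
 by (simp add: image_image comp_def)

lemma im_st: assumes p: "bij p" shows "im p (st si a K) = st (p ` si) (p a) (im p K)"
proof (rule set_eqI)
 fix rh
 have i: "inv p ` (rh - {p a} Un p ` si) = inv p ` rh - {a} Un si"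
  using p by (simp add: image_Un image_set_diff bij_is_inj bij_imp_bij_inv)
 have r: "p ` (inv p ` rh) = rh" using p by (simp add: bij_is_surj image_f_inv_f)
 have s: "si <= inv p ` rh \<longleftrightarrow> p ` si <= rh"
  by (subst (2) r[symmetric]) (simp add: inj_image_subset_iff[OF bij_is_inj[OF p]])
 have a: "a \<in> inv p ` rh \<longleftrightarrow> p a \<in> rh"
  by (subst (2) r[symmetric]) (simp add: inj_image_mem_iff[OF bij_is_inj[OF p]])
 show "rh \<in> im p (st si a K) \<longleftrightarrow> rh \<in> st (p ` si) (p a) (im p K)"
  unfolding in_im[OF p] st_def mem_Collect_eq i s a ..
qed

lemma im_lk: assumes p: "bij p" shows "im p (lk A K) = lk (p ` A) (im p K)"
proof (rule set_eqI)
 fix rh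
 have i: "inv p ` (rh Un p ` A) = inv p ` rh Un A"
  using p by (simp add: image_Un bij_is_inj)
 have s: "inv p ` rh Int A = {} \<longleftrightarrow> rh Int p ` A = {}"
 proof -
  have "p ` (inv p ` rh Int A) = rh Int p ` A"
   using p by (simp add: image_Int[OF bij_is_inj[OF p]] bij_is_surj image_f_inv_f)
  then show ?thesis by (metis image_is_empty)
 qed
 show "rh \<in> im p (lk A K) \<longleftrightarrow> rh \<in> lk (p ` A) (im p K)"
  unfolding in_im[OF p] lk_def mem_Collect_eq i s ..
qed

lemma im_cone: assumes p: "bij p" shows "im p (cone b Q) = cone (p b) (im p Q)"
proof (rule set_eqI)
 fix rh
 have i: "inv p ` (rh - {p b}) = inv p ` rh - {b}"
  using p by (simp add: image_set_diff bij_is_inj bij_imp_bij_inv)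
 show "rh \<in> im p (cone b Q) \<longleftrightarrow> rh \<in> cone (p b) (im p Q)"
  unfolding in_im[OF p] cone_def mem_Collect_eq i ..
qed

lemma im_Pow: "bij p ==> im p (Pow V) = Pow (p ` V)"
 by (auto simp: subset_image_iff)

lemma smv_im: assumes p: "bij p" and m: "smv S K K'" shows "smv (im p S) (im p K) (im p K')"
proof -
 obtain si a where *: "cx K" "si \<in> K" "si ~= {}" "si ~: S" "a ~: \<Union>K" "a ~: \<Union>S" "K' = st si a K"
  using m by (auto simp: smv_def)
 have inj: "inj p" using p by (rule bij_is_inj)
 have "p ` si ~: im p S" using *(4) by (simp add: inj inj_image_eq_iff image_iff)
 moreover have "p a ~: \<Union>(im p K)" "p a ~: \<Union>(im p S)"
  using *(5,6) unfolding Union_im by (simp_all add: inj inj_image_mem_iff)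
 ultimately show ?thesis unfolding *(7) im_st[OF p]
  using *(1-3) by (intro smvI cx_im) auto
qed

lemma seq_im: "bij p ==> seq S K K' ==> seq (im p S) (im p K) (im p K')"
 by (erule seq_lift) (auto intro: seq1 smv_im)

text \<open>The points of \<open>W\<close> are swapped one at a time with fresh points. This moves
  the auxiliary vertices of a path off \<open>W\<close> while the vertices in \<open>A\<close>
  stay.\<close>

lemma ex_bij_avoid:
 fixes A :: "'v::infinite set"
 assumes "finite A" "finite U" "finite W" "W Int A = {}"
 shows "\<exists>p. bij p & (\<forall>v\<in>A. p v = v) & p ` U Int W = {}"
 using assms(3,4)
proof (induction W)
 case empty
 show ?case by (rule exI[of _ "%x. x"]) (auto simp: bij_betw_def)
next
 case (insert w W)
 then obtain p where p: "bij p" "\<forall>v\<in>A. p v = v" "p ` U Int W = {}" by auto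
 have "finite (insert w (A Un p ` U Un W))" using assms insert by simp
 then obtain y where y: "y ~: insert w (A Un p ` U Un W)" using infinite_UNIV ex_new_if_finite by blast
 let ?q = "Transposition.transpose w y \<circ> p"
 have "bij ?q" using p(1) by (simp add: bij_comp)
 moreover have "\<forall>v\<in>A. ?q v = v"
  using p(2) y insert.prems by (auto simp: Transposition.transpose_def)
 moreover have "?q ` U Int insert w W = {}"
  using p(3) y insert.hyps by (auto simp: Transposition.transpose_def)
 ultimately show ?case by blast
qed

definition smvA :: "'v set => 'v set set => 'v set set => 'v set set => bool" where
 "smvA W S K K' \<longleftrightarrow> smv S K K' & (\<Union>K Un \<Union>K') Int W = {}"

lemma smvA_im:
 assumes "bij p" "smvA W S K K'" shows "smvA (p ` W) (im p S) (im p K) (im p K')"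
proof -
 have "(\<Union>(im p K) Un \<Union>(im p K')) Int p ` W = p ` ((\<Union>K Un \<Union>K') Int W)"
  using assms(1) by (simp add: Union_im image_Int bij_is_inj image_Un)
 then show ?thesis using assms smv_im[OF assms(1)] by (simp add: smvA_def)
qed

lemma equivclp_lift:
 assumes "equivclp r K K'" "\<And>K K'. r K K' ==> equivclp s (f K) (f K')"
 shows "equivclp s (f K) (f K')"
 using assms(1)
proof (induction rule: equivclp_induct)
 case base show ?case by (simp add: equivclp_def)
next
 case (step y z)
 from step(2) have "equivclp s (f y) (f z)"
  using assms(2)[of y z] equivclp_sym[OF assms(2)[of z y]] by blast
 with step(3) show ?case by (rule transpD[OF transp_equivclp])
qed

lemma rtranclp_lift:
 assumes "r\<^sup>*\<^sup>* K K'" "\<And>K K'. r K K' ==> s\<^sup>*\<^sup>* (f K) (f K')"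
 shows "s\<^sup>*\<^sup>* (f K) (f K')"
 using assms(1) by induction (auto intro: assms(2) rtranclp_trans)

text \<open>A path has finitely many steps and hence meets only finitely many vertices.\<close>

lemma seq_bounded:
 assumes "seq S K K'" "cx K"
 shows "\<exists>U. finite U & (\<forall>W. W Int U = {} --> equivclp (smvA W S) K K')"
 using assms(1)
proof (induction rule: equivclp_induct)
 case base show ?case by (intro exI[of _ "{}"]) (simp add: equivclp_def)
next
 case (step y z)
 then obtain U where U: "finite U" "\<And>W. W Int U = {} ==> equivclp (smvA W S) K y" by blast
 have "cx y" "cx z" using step(2) smv_cx[of S y z] smv_cx[of S z y] by auto
 then have f: "finite (U Un \<Union>y Un \<Union>z)" using U(1) cx_finite_vertices by blast
 have "equivclp (smvA W S) K z" if "W Int (U Un \<Union>y Un \<Union>z) = {}" for W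
 proof -
  have "(\<Union>y Un \<Union>z) Int W = {}" "(\<Union>z Un \<Union>y) Int W = {}" using that by auto
  then have "smvA W S y z \<or> smvA W S z y" using step(2) by (simp add: smvA_def)
  then have "equivclp (smvA W S) y z" by (auto intro: r_into_equivclp converse_r_into_equivclp)
  moreover have "equivclp (smvA W S) K y" using U(2) that by blast
  ultimately show ?thesis by (rule transpD[OF transp_equivclp, rotated])
 qed
 with f show ?case by (intro exI[of _ "U Un \<Union>y Un \<Union>z"] conjI allI impI)
qed

lemma fwd_bounded:
 assumes "(smv S)\<^sup>*\<^sup>* K K'" "cx K"
 shows "\<exists>U. finite U & (\<forall>W. W Int U = {} --> (smvA W S)\<^sup>*\<^sup>* K K')"
 using assms(1)
proof induction
 case base show ?case by (intro exI[of _ "{}"]) simp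
next
 case (step y z)
 then obtain U where U: "finite U" "\<And>W. W Int U = {} ==> (smvA W S)\<^sup>*\<^sup>* K y" by blast
 have "cx y" "cx z" using smv_cx[OF step(2)] by auto
 then have f: "finite (U Un \<Union>y Un \<Union>z)" using U(1) cx_finite_vertices by blast
 have "(smvA W S)\<^sup>*\<^sup>* K z" if "W Int (U Un \<Union>y Un \<Union>z) = {}" for W
 proof -
  have "smvA W S y z" using step(2) that by (auto simp: smvA_def)
  moreover have "(smvA W S)\<^sup>*\<^sup>* K y" using U(2) that by blast
  ultimately show ?thesis by simp
 qed
 with f show ?case by (intro exI[of _ "U Un \<Union>y Un \<Union>z"] conjI allI impI)
qed

text \<open>Only intermediate vertices have to move: a bijection fixes the vertices of both ends and
  of \<open>S\<close> and pushes the vertices used by the path off \<open>W\<close>.\<close>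

lemma seq_avoid:
 fixes K :: "'v::infinite set set"
 assumes "seq S K K'" "cx K" "finite (\<Union>S)" "finite W" "W Int (\<Union>K Un \<Union>K' Un \<Union>S) = {}"
 shows "equivclp (smvA W S) K K'"
proof -
 obtain U where U: "finite U" "\<And>W. W Int U = {} ==> equivclp (smvA W S) K K'"
  using seq_bounded[OF assms(1,2)] by blast
 have "cx K'" using assms(1,2) seq_cx by blast
 then have "finite (\<Union>K Un \<Union>K' Un \<Union>S)" using assms(2,3) cx_finite_vertices by blast
 then obtain p where p: "bij p" "\<forall>v\<in>\<Union>K Un \<Union>K' Un \<Union>S. p v = v" "p ` U Int W = {}"
  using ex_bij_avoid[OF _ U(1) assms(4,5)] by blast
 have "inv p ` W Int U = {}"
  using p(1,3) by (auto simp: surj_f_inv_f[OF bij_is_surj])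
 then have e: "equivclp (smvA (inv p ` W) S) K K'" by (rule U(2))
 have w: "p ` (inv p ` W) = W" using p(1) by (simp add: bij_is_surj image_f_inv_f)
 have "im p K = K" "im p K' = K'" "im p S = S" using p(2) by (auto intro!: im_fix)
 then show ?thesis using equivclp_lift[OF e, of "smvA W S" "im p"] smvA_im[OF p(1), of "inv p ` W" S]
  by (simp add: w r_into_equivclp)
qed

text \<open>Unlike in \<open>seq_avoid\<close> the end cannot be kept, because its new vertices may
  lie in \<open>W\<close>; it is returned renamed by \<open>p\<close>.\<close>

lemma fwd_avoid:
 fixes K :: "'v::infinite set set"
 assumes "(smv S)\<^sup>*\<^sup>* K K'" "cx K" "finite (\<Union>S)" "finite W" "W Int (\<Union>K Un \<Union>S) = {}"
 shows "\<exists>p. bij p & (\<forall>v\<in>\<Union>K Un \<Union>S. p v = v) & (smvA W S)\<^sup>*\<^sup>* K (im p K')"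
proof -
 obtain U where U: "finite U" "\<And>W. W Int U = {} ==> (smvA W S)\<^sup>*\<^sup>* K K'"
  using fwd_bounded[OF assms(1,2)] by blast
 have "finite (\<Union>K Un \<Union>S)" using assms(2,3) cx_finite_vertices by blast
 then obtain p where p: "bij p" "\<forall>v\<in>\<Union>K Un \<Union>S. p v = v" "p ` U Int W = {}"
  using ex_bij_avoid[OF _ U(1) assms(4,5)] by blast
 have "inv p ` W Int U = {}"
  using p(1,3) by (auto simp: surj_f_inv_f[OF bij_is_surj])
 then have e: "(smvA (inv p ` W) S)\<^sup>*\<^sup>* K K'" by (rule U(2))
 have w: "p ` (inv p ` W) = W" using p(1) by (simp add: bij_is_surj image_f_inv_f)
 have "im p K = K" "im p S = S" using p(2) by (auto intro!: im_fix)
 then have "(smvA W S)\<^sup>*\<^sup>* K (im p K')"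
  using rtranclp_lift[OF e, of "smvA W S" "im p"] smvA_im[OF p(1), of "inv p ` W" S]
  by (simp add: w r_into_rtranclp)
 then show ?thesis using p(1,2) by blast
qed

subsection \<open>Moves inside a larger complex\<close>

lemma st_Un: assumes "\<And>rh. rh \<in> R ==> ~ si <= rh" "a ~: \<Union>R"
 shows "st si a (K Un R) = st si a K Un R"
 using assms by (auto simp: st_def split: if_splits)

lemma st_jn:
 assumes "si Int \<Union>J = {}" "a ~: \<Union>J"
 shows "st si a (jn J K) = jn J (st si a K)"
proof (rule set_eqI)
 fix rh
 have 1: "(rh - {a} Un si) Int \<Union>J = rh Int \<Union>J" "(rh - {a} Un si) - \<Union>J = rh - \<Union>J - {a} Un si"
  "si <= rh - \<Union>J \<longleftrightarrow> si <= rh" "a \<in> rh - \<Union>J \<longleftrightarrow> a \<in> rh" using assms by auto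
 show "rh \<in> st si a (jn J K) \<longleftrightarrow> rh \<in> jn J (st si a K)"
  unfolding st_def jn_def mem_Collect_eq 1 by auto
qed

lemma smv_Un:
 assumes "smv S K K'" "cx R" "\<And>rh. rh \<in> R ==> rh <= \<Union>S ==> rh \<in> S"
  and "(\<Union>K Un \<Union>K') Int (\<Union>R - \<Union>S) = {}"
  and "\<And>ta. ta \<in> S' ==> ta Int (\<Union>R - \<Union>S) = {} ==> ta \<in> S" "\<Union>S' <= \<Union>S Un \<Union>R"
 shows "smv S' (K Un R) (K' Un R)"
proof -
 obtain si a where *: "cx K" "si \<in> K" "si ~= {}" "si ~: S" "a ~: \<Union>K" "a ~: \<Union>S" "K' = st si a K"
  using assms(1) by (auto simp: smv_def)
 have "a \<in> \<Union>K'" using st_vertices'(2)[OF *(1-3,5)] *(7) by simp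
 then have a: "a ~: \<Union>R" using assms(4) *(6) by blast
 have n: "~ si <= rh" if "rh \<in> R" for rh
 proof
  assume s: "si <= rh"
  have "si \<in> R" using cx_sub[OF assms(2) that s] .
  moreover have "si <= \<Union>S" using s that *(2) assms(4) by blast
  ultimately show False using assms(3) *(4) by blast
 qed
 have "K' Un R = st si a (K Un R)" using st_Un[OF n a] *(7) by blast
 moreover have "si ~: S'" using assms(4,5) *(2,4) by blast
 moreover have a': "a ~: \<Union>S'" using assms(6) a *(6) by blast
 ultimately show ?thesis
  using smvI[of "K Un R" si S' a, OF cx_Un[OF *(1) assms(2)] _ *(3)] *(2,5) a a' by auto
qed

text \<open>If \<open>R\<close> meets the ends of the path only in vertices of \<open>S\<close>, and
  every face of \<open>R\<close> on these vertices is protected, then no face of \<open>R\<close>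
  contains a starred face, and starring does not see \<open>R\<close>. Intermediate vertices are
  moved off \<open>R\<close> beforehand.\<close>

lemma seq_Un:
 fixes K :: "'v::infinite set set"
 assumes "seq S K K'" "cx K" "cx R" "finite (\<Union>S)" "\<And>rh. rh \<in> R ==> rh <= \<Union>S ==> rh \<in> S"
  and "\<Union>R Int (\<Union>K Un \<Union>K') <= \<Union>S"
  and "\<And>ta. ta \<in> S' ==> ta Int (\<Union>R - \<Union>S) = {} ==> ta \<in> S" "\<Union>S' <= \<Union>S Un \<Union>R"
 shows "seq S' (K Un R) (K' Un R)"
proof -
 have "finite (\<Union>R - \<Union>S)" using cx_finite_vertices[OF assms(3)] by simp
 then have "equivclp (smvA (\<Union>R - \<Union>S) S) K K'"
  using assms(6) by (intro seq_avoid[OF assms(1,2,4)]) auto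
 then show ?thesis
 proof (rule equivclp_lift)
  fix K K' assume "smvA (\<Union>R - \<Union>S) S K K'"
  then show "seq S' (K Un R) (K' Un R)" unfolding smvA_def
   by (intro seq1 smv_Un[where S = S] assms(3,5,7,8)) auto
 qed
qed

lemma smv_jn:
 assumes "smv S K K'" "cx J" "(\<Union>K Un \<Union>K') Int \<Union>J = {}"
  and "\<And>ta. ta \<in> S' ==> ta Int \<Union>J = {} ==> ta \<in> S" "\<Union>S' <= \<Union>S Un \<Union>J"
 shows "smv S' (jn J K) (jn J K')"
proof -
 obtain si a where *: "cx K" "si \<in> K" "si ~= {}" "si ~: S" "a ~: \<Union>K" "a ~: \<Union>S" "K' = st si a K"
  using assms(1) by (auto simp: smv_def)
 have "a \<in> \<Union>K'" using st_vertices'(2)[OF *(1-3,5)] *(7) by simp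
 then have a: "a ~: \<Union>J" using assms(3) by blast
 have s: "si Int \<Union>J = {}" using *(2) assms(3) by blast
 have e: "jn J K' = st si a (jn J K)" using st_jn[OF s a] *(7) by simp
 have "si \<in> jn J K" using s *(2) assms(2) by (simp add: jn_def Diff_triv)
 moreover have "a ~: rh" if "rh \<in> jn J K" for rh
  using that a *(5) unfolding jn_def by blast
 then have "a ~: \<Union>(jn J K)" by blast
 moreover have "si ~: S'" using assms(4) s *(4) by blast
 moreover have "a ~: \<Union>S'" using assms(5) a *(6) by blast
 ultimately show ?thesis unfolding e using cx_jn[OF assms(2) *(1)] *(3) by (intro smvI)
qed

lemma seq_jn:
 fixes K :: "'v::infinite set set"
 assumes "seq S K K'" "cx K" "cx J" "finite (\<Union>S)" "\<Union>J Int (\<Union>K Un \<Union>K' Un \<Union>S) = {}"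
  and "\<And>ta. ta \<in> S' ==> ta Int \<Union>J = {} ==> ta \<in> S" "\<Union>S' <= \<Union>S Un \<Union>J"
 shows "seq S' (jn J K) (jn J K')"
proof -
 have "equivclp (smvA (\<Union>J) S) K K'"
  using assms(5) by (intro seq_avoid[OF assms(1,2,4)] cx_finite_vertices assms(3)) auto
 then show ?thesis
 proof (rule equivclp_lift)
  fix K K' assume "smvA (\<Union>J) S K K'"
  then show "seq S' (jn J K) (jn J K')" unfolding smvA_def
   by (intro seq1 smv_jn[where S = S] assms(3,6,7)) auto
 qed
qed

section \<open>Equalities between starred cones\<close>

lemma fresh_vertex: "finite W ==> \<exists>v::'v::infinite. v ~: W"
 using infinite_UNIV ex_new_if_finite by blast

text \<open>Complexes defined by membership are compared on a face free of the special vertices and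
  on its extensions by them; this leaves a propositional problem for the simplifier.\<close>

lemma split2:
 assumes "\<And>rh. b ~: rh ==> c ~: rh ==> P rh & P (insert b rh) & P (insert c rh) & P (insert b (insert c rh))"
 shows "P rh"
proof -
 let ?r = "rh - {b, c}"
 have "rh = ?r \<or> rh = insert b ?r \<or> rh = insert c ?r \<or> rh = insert b (insert c ?r)" by auto
 moreover have "P ?r & P (insert b ?r) & P (insert c ?r) & P (insert b (insert c ?r))" using assms[of ?r] by simp
 ultimately show ?thesis by (elim disjE conjE) (erule ssubst, assumption)+
qed

lemma split3:
 assumes "\<And>rh. a ~: rh ==> b ~: rh ==> c ~: rh ==> P rh & P (insert b rh) & P (insert c rh) & P (insert b (insert c rh))
  & P (insert a rh) & P (insert a (insert b rh)) & P (insert a (insert c rh)) & P (insert a (insert b (insert c rh)))"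
 shows "P rh"
proof -
 let ?r = "rh - {a, b, c}"
 let ?i = "%v ta. if v \<in> rh then insert v ta else ta"
 have e: "rh = ?i a (?i b (?i c ?r))" by auto
 have "P (?i a (?i b (?i c ta)))" if "a ~: ta" "b ~: ta" "c ~: ta" for ta
  using assms[OF that] by simp
 from this[of ?r] have "P (?i a (?i b (?i c ?r)))" by blast
 then show ?thesis by (rule ssubst[OF e])
qed

lemma not_in_vertex2 [simp]: "c ~: \<Union>K ==> insert b (insert c rh) ~: K"
 and not_in_vertex3 [simp]: "c ~: \<Union>K ==> insert a (insert b (insert c rh)) ~: K"
 by auto

lemma nv: assumes "b ~: \<Union>K" shows "insert b rh ~: K" "insert v (insert b rh) ~: K" "insert w (insert v (insert b rh)) ~: K"
 using assms by auto

lemmas st_simps = st_def cone_def cst_def ob_def subset_insert insert_Diff_if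

lemma cx_UnD: "cx Q ==> rh Un C \<in> Q ==> rh \<in> Q" "cx Q ==> rh Un C \<in> Q ==> C \<in> Q"
 by (auto elim: cx_sub)

text \<open>Starring the join of \<open>b\<close> and \<open>C\<close> in the cone over
  \<open>Q\<close> stars \<open>C\<close> in the base and leaves behind the block
  \<open>cone c (cst C Q)\<close>, which fills the space between the base and its starring.\<close>

lemma st_cone_fwd:
 assumes "cx Q" "b ~: \<Union>Q" "C \<in> Q" "c ~: \<Union>Q" "c ~= b" "c ~: \<Union>R" "\<And>rh. rh \<in> R ==> ~ insert b C <= rh"
 shows "st (insert b C) c (cone b Q Un R) = cone b (st C c Q) Un (cone c (cst C Q) Un R)"
proof (rule set_eqI)
 fix rh
 have bc: "b ~: C" "c ~: C" using assms by auto
 have r: "C <= rh ==> insert b rh ~: R" "insert b (rh Un C) ~: R" for rh using assms(7) by auto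
 note u = cx_UnD[OF assms(1)]
 have w: "C <= rh ==> rh \<in> Q ==> rh Un C \<in> Q" for rh by (simp add: Un_absorb2)
 show "rh \<in> st (insert b C) c (cone b Q Un R) \<longleftrightarrow> rh \<in> cone b (st C c Q) Un (cone c (cst C Q) Un R)"
  apply (rule split2[where b = b and c = c and rh = rh])
  apply (simp add: st_simps nv[OF assms(2)] nv[OF assms(4)] nv[OF assms(6)] bc assms(5) assms(5)[symmetric] r)
  subgoal for ta using u(1)[of ta C] w[of ta] r(1)[of ta] by blast
  done
qed

text \<open>The block left behind is the one of \<open>st_cone_fwd\<close>. Hence the two cones over
  \<open>Q\<close> and over its boundary can be compared after both have been starred.\<close>

lemma st_cone_apex:
 assumes "cx Q" "cx F" "F <= Q" "b ~: \<Union>Q" "C \<in> Q" "C ~: F" "c ~: \<Union>Q" "c ~= b" "c ~: \<Union>R" "z ~: \<Union>R" "z ~= c"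
  "Q Un cone b F <= R"
 shows "st (insert z C) c (cone z (Q Un cone b F) Un R) = cone z (st C c Q Un cone b F) Un (cone c (cst C Q) Un R)"
proof (rule set_eqI)
 fix rh
 have z: "z ~: \<Union>Q" "z ~: \<Union>F" "c ~: \<Union>F" "b ~: \<Union>F" using assms by blast+
 have bc: "b ~: C" "c ~: C" "z ~: C" using assms z by auto
 have f: "~ (C <= rh & rh - {b} \<in> F)" "(rh Un C) - {b} ~: F" for rh
  using assms(6) bc cx_sub[OF assms(2), of "rh - {b}" C] cx_sub[OF assms(2), of "rh Un C - {b}" C] by auto
 have f': "C <= rh ==> rh - {b} ~: F" for rh using f by blast
 have q: "rh \<in> Q ==> rh \<in> R" "rh - {b} \<in> F ==> rh \<in> R" for rh using assms(12) by (auto simp: cone_def)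
 have zc: "z \<in> rh ==> rh ~: R" for rh using assms(10) by auto
 note u = cx_UnD[OF assms(1)]
 have w: "C <= rh ==> rh \<in> Q ==> rh Un C \<in> Q" for rh by (simp add: Un_absorb2)
 show "rh \<in> st (insert z C) c (cone z (Q Un cone b F) Un R) \<longleftrightarrow> rh \<in> cone z (st C c Q Un cone b F) Un (cone c (cst C Q) Un R)"
  apply (rule split2[where b = z and c = c and rh = rh])
  apply (simp add: assms(8,11) assms(8)[symmetric] assms(11)[symmetric] nv[OF z(1)] nv[OF z(3)] nv[OF z(2)] nv[OF assms(7)] nv[OF assms(9)] nv[OF assms(10)] bc st_simps f)
  subgoal for ta using q[of ta] f'[of ta] u(1)[of ta C] w[of ta] by blast
  done
qed

text \<open>The cone over the starred base, and the cone over \<open>Q\<close> with the block added,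
  have the same boundary; the starrings at the edge \<open>{b, c}\<close> and at \<open>C\<close>
  give a common subdivision.\<close>

lemma st_cone_bwd:
 assumes "cx Q" "b ~: \<Union>Q" "C \<in> Q" "C ~= {}" "c ~: \<Union>Q" "c ~= b" "\<And>rh. rh \<in> R ==> ~ C <= rh" "\<And>rh. rh \<in> R ==> ~ {b, c} <= rh"
  "x ~: \<Union>Q" "x ~: \<Union>R" "x ~= b" "x ~= c"
 shows "st {b, c} x (cone b (st C c Q) Un R) = st C x (cone b Q Un (cone c (cst C Q) Un R))"
proof (rule set_eqI)
 fix rh
 have bc: "b ~: C" "c ~: C" "x ~: C" using assms by auto
 have r: "insert b (insert c rh) ~: R" "C <= rh ==> rh ~: R" "rh Un C ~: R" "insert v (rh Un C) ~: R" "insert w (insert v (rh Un C)) ~: R"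
  for rh v w using assms(7,8) by auto
 note u = cx_UnD[OF assms(1)]
 show "rh \<in> st {b, c} x (cone b (st C c Q) Un R) \<longleftrightarrow> rh \<in> st C x (cone b Q Un (cone c (cst C Q) Un R))"
  apply (rule split3[where a = x and b = b and c = c and rh = rh])
  apply (simp add: st_simps nv[OF assms(2)] nv[OF assms(5)] nv[OF assms(9)] nv[OF assms(10)] bc assms(4,6,11,12) assms(6,11,12)[symmetric] r)
  subgoal for ta using u(1)[of ta C] assms(7)[of ta] assms(7)[of "insert b ta"] assms(7)[of "insert c ta"] by blast
  done
qed

lemma st_cone_apex_bwd:
 assumes "cx Q" "cx F" "F <= Q" "b ~: \<Union>Q" "C \<in> Q" "C ~= {}" "C ~: F" "c ~: \<Union>Q" "c ~= b" "\<And>rh. rh \<in> R ==> ~ C <= rh"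
  "x ~: \<Union>Q" "x ~: \<Union>R" "x ~= z" "x ~= c" "x ~= b" "z ~: \<Union>R" "z ~: \<Union>Q" "z ~= c" "st C c Q Un cone b F <= R"
 shows "st {z, c} x (cone z (st C c Q Un cone b F) Un R) = st C x (cone z (Q Un cone b F) Un (cone c (cst C Q) Un R))"
proof (rule set_eqI)
 fix rh
 have z: "z ~: \<Union>F" "c ~: \<Union>F" "b ~: \<Union>F" "x ~: \<Union>F" using assms by blast+
 have bc: "b ~: C" "c ~: C" "z ~: C" "x ~: C" using assms by auto
 have f1: "(rh Un C) - {b} ~: F" for rh
  using assms(7) bc cx_sub[OF assms(2), of "rh Un C - {b}" C] by auto
 have f2: "C <= rh ==> rh - {b} ~: F" for rh
  using assms(7) bc cx_sub[OF assms(2), of "rh - {b}" C] by auto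
 have q1: "rh \<in> st C c Q ==> rh \<in> R" "rh - {b} \<in> F ==> rh \<in> R" for rh using assms(19) by (auto simp: cone_def)
 have q2: "c ~: rh ==> rh \<in> Q ==> ~ C <= rh ==> rh \<in> R" for rh using q1(1)[of rh] by (simp add: st_def)
 have r: "rh Un C ~: R" "insert v (rh Un C) ~: R" for rh v using assms(10) by auto
 note u = cx_UnD[OF assms(1)]
 show "rh \<in> st {z, c} x (cone z (st C c Q Un cone b F) Un R) \<longleftrightarrow> rh \<in> st C x (cone z (Q Un cone b F) Un (cone c (cst C Q) Un R))"
  apply (rule split3[where a = x and b = z and c = c and rh = rh])
  apply (simp add: st_simps nv[OF assms(4)] nv[OF assms(8)] nv[OF assms(11)] nv[OF assms(12)] nv[OF assms(16)] nv[OF assms(17)]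
    nv[OF z(1)] nv[OF z(2)] nv[OF z(4)] bc assms(6,9,13,14,15,18) assms(9,13,14,15,18)[symmetric] f1 r)
  subgoal for ta using q1(2)[of ta] q2[of ta] f2[of ta] u(1)[of ta C] assms(10)[of ta] assms(10)[of "insert c ta"] by blast
  done
qed

text \<open>If the base is itself a cone with apex \<open>w\<close>, then \<open>{b, w}\<close> is
  an interior edge, and its starring is already the cone from \<open>z\<close> over the
  boundary.\<close>

lemma st_cone_cone:
 assumes "cx F" "w ~: \<Union>F" "b ~: \<Union>F" "b ~= w" "z ~: \<Union>F" "z ~= b" "z ~= w" "z ~: \<Union>R" "\<And>rh. rh \<in> R ==> ~ {b, w} <= rh"
  "cone w F Un cone b F <= R"
 shows "st {b, w} z (cone b (cone w F) Un R) = cone z (cone w F Un cone b F) Un R"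
proof (rule set_eqI)
 fix rh
 have r: "insert b (insert w rh) ~: R" "z \<in> rh ==> rh ~: R" for rh using assms(8,9) by auto
 show "rh \<in> st {b, w} z (cone b (cone w F) Un R) \<longleftrightarrow> rh \<in> cone z (cone w F Un cone b F) Un R"
  apply (rule split3[where a = z and b = b and c = w and rh = rh])
  apply (simp add: st_def cone_def insert_Diff_if nv[OF assms(2)] nv[OF assms(3)] nv[OF assms(5)] nv[OF assms(8)] assms(4,6,7) assms(4,6,7)[symmetric] r(1))
  done
qed

lemma notin_Un: "c ~: \<Union>K ==> c ~: \<Union>L ==> c ~: \<Union>(K Un L)"
 by blast

lemma notin_cone: "c ~: \<Union>Q ==> c ~= b ==> c ~: \<Union>(cone b Q)"
 unfolding cone_def by blast

lemma notin_st: "c ~: \<Union>K ==> c ~= a ==> c ~: \<Union>(st si a K)"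
 using st_vertices[of si a K] by blast

lemma notin_lk: "c ~: \<Union>K ==> c ~: \<Union>(lk A K)"
 unfolding lk_def by blast

section \<open>Cones over cells\<close>

text \<open>The second stage stars only faces with a vertex off \<open>E\<close>, as
  \<open>PC_bwd\<close> demands. In the first stage, where only \<open>E\<close> is protected, moves
  run forwards, and re-coning is pulled back along them by \<open>PC_fwd\<close>.\<close>

definition cW :: "'v set set => 'v set set => bool" where
 "cW K E \<longleftrightarrow> (\<exists>K' w. (smv E)\<^sup>*\<^sup>* K K' & w ~: \<Union>E & seq (Pow (\<Union>E)) K' (cone w E))"

text \<open>The setting for exchanging the apex of \<open>cone b Q\<close>: \<open>R\<close> is the
  rest of the complex, which contains the boundary \<open>Q Un cone b F\<close> of the cone; the
  protected family \<open>S\<close> contains \<open>R\<close> and meets the cone only in that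
  boundary; \<open>z\<close> is the new apex.\<close>

definition pctx :: "'v set set => 'v set set => 'v => 'v => 'v set set => 'v set set => bool" where
 "pctx Q F b z R S \<longleftrightarrow> cx R & R <= S & dn S & finite (\<Union>S) & b ~: \<Union>Q & Q Un cone b F <= R &
  S Int cone b Q <= Q Un cone b F & z ~: \<Union>S"

text \<open>Re-coning: the cone over \<open>Q\<close> may be replaced by the cone from a new apex
  over its boundary. All contexts are quantified over, because each inductive step enlarges
  \<open>R\<close> and \<open>S\<close> by a block.\<close>

definition PC :: "'v set set => 'v set set => bool" where
 "PC Q F \<longleftrightarrow> (\<forall>b z R S. pctx Q F b z R S --> seq S (cone b Q Un R) (cone z (Q Un cone b F) Un R))"

lemma PCD: "PC Q F ==> pctx Q F b z R S ==> seq S (cone b Q Un R) (cone z (Q Un cone b F) Un R)"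
 by (auto simp: PC_def)

section \<open>Re-coning under renaming and star moves\<close>

lemma pctx_im:
 assumes p: "bij p" and c: "pctx Q F b z R S"
 shows "pctx (im p Q) (im p F) (p b) (p z) (im p R) (im p S)"
proof -
 have inj: "inj p" using p by (rule bij_is_inj)
 have "dn (im p S)"
  unfolding dn_def
 proof (intro ballI allI impI)
  fix si ta assume "si \<in> im p S" "ta <= si"
  then show "ta \<in> im p S" using c unfolding in_im[OF p] pctx_def by (auto intro: dn_sub image_mono)
 qed
 moreover have "im p S Int cone (p b) (im p Q) = im p (S Int cone b Q)"
  unfolding im_cone[OF p, symmetric] by (rule image_Int[symmetric]) (metis injI inj_image_eq_iff inj)
 ultimately show ?thesis using c unfolding pctx_def im_cone[OF p, symmetric] Union_im
  by (auto simp: inj_image_mem_iff[OF inj] cx_im im_cone[OF p, symmetric] simp del: image_Int)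
qed

lemma PC_im:
 assumes p: "bij p" and f: "\<And>v. v \<in> \<Union>F ==> p v = v" and h: "PC Q F"
 shows "PC (im p Q) F"
 unfolding PC_def
proof (intro allI impI)
 fix b z R S assume c: "pctx (im p Q) F b z R S"
 let ?q = "inv p"
 have q: "bij ?q" using p by (rule bij_imp_bij_inv)
 have "im ?q F = F" by (rule im_fix) (metis f bij_inv_eq_iff p)
 then have "pctx Q F (?q b) (?q z) (im ?q R) (im ?q S)"
  using pctx_im[OF q c] im_im_inv(1)[OF p] by simp
 from seq_im[OF p PCD[OF h this]]
 show "seq S (cone b (im p Q) Un R) (cone z (im p Q Un cone b F) Un R)"
  using im_fix[of F p, OF f] by (simp add: im_Un im_cone[OF p] im_im_inv[OF p] surj_f_inv_f[OF bij_is_surj[OF p]])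
qed

lemma pctx_b: assumes "pctx Q F b z R S" "cx F" shows "b \<in> \<Union>S" "z ~= b" "{b} \<in> S"
proof -
 have "{b} \<in> cone b F" using assms(2) by (simp add: cone_def)
 then show "{b} \<in> S" using assms(1) by (auto simp: pctx_def)
 then show "b \<in> \<Union>S" "z ~= b" using assms(1) by (auto simp: pctx_def)
qed

text \<open>One star move on each side (\<open>st_cone_fwd\<close> and \<open>st_cone_apex\<close>)
  leads to the corresponding cones for \<open>st C c Q\<close>, with the same block \<open>T\<close>
  left over. The block is absorbed into the context.\<close>

lemma pc_fwd_at:
 assumes Q: "cx Q" "cx F" "F <= Q" "C \<in> Q" "C ~= {}" "C ~: F"
  and c: "c ~: \<Union>Q" "c ~: \<Union>S" "c ~= z"
  and p: "pctx Q F b z R S"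
 defines "T \<equiv> cone c (cst C Q)"
 shows "pctx (st C c Q) F b z (T Un R) (T Un S)" (is ?A)
  and "seq (T Un S) (cone b (st C c Q) Un (T Un R)) (cone z (st C c Q Un cone b F) Un (T Un R)) ==>
   seq S (cone b Q Un R) (cone z (Q Un cone b F) Un R)"
proof -
 note b = pctx_b[OF p Q(2)]
 have p': "cx R" "R <= S" "dn S" "finite (\<Union>S)" "b ~: \<Union>Q" "Q Un cone b F <= R" "z ~: \<Union>S"
  using p unfolding pctx_def by blast+
 have "S Int cone b (Q) <= Q Un cone b F" using p unfolding pctx_def by blast
 then have pS: "\<And>rh. rh \<in> S ==> rh - {b} \<in> Q ==> rh \<in> Q \<or> rh - {b} \<in> F" by (auto simp: cone_def)
 have cb: "c ~= b" "c ~: \<Union>R" "z ~: \<Union>R" "z ~: \<Union>Q" using b c p' by auto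
 have bC: "insert b C ~: S"
 proof
  assume "insert b C \<in> S"
  moreover have "b ~: C" using p'(5) Q(4) by auto
  ultimately show False using pS[of "insert b C"] Q(4,6) p'(5) by auto
 qed
 then have nR: "~ insert b C <= rh" if "rh \<in> R" for rh using that p'(2) dn_sub[OF p'(3)] by blast
 have T: "cx T" unfolding T_def using Q by (simp add: cx_cone cx_cst)
 have VT: "\<Union>T <= insert c (\<Union>Q)" unfolding T_def by (auto simp: cone_def cst_def)
 have T_in: "rh \<in> T \<longleftrightarrow> rh - {c} Un C \<in> Q" for rh by (simp add: T_def cone_def cst_def)
 show ?A
  unfolding pctx_def
 proof (intro conjI)
  show "cx (T Un R)" "dn (T Un S)" "T Un R <= T Un S" using T p' by (auto intro: cx_Un dn_Un cx_dn)
  show "finite (\<Union>(T Un S))" using cx_finite_vertices[OF T] p'(4) by auto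
  show "b ~: \<Union>(st C c Q)" using st_vertices[of C c Q] p'(5) cb by auto
  show "z ~: \<Union>(T Un S)" by (rule notin_Un) (use VT c cb in blast, rule p'(7))
  have "rh \<in> T Un R" if r: "rh \<in> st C c Q" for rh
   using r p'(6) unfolding Un_iff T_in st_def by (auto split: if_splits)
  then show "st C c Q Un cone b F <= T Un R" using p'(6) by auto
  show "(T Un S) Int cone b (st C c Q) <= st C c Q Un cone b F"
  proof
   fix rh assume r: "rh \<in> (T Un S) Int cone b (st C c Q)"
   show "rh \<in> st C c Q Un cone b F"
   proof (cases "b \<in> rh")
    case False
    then show ?thesis using r by (simp add: cone_def)
   next
    case True
    then have "rh ~: T" using VT p'(5) cb(1) by blast
    then have s: "rh \<in> S" using r by auto
    then have "c ~: rh" using c(2) by auto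
    then have "rh - {b} \<in> Q" using r by (auto simp: cone_def st_def)
    then show ?thesis using pS[OF s] True p'(5) by (auto simp: cone_def)
   qed
  qed
 qed
 assume h: "seq (T Un S) (cone b (st C c Q) Un (T Un R)) (cone z (st C c Q Un cone b F) Un (T Un R))"
 have cxQF: "cx (cone b Q Un R)" "cx (cone z (Q Un cone b F) Un R)" using Q(1,2) p'(1) by (simp_all add: cx_Un cx_cone)
 have "smv S (cone b Q Un R) (st (insert b C) c (cone b Q Un R))"
  by (rule smvI[OF cxQF(1) _ _ bC notin_Un[OF notin_cone[OF c(1) cb(1)] cb(2)] c(2)]) (use p'(5) Q(4) in \<open>auto simp: cone_def\<close>)
 then have 1: "seq S (cone b Q Un R) (cone b (st C c Q) Un (T Un R))"
  using st_cone_fwd[OF Q(1) p'(5) Q(4) c(1) cb(1,2) nR] unfolding T_def by (simp add: seq1)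
 have zC: "z ~: C" using cb(4) Q(4) by auto
 have "insert z C ~: S" using p'(7) by auto
 moreover have "c ~: \<Union>F" using c(1) Q(3) by blast
 then have "c ~: \<Union>(cone z (Q Un cone b F) Un R)"
  using c cb by (intro notin_Un notin_cone)
 moreover have "insert z C \<in> cone z (Q Un cone b F) Un R" using zC Q(4) by (simp add: cone_def)
 ultimately have "smv S (cone z (Q Un cone b F) Un R) (st (insert z C) c (cone z (Q Un cone b F) Un R))"
  using cxQF c(2) by (intro smvI) auto
 then have 2: "seq S (cone z (st C c Q Un cone b F) Un (T Un R)) (cone z (Q Un cone b F) Un R)"
  using st_cone_apex[OF Q(1-3) p'(5) Q(4,6) c(1) cb(1,2,3) c(3)[symmetric] p'(6)] unfolding T_def by (simp add: seq1')
 have "seq S (cone b (st C c Q) Un (T Un R)) (cone z (st C c Q Un cone b F) Un (T Un R))"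
  by (rule seq_mono[OF h]) auto
 then show "seq S (cone b Q Un R) (cone z (Q Un cone b F) Un R)"
  by (rule seq_trans[OF seq_trans[OF 1] 2])
qed

text \<open>Here \<open>T\<close> fills the gap between the starred base and \<open>Q\<close>. Each
  common subdivision involves a starring at \<open>C\<close> itself, so \<open>C\<close> must not be
  protected.\<close>

lemma pc_bwd_at:
 fixes Q :: "'v::infinite set set"
 assumes Q: "cx Q" "cx F" "F <= Q" "C \<in> Q" "C ~= {}"
  and c: "c ~: \<Union>Q" "C ~: S" "z ~: \<Union>Q"
  and p: "pctx (st C c Q) F b z R S"
 defines "T \<equiv> cone c (cst C Q)"
 shows "pctx Q F b z (T Un R) (T Un S)" (is ?A)
  and "seq (T Un S) (cone b Q Un (T Un R)) (cone z (Q Un cone b F) Un (T Un R)) ==>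
   seq S (cone b (st C c Q) Un R) (cone z (st C c Q Un cone b F) Un R)"
proof -
 note b = pctx_b[OF p Q(2)]
 have p': "cx R" "R <= S" "dn S" "finite (\<Union>S)" "b ~: \<Union>(st C c Q)" "st C c Q Un cone b F <= R" "z ~: \<Union>S"
  using p unfolding pctx_def by blast+
 have "S Int cone b (st C c Q) <= st C c Q Un cone b F" using p unfolding pctx_def by blast
 then have pS: "\<And>rh. rh \<in> S ==> rh - {b} \<in> st C c Q ==> rh \<in> st C c Q \<or> rh - {b} \<in> F" by (auto simp: cone_def)
 have cF: "C ~: F"
 proof
  assume "C \<in> F"
  then have "C - {b} \<in> F" by (rule cx_sub[OF Q(2)]) auto
  then show False using p' c(2) by (auto simp: cone_def)
 qed
 have cst: "c \<in> \<Union>(st C c Q)" using st_vertices'(2)[OF Q(1,4,5) c(1)] .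
 then have cb: "c ~= b" "c ~= z" "z ~: \<Union>R" using p' by auto
 have nS: "~ C <= rh" if "rh \<in> S" for rh using that dn_sub[OF p'(3)] c(2) by blast
 have bQ: "b ~: \<Union>Q"
 proof
  assume "b \<in> \<Union>Q"
  then have "{b} \<in> Q" using cx_vertex[OF Q(1)] by blast
  moreover have "{b} ~: st C c Q" using p'(5) by blast
  ultimately show False using nS[OF b(3)] cb by (auto simp: st_def)
 qed
 have bC: "b ~: C" "c ~: C" "z ~: C" using bQ Q(4) c by auto
 have bcS: "{b, c} ~: S"
 proof
  assume "{b, c} \<in> S"
  moreover have "{c} \<in> st C c Q" using Q(4,5) bC by (auto simp: st_def)
  ultimately have "{b, c} \<in> st C c Q \<or> {c} \<in> F" using pS[of "{b, c}"] cb by (simp add: insert_Diff_if)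
  then show False using p'(5) Q(3) c(1) by blast
 qed
 have nR: "~ {b, c} <= rh" "~ C <= rh" if "rh \<in> R" for rh using that p'(2) dn_sub[OF p'(3)] bcS nS by blast+
 have T: "cx T" unfolding T_def using Q by (simp add: cx_cone cx_cst)
 have VT: "\<Union>T <= insert c (\<Union>Q)" unfolding T_def by (auto simp: cone_def cst_def)
 have T_in: "rh \<in> T \<longleftrightarrow> rh - {c} Un C \<in> Q" for rh by (simp add: T_def cone_def cst_def)
 show ?A
  unfolding pctx_def
 proof (intro conjI)
  show "cx (T Un R)" "dn (T Un S)" "T Un R <= T Un S" using T p' by (auto intro: cx_Un dn_Un cx_dn)
  show "finite (\<Union>(T Un S))" using cx_finite_vertices[OF T] p'(4) by auto
  show "b ~: \<Union>Q" by (rule bQ)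
  show "z ~: \<Union>(T Un S)" by (rule notin_Un) (use VT c cb in blast, rule p'(7))
  have "rh \<in> T Un R" if r: "rh \<in> Q" for rh
  proof (cases "C <= rh")
   case True
   moreover have "c ~: rh" using r c(1) by auto
   ultimately show ?thesis using r by (simp add: T_in Un_absorb2)
  next
   case False
   moreover have "c ~: rh" using r c(1) by auto
   ultimately have "rh \<in> st C c Q" using r by (simp add: st_def)
   then show ?thesis using p'(6) by blast
  qed
  then show "Q Un cone b F <= T Un R" using p'(6) by auto
  show "(T Un S) Int cone b Q <= Q Un cone b F"
  proof
   fix rh assume r: "rh \<in> (T Un S) Int cone b Q"
   show "rh \<in> Q Un cone b F"
   proof (cases "b \<in> rh")
    case False
    then show ?thesis using r by (simp add: cone_def)
   next
    case True
    then have "rh ~: T" using VT bQ cb(1) by blast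
    then have s: "rh \<in> S" using r by auto
    have "rh - {b} \<in> Q" using r by (simp add: cone_def)
    moreover have "c ~: rh - {b}" using calculation c(1) by auto
    moreover have "~ C <= rh - {b}" using nS[OF s] by auto
    ultimately have "rh - {b} \<in> st C c Q" by (auto simp: st_def)
    then show ?thesis using pS[OF s] True p'(5) by (auto simp: cone_def)
   qed
  qed
 qed
 assume h: "seq (T Un S) (cone b Q Un (T Un R)) (cone z (Q Un cone b F) Un (T Un R))"
 have "finite (insert z (insert b (insert c (\<Union>Q Un \<Union>S))))" using cx_finite_vertices[OF Q(1)] p'(4) by simp
 then obtain x where x0: "x ~: insert z (insert b (insert c (\<Union>Q Un \<Union>S)))" using fresh_vertex by blast
 then have x: "x ~: \<Union>Q" "x ~: \<Union>S" "x ~= z" "x ~= b" "x ~= c" "x ~: \<Union>R" "x ~: \<Union>T" "x ~: \<Union>F" using p'(2) VT Q(3) by auto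
 have st: "cx (st C c Q)" using Q by (intro cx_st)
 have V: "\<Union>(st C c Q) <= insert c (\<Union>Q)" by (rule st_vertices)
 have c1: "cx (cone b (st C c Q) Un R)" "cx (cone b Q Un (T Un R))" "cx (cone z (Q Un cone b F) Un (T Un R))"
  "cx (cone z (st C c Q Un cone b F) Un R)" using Q(1,2) p'(1) st T by (simp_all add: cx_Un cx_cone)
 have x1: "x ~: \<Union>(cone b (st C c Q) Un R)" "x ~: \<Union>(cone b Q Un (T Un R))" "x ~: \<Union>(cone z (Q Un cone b F) Un (T Un R))"
  "x ~: \<Union>(cone z (st C c Q Un cone b F) Un R)"
  using x by - (intro notin_Un notin_cone notin_st; assumption)+
 have m1: "{b, c} \<in> cone b (st C c Q)" "{z, c} \<in> cone z (st C c Q Un cone b F)"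
  using Q(4,5) bC cb by (auto simp: cone_def st_def insert_Diff_if)
 have m2: "C \<in> cone b Q" "C \<in> cone z (Q Un cone b F)" using Q(4) bC by (simp_all add: cone_def)
 have zS: "{z, c} ~: S" using p'(7) by blast
 have "smv S (cone b (st C c Q) Un R) (st {b, c} x (cone b (st C c Q) Un R))"
  using c1(1) m1(1) bcS x1(1) x(2) by (intro smvI) auto
 moreover have "smv S (cone b Q Un (T Un R)) (st C x (cone b Q Un (T Un R)))"
  using c1(2) m2(1) Q(5) c(2) x1(2) x(2) by (intro smvI) auto
 moreover have "st {b, c} x (cone b (st C c Q) Un R) = st C x (cone b Q Un (T Un R))"
  unfolding T_def by (rule st_cone_bwd[OF Q(1) bQ Q(4,5) c(1) cb(1) nR(2) nR(1) x(1,6,4,5)])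
 ultimately have 1: "seq S (cone b (st C c Q) Un R) (cone b Q Un (T Un R))"
  using seq_trans[OF seq1 seq1'] by metis
 have "smv S (cone z (st C c Q Un cone b F) Un R) (st {z, c} x (cone z (st C c Q Un cone b F) Un R))"
  using c1(4) m1(2) zS x1(4) x(2) by (intro smvI) auto
 moreover have "smv S (cone z (Q Un cone b F) Un (T Un R)) (st C x (cone z (Q Un cone b F) Un (T Un R)))"
  using c1(3) m2(2) Q(5) c(2) x1(3) x(2) by (intro smvI) auto
 moreover have "st {z, c} x (cone z (st C c Q Un cone b F) Un R) = st C x (cone z (Q Un cone b F) Un (T Un R))"
  unfolding T_def by (rule st_cone_apex_bwd[OF Q(1-3) bQ Q(4,5) cF c(1) cb(1) nR(2) x(1,6,3,5,4) cb(3) c(3) cb(2)[symmetric] p'(6)])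
 ultimately have 2: "seq S (cone z (Q Un cone b F) Un (T Un R)) (cone z (st C c Q Un cone b F) Un R)"
  using seq_trans[OF seq1 seq1'] by metis
 have "seq S (cone b Q Un (T Un R)) (cone z (Q Un cone b F) Un (T Un R))"
  by (rule seq_mono[OF h]) auto
 then show "seq S (cone b (st C c Q) Un R) (cone z (st C c Q Un cone b F) Un R)"
  by (rule seq_trans[OF seq_trans[OF 1] 2])
qed


text \<open>The new vertex takes over the link of \<open>y\<close>. Renaming a vertex is therefore a
  star move.\<close>

lemma st_vertex:
 assumes "cx Q" "{y} \<in> Q" "c ~: \<Union>Q"
 shows "st {y} c Q = im (Transposition.transpose y c) Q"
proof (rule set_eqI)
 fix rh
 have yc: "y ~= c" using assms by auto
 let ?p = "Transposition.transpose y c"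
 have e: "rh \<in> im ?p Q \<longleftrightarrow> ?p ` rh \<in> Q" by (simp add: in_im)
 have f: "rh' ~: Q" if "c \<in> rh'" for rh' using assms(3) that by auto
 have g: "?p ` rh' = rh'" if "y ~: rh'" "c ~: rh'" for rh'
  using that by (auto simp: Transposition.transpose_def image_iff)
 show "rh \<in> st {y} c Q \<longleftrightarrow> rh \<in> im ?p Q"
  unfolding e
  apply (rule split2[where b = y and c = c and rh = rh])
  using yc by (auto simp: st_def g f insert_Diff_if)
qed

lemma transpose_fix: "v ~= x ==> v ~= y ==> Transposition.transpose x y v = v"
 by (simp add: Transposition.transpose_def)

lemma PC_fwd:
 fixes Q :: "'v::infinite set set"
 assumes Q: "cx Q" "cx F" "F <= Q" "C \<in> Q" "C ~= {}" "C ~: F" "c ~: \<Union>Q" and h: "PC (st C c Q) F"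
 shows "PC Q F"
 unfolding PC_def
proof (intro allI impI)
 fix b z R S assume p: "pctx Q F b z R S"
 have "finite (insert z (insert c (\<Union>Q Un \<Union>S)))" using cx_finite_vertices[OF Q(1)] p by (simp add: pctx_def)
 then obtain c' where "c' ~: insert z (insert c (\<Union>Q Un \<Union>S))" using fresh_vertex by blast
 then have c': "c' ~: \<Union>Q" "c' ~: \<Union>S" "c' ~= z" by auto
 let ?p = "Transposition.transpose c c'"
 have fx: "?p v = v" if "v \<in> \<Union>Q" for v using that Q(7) c'(1) by (intro transpose_fix) auto
 have "?p ` C = C" using fx Q(4) by force
 moreover have "im ?p Q = Q" using fx by (rule im_fix)
 ultimately have "im ?p (st C c Q) = st C c' Q" by (simp add: im_st)
 moreover have "PC (im ?p (st C c Q)) F" using fx Q(3) by (intro PC_im h) auto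
 ultimately have "PC (st C c' Q) F" by simp
 then show "seq S (cone b Q Un R) (cone z (Q Un cone b F) Un R)"
  using pc_fwd_at[OF Q(1-6) c' p] by (auto dest: PCD)
qed

text \<open>\<open>C\<close> may be protected although it is no longer a face of the starred
  complex, which blocks \<open>pc_bwd_at\<close>. So a vertex \<open>y0\<close> of \<open>C\<close>
  off \<open>F\<close> is exchanged for a fresh \<open>y\<close> by \<open>pc_fwd_at\<close>: the
  renamed \<open>C\<close> contains \<open>y\<close>, hence is not in \<open>S\<close>, and it is
  not in the new block because \<open>C\<close> is not in \<open>st C c Q\<close>. This is where a
  vertex of \<open>C\<close> outside \<open>F\<close> is required.\<close>

lemma PC_bwd:
 fixes Q :: "'v::infinite set set"
 assumes Q: "cx Q" "cx F" "F <= Q" "C \<in> Q" "~ C <= \<Union>F" "c ~: \<Union>Q" and h: "PC Q F"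
 shows "PC (st C c Q) F"
proof -
 obtain y0 where y0: "y0 \<in> C" "y0 ~: \<Union>F" using Q(5) by blast
 have y0Q: "{y0} \<in> Q" "y0 \<in> \<Union>Q" using cx_sub[OF Q(1,4)] y0(1) Q(4) by auto
 have C0: "C ~= {}" using y0 by auto
 have cF: "c ~: \<Union>F" using Q by auto
 show ?thesis
 \<comment> \<open>Starring a single vertex renames it, and \<open>PC_im\<close> applies.\<close>
 proof (cases "C = {y0}")
  case True
  have "PC (im (Transposition.transpose y0 c) Q) F"
   using y0(2) cF by (intro PC_im h) (auto intro!: transpose_fix)
  then show ?thesis unfolding True st_vertex[OF Q(1) y0Q(1) Q(6)] .
 next
  case False
  show ?thesis
   unfolding PC_def
  proof (intro allI impI)
   fix b z R S assume p: "pctx (st C c Q) F b z R S"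
   let ?Q = "st C c Q"
   have cxQ: "cx ?Q" by (rule cx_st[OF Q(1,4) C0])
   have "\<nexists>v. C = {v}" using False y0(1) by auto
   then have VQ: "\<Union>Q <= \<Union>?Q" using st_vertices'(1)[OF Q(1,4) C0 Q(6)] by simp
   have zS: "z ~: \<Union>S" "finite (\<Union>S)" "\<Union>?Q <= \<Union>S" using p unfolding pctx_def by auto
   have "finite (insert z (insert c (\<Union>?Q Un \<Union>S)))" using cx_finite_vertices[OF cxQ] zS(2) by simp
   then obtain y where "y ~: insert z (insert c (\<Union>?Q Un \<Union>S))" using fresh_vertex by blast
   then have y: "y ~: \<Union>?Q" "y ~: \<Union>S" "y ~= z" "y ~= c" "y ~: \<Union>Q" using VQ by auto
   have FQ: "F <= ?Q" by (rule st_supset[OF Q(3) cx_dn[OF Q(2)]]) (use Q(5) cF in auto)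
   have y0': "{y0} \<in> ?Q" "{y0} ~: F" using False y0 y0Q Q(6) C0 by (auto simp: st_def)
   note A = pc_fwd_at[OF cxQ Q(2) FQ y0'(1) _ y0'(2) y(1-3) p]
   let ?p = "Transposition.transpose y0 y" and ?T = "cone y (cst {y0} ?Q)"
   have pc: "?p c = c" using y(4) y0Q(2) Q(6) by (intro transpose_fix) auto
   have e: "st {y0} y ?Q = st (?p ` C) c (im ?p Q)"
    unfolding st_vertex[OF cxQ y0'(1) y(1)] im_st[OF bij_transpose] pc ..
   have fF: "?p v = v" if "v \<in> \<Union>F" for v using that y0(2) y(5) Q(3) by (intro transpose_fix) auto
   have h': "PC (im ?p Q) F" by (rule PC_im[OF bij_transpose fF h])
   have "im ?p F = F" using fF by (rule im_fix)
   then have FQ1: "F <= im ?p Q" using Q(3) by (metis image_mono)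
   have c1: "c ~: \<Union>(im ?p Q)" "z ~: \<Union>(im ?p Q)"
   proof -
    have *: "v \<in> insert y (\<Union>Q)" if "v \<in> \<Union>(im ?p Q)" for v
     using that y0Q(2) unfolding Union_im by (auto simp: Transposition.transpose_def split: if_splits)
    show "c ~: \<Union>(im ?p Q)" by (rule notI, drule *) (use Q(6) y(4) in simp)
    have "z ~: \<Union>Q" using VQ zS(1,3) by blast
    then show "z ~: \<Union>(im ?p Q)" by - (rule notI, drule *, use y(3) in simp)
   qed
   have C1: "?p ` C = insert y (C - {y0})"
   proof -
    have "y ~: C" using y(5) Q(4) by auto
    then show ?thesis using y0(1) by (auto simp: Transposition.transpose_def image_iff)
   qed
   have "?p ` C ~: ?T Un S"
   proof -
    have "y ~: C" using y(5) Q(4) by auto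
    then have "insert y (C - {y0}) - {y} Un {y0} = C" using y0(1) by auto
    moreover have "C ~: ?Q" by (simp add: st_def)
    ultimately have "?p ` C ~: ?T" unfolding C1 cone_def cst_def mem_Collect_eq by (simp only: not_False_eq_True)
    moreover have "?p ` C ~: S" unfolding C1 using y(2) by blast
    ultimately show ?thesis by blast
   qed
   note B = pc_bwd_at[OF cx_im[OF Q(1)] Q(2) FQ1 imageI[OF Q(4)] _ c1(1) this c1(2), folded e, OF _ A(1)]
   have ne: "?p ` C ~= {}" "{y0} ~= {}" using C0 by auto
   show "seq S (cone b ?Q Un R) (cone z (?Q Un cone b F) Un R)"
    by (rule A(2)[OF ne(2)], rule B(2)[OF ne], rule PCD[OF h'], rule B(1)[OF ne])
  qed
 qed
qed

lemma PC_base: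
 assumes F: "cx F" "w ~: \<Union>F"
 shows "PC (cone w F) F"
 unfolding PC_def
proof (intro allI impI)
 fix b z R S assume p: "pctx (cone w F) F b z R S"
 note b = pctx_b[OF p F(1)]
 have wF: "cx (cone w F)" using F by (simp add: cx_cone)
 have p': "cx R" "R <= S" "dn S" "b ~: \<Union>(cone w F)" "cone w F Un cone b F <= R" "z ~: \<Union>S"
  and pS: "\<And>rh. rh \<in> S ==> rh - {b} \<in> cone w F ==> rh \<in> cone w F \<or> rh - {b} \<in> F"
  using p unfolding pctx_def cone_def by blast+
 have bw: "b ~: \<Union>F" "b ~= w" using p'(4) cone_vertices[OF F(1), of w] by auto
 have w: "{w} \<in> cone w F" using F by (simp add: cone_def)
 have bwS: "{b, w} ~: S"
 proof
  assume "{b, w} \<in> S"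
  then have "{b, w} \<in> cone w F \<or> {w} \<in> F" using pS[of "{b, w}"] w bw by (simp add: insert_Diff_if)
  then show False using p'(4) F(2) by blast
 qed
 have z: "z ~= w" "z ~: \<Union>F" "z ~: \<Union>R" "z ~: \<Union>(cone w F)" using p' w cone_supset[OF F(1), of w] by blast+
 have "~ {b, w} <= rh" if "rh \<in> R" for rh using that p'(2) bwS dn_sub[OF p'(3)] by blast
 note e = st_cone_cone[OF F bw z(2) b(2) z(1,3) this p'(5)]
 have "z ~: \<Union>(cone b (cone w F) Un R)" using z b(2) cone_vertices[OF wF, of b] by simp
 moreover have "{b, w} \<in> cone b (cone w F)" using w bw by (simp add: cone_def insert_Diff_if)
 ultimately have "smv S (cone b (cone w F) Un R) (st {b, w} z (cone b (cone w F) Un R))"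
  using bwS p'(6) by (intro smvI cx_Un[OF cx_cone[OF wF] p'(1)]) auto
 then show "seq S (cone b (cone w F) Un R) (cone z (cone w F Un cone b F) Un R)"
  using e by (simp add: seq1)
qed

lemma smv_face_mono: assumes "smv S K K'" "F <= S" shows "F <= K ==> dn F ==> F <= K'" "F <= K' ==> F <= K"
proof -
 obtain si a where *: "si ~: S" "a ~: \<Union>S" "K' = st si a K" using assms(1) by (auto simp: smv_def)
 show "F <= K ==> dn F ==> F <= K'" unfolding *(3) using *(1,2) assms(2) by (intro st_supset) auto
 have "a ~: rh" if "rh \<in> F" for rh using that *(2) assms(2) by blast
 then show "F <= K' ==> F <= K" unfolding *(3) st_def by auto
qed

text \<open>\<open>PC_base\<close> handles the cone at the end of the second stage; from there
  \<open>PC_fwd\<close> and \<open>PC_bwd\<close> cover both directions of that stage, and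
  \<open>PC_fwd\<close> alone the forward stage.\<close>

theorem cW_PC:
 fixes Q :: "'v::infinite set set"
 assumes "cx Q" "cx F" "F <= Q" "cW Q F"
 shows "PC Q F"
proof -
 obtain Q' w where q: "(smv F)\<^sup>*\<^sup>* Q Q'" "w ~: \<Union>F" "seq (Pow (\<Union>F)) Q' (cone w F)"
  using assms(4) by (auto simp: cW_def)
 have "seq (Pow (\<Union>F)) (cone w F) Q'" using q(3) by (rule seq_sym)
 then have "PC Q' F & cx Q' & F <= Q'"
 proof (induction rule: equivclp_induct)
  case base show ?case using PC_base[OF assms(2) q(2)] assms(2) by (simp add: cx_cone cone_supset)
 next
  case (step y z)
  have FP: "F <= Pow (\<Union>F)" by auto
  from step(2) show ?case
  proof
   assume m: "smv (Pow (\<Union>F)) y z"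
   then obtain si a where *: "cx y" "si \<in> y" "si ~: Pow (\<Union>F)" "a ~: \<Union>y" "z = st si a y" by (auto simp: smv_def)
   show ?thesis using PC_bwd[of y F si a] * step(3) assms(2) smv_cx[OF m] smv_face_mono(1)[OF m FP] cx_dn[OF assms(2)] by auto
  next
   assume m: "smv (Pow (\<Union>F)) z y"
   then obtain si a where *: "cx z" "si \<in> z" "si ~= {}" "si ~: Pow (\<Union>F)" "a ~: \<Union>z" "y = st si a z" by (auto simp: smv_def)
   have "F <= z" using smv_face_mono(2)[OF m FP] step(3) by blast
   then show ?thesis using PC_fwd[of z F si a] * step(3) assms(2) by auto
  qed
 qed
 then have "PC Q' F" by blast
 with q(1) have "cx Q --> F <= Q --> PC Q F"
 proof (induction rule: converse_rtranclp_induct)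
  case base then show ?case by blast
 next
  case (step y z)
  obtain si a where *: "cx y" "si \<in> y" "si ~= {}" "si ~: F" "a ~: \<Union>y" "z = st si a y"
   using step(1) by (auto simp: smv_def)
  show ?case
   using PC_fwd[OF *(1) assms(2) _ *(2,3,4,5)] step smv_cx[OF step(1)] smv_face_mono(1)[OF step(1) order_refl] cx_dn[OF assms(2)] *(6)
   by auto
 qed
 then show ?thesis using assms by blast
qed

section \<open>Cells\<close>

text \<open>Weaker than the second stage of \<open>cW\<close>, since only the faces of
  \<open>E\<close> are protected.\<close>

definition wc :: "'v set set => 'v set set => bool" where
 "wc K E \<longleftrightarrow> (\<exists>v. v ~: \<Union>E & seq E K (cone v E))"

text \<open>The empty face gives the condition on \<open>K\<close> itself. Asking it in all links
  makes the notion stable under links and under starring at faces of \<open>E\<close>.\<close>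

definition Gw :: "'v set set => 'v set set => bool" where
 "Gw K E \<longleftrightarrow> cx K & cx E & E <= K & (\<forall>A\<in>E. wc (lk A K) (lk A E))"

lemma GwD: assumes "Gw K E" shows "cx K" "cx E" "E <= K" "A \<in> E ==> wc (lk A K) (lk A E)"
 using assms by (auto simp: Gw_def)

lemma lk_empty [simp]: "lk {} K = K"
 by (simp add: lk_def)

lemma lk_lk: "A Int B = {} ==> lk B (lk A K) = lk (A Un B) K"
 unfolding lk_def by (rule Collect_cong) (auto simp: Un_ac)

lemma lk_mono: "E <= K ==> lk A E <= lk A K"
 by (auto simp: lk_def)

lemma Gw_wc: "Gw K E ==> wc K E"
 using GwD(4)[of K E "{}"] GwD(2)[of K E] by simp

lemma Gw_lk: assumes "Gw K E" "A \<in> E" shows "Gw (lk A K) (lk A E)"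
proof -
 note g = GwD[OF assms(1)]
 have "wc (lk B (lk A K)) (lk B (lk A E))" if "B \<in> lk A E" for B
 proof -
  have "A Int B = {}" "A Un B \<in> E" using that by (auto simp: lk_def Un_commute)
  then show ?thesis using g(4) by (simp add: lk_lk)
 qed
 then show ?thesis using g assms(2) by (auto simp: Gw_def lk_mono intro!: cx_lk)
qed

lemma lk_st:
 assumes "A Un si \<in> K" "~ si <= A" "a ~: A"
 shows "lk A (st si a K) = st (si - A) a (lk A K)"
proof (rule set_eqI)
 fix rh
 have "rh Int A = {} ==> (rh Un A) - {a} Un si = (rh - {a} Un (si - A)) Un A"
  "(rh - {a} Un (si - A)) Int A = {} \<longleftrightarrow> rh Int A = {}" "si <= rh Un A \<longleftrightarrow> si - A <= rh" "a \<in> rh Un A \<longleftrightarrow> a \<in> rh"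
  using assms by auto
 then show "rh \<in> lk A (st si a K) \<longleftrightarrow> rh \<in> st (si - A) a (lk A K)"
  unfolding lk_def st_def mem_Collect_eq by (smt (verit, best))
qed

lemma lk_st_off:
 assumes "cx K" "A Un si ~: K" "a ~: A" "a ~: \<Union>K"
 shows "lk A (st si a K) = lk A K"
proof (rule set_eqI)
 fix rh
 have 1: "(rh Un A) - {a} Un si ~: K" using cx_sub[OF assms(1), of "(rh Un A) - {a} Un si" "A Un si"] assms(2,3) by auto
 have 2: "si <= rh Un A ==> rh Un A ~: K" using cx_sub[OF assms(1), of "rh Un A" "A Un si"] assms(2) by auto
 have 3: "a \<in> rh ==> rh Un A ~: K" using assms(4) by auto
 show "rh \<in> lk A (st si a K) \<longleftrightarrow> rh \<in> lk A K"
  using 1 2 3 assms(3) by (auto simp: lk_def st_def)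
qed

text \<open>If \<open>A\<close> and the starred face span a face of \<open>K\<close>, the move acts
  on the link as a starring at \<open>si - A\<close>; otherwise the link does not change.\<close>

lemma smv_lk:
 assumes "smv E K K'" "cx E" "A \<in> E"
 shows "lk A K' = lk A K \<or> smv (lk A E) (lk A K) (lk A K')"
proof -
 obtain si a where *: "cx K" "si \<in> K" "si ~= {}" "si ~: E" "a ~: \<Union>K" "a ~: \<Union>E" "K' = st si a K"
  using assms(1) by (auto simp: smv_def)
 have a: "a ~: A" using *(6) assms(3) by auto
 have s: "~ si <= A" using *(4) assms(2,3) cx_sub by blast
 show ?thesis
 proof (cases "A Un si \<in> K")
  case False
  then show ?thesis using lk_st_off[OF *(1) _ a *(5)] *(7) by blast
 next
  case True
  then have "A \<in> K" using *(1) cx_sub by blast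
  have e: "si - A Un A = A Un si" by auto
  have "si - A ~: lk A E" unfolding lk_def mem_Collect_eq e using *(4) assms(2) cx_sub[of E "A Un si" si] by blast
  moreover have "si - A \<in> lk A K" unfolding lk_def mem_Collect_eq e using True by auto
  moreover have "a ~: \<Union>(lk A K)" "a ~: \<Union>(lk A E)" using *(5,6) by (auto simp: lk_def)
  ultimately show ?thesis unfolding *(7) lk_st[OF True s a]
   using s cx_lk[OF *(1) \<open>A \<in> K\<close>] by (intro disjI2 smvI) auto
 qed
qed

lemma wc_seq: assumes "seq E K K'" shows "wc K E \<longleftrightarrow> wc K' E"
proof -
 have "seq E K (cone v E) \<longleftrightarrow> seq E K' (cone v E)" for v
  using seq_trans[OF assms, of "cone v E"] seq_trans[OF seq_sym[OF assms], of "cone v E"] by blast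
 then show ?thesis by (simp add: wc_def)
qed

lemma Gw_off:
 assumes "smv E K K'" "dn E" shows "Gw K E \<longleftrightarrow> Gw K' E"
proof -
 have "wc (lk A K) (lk A E) \<longleftrightarrow> wc (lk A K') (lk A E)" if "cx E" "A \<in> E" for A
  using smv_lk[OF assms(1) that] wc_seq[OF seq1, of "lk A E" "lk A K" "lk A K'"] by auto
 then show ?thesis using smv_cx[OF assms(1)] smv_face_mono(1)[OF assms(1) order_refl _ assms(2)]
   smv_face_mono(2)[OF assms(1) order_refl]
  unfolding Gw_def by auto
qed

lemma Gw_fwd: "(smv E)\<^sup>*\<^sup>* K K' ==> Gw K E ==> Gw K' E"
 by (induction rule: rtranclp_induct) (auto dest: Gw_off GwD(2) cx_dn)

section \<open>Full boundaries and collars\<close>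

lemma st_card:
 assumes "cx K" "si \<in> K" "\<And>rh. rh \<in> K ==> card rh \<le> d" "ta \<in> st si a K"
 shows "card ta \<le> d"
proof (cases "a \<in> ta")
 \<comment> \<open>Exchange \<open>a\<close> for a vertex \<open>x\<close> of \<open>si\<close>
   missing from \<open>ta\<close>; the result lies in a face of \<open>K\<close> and has as many
   elements.\<close>
 case True
 then have t: "ta - {a} Un si \<in> K" "~ si <= ta" using assms(4) by (auto simp: st_def)
 then obtain x where x: "x \<in> si" "x ~: ta" by blast
 have f: "finite (ta - {a} Un si)" using t(1) assms(1) cx_face_finite by blast
 have ft: "finite ta" using f by simp
 have "card (insert x (ta - {a})) = Suc (card (ta - {a}))" using x(2) ft by (intro card_insert_disjoint) auto
 then have "card ta = card (insert x (ta - {a}))" using card_Suc_Diff1[OF ft True] by simp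
 also have "\<dots> \<le> card (ta - {a} Un si)" using x f by (intro card_mono) auto
 finally show ?thesis using assms(3)[OF t(1)] by simp
next
 case False
 then show ?thesis using assms(3,4) by (auto simp: st_def)
qed

lemma fwd_card:
 assumes "(smv E)\<^sup>*\<^sup>* K K'" "\<And>rh. rh \<in> K ==> card rh \<le> d" "ta \<in> K'"
 shows "card ta \<le> d"
 using assms(1,3)
proof (induction arbitrary: ta)
 case base then show ?case using assms(2) by blast
next
 case (step y z)
 then show ?case using st_card[of y _ d] unfolding smv_def by blast
qed

text \<open>Starring a face on vertices of \<open>E\<close> that is not in \<open>E\<close> destroys
  it and creates no other face of this kind, since every new face contains \<open>a\<close>.\<close>

lemma ex_full:
 fixes K :: "'v::infinite set set"
 assumes "cx K" "cx E" "E <= K"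
 shows "\<exists>K'. (smv E)\<^sup>*\<^sup>* K K' & K' Int Pow (\<Union>E) = E"
 using assms
proof (induction "card (K Int Pow (\<Union>E) - E)" arbitrary: K rule: less_induct)
 case less
 show ?case
 proof (cases "K Int Pow (\<Union>E) = E")
  case True then show ?thesis by blast
 next
  case False
  then obtain si where s: "si \<in> K" "si <= \<Union>E" "si ~: E" using less(4) by blast
  have "finite (\<Union>K Un \<Union>E)" using less cx_finite_vertices by auto
  then obtain a where a: "a ~: \<Union>K" "a ~: \<Union>E" using fresh_vertex by (metis UnCI)
  have ne: "si ~= {}" using s less(3) by auto
  let ?K = "st si a K"
  have m: "smv E K ?K" using less s a ne by (intro smvI)
  have "?K Int Pow (\<Union>E) - E <= K Int Pow (\<Union>E) - E - {si}"
   using a by (auto simp: st_def split: if_splits)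
  also have "\<dots> < K Int Pow (\<Union>E) - E" using s by auto
  finally have "card (?K Int Pow (\<Union>E) - E) < card (K Int Pow (\<Union>E) - E)"
   using less(2) by (intro psubset_card_mono) (auto simp: cx_finite)
  moreover have "cx ?K" using smv_cx[OF m] by blast
  moreover have "E <= ?K" by (rule smv_face_mono(1)[OF m order_refl less(4) cx_dn[OF less(3)]])
  ultimately obtain K' where "(smv E)\<^sup>*\<^sup>* ?K K'" "K' Int Pow (\<Union>E) = E" using less(1) less(3) by blast
  then show ?thesis using m by (meson converse_rtranclp_into_rtranclp)
 qed
qed

lemma PC_im':
 fixes p :: "'v => 'v"
 assumes p: "bij p" and h: "PC Q F"
 shows "PC (im p Q) (im p F)"
 unfolding PC_def
proof (intro allI impI)
 fix b z R S assume c: "pctx (im p Q) (im p F) b z R S"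
 let ?q = "inv p"
 have q: "bij ?q" using p by (rule bij_imp_bij_inv)
 have "pctx Q F (?q b) (?q z) (im ?q R) (im ?q S)"
  using pctx_im[OF q c] im_im_inv(1)[OF p] by simp
 from seq_im[OF p PCD[OF h this]]
 show "seq S (cone b (im p Q) Un R) (cone z (im p Q Un cone b (im p F)) Un R)"
  by (simp add: im_Un im_cone[OF p] im_im_inv[OF p] surj_f_inv_f[OF bij_is_surj[OF p]])
qed

text \<open>The star of \<open>v'\<close> in the renamed complex is a cone over
  \<open>lk {v} D\<close>. Re-coning it from the old vertex \<open>v\<close> restores
  \<open>D\<close> and adds a block over the star of \<open>v\<close> in \<open>E\<close>.\<close>

lemma collar_step:
 fixes D :: "'v::infinite set set"
 assumes D: "cx D" "cx E" "D Int Pow (\<Union>E) = E" "v \<in> \<Union>E" "v' ~: \<Union>D" and h: "PC (lk {v} D) (lk {v} E)"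
 defines "t \<equiv> Transposition.transpose v v'"
 shows "seq (Pow (\<Union>(im t E))) (im t D) (D Un cone v' (cst {v} E))"
proof -
 let ?L = "lk {v} D" and ?l = "lk {v} E" and ?E = "\<Union>(im t E)"
 let ?R = "{rh \<in> D. v ~: rh} Un cone v' ?l"
 have ED: "E <= D" using D(3) by blast
 have vE: "{v} \<in> E" using D(4) cx_vertex[OF D(2), of v] by simp
 then have vD: "{v} \<in> D" using ED by blast
 have v': "v' ~: \<Union>E" "v ~= v'" using D(4,5) ED by auto
 have E': "?E = insert v' (\<Union>E - {v})"
  unfolding Union_im t_def using D(4) v' by (auto simp: Transposition.transpose_def image_iff)
 have tD: "im t D = st {v} v' D" unfolding t_def using st_vertex[OF D(1) vD D(5)] by simp
 have sub: "insert v rh \<in> D ==> rh \<in> D" for rh by (rule cx_sub_insertD[OF D(1)])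
 have subE: "insert v rh \<in> E ==> insert v rh \<in> D" for rh using ED by blast
 have v'D: "rh \<in> D ==> v' ~: rh" for rh using D(5) by auto
 have 1: "cone v' ?L Un ?R = im t D"
 proof (rule set_eqI)
  fix rh show "rh \<in> cone v' ?L Un ?R \<longleftrightarrow> rh \<in> im t D"
   unfolding tD
   apply (rule split2[where b = v and c = v' and rh = rh])
   apply (simp add: st_def cone_def lk_def insert_Diff_if nv[OF D(5)] nv[OF v'(1)] v'(2) v'(2)[symmetric])
   subgoal for ta using sub[of ta] subE[of ta] by blast
   done
 qed
 have 2: "cone v (?L Un cone v' ?l) Un ?R = D Un cone v' (cst {v} E)"
 proof (rule set_eqI)
  fix rh show "rh \<in> cone v (?L Un cone v' ?l) Un ?R \<longleftrightarrow> rh \<in> D Un cone v' (cst {v} E)"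
   apply (rule split2[where b = v and c = v' and rh = rh])
   apply (simp add: cst_def cone_def lk_def insert_Diff_if nv[OF D(5)] nv[OF v'(1)] v'(2) v'(2)[symmetric])
   subgoal for ta using sub[of ta] subE[of ta] by blast
   done
 qed
 have cxR: "cx ?R"
 proof (rule cx_Un)
  show "cx {rh \<in> D. v ~: rh}" using cx_Int[OF D(1), of "{rh. v ~: rh}"] by (simp add: dn_def subset_eq Collect_conj_eq Int_commute) blast
  show "cx (cone v' ?l)" using D(2) vE by (intro cx_cone cx_lk)
 qed
 \<comment> \<open>After the renaming \<open>v\<close> is a vertex neither of \<open>?R\<close> nor
   of the new boundary, so it can serve as the new apex.\<close>
 have "pctx ?L ?l v' v ?R (?R Un Pow ?E)"
  unfolding pctx_def
 proof (intro conjI)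
  show "cx ?R" by (rule cxR)
  show "dn (?R Un Pow ?E)" using cxR by (intro dn_Un dn_Pow cx_dn)
  show "finite (\<Union>(?R Un Pow ?E))"
   using cx_finite_vertices[OF cxR] cx_finite_vertices[OF D(2)] unfolding E' by simp
  show "v' ~: \<Union>?L" using D(5) by (auto simp: lk_def)
  show "?L Un cone v' ?l <= ?R" by (auto simp: lk_def dest: sub)
  show "v ~: \<Union>(?R Un Pow ?E)" unfolding E' using v'(2) by (auto simp: cone_def lk_def)
  show "(?R Un Pow ?E) Int cone v' ?L <= ?L Un cone v' ?l"
  proof
   fix rh assume r: "rh \<in> (?R Un Pow ?E) Int cone v' ?L"
   show "rh \<in> ?L Un cone v' ?l"
   proof (cases "v' \<in> rh")
    case False then show ?thesis using r by (simp add: cone_def)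
   next
    case True
    show ?thesis
    proof (cases "rh \<in> ?R")
     case True2: True then show ?thesis using v'D True by auto
    next
     case False
     then have "rh <= ?E" using r by auto
     moreover have rl: "v ~: rh - {v'}" "insert v (rh - {v'}) \<in> D" using r by (auto simp: cone_def lk_def)
     ultimately have "insert v (rh - {v'}) <= \<Union>E" using D(4) unfolding E' by blast
     \<comment> \<open>Fullness of \<open>E\<close> in \<open>D\<close>: a protected face of the
       cone that lies on boundary vertices comes from a face of \<open>E\<close>.\<close>
     then have "insert v (rh - {v'}) \<in> E" using rl(2) D(3) by blast
     then show ?thesis using rl(1) by (auto simp: cone_def lk_def)
    qed
   qed
  qed
 qed auto
 from PCD[OF h this] show ?thesis unfolding 1 2 by (rule seq_mono) auto
qed


lemma im_lk_vertex: "bij p ==> p v = v ==> im p (lk {v} K) = lk {v} (im p K)"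
 using im_lk[of p "{v}" K] by simp

lemma im_Int_Pow: "bij p ==> im p (D Int Pow V) = im p D Int Pow (p ` V)"
proof -
 assume p: "bij p"
 have "inj ((`) p)" by (simp add: inj_def inj_image_eq_iff[OF bij_is_inj[OF p]])
 then show ?thesis using image_Int[of "(`) p" D "Pow V"] im_Pow[OF p, of V] by simp
qed

text \<open>The renaming \<open>p\<close> and the collar \<open>C\<close> are chosen before
  \<open>D\<close>. Two complexes with the same full boundary thus receive the same collar and can
  be compared inside it. The boundary vertices are treated one at a time by
  \<open>collar_step\<close>.\<close>

lemma collar:
 fixes E :: "'v::infinite set set"
 assumes E: "cx E" "finite W" "\<Union>E <= W" and X: "finite X" "X <= \<Union>E"
 shows "\<exists>p C. bij p & (\<forall>v\<in>W - X. p v = v) & p ` X Int W = {} & cx C & C Int Pow W <= E & p ` X <= \<Union>C &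
  (\<forall>D. cx D --> \<Union>D <= W --> D Int Pow (\<Union>E) = E --> (\<forall>v\<in>\<Union>E. PC (lk {v} D) (lk {v} E)) -->
   seq (Pow (p ` \<Union>E)) (im p D) (D Un C))"
 using X
proof (induction X)
 case empty
 have "cx {{}}" by (auto simp: cx_def)
 moreover have "D Un {{}} = D" if "cx D" for D :: "'v set set" using that by auto
 ultimately show ?case using E(1)
  by (intro exI[of _ "%x. x"] exI[of _ "{{}}"]) (auto simp: bij_betw_def)
next
 case (insert v X)
 then obtain p C where p: "bij p" "\<forall>v\<in>W - X. p v = v" "p ` X Int W = {}" and C: "cx C" "C Int Pow W <= E" "p ` X <= \<Union>C"
  and D: "\<And>D. cx D ==> \<Union>D <= W ==> D Int Pow (\<Union>E) = E ==> (\<forall>v\<in>\<Union>E. PC (lk {v} D) (lk {v} E)) ==>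
   seq (Pow (p ` \<Union>E)) (im p D) (D Un C)" by auto
 have inj: "inj p" using p(1) by (rule bij_is_inj)
 have vW: "v \<in> W" "v \<in> \<Union>E" "p v = v" using insert E(3) p(2) by auto
 have "finite (W Un p ` W Un \<Union>C)" using E(2) cx_finite_vertices[OF C(1)] by simp
 from fresh_vertex[OF this] obtain v' where v'0: "v' ~: W Un p ` W Un \<Union>C" ..
 have v': "v' ~: W" "v' ~: p ` W" "v' ~: \<Union>C" using v'0 by simp_all
 let ?t = "Transposition.transpose v v'"
 let ?q = "?t \<circ> p"
 let ?E = "im p E"
 let ?R = "cone v' (cst {v} ?E)"
 have pu: "p u ~= v" "p u ~= v'" if "u \<in> W" "u ~= v" for u
 proof -
  show "p u ~= v" using injD[OF inj, of u v] that(2) vW(3) by auto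
  show "p u ~= v'" using v'(2) that(1) by auto
 qed
 have qu: "?q u = p u" if "u \<in> W" "u ~= v" for u using pu[OF that] by (simp add: transpose_fix)
 have qv: "?q v = v'" using vW by simp
 have "{v} \<in> E" using vW(2) cx_vertex[OF E(1), of v] by simp
 from imageI[OF this, of "%si. p ` si"] have Ev: "{v} \<in> ?E" using vW(3) by simp
 have cxE: "cx ?E" using E(1) by (rule cx_im)
 have cxR: "cx ?R" by (intro cx_cone cx_cst cxE Ev)
 have VR: "\<Union>?R <= insert v' (p ` \<Union>E)" unfolding cone_def cst_def by blast
 have v'R: "{v'} \<in> ?R" using Ev by (simp add: cone_def cst_def)
 have Xq: "?q ` X = p ` X"
 proof (rule image_cong[OF refl])
  fix x assume "x \<in> X"
  then show "?q x = p x" using insert.prems insert.hyps(2) E(3) by (intro qu) blast+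
 qed
 show ?case
 proof (intro exI[of _ ?q] exI[of _ "C Un ?R"] conjI allI impI ballI)
  show "bij ?q" using p(1) by (simp add: bij_comp)
  show "?q u = u" if "u \<in> W - insert v X" for u using that qu[of u] p(2) by auto
  show "?q ` insert v X Int W = {}" using Xq qv p(3) v'(1) by auto
  show "cx (C Un ?R)" by (rule cx_Un[OF C(1) cxR])
  have "p ` X <= \<Union>(C Un ?R)" "v' \<in> \<Union>(C Un ?R)" using C(3) v'R by auto
  then show "?q ` insert v X <= \<Union>(C Un ?R)" unfolding image_insert Xq qv by blast
  show "(C Un ?R) Int Pow W <= E"
  proof
   fix rh assume r: "rh \<in> (C Un ?R) Int Pow W"
   show "rh \<in> E"
   proof (cases "rh \<in> C")
    case True then show ?thesis using r C(2) by blast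
   next
    case False
    then have "rh - {v'} Un {v} \<in> ?E" using r by (simp add: cone_def cst_def)
    moreover have "v' ~: rh" using r v'(1) by auto
    ultimately have "rh \<in> ?E" using cx_sub[OF cxE, of "rh - {v'} Un {v}" rh] by auto
    then obtain e where e: "e \<in> E" "rh = p ` e" by auto
    have "u ~: X" if "u \<in> e" for u using that e(2) r p(3) by blast
    then have "p u = u" if "u \<in> e" for u using that p(2) e(1) E(3) by blast
    then have "p ` e = e" by force
    then show ?thesis using e by simp
   qed
  qed
  fix D assume d: "cx D" "\<Union>D <= W" "D Int Pow (\<Union>E) = E" "\<forall>v\<in>\<Union>E. PC (lk {v} D) (lk {v} E)"
  let ?D = "im p D"
  have cxD: "cx ?D" using d(1) by (rule cx_im)
  have full: "?D Int Pow (\<Union>?E) = ?E" using im_Int_Pow[OF p(1), of D "\<Union>E", unfolded d(3)] unfolding Union_im by (rule sym)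
  have v'D: "v' ~: \<Union>?D" unfolding Union_im using v'(2) d(2) by blast
  have "PC (lk {v} ?D) (lk {v} ?E)"
   using PC_im'[OF p(1) bspec[OF d(4) vW(2)]] by (simp add: im_lk_vertex[OF p(1) vW(3)])
  note c = collar_step[OF cxD cxE full _ v'D this]
  have "v \<in> \<Union>?E" using Ev by blast
  from c[OF this] have 1: "seq (Pow (?q ` \<Union>E)) (im ?q D) (?D Un ?R)"
   by (simp add: im_comp Union_im image_comp)
  have VE: "?q ` \<Union>E <= insert v' (p ` \<Union>E)"
  proof
   fix y assume "y \<in> ?q ` \<Union>E"
   then obtain u where u: "u \<in> \<Union>E" "y = ?q u" by (rule imageE)
   show "y \<in> insert v' (p ` \<Union>E)"
   proof (cases "u = v")
    case True then show ?thesis using u(2) qv by simp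
   next
    case False
    then have "y = p u" using u qu[of u] subsetD[OF E(3) u(1)] by simp
    then show ?thesis using u(1) by (intro insertI2 image_eqI)
   qed
  qed
  have "seq (Pow (p ` \<Union>E)) ?D (D Un C)" by (rule D[OF d])
  then have 2: "seq (Pow (?q ` \<Union>E)) (?D Un ?R) ((D Un C) Un ?R)"
  proof (rule seq_Un[OF _ cxD cxR])
   show "finite (\<Union>(Pow (p ` \<Union>E)))" using cx_finite_vertices[OF E(1)] by simp
   show "rh \<in> Pow (p ` \<Union>E)" if "rh <= \<Union>(Pow (p ` \<Union>E))" for rh using that by simp
   have "v' ~: \<Union>D" using d(2) v'(1) by (rule contra_subsetD)
   with v'D v'(3) have n: "v' ~: \<Union>?D Un \<Union>(D Un C)" by (simp only: Union_Un_distrib Un_iff simp_thms)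
   show "\<Union>?R Int (\<Union>?D Un \<Union>(D Un C)) <= \<Union>(Pow (p ` \<Union>E))"
   proof
    fix x assume x: "x \<in> \<Union>?R Int (\<Union>?D Un \<Union>(D Un C))"
    have "x \<in> insert v' (p ` \<Union>E)" by (rule subsetD[OF VR IntD1[OF x]])
    moreover have "x ~= v'" using n IntD2[OF x] by metis
    ultimately show "x \<in> \<Union>(Pow (p ` \<Union>E))" unfolding Union_Pow_eq by (metis insertE)
   qed
   have "v' ~: p ` \<Union>E" using image_mono[OF E(3), of p] v'(2) by (rule contra_subsetD)
   then have v'': "v' \<in> \<Union>?R - \<Union>(Pow (p ` \<Union>E))" unfolding Union_Pow_eq using UnionI[OF v'R, of v'] by (metis DiffI insertI1)
   show "ta \<in> Pow (p ` \<Union>E)" if t: "ta \<in> Pow (?q ` \<Union>E)" "ta Int (\<Union>?R - \<Union>(Pow (p ` \<Union>E))) = {}" for ta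
   proof
    show "ta <= p ` \<Union>E"
    proof
     fix y assume y: "y \<in> ta"
     have "y \<in> insert v' (p ` \<Union>E)" by (rule subsetD[OF VE subsetD[OF PowD[OF t(1)] y]])
     moreover have "y ~= v'" using t(2) y v'' by (metis IntI emptyE)
     ultimately show "y \<in> p ` \<Union>E" by (metis insertE)
    qed
   qed
   show "\<Union>(Pow (?q ` \<Union>E)) <= \<Union>(Pow (p ` \<Union>E)) Un \<Union>?R"
    unfolding Union_Pow_eq
   proof
    fix y assume "y \<in> ?q ` \<Union>E"
    then have "y \<in> insert v' (p ` \<Union>E)" by (rule subsetD[OF VE])
    then show "y \<in> p ` \<Union>E Un \<Union>?R"
    proof
     assume "y = v'" then show ?thesis using UnionI[OF v'R, of v'] by simp
    next
     assume "y \<in> p ` \<Union>E" then show ?thesis by (rule UnI1)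
    qed
   qed
  qed
  show "seq (Pow (?q ` \<Union>E)) (im ?q D) (D Un (C Un ?R))" using seq_trans[OF 1 2] by (simp add: Un_assoc)
 qed
qed

lemma lk_cone: "v ~= b ==> lk {v} (cone b E) = cone b (lk {v} E)"
 by (auto simp: lk_def cone_def insert_Diff_if)

text \<open>Let \<open>K1\<close> be obtained from \<open>K\<close> by making \<open>E\<close> full.
  Up to the renaming \<open>p\<close>, adding the common collar changes neither \<open>K1\<close>
  nor \<open>cone v0 E\<close>, relative to all sets of outer boundary vertices. Inside the collar
  the weak path from \<open>K1\<close> to the cone can be used, because the outer boundary is out of
  its reach. The collar needs re-coning in links of vertices, which have smaller dimension.\<close>

theorem Gw_cW:
 fixes K :: "'v::infinite set set"
 assumes "Gw K E"
 shows "cW K E"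
proof -
 have "cW K E" if "Gw K E" "\<And>rh. rh \<in> K ==> card rh \<le> d" for d
  using that
 proof (induction d arbitrary: K E rule: less_induct)
  case (less d)
  note g = GwD[OF less(2)]
  obtain K1 where K1: "(smv E)\<^sup>*\<^sup>* K K1" "K1 Int Pow (\<Union>E) = E" using ex_full[OF g(1-3)] by blast
  have g1: "Gw K1 E" using Gw_fwd[OF K1(1) less(2)] .
  have card1: "card rh \<le> d" if "rh \<in> K1" for rh using fwd_card[OF K1(1) _ that] less(3) by blast
  note h = GwD[OF g1]
  have pc: "PC (lk {v} K1) (lk {v} E)" if "v \<in> \<Union>E" for v
  proof -
   have v: "{v} \<in> E" using that cx_vertex[OF g(2), of v] by simp
   have gl: "Gw (lk {v} K1) (lk {v} E)" by (rule Gw_lk[OF g1 v])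
   have "card rh \<le> d - 1" if "rh \<in> lk {v} K1" for rh
   proof -
    have r: "insert v rh \<in> K1" "v ~: rh" using that by (auto simp: lk_def)
    then have "finite rh" using cx_face_finite[OF h(1) r(1)] by simp
    then show ?thesis using card1[OF r(1)] r(2) by simp
   qed
   moreover have "d > 0" using card1[of "{v}"] v h(3) by fastforce
   ultimately have "cW (lk {v} K1) (lk {v} E)" using less(1)[of "d - 1"] gl by simp
   then show ?thesis using GwD[OF gl] by (intro cW_PC)
  qed
  obtain v0 where v0: "v0 ~: \<Union>E" "seq E K1 (cone v0 E)" using Gw_wc[OF g1] by (auto simp: wc_def)
  let ?W = "insert v0 (\<Union>K1)"
  have EW: "\<Union>E <= ?W" using h(3) by blast
  have fE: "finite (\<Union>E)" by (rule cx_finite_vertices[OF g(2)])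
  obtain p C where p: "bij p" "p ` \<Union>E Int ?W = {}" and C: "cx C" "C Int Pow ?W <= E" "p ` \<Union>E <= \<Union>C"
   and D: "\<And>D. cx D ==> \<Union>D <= ?W ==> D Int Pow (\<Union>E) = E ==> (\<forall>v\<in>\<Union>E. PC (lk {v} D) (lk {v} E)) ==>
   seq (Pow (p ` \<Union>E)) (im p D) (D Un C)"
   using collar[OF g(2) _ EW fE order_refl] cx_finite_vertices[OF h(1)] by auto
  have 1: "seq (Pow (p ` \<Union>E)) (im p K1) (K1 Un C)" using D[of K1] h(1) K1(2) pc by blast
  have cc: "cx (cone v0 E)" using g(2) by (rule cx_cone)
  have V0: "\<Union>(cone v0 E) <= ?W" using cone_vertices[OF g(2)] EW by auto
  have 2: "seq (Pow (p ` \<Union>E)) (im p (cone v0 E)) (cone v0 E Un C)"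
  proof (rule D[OF cc V0])
   have "rh \<in> E" if "rh \<in> cone v0 E" "rh <= \<Union>E" for rh
   proof -
    have "rh - {v0} = rh" using that(2) v0(1) by blast
    then show ?thesis using that(1) by (simp add: cone_def)
   qed
   then show "cone v0 E Int Pow (\<Union>E) = E" using cone_supset[OF g(2), of v0] by blast
   show "\<forall>v\<in>\<Union>E. PC (lk {v} (cone v0 E)) (lk {v} E)"
   proof
    fix v assume v: "v \<in> \<Union>E"
    then have "{v} \<in> E" using cx_vertex[OF g(2), of v] by simp
    then have "PC (cone v0 (lk {v} E)) (lk {v} E)" using v0(1) g(2) by (intro PC_base cx_lk notin_lk)
    moreover have "v ~= v0" using v v0 by blast
    ultimately show "PC (lk {v} (cone v0 E)) (lk {v} E)" by (simp add: lk_cone)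
   qed
  qed
  have CE: "\<Union>C Int ?W <= \<Union>E"
  proof
   fix v assume "v \<in> \<Union>C Int ?W"
   then have "{v} \<in> C Int Pow ?W" using cx_vertex[OF C(1), of v] by simp
   then show "v \<in> \<Union>E" using C(2) by blast
  qed
  \<comment> \<open>The protected vertices belong to the collar and are new, so a path that protects
    \<open>E\<close> alone suffices.\<close>
  have 3: "seq (Pow (p ` \<Union>E)) (K1 Un C) (cone v0 E Un C)"
  proof (rule seq_Un[OF v0(2) h(1) C(1) fE])
   show "rh \<in> E" if "rh \<in> C" "rh <= \<Union>E" for rh using that C(2) EW by blast
   show "\<Union>C Int (\<Union>K1 Un \<Union>(cone v0 E)) <= \<Union>E" using CE V0 by blast
   show "\<Union>(Pow (p ` \<Union>E)) <= \<Union>E Un \<Union>C" using C(3) by auto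
   fix ta assume t: "ta \<in> Pow (p ` \<Union>E)" "ta Int (\<Union>C - \<Union>E) = {}"
   have "x \<in> \<Union>C - \<Union>E" if "x \<in> ta" for x
   proof (rule DiffI)
    have x: "x \<in> p ` \<Union>E" using t(1) that by blast
    then show "x \<in> \<Union>C" using C(3) by (rule rev_subsetD)
    show "x ~: \<Union>E"
    proof
     assume "x \<in> \<Union>E"
     then have "x \<in> ?W" using EW by (rule rev_subsetD)
     with x have "x \<in> p ` \<Union>E Int ?W" by (rule IntI)
     then show False unfolding p(2) by (rule emptyE)
    qed
   qed
   then have "ta = {}" using t(2) by blast
   then show "ta \<in> E" using g(2) by simp
  qed
  have "seq (Pow (p ` \<Union>E)) (im p K1) (im p (cone v0 E))"
   by (rule seq_trans[OF seq_trans[OF 1 3] seq_sym[OF 2]])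
  from seq_im[OF bij_imp_bij_inv[OF p(1)] this]
  have "seq (Pow (\<Union>E)) K1 (cone v0 E)"
   by (simp add: im_im_inv[OF p(1)] im_Pow[OF bij_imp_bij_inv[OF p(1)]] image_inv_f_f[OF bij_is_inj[OF p(1)]])
  then show "cW K E" using K1(1) v0(1) by (auto simp: cW_def)
 qed
 moreover have "card rh \<le> card (\<Union>K)" if "rh \<in> K" for rh
  using that cx_finite_vertices[OF GwD(1)[OF assms]] by (intro card_mono) auto
 ultimately show ?thesis using assms by blast
qed

corollary Gw_PC: "Gw K E ==> PC K (E :: 'v::infinite set set)"
 by (rule cW_PC[OF GwD(1-3) Gw_cW])

section \<open>Joins, unions and cones of cells\<close>

lemma cone_rename:
 fixes E :: "'v::infinite set set"
 assumes "cx E" "v ~: \<Union>E" "v' ~: \<Union>E"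
 shows "seq (Pow (\<Union>E)) (cone v E) (cone v' E)"
proof (cases "v = v'")
 case False
 have c: "cx (cone v E)" using assms(1) by (rule cx_cone)
 have v: "{v} \<in> cone v E" using assms(1) by (simp add: cone_def)
 have v': "v' ~: \<Union>(cone v E)" using assms(3) False by (intro notin_cone) auto
 have "im (Transposition.transpose v v') E = E" using assms(2,3) by (intro im_fix transpose_fix) auto
 then have "st {v} v' (cone v E) = cone v' E"
  unfolding st_vertex[OF c v v'] by (simp add: im_cone)
 moreover have "smv (Pow (\<Union>E)) (cone v E) (st {v} v' (cone v E))"
  using c v v' assms(2,3) by (intro smvI) auto
 ultimately show ?thesis by (simp add: seq1)
qed simp

lemma wc_any:
 fixes E :: "'v::infinite set set"
 assumes "wc K E" "cx E" "v ~: \<Union>E" shows "seq E K (cone v E)"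
proof -
 obtain u where u: "u ~: \<Union>E" "seq E K (cone u E)" using assms(1) by (auto simp: wc_def)
 have "seq E (cone u E) (cone v E)"
  by (rule seq_mono[OF cone_rename[OF assms(2) u(1) assms(3)]]) auto
 then show ?thesis by (rule seq_trans[OF u(2)])
qed

lemma cone_jn: "w ~: \<Union>J ==> cone w (jn J l) = jn J (cone w l)"
proof -
 assume w: "w ~: \<Union>J"
 have "(rh - {w}) Int \<Union>J = rh Int \<Union>J" "rh - {w} - \<Union>J = rh - \<Union>J - {w}" for rh using w by auto
 then show ?thesis unfolding cone_def jn_def by simp
qed

lemma jn_vertices: "\<Union>(jn J K) <= \<Union>J Un \<Union>K"
 unfolding jn_def by blast

lemma disj_aux: "A Int B = {} ==> C <= B ==> w ~: A ==> D = insert w C ==> A Int (B Un D Un C) = {}"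
 by blast

lemma wc_jn:
 fixes L :: "'v::infinite set set"
 assumes "wc L l" "cx L" "cx l" "l <= L" "cx J" "\<Union>J Int \<Union>L = {}"
 shows "wc (jn J L) (jn J l)"
proof -
 have "finite (\<Union>J Un \<Union>L)" using assms cx_finite_vertices by blast
 from fresh_vertex[OF this] obtain w where w: "w ~: \<Union>J Un \<Union>L" ..
 then have w': "w ~: \<Union>J" "w ~: \<Union>L" "w ~: \<Union>l" using assms(4) by blast+
 have s: "seq l L (cone w l)" by (rule wc_any[OF assms(1,3) w'(3)])
 have "seq (jn J l) (jn J L) (jn J (cone w l))"
 proof (rule seq_jn[OF s assms(2,5)])
  show "finite (\<Union>l)" using assms(3) by (rule cx_finite_vertices)
  show "\<Union>J Int (\<Union>L Un \<Union>(cone w l) Un \<Union>l) = {}"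
   by (rule disj_aux[OF assms(6) Union_mono[OF assms(4)] w'(1) cone_vertices[OF assms(3)]])
  show "ta \<in> l" if "ta \<in> jn J l" "ta Int \<Union>J = {}" for ta using that by (simp add: jn_def Diff_triv)
  show "\<Union>(jn J l) <= \<Union>l Un \<Union>J" using jn_vertices[of J l] by blast
 qed
 moreover have "w ~: \<Union>(jn J l)" using jn_vertices[of J l] w' by blast
 ultimately show ?thesis unfolding wc_def cone_jn[OF w'(1), symmetric] by blast
qed

text \<open>The forward stage may end in vertices of \<open>J\<close>. Its end is renamed off
  \<open>J\<close> by \<open>fwd_avoid\<close>, and the path to a cone is renamed with it.\<close>

lemma cW_jn:
 fixes L :: "'v::infinite set set"
 assumes "cW L l" "cx L" "cx l" "l <= L" "cx J" "\<Union>J Int \<Union>L = {}"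
 shows "cW (jn J L) (jn J l)"
proof -
 obtain K' w0 where K': "(smv l)\<^sup>*\<^sup>* L K'" "w0 ~: \<Union>l" "seq (Pow (\<Union>l)) K' (cone w0 l)"
  using assms(1) by (auto simp: cW_def)
 have fl: "finite (\<Union>l)" using assms(3) by (rule cx_finite_vertices)
 have d: "\<Union>J Int (\<Union>L Un \<Union>l) = {}" using assms(4,6) by blast
 obtain p where p: "bij p" "\<forall>v\<in>\<Union>L Un \<Union>l. p v = v" "(smvA (\<Union>J) l)\<^sup>*\<^sup>* L (im p K')"
  using fwd_avoid[OF K'(1) assms(2) fl cx_finite_vertices[OF assms(5)] d] by blast
 have fixl: "im p l = l" "p ` \<Union>l = \<Union>l" using p(2) im_fix[of l p] Union_im[of p l] by auto
 have 1: "(smv (jn J l))\<^sup>*\<^sup>* (jn J L) (jn J (im p K'))"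
 proof (rule rtranclp_lift[OF p(3)])
  fix K K' assume m: "smvA (\<Union>J) l K K'"
  have "smv (jn J l) (jn J K) (jn J K')"
  proof (rule smv_jn[of l, OF _ assms(5)])
   show "smv l K K'" "(\<Union>K Un \<Union>K') Int \<Union>J = {}" using m by (simp_all add: smvA_def)
   show "ta \<in> l" if "ta \<in> jn J l" "ta Int \<Union>J = {}" for ta using that by (simp add: jn_def Diff_triv)
   show "\<Union>(jn J l) <= \<Union>l Un \<Union>J" using jn_vertices[of J l] by blast
  qed
  then show "(smv (jn J l))\<^sup>*\<^sup>* (jn J K) (jn J K')" ..
 qed
 have cK: "cx (im p K')" "\<Union>J Int \<Union>(im p K') = {}"
 proof -
  have "cx K' & \<Union>J Int \<Union>K' = {}" if "(smvA (\<Union>J) l)\<^sup>*\<^sup>* L K'" for K'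
   using that by induction (use assms(2,6) in \<open>auto simp: smvA_def dest: smv_cx\<close>)
  then show "cx (im p K')" "\<Union>J Int \<Union>(im p K') = {}" using p(3) by blast+
 qed
 have pl: "p w0 ~: \<Union>l" using K'(2) fixl(2) inj_image_mem_iff[OF bij_is_inj[OF p(1)], of w0 "\<Union>l"] by simp
 have 2: "seq (Pow (\<Union>l)) (im p K') (cone (p w0) l)"
  using seq_im[OF p(1) K'(3)] fixl by (simp add: im_Pow[OF p(1)] im_cone[OF p(1)])
 have "finite (\<Union>J Un \<Union>L)" using assms cx_finite_vertices by blast
 from fresh_vertex[OF this] obtain w where w: "w ~: \<Union>J Un \<Union>L" ..
 then have w': "w ~: \<Union>J" "w ~: \<Union>L" "w ~: \<Union>l" using assms(4) by blast+
 have 3: "seq (Pow (\<Union>l)) (im p K') (cone w l)"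
  by (rule seq_trans[OF 2 cone_rename[OF assms(3) pl w'(3)]])
 have "seq (Pow (\<Union>(jn J l))) (jn J (im p K')) (jn J (cone w l))"
 proof (rule seq_jn[OF 3 cK(1) assms(5)])
  show "finite (\<Union>(Pow (\<Union>l)))" using fl by simp
  show "\<Union>J Int (\<Union>(im p K') Un \<Union>(cone w l) Un \<Union>(Pow (\<Union>l))) = {}"
   using cK(2) d w'(1) cone_vertices[OF assms(3), of w] by auto
  show "ta \<in> Pow (\<Union>l)" if "ta \<in> Pow (\<Union>(jn J l))" "ta Int \<Union>J = {}" for ta using that jn_vertices[of J l] by blast
  show "\<Union>(Pow (\<Union>(jn J l))) <= \<Union>(Pow (\<Union>l)) Un \<Union>J" using jn_vertices[of J l] by auto
 qed
 moreover have "w ~: \<Union>(jn J l)" using jn_vertices[of J l] w' by blast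
 ultimately show ?thesis unfolding cW_def cone_jn[OF w'(1), symmetric] using 1 by blast
qed

text \<open>The empty face is kept, so the boundary of a single vertex is \<open>{{}}\<close>, the
  sphere of dimension -1; it has no vertices and is the exceptional case in joins.\<close>

definition bd :: "'v set => 'v set set" where
 "bd C = Pow C - {C}"

lemma cx_bd: "finite C ==> C ~= {} ==> cx (bd C)"
 by (rule cxI[of C]) (auto simp: bd_def)

lemma bd_vertices: "\<Union>(bd C) = (if \<exists>v. C = {v} then {} else C)"
proof -
 have "{v} \<in> bd C" if "v \<in> C" "\<nexists>v. C = {v}" for v
  using that unfolding bd_def by blast
 then have "C <= \<Union>(bd C)" if "\<nexists>v. C = {v}" using that by blast
 moreover have "\<Union>(bd C) <= C" unfolding bd_def by blast
 moreover have "\<Union>(bd {v}) = {}" for v :: 'a unfolding bd_def by blast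
 ultimately show ?thesis by (cases "\<exists>v. C = {v}") (metis, metis subset_antisym)
qed

lemma ob_jn: "ob C K = jn (bd C) (lk C K)"
proof (rule set_eqI)
 fix rh
 show "rh \<in> ob C K \<longleftrightarrow> rh \<in> jn (bd C) (lk C K)"
 proof (cases "\<exists>v. C = {v}")
  case True
  then obtain v where "C = {v}" ..
  moreover have "bd {v} = {{}}" by (auto simp: bd_def)
  ultimately show ?thesis unfolding ob_def jn_def lk_def by simp
 next
  case False
  then have "\<Union>(bd C) = C" by (simp add: bd_vertices)
  moreover have "rh - C Un C = rh Un C" "rh Int C = C \<longleftrightarrow> C <= rh" by auto
  ultimately show ?thesis unfolding ob_def jn_def lk_def by (auto simp: bd_def)
 qed
qed

lemma bd_lk_disjoint: "\<Union>(bd C) Int \<Union>(lk C K) = {}"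
 by (auto simp: bd_def lk_def)

lemma wc_ob:
 fixes K :: "'v::infinite set set"
 assumes "wc (lk C K) (lk C E)" "cx K" "cx E" "E <= K" "C \<in> E" "C ~= {}"
 shows "wc (ob C K) (ob C E)"
 unfolding ob_jn using assms cx_face_finite[of E C]
 by (intro wc_jn cx_lk cx_bd lk_mono bd_lk_disjoint) auto

text \<open>The link of \<open>C\<close> is again a cell, and \<open>ob\<close> is its join with
  \<open>bd C\<close>. So the cone that a starring at \<open>C\<close> creates can be
  re-coned.\<close>

lemma PC_ob:
 fixes K :: "'v::infinite set set"
 assumes "Gw K E" "C \<in> E" "C ~= {}"
 shows "PC (ob C K) (ob C E)"
proof -
 note g = GwD[OF assms(1)]
 have c: "C \<in> K" "finite C" using assms(2) g cx_face_finite[of E C] by auto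
 have "cW (ob C K) (ob C E)"
  unfolding ob_jn using c assms g
  by (intro cW_jn cx_lk cx_bd lk_mono bd_lk_disjoint Gw_cW Gw_lk) auto
 moreover have "ob C E <= ob C K" using g(3) by (auto simp: ob_def)
 ultimately show ?thesis using c assms(2,3) g by (intro cW_PC cx_ob)
qed

lemma fwd_Un:
 assumes "(smvA W E)\<^sup>*\<^sup>* K K'" "cx K" "cx R" "R Int K <= E" "\<Union>R - \<Union>K <= W"
 shows "(smv (E Un R))\<^sup>*\<^sup>* (K Un R) (K' Un R) & R Int K' <= E & cx K'"
 using assms(1)
proof induction
 case base show ?case using assms(2,4) by simp
next
 case (step y z)
 obtain si a where *: "cx y" "si \<in> y" "si ~= {}" "si ~: E" "a ~: \<Union>y" "a ~: \<Union>E" "z = st si a y" "(\<Union>y Un \<Union>z) Int W = {}"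
  using step(2) by (auto simp: smv_def smvA_def)
 have "a \<in> \<Union>z" using st_vertices'(2)[OF *(1-3,5)] *(7) by simp
 then have aW: "a ~: W" using *(8) by blast
 have aR: "a ~: \<Union>R"
 proof
  assume aR: "a \<in> \<Union>R"
  then have "a \<in> \<Union>K" using aW assms(5) by blast
  then have "{a} \<in> R Int K" using aR cx_vertex[OF assms(3), of a] cx_vertex[OF assms(2), of a] by simp
  then show False using assms(4) *(6) by blast
 qed
 have n: "~ si <= rh" if "rh \<in> R" for rh
 proof
  assume "si <= rh"
  then have "si \<in> R" using cx_sub[OF assms(3) that] by blast
  then show False using step(3) *(2,4) by blast
 qed
 have "si ~: R" using n by blast
 then have "smv (E Un R) (y Un R) (st si a (y Un R))"
  using *(2-6) aR by (intro smvI cx_Un *(1) assms(3)) auto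
 then have "smv (E Un R) (y Un R) (z Un R)" using st_Un[OF n aR] *(7) by simp
 moreover have "R Int z <= E"
 proof
  fix rh assume r: "rh \<in> R Int z"
  then have "a ~: rh" using aR by blast
  then have "rh \<in> y" using r *(7) by (simp add: st_def)
  then show "rh \<in> E" using r step(3) by blast
 qed
 moreover have "cx z" using *(7) cx_st[OF *(1-3)] by simp
 ultimately show ?case using step(3) by (auto intro: rtranclp.rtrancl_into_rtrancl)
qed

text \<open>Unlike in \<open>seq_Un\<close>, \<open>R\<close> may contain faces that are spanned by
  vertices of \<open>E\<close> without being in \<open>E\<close>. They do no harm: \<open>R\<close>
  meets \<open>K\<close> only in \<open>E\<close>, forward moves keep it so, and the second stage of
  \<open>cW\<close> leaves all sets of boundary vertices alone.\<close>

lemma cW_Un: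
 fixes K :: "'v::infinite set set"
 assumes "cW K E" "cx K" "cx E" "E <= K" "cx R" "R Int K <= E" "v ~: \<Union>K" "v ~: \<Union>R"
 shows "seq (E Un R) (K Un R) (cone v E Un R)"
proof -
 obtain K' w where K': "(smv E)\<^sup>*\<^sup>* K K'" "w ~: \<Union>E" "seq (Pow (\<Union>E)) K' (cone w E)"
  using assms(1) by (auto simp: cW_def)
 have fE: "finite (\<Union>E)" using assms(3) by (rule cx_finite_vertices)
 have vE: "v ~: \<Union>E" using assms(4,7) by blast
 let ?W = "\<Union>R - \<Union>K"
 have W: "finite ?W" "?W Int (\<Union>K Un \<Union>E) = {}" using cx_finite_vertices[OF assms(5)] assms(4) by auto
 obtain p where p: "bij p" "\<forall>v\<in>\<Union>K Un \<Union>E. p v = v" "(smvA ?W E)\<^sup>*\<^sup>* K (im p K')"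
  using fwd_avoid[OF K'(1) assms(2) fE W] by blast
 have fixE: "im p E = E" "p ` \<Union>E = \<Union>E" using p(2) im_fix[of E p] Union_im[of p E] by auto
 have f: "(smv (E Un R))\<^sup>*\<^sup>* (K Un R) (im p K' Un R)" "R Int im p K' <= E" "cx (im p K')"
  using fwd_Un[OF p(3) assms(2,5,6) order_refl] by blast+
 have pw: "p w ~: \<Union>E" using K'(2) fixE(2) inj_image_mem_iff[OF bij_is_inj[OF p(1)], of w "\<Union>E"] by simp
 have "seq (Pow (\<Union>E)) (im p K') (cone (p w) E)"
  using seq_im[OF p(1) K'(3)] fixE by (simp add: im_Pow[OF p(1)] im_cone[OF p(1)])
 then have s: "seq (Pow (\<Union>E)) (im p K') (cone v E)"
  using cone_rename[OF assms(3) pw vE] by (rule seq_trans)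
 have "seq (E Un R) (im p K' Un R) (cone v E Un R)"
 proof (rule seq_Un[OF s f(3) assms(5)])
  show "finite (\<Union>(Pow (\<Union>E)))" using fE by simp
  show "rh \<in> Pow (\<Union>E)" if "rh <= \<Union>(Pow (\<Union>E))" for rh using that by simp
  show "\<Union>R Int (\<Union>(im p K') Un \<Union>(cone v E)) <= \<Union>(Pow (\<Union>E))"
  proof
   fix x assume x: "x \<in> \<Union>R Int (\<Union>(im p K') Un \<Union>(cone v E))"
   show "x \<in> \<Union>(Pow (\<Union>E))"
   proof (cases "x \<in> \<Union>(im p K')")
    case True
    then have "{x} \<in> R Int im p K'" using x cx_vertex[OF assms(5), of x] cx_vertex[OF f(3), of x] by simp
    then show ?thesis using f(2) by blast
   next
    case False
    then show ?thesis using x assms(8) cone_vertices[OF assms(3), of v] by auto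
   qed
  qed
  show "ta \<in> Pow (\<Union>E)" if "ta \<in> E Un R" "ta Int (\<Union>R - \<Union>(Pow (\<Union>E))) = {}" for ta using that by auto
  show "\<Union>(E Un R) <= \<Union>(Pow (\<Union>E)) Un \<Union>R" by auto
 qed
 then show ?thesis by (rule seq_trans[OF fwd_seq[OF f(1)]])
qed

lemma lk_cone_Un:
 assumes "b ~: \<Union>Q" "b ~: A"
 shows "lk A (cone b Q) = cone b (lk A Q)"
proof -
 have "(rh Un A) - {b} = (rh - {b}) Un A" "(rh - {b}) Int A = {} \<longleftrightarrow> rh Int A = {}" for rh using assms(2) by auto
 then show ?thesis unfolding lk_def cone_def by simp
qed

lemma lk_cone_in:
 assumes "b ~: \<Union>Q" "b \<in> A"
 shows "lk A (cone b Q) = lk (A - {b}) Q"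
proof (rule set_eqI)
 fix rh
 have "rh \<in> lk (A - {b}) Q ==> b ~: rh" using assms(1) by (auto simp: lk_def)
 moreover have "b ~: rh ==> (rh Un A) - {b} = rh Un (A - {b})" "b ~: rh ==> rh Int A = {} \<longleftrightarrow> rh Int (A - {b}) = {}" by auto
 moreover have "rh \<in> lk A (cone b Q) ==> b ~: rh" using assms(2) by (auto simp: lk_def)
 ultimately show "rh \<in> lk A (cone b Q) \<longleftrightarrow> rh \<in> lk (A - {b}) Q"
  by (cases "b \<in> rh") (auto simp: lk_def cone_def)
qed

lemma lk_Un: "lk A (K Un L) = lk A K Un lk A L"
 by (auto simp: lk_def)

text \<open>The smallest context: the boundary of the cone serves both as \<open>R\<close> and as
  \<open>S\<close>.\<close>

lemma PC_wc_cone: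
 fixes Q :: "'v::infinite set set"
 assumes "PC Q F" "cx Q" "cx F" "F <= Q" "b ~: \<Union>Q"
 shows "wc (cone b Q) (Q Un cone b F)"
proof -
 let ?R = "Q Un cone b F"
 have c: "cx ?R" using assms by (intro cx_Un cx_cone)
 from fresh_vertex[OF cx_finite_vertices[OF c]] obtain z where z: "z ~: \<Union>?R" ..
 have "pctx Q F b z ?R ?R"
  unfolding pctx_def using c assms(5) z cx_finite_vertices[OF c] cx_dn[OF c] by blast
 from PCD[OF assms(1) this] have "seq ?R (cone b Q Un ?R) (cone z ?R Un ?R)" .
 moreover have "cone b Q Un ?R = cone b Q" using cone_supset[OF assms(2), of b] assms(4) by (auto simp: cone_def)
 moreover have "cone z ?R Un ?R = cone z ?R" using cone_supset[OF c, of z] by blast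
 ultimately show ?thesis using z by (auto simp: wc_def simp del: Union_iff UN_iff)
qed

text \<open>At a boundary face through \<open>b\<close> the link is a link in the base; at a face of
  \<open>F\<close> it is a cone over such a link, handled by re-coning; at any other face of
  \<open>Q\<close> it is a cone over the whole of its boundary.\<close>

lemma Gw_cone:
 fixes Q :: "'v::infinite set set"
 assumes "Gw Q F" "b ~: \<Union>Q"
 shows "Gw (cone b Q) (Q Un cone b F)"
proof -
 note g = GwD[OF assms(1)]
 have bF: "b ~: \<Union>F" using assms(2) g(3) by blast
 have "wc (lk A (cone b Q)) (lk A (Q Un cone b F))" if A: "A \<in> Q Un cone b F" for A
 proof (cases "b \<in> A")
  case True
  then have "A ~: Q" using assms(2) by blast
  then have F: "A - {b} \<in> F" using A by (simp add: cone_def)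
  have "lk A Q = {}" using True assms(2) by (auto simp: lk_def)
  then show ?thesis using g(4)[OF F] by (simp add: lk_Un lk_cone_in[OF assms(2) True] lk_cone_in[OF bF True])
 next
  case False
  have e: "lk A (cone b Q) = cone b (lk A Q)" "lk A (cone b F) = cone b (lk A F)"
   using lk_cone_Un[OF assms(2) False] lk_cone_Un[OF bF False] by auto
  have bl: "b ~: \<Union>(lk A Q)" using assms(2) by (rule notin_lk)
  show ?thesis
  proof (cases "A \<in> F")
   case True
   have gl: "Gw (lk A Q) (lk A F)" by (rule Gw_lk[OF assms(1) True])
   show ?thesis unfolding lk_Un e using GwD[OF gl] by (intro PC_wc_cone Gw_PC[OF gl] bl)
  next
   case F: False
   have "lk A F = {}" using cx_sub[OF g(2)] F by (auto simp: lk_def)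
   moreover have "cone b ({} :: 'v set set) = {}" by (simp add: cone_def)
   ultimately show ?thesis unfolding lk_Un e wc_def using bl by (intro exI[of _ b]) simp
  qed
 qed
 moreover have "cone b F <= cone b Q" using g(3) by (auto simp: cone_def)
 ultimately show ?thesis unfolding Gw_def
  using cx_cone[OF g(1), of b] cx_Un[OF g(1) cx_cone[OF g(2)], of b] cone_supset[OF g(1), of b] by blast
qed

text \<open>A join with a full simplex is an iterated cone, one for each vertex of
  \<open>X\<close>.\<close>

lemma Gw_simplex_join:
 fixes L :: "'v::infinite set set"
 assumes "Gw L l" "finite X" "X Int \<Union>L = {}"
 shows "Gw {rh. rh - X \<in> L} {rh. rh - X \<in> L & (~ X <= rh \<or> rh - X \<in> l)}"
 using assms(2,3)
proof (induction X)
 case empty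
 have "{rh. rh - {} \<in> L & (~ {} <= rh \<or> rh - {} \<in> l)} = l" using GwD(3)[OF assms(1)] by auto
 then show ?case using assms(1) by simp
next
 case (insert x X)
 let ?Q = "{rh. rh - X \<in> L}" and ?F = "{rh. rh - X \<in> L & (~ X <= rh \<or> rh - X \<in> l)}"
 have x: "x ~: \<Union>L" "x ~: X" using insert by auto
 have xQ: "x ~: \<Union>?Q" using x by blast
 have d: "rh - insert x X = rh - {x} - X" for rh by auto
 have q: "x ~: rh ==> rh - {x} = rh" for rh by auto
 have "Gw (cone x ?Q) (?Q Un cone x ?F)" using insert by (intro Gw_cone xQ) auto
 moreover have "cone x ?Q = {rh. rh - insert x X \<in> L}" unfolding cone_def d by simp
 moreover have "?Q Un cone x ?F = {rh. rh - insert x X \<in> L & (~ insert x X <= rh \<or> rh - insert x X \<in> l)}"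
 proof (rule set_eqI)
  fix rh
  have "x \<in> rh ==> rh - X ~: L" using x by blast
  moreover have "X <= rh - {x} \<longleftrightarrow> X <= rh" using x(2) by auto
  ultimately show "rh \<in> ?Q Un cone x ?F \<longleftrightarrow> rh \<in> {rh. rh - insert x X \<in> L & (~ insert x X <= rh \<or> rh - insert x X \<in> l)}"
   unfolding cone_def d by (cases "x \<in> rh") (auto simp: q)
 qed
 ultimately show ?case by simp
qed

section \<open>Invariance of cells under arbitrary stellar moves\<close>

text \<open>The first equality isolates the cone created by starring \<open>B\<close>. The second
  recognises its re-coning from \<open>z\<close> as a starring of \<open>K\<close> enlarged by a
  block over the star of \<open>B\<close> in \<open>E\<close>.\<close>

lemma st_fwd_id:
 assumes K: "cx K" "cx E" "E <= K" "B \<in> E" "B ~= {}" "a ~: \<Union>K" "z ~: \<Union>K" "z ~= a"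
 shows "st B a K = cone a (ob B K) Un ({rh \<in> K. ~ B <= rh} Un cone a (ob B E))"
  and "cone z (ob B K Un cone a (ob B E)) Un ({rh \<in> K. ~ B <= rh} Un cone a (ob B E)) = st B z (K Un cone a (cst B E))"
proof -
 have B: "a ~: B" "z ~: B" "a ~: \<Union>E" "z ~: \<Union>E" using K by auto
 have u: "rh Un B \<in> K ==> rh \<in> K" "rh Un B \<in> E ==> rh Un B \<in> K" for rh using cx_UnD(1)[OF K(1)] K(3) by blast+
 show "st B a K = cone a (ob B K) Un ({rh \<in> K. ~ B <= rh} Un cone a (ob B E))"
 proof (rule set_eqI)
  fix rh show "rh \<in> st B a K \<longleftrightarrow> rh \<in> cone a (ob B K) Un ({rh \<in> K. ~ B <= rh} Un cone a (ob B E))"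
   apply (rule split2[where b = a and c = z and rh = rh])
   apply (simp add: st_simps nv[OF K(6)] nv[OF K(7)] nv[OF B(3)] nv[OF B(4)] B K(8) K(8)[symmetric])
   subgoal for ta using u[of ta] by blast
   done
 qed
 show "cone z (ob B K Un cone a (ob B E)) Un ({rh \<in> K. ~ B <= rh} Un cone a (ob B E)) = st B z (K Un cone a (cst B E))"
 proof (rule set_eqI)
  fix rh show "rh \<in> cone z (ob B K Un cone a (ob B E)) Un ({rh \<in> K. ~ B <= rh} Un cone a (ob B E)) \<longleftrightarrow> rh \<in> st B z (K Un cone a (cst B E))"
   apply (rule split2[where b = a and c = z and rh = rh])
   apply (simp add: st_simps nv[OF K(6)] nv[OF K(7)] nv[OF B(3)] nv[OF B(4)] B K(8) K(8)[symmetric])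
   subgoal for ta using u[of ta] by blast
   done
 qed
qed

lemma st_apex_id:
 assumes E: "cx E" "B \<in> E" "B ~= {}" "a ~: \<Union>E" "v ~: \<Union>E" "v ~= a" "z ~: \<Union>E" "z ~= a" "z ~= v"
 shows "st B z (cone v E Un cone a (cst B E)) = st {v, a} z (cone v (st B a E))"
  and "st (insert v B) a (cone v E) = cone v (st B a E) Un cone a (cst B E)"
proof -
 have B: "a ~: B" "z ~: B" "v ~: B" using E by auto
 have u: "rh Un B \<in> E ==> rh \<in> E" "rh \<in> E ==> B <= rh ==> rh Un B \<in> E" for rh using cx_UnD(1)[OF E(1), of rh B] by (simp_all add: Un_absorb2)
 show "st B z (cone v E Un cone a (cst B E)) = st {v, a} z (cone v (st B a E))"
 proof (rule set_eqI)
  fix rh show "rh \<in> st B z (cone v E Un cone a (cst B E)) \<longleftrightarrow> rh \<in> st {v, a} z (cone v (st B a E))"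
   apply (rule split3[where a = z and b = v and c = a and rh = rh])
   apply (simp add: st_simps nv[OF E(4)] nv[OF E(5)] nv[OF E(7)] B E(6,8,9) E(6,8,9)[symmetric])
   subgoal for ta using u[of ta] by blast
   done
 qed
 show "st (insert v B) a (cone v E) = cone v (st B a E) Un cone a (cst B E)"
 proof (rule set_eqI)
  fix rh show "rh \<in> st (insert v B) a (cone v E) \<longleftrightarrow> rh \<in> cone v (st B a E) Un cone a (cst B E)"
   apply (rule split2[where b = v and c = a and rh = rh])
   apply (simp add: st_simps nv[OF E(4)] nv[OF E(5)] B E(6) E(6)[symmetric])
   subgoal for ta using u[of ta] by blast
   done
 qed
qed

text \<open>Re-coning the cone at \<open>a\<close> from \<open>z\<close> makes the starring at
  \<open>B\<close> reversible without touching the new boundary, since \<open>B\<close> is no longer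
  one of its faces. Undoing it leaves \<open>K\<close> with a block on its boundary; there
  \<open>K\<close> is replaced by \<open>cone v E\<close>, and this cone together with the block is
  equivalent to the cone over the starred boundary.\<close>

lemma wc_st_fwd:
 fixes K :: "'v::infinite set set"
 assumes g: "Gw K E" and B: "B \<in> E" "B ~= {}" "a ~: \<Union>K"
 shows "wc (st B a K) (st B a E)"
proof -
 note K = GwD(1-3)[OF g]
 have BK: "B \<in> K" using B K by blast
 have aE: "a ~: \<Union>E" using B(3) K(3) by blast
 have "finite (insert a (\<Union>K))" using cx_finite_vertices[OF K(1)] by simp
 from fresh_vertex[OF this] obtain z where "z ~: insert a (\<Union>K)" ..
 then have z: "z ~: \<Union>K" "z ~= a" "z ~: \<Union>E" using K(3) by auto
 have "finite (insert a (insert z (\<Union>K)))" using cx_finite_vertices[OF K(1)] by simp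
 from fresh_vertex[OF this] obtain v where "v ~: insert a (insert z (\<Union>K))" ..
 then have v: "v ~: \<Union>K" "v ~= a" "v ~= z" "v ~: \<Union>E" using K(3) by auto
 let ?E1 = "st B a E" and ?T = "cone a (cst B E)" and ?R = "{rh \<in> K. ~ B <= rh} Un cone a (ob B E)"
 note id = st_fwd_id[OF K B(1,2,3) z(1,2)]
 have cT: "cx ?T" using K(2) B(1) by (intro cx_cone cx_cst)
 have cE1: "cx ?E1" using K(2) B by (intro cx_st)
 have cR: "cx ?R"
 proof (rule cx_Un)
  have "{rh \<in> K. ~ B <= rh} = K Int {rh. ~ B <= rh}" by auto
  then show "cx {rh \<in> K. ~ B <= rh}" using cx_Int[OF K(1), of "{rh. ~ B <= rh}"] B(2) by (auto simp: dn_def)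
  show "cx (cone a (ob B E))" using K(2) B by (intro cx_cone cx_ob)
 qed
 \<comment> \<open>The context contains the new boundary, so re-coning in it is a path relative to
   \<open>?E1\<close>.\<close>
 have E1R: "?E1 <= ?R"
 proof
  fix rh assume "rh \<in> ?E1"
  then show "rh \<in> ?R" using K(3) by (cases "a \<in> rh") (auto simp: st_def cone_def ob_def)
 qed
 have aob: "a ~: \<Union>(ob B K)" using B(3) unfolding ob_def by blast
 have zR: "z ~: \<Union>?R"
 proof (rule notin_Un)
  show "z ~: \<Union>{rh \<in> K. ~ B <= rh}" using z by blast
  have "z ~: \<Union>(ob B E)" using z unfolding ob_def by blast
  then show "z ~: \<Union>(cone a (ob B E))" using z by (intro notin_cone)
 qed
 have "pctx (ob B K) (ob B E) a z ?R ?R"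
  unfolding pctx_def
 proof (intro conjI)
  show "cx ?R" "dn ?R" "finite (\<Union>?R)" using cR cx_dn[OF cR] cx_finite_vertices[OF cR] by blast+
  show "a ~: \<Union>(ob B K)" by (rule aob)
  show "z ~: \<Union>?R" by (rule zR)
  show "ob B K Un cone a (ob B E) <= ?R" using cx_UnD(1)[OF K(1)] by (auto simp: ob_def)
  show "?R Int cone a (ob B K) <= ob B K Un cone a (ob B E)"
  proof
   fix rh assume r: "rh \<in> ?R Int cone a (ob B K)"
   show "rh \<in> ob B K Un cone a (ob B E)"
   proof (cases "a \<in> rh")
    case True
    then have "rh ~: K" using B(3) by blast
    then show ?thesis using r by blast
   next
    case False
    then show ?thesis using r by (simp add: cone_def)
   qed
  qed
 qed simp
 from PCD[OF PC_ob[OF g B(1,2)] this]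
 have "seq ?R (st B a K) (st B z (K Un ?T))" unfolding id(1)[symmetric] id(2) .
 then have 1: "seq ?E1 (st B a K) (st B z (K Un ?T))" using E1R by (rule seq_mono)
 have BE1: "B ~: ?E1" by (simp add: st_def)
 have zE1: "z ~: \<Union>?E1" using z by (intro notin_st)
 have zT: "z ~: \<Union>?T"
 proof (rule notin_cone)
  show "z ~: \<Union>(cst B E)" using z(3) unfolding cst_def by blast
 qed (rule z(2))
 have "smv ?E1 (K Un ?T) (st B z (K Un ?T))"
  by (rule smvI[OF cx_Un[OF K(1) cT] _ B(2) BE1 notin_Un[OF z(1) zT] zE1]) (use BK in simp)
 then have 2: "seq ?E1 (st B z (K Un ?T)) (K Un ?T)" by (rule seq1')
 have VT: "\<Union>?T <= insert a (\<Union>E)" unfolding cone_def cst_def by blast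
 have aT: "{a} \<in> ?T" using B(1) by (simp add: cone_def cst_def)
 have "seq E K (cone v E)" by (rule wc_any[OF Gw_wc[OF g] K(2) v(4)])
 then have 3: "seq ?E1 (K Un ?T) (cone v E Un ?T)"
 proof (rule seq_Un[OF _ K(1) cT cx_finite_vertices[OF K(2)]])
  show "rh \<in> E" if "rh \<in> ?T" "rh <= \<Union>E" for rh
  proof -
   have "rh - {a} = rh" using that(2) aE by blast
   then show ?thesis using that(1) cx_UnD(1)[OF K(2), of rh B] by (simp add: cone_def cst_def)
  qed
  have "a ~: \<Union>K Un \<Union>(cone v E)" using B(3) aE v(2) cone_vertices[OF K(2), of v] by simp
  then show "\<Union>?T Int (\<Union>K Un \<Union>(cone v E)) <= \<Union>E" using VT by blast
  have aTE: "a \<in> \<Union>?T - \<Union>E" using aT aE by blast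
  show "ta \<in> E" if "ta \<in> ?E1" "ta Int (\<Union>?T - \<Union>E) = {}" for ta
  proof -
   have "a ~: ta" using that(2) aTE by blast
   then show ?thesis using that(1) by (simp add: st_def)
  qed
  show "\<Union>?E1 <= \<Union>E Un \<Union>?T" using st_vertices[of B a E] aT by blast
 qed
 have E': "cx (cone v E Un ?T)" "cx (cone v ?E1)" using K(2) cT cE1 by (auto intro: cx_Un cx_cone)
 have "smv ?E1 (cone v E Un ?T) (st B z (cone v E Un ?T))"
 proof (rule smvI[OF E'(1) _ B(2) BE1 _ zE1])
  show "B \<in> cone v E Un ?T" using cone_supset[OF K(2), of v] B(1) by blast
  show "z ~: \<Union>(cone v E Un ?T)" by (rule notin_Un[OF notin_cone[OF z(3) v(3)[symmetric]] zT])
 qed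
 moreover have "smv ?E1 (cone v ?E1) (st {v, a} z (cone v ?E1))"
 proof (rule smvI[OF E'(2) _ _ _ _ zE1])
  have "{a} \<in> ?E1" using B aE by (auto simp: st_def)
  then show "{v, a} \<in> cone v ?E1" using v(2) by (simp add: cone_def insert_Diff_if)
  have "v ~: \<Union>?E1" using v by (intro notin_st)
  then show "{v, a} ~: ?E1" by blast
  show "z ~: \<Union>(cone v ?E1)" using zE1 v(3) by (intro notin_cone) auto
 qed simp
 ultimately have 4: "seq ?E1 (cone v E Un ?T) (cone v ?E1)"
  unfolding st_apex_id(1)[OF K(2) B(1,2) aE v(4,2) z(3,2) v(3)[symmetric]]
  using seq_trans[OF seq1 seq1'] by blast
 have "seq ?E1 (st B a K) (cone v ?E1)"
  by (rule seq_trans[OF seq_trans[OF seq_trans[OF 1 2] 3] 4])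
 moreover have "v ~: \<Union>?E1" using v by (intro notin_st)
 ultimately show ?thesis unfolding wc_def by blast
qed

text \<open>The closed star of \<open>B\<close> in \<open>K\<close> is a cone whose apex is any
  vertex \<open>b\<close> of \<open>B\<close>; the base \<open>?Q\<close> is the join of the simplex
  on \<open>B - {b}\<close> with the link of \<open>B\<close>, a cell by assumption. Re-coning from
  \<open>a\<close> turns \<open>K\<close> into the starred complex with a block \<open>?T\<close>,
  to which the assumption on the starred complex applies. One move turns the resulting cone and
  block back into \<open>cone v E\<close>.\<close>

lemma wc_st_bwd:
 fixes K :: "'v::infinite set set"
 assumes K: "cx K" "cx E" "E <= K" and B: "B \<in> E" "B ~= {}" "a ~: \<Union>K"
  and g: "Gw (st B a K) (st B a E)" "Gw (lk B K) (lk B E)"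
 shows "wc K E"
proof -
 have BK: "B \<in> K" "finite B" using B K cx_face_finite[OF K(2)] by auto
 have aE: "a ~: \<Union>E" using B(3) K(3) by blast
 obtain b where b: "b \<in> B" using B(2) by blast
 let ?X = "B - {b}"
 let ?Q = "{rh. rh - ?X \<in> lk B K}" and ?F = "{rh. rh - ?X \<in> lk B K & (~ ?X <= rh \<or> rh - ?X \<in> lk B E)}"
 have gQ: "Gw ?Q ?F" using g(2) BK(2) by (intro Gw_simplex_join) (auto simp: lk_def)
 have Qin: "rh \<in> ?Q \<longleftrightarrow> b ~: rh & rh Un B \<in> K" and lE: "rh - ?X \<in> lk B E \<longleftrightarrow> b ~: rh & rh Un B \<in> E" for rh
 proof -
  have "rh - ?X Un B = rh Un B" "(rh - ?X) Int B = {} \<longleftrightarrow> b ~: rh" using b by auto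
  then show "rh \<in> ?Q \<longleftrightarrow> b ~: rh & rh Un B \<in> K" "rh - ?X \<in> lk B E \<longleftrightarrow> b ~: rh & rh Un B \<in> E" unfolding lk_def by auto
 qed
 have Fin: "rh \<in> ?F \<longleftrightarrow> b ~: rh & rh Un B \<in> K & (~ ?X <= rh \<or> rh Un B \<in> E)" for rh
  using Qin[of rh] lE[of rh] by auto
 let ?R = "{rh \<in> K. ~ B <= rh} Un cst B E"
 have bB: "rh - {b} Un B = rh Un B" "?X <= rh - {b} \<longleftrightarrow> ?X <= rh" "b \<in> rh ==> ?X <= rh \<longleftrightarrow> B <= rh" for rh using b by auto
 have cQ: "rh \<in> cone b ?Q \<longleftrightarrow> rh Un B \<in> K" for rh unfolding cone_def mem_Collect_eq Qin[unfolded mem_Collect_eq] bB by simp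
 have QF: "rh \<in> ?Q Un cone b ?F \<longleftrightarrow> rh Un B \<in> K & (~ B <= rh \<or> rh Un B \<in> E)" for rh
 proof -
  have "rh \<in> cone b ?F \<longleftrightarrow> rh Un B \<in> K & (~ ?X <= rh \<or> rh Un B \<in> E)"
   unfolding cone_def mem_Collect_eq[of _ "%rh. rh - {b} \<in> ?F"] Fin bB by simp
  then show ?thesis using Qin[of rh] bB(3)[of rh] b by blast
 qed
 have sub: "rh Un B \<in> K ==> rh \<in> K" "rh Un B \<in> E ==> rh Un B \<in> K" "rh Un B \<in> E ==> rh \<in> E" "B <= rh ==> rh Un B = rh" for rh
  using cx_UnD(1)[OF K(1)] cx_UnD(1)[OF K(2)] K(3) by auto
 have cR: "cx ?R"
 proof (rule cx_Un)
  have "{rh \<in> K. ~ B <= rh} = K Int {rh. ~ B <= rh}" by auto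
  then show "cx {rh \<in> K. ~ B <= rh}" using cx_Int[OF K(1), of "{rh. ~ B <= rh}"] B(2) by (auto simp: dn_def)
  show "cx (cst B E)" using K(2) B by (intro cx_cst)
 qed
 have aR: "a ~: \<Union>?R" using B(3) aE unfolding cst_def by blast
 have "pctx ?Q ?F b a ?R ?R"
  unfolding pctx_def
 proof (intro conjI)
  show "cx ?R" "dn ?R" "finite (\<Union>?R)" using cR cx_dn[OF cR] cx_finite_vertices[OF cR] by blast+
  show "b ~: \<Union>?Q" using Qin by blast
  show "a ~: \<Union>?R" by (rule aR)
  show "?Q Un cone b ?F <= ?R"
  proof
   fix rh assume "rh \<in> ?Q Un cone b ?F"
   then show "rh \<in> ?R" using sub(1)[of rh] unfolding QF cst_def by blast
  qed
  show "?R Int cone b ?Q <= ?Q Un cone b ?F"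
  proof
   fix rh assume "rh \<in> ?R Int cone b ?Q"
   then show "rh \<in> ?Q Un cone b ?F" unfolding QF Int_iff cQ cst_def by blast
  qed
 qed simp
 from PCD[OF Gw_PC[OF gQ] this]
 have 1: "seq ?R (cone b ?Q Un ?R) (cone a (?Q Un cone b ?F) Un ?R)" .
 let ?T = "cone a (cst B E)" and ?E1 = "st B a E" and ?K1 = "st B a K"
 have e1: "cone b ?Q Un ?R = K"
 proof (rule set_eqI)
  fix rh show "rh \<in> cone b ?Q Un ?R \<longleftrightarrow> rh \<in> K"
   unfolding Un_iff cQ mem_Collect_eq cst_def using sub[of rh] by auto
 qed
 have e2: "cone a (?Q Un cone b ?F) Un ?R = ?K1 Un ?T"
 proof (rule set_eqI)
  fix rh
  have aB: "a ~: B" using BK(1) B(3) by auto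
  have c1: "rh \<in> cone a (?Q Un cone b ?F) \<longleftrightarrow> rh - {a} Un B \<in> K & (~ B <= rh - {a} \<or> rh - {a} Un B \<in> E)"
   unfolding cone_def mem_Collect_eq[of _ "%rh. rh - {a} \<in> ?Q Un _"] QF[unfolded cone_def] by simp
  have c2: "rh \<in> ?T \<longleftrightarrow> rh - {a} Un B \<in> E" by (simp add: cone_def cst_def)
  have c3: "rh \<in> cst B E \<longleftrightarrow> rh Un B \<in> E" by (simp add: cst_def)
  have c4: "rh \<in> ?K1 \<longleftrightarrow> ~ B <= rh & (if a \<in> rh then rh - {a} Un B \<in> K else rh \<in> K)" by (simp add: st_def)
  have c5: "B <= rh - {a} \<longleftrightarrow> B <= rh" using aB by auto
  show "rh \<in> cone a (?Q Un cone b ?F) Un ?R \<longleftrightarrow> rh \<in> ?K1 Un ?T"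
  proof (cases "a \<in> rh")
   case True
   then have "rh ~: K" "rh Un B ~: E" using B(3) aE by auto
   then show ?thesis unfolding Un_iff c1 c2 c3 c4 c5 mem_Collect_eq using True sub(2)[of "rh - {a}"] by argo
  next
   case False
   then have "rh - {a} = rh" by auto
   then show ?thesis unfolding Un_iff c1 c2 c3 c4 c5 mem_Collect_eq using False sub(1,2,3)[of rh] by argo
  qed
 qed
 have "E <= ?R"
 proof
  fix rh assume "rh \<in> E" then show "rh \<in> ?R" using K(3) sub(4)[of rh] by (cases "B <= rh") (auto simp: cst_def)
 qed
 with 1 have 1: "seq E K (?K1 Un ?T)" unfolding e1 e2 by (rule seq_mono)
 have cT: "cx ?T" using K(2) B(1) by (intro cx_cone cx_cst)
 have "finite (insert a (\<Union>K))" using cx_finite_vertices[OF K(1)] by simp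
 from fresh_vertex[OF this] obtain v where "v ~: insert a (\<Union>K)" ..
 then have v: "v ~: \<Union>K" "v ~= a" "v ~: \<Union>E" using K(3) by auto
 have vT: "v ~: \<Union>?T"
 proof (rule notin_cone)
  show "v ~: \<Union>(cst B E)" using v(3) unfolding cst_def by blast
 qed (rule v(2))
 note g1 = GwD[OF g(1)]
 have "?T Int ?K1 <= ?E1"
 proof
  fix rh assume r: "rh \<in> ?T Int ?K1"
  then show "rh \<in> ?E1" using sub(3)[of rh] by (cases "a \<in> rh") (auto simp: cone_def cst_def st_def)
 qed
 \<comment> \<open>Unless it is a single vertex, \<open>B\<close> is a face of \<open>?T\<close> on
   vertices of \<open>?E1\<close> that is not in \<open>?E1\<close>; hence the use of
   \<open>cW_Un\<close> rather than \<open>seq_Un\<close>.\<close>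
 then have 2: "seq (?E1 Un ?T) (?K1 Un ?T) (cone v ?E1 Un ?T)"
  using v vT by (intro cW_Un Gw_cW[OF g(1)] g1(1-3) cT notin_st)
 have "E <= ?E1 Un ?T"
 proof
  fix rh assume r: "rh \<in> E"
  then have "a ~: rh" using aE by blast
  then show "rh \<in> ?E1 Un ?T" using r sub(4)[of rh] by (cases "B <= rh") (auto simp: cone_def cst_def st_def)
 qed
 with 2 have 2: "seq E (?K1 Un ?T) (cone v ?E1 Un ?T)" by (rule seq_mono)
 have "finite (insert a (insert v (\<Union>E)))" using cx_finite_vertices[OF K(2)] by simp
 from fresh_vertex[OF this] obtain z where "z ~: insert a (insert v (\<Union>E))" ..
 then have z: "z ~: \<Union>E" "z ~= a" "z ~= v" by auto
 have "smv E (cone v E) (st (insert v B) a (cone v E))"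
 proof (rule smvI)
  show "cx (cone v E)" using K(2) by (rule cx_cone)
  have "v ~: B" using v(1) BK(1) by blast
  then show "insert v B \<in> cone v E" using B(1) by (simp add: cone_def)
  show "insert v B ~: E" using v(3) by blast
  show "a ~: \<Union>(cone v E)" using aE v(2) by (intro notin_cone) auto
  show "a ~: \<Union>E" by (rule aE)
 qed simp
 then have 3: "seq E (cone v ?E1 Un ?T) (cone v E)"
  unfolding st_apex_id(2)[OF K(2) B(1,2) aE v(3,2) z] by (rule seq1')
 show ?thesis unfolding wc_def using seq_trans[OF seq_trans[OF 1 2] 3] v(3) by blast
qed

lemma lk_st_new:
 assumes "a ~: \<Union>K" "a ~: A" "a ~: B" "~ B <= A"
 shows "lk (insert a A) (st B a K) = ob (B - A) (lk A K)"
proof (rule set_eqI)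
 fix rh
 have "a \<in> rh ==> rh Un (B - A) Un A ~: K" using assms(1) by blast
 moreover have "a ~: rh ==> (rh Un insert a A) - {a} Un B = rh Un (B - A) Un A" using assms(2) by blast
 moreover have "B <= rh Un insert a A \<longleftrightarrow> B - A <= rh" using assms(3) by blast
 moreover have "(rh Un (B - A)) Int A = {} \<longleftrightarrow> rh Int A = {}" by blast
 ultimately show "rh \<in> lk (insert a A) (st B a K) \<longleftrightarrow> rh \<in> ob (B - A) (lk A K)"
  unfolding lk_def st_def ob_def by (cases "a \<in> rh") auto
qed

lemma lk_lk': "B <= A ==> lk (A - B) (lk B K) = lk A K"
 by (subst lk_lk) (auto simp: Un_absorb1)

lemma ob_single: "ob {y} K = lk {y} K"
 by (auto simp: ob_def lk_def)

text \<open>At a face without \<open>a\<close> the link is unchanged, starred off its boundary, or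
  starred together with it, which is \<open>wc_st_fwd\<close>. At a face through \<open>a\<close>
  the link is \<open>ob\<close> of a link, hence a join.\<close>

lemma Gw_st:
 fixes K :: "'v::infinite set set"
 assumes g: "Gw K E" and B: "B \<in> E" "B ~= {}" "a ~: \<Union>K"
 shows "Gw (st B a K) (st B a E)"
proof -
 note K = GwD(1-3)[OF g]
 have BK: "B \<in> K" using B K by blast
 have aE: "a ~: \<Union>E" using B(3) K(3) by blast
 have aB: "a ~: B" using aE B(1) by blast
 have "wc (lk A (st B a K)) (lk A (st B a E))" if A: "A \<in> st B a E" for A
 proof (cases "a \<in> A")
  case False
  then have AE: "A \<in> E" "~ B <= A" using A by (auto simp: st_def)
  show ?thesis
  proof (cases "A Un B \<in> K")
   case False2: False
   then have "A Un B ~: E" using K(3) by blast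
   then show ?thesis using lk_st_off[OF K(1) False2 False B(3)] lk_st_off[OF K(2) _ False aE] GwD(4)[OF g AE(1)] by simp
  next
   case AB: True
   have e: "lk A (st B a K) = st (B - A) a (lk A K)" by (rule lk_st[OF AB AE(2) False])
   show ?thesis
   proof (cases "A Un B \<in> E")
    case True
    have "B - A \<in> lk A E" using True by (simp add: lk_def Un_commute) blast
    then show ?thesis unfolding e lk_st[OF True AE(2) False]
     using AE(2) B(3) by (intro wc_st_fwd Gw_lk[OF g AE(1)] notin_lk) auto
   next
    case AB': False
    have eE: "lk A (st B a E) = lk A E" by (rule lk_st_off[OF K(2) AB' False aE])
    have BA: "B - A Un A = A Un B" by blast
    have AK: "A \<in> K" using AE(1) K(3) by blast
    have "smv (lk A E) (lk A K) (st (B - A) a (lk A K))"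
    proof (rule smvI[OF cx_lk[OF K(1) AK] _ _ _ notin_lk[OF B(3)] notin_lk[OF aE]])
     show "B - A \<in> lk A K" unfolding lk_def mem_Collect_eq BA using AB by blast
     show "B - A ~: lk A E" unfolding lk_def mem_Collect_eq BA using AB' by blast
     show "B - A ~= {}" using AE(2) by blast
    qed
    from wc_seq[OF seq1[OF this]] show ?thesis unfolding e eE using GwD(4)[OF g AE(1)] by simp
   qed
  qed
 next
  case True
  define A0 where "A0 = A - {a}"
  have A0: "A = insert a A0" "a ~: A0" using True by (auto simp: A0_def)
  have A1: "A0 Un B \<in> E" "~ B <= A0" using A True by (auto simp: st_def A0_def)
  have AE: "A0 \<in> E" using cx_UnD(1)[OF K(2) A1(1)] .
  have BA: "B - A0 Un A0 = A0 Un B" "A0 Int (B - A0) = {}" "A0 Un (B - A0) = A0 Un B" by blast+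
  have C: "B - A0 \<in> lk A0 E" unfolding lk_def mem_Collect_eq BA using A1(1) by blast
  note gl = GwD[OF Gw_lk[OF g AE]]
  have "wc (ob (B - A0) (lk A0 K)) (ob (B - A0) (lk A0 E))"
   using A1(2) by (intro wc_ob gl C) auto
  then show ?thesis unfolding A0(1) lk_st_new[OF B(3) A0(2) aB A1(2)] lk_st_new[OF aE A0(2) aB A1(2)] .
 qed
 moreover have "st B a E <= st B a K" using K(3) by (auto simp: st_def split: if_splits)
 ultimately show ?thesis unfolding Gw_def using cx_st[OF K(1) BK B(2)] cx_st[OF K(2) B(1,2)] by blast
qed

text \<open>The link of a face above \<open>B\<close> reappears at the face in which one vertex of
  \<open>B\<close> is exchanged for \<open>a\<close>. This yields the assumption on the link of
  \<open>B\<close> in \<open>wc_st_bwd\<close>, which settles the faces not above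
  \<open>B\<close>.\<close>

lemma Gw_st_rev:
 fixes K :: "'v::infinite set set"
 assumes K: "cx K" "cx E" "E <= K" and g: "Gw (st B a K) (st B a E)" and B: "B \<in> E" "B ~= {}" "a ~: \<Union>K"
 shows "Gw K E"
proof -
 have BK: "B \<in> K" using B K by blast
 have aE: "a ~: \<Union>E" using B(3) K(3) by blast
 have aB: "a ~: B" using aE B(1) by blast
 have sup: "wc (lk A K) (lk A E)" if A: "A \<in> E" "B <= A" for A
 proof -
  obtain y where y: "y \<in> B" using B(2) by blast
  let ?A = "A - {y}"
  have aA: "a ~: ?A" "~ B <= ?A" "B - ?A = {y}" using A y aE by blast+
  have "?A Un B = A" using A(2) y by blast
  then have "insert a ?A \<in> st B a E" using aA(1,2) A(1) aB by (auto simp: st_def)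
  from GwD(4)[OF g this] show ?thesis
   unfolding lk_st_new[OF B(3) aA(1) aB aA(2)] lk_st_new[OF aE aA(1) aB aA(2)] aA(3) ob_single
   using lk_lk[of ?A "{y}"] A(2) y by (simp add: insert_absorb subsetD)
 qed
 have gB: "Gw (lk A K) (lk A E)" if A: "A \<in> E" "B <= A" for A
 proof -
  have "wc (lk C (lk A K)) (lk C (lk A E))" if C: "C \<in> lk A E" for C
  proof -
   have "A Int C = {}" "A Un C \<in> E" using C by (auto simp: lk_def Un_commute)
   then show ?thesis using sup[of "A Un C"] A(2) by (simp add: lk_lk le_supI1)
  qed
  then show ?thesis unfolding Gw_def using cx_lk[OF K(1), of A] cx_lk[OF K(2) A(1)] K(3) A(1) lk_mono[OF K(3), of A] by blast
 qed
 have "wc (lk A K) (lk A E)" if A: "A \<in> E" for A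
 proof (cases "B <= A")
  case True then show ?thesis by (rule sup[OF A])
 next
  case BA: False
  have aA: "a ~: A" using A aE by blast
  have A1: "A \<in> st B a E" using A aA BA by (simp add: st_def)
  have AK: "A \<in> K" using A K(3) by blast
  have BAe: "B - A Un A = A Un B" "A Int (B - A) = {}" "A Un (B - A) = A Un B" by blast+
  show ?thesis
  proof (cases "A Un B \<in> K")
   case False
   then have "A Un B ~: E" using K(3) by blast
   then show ?thesis using lk_st_off[OF K(1) False aA B(3)] lk_st_off[OF K(2) _ aA aE] GwD(4)[OF g A1] by simp
  next
   case AB: True
   have e: "lk A (st B a K) = st (B - A) a (lk A K)" by (rule lk_st[OF AB BA aA])
   show ?thesis
   proof (cases "A Un B \<in> E")
    case True
    have eE: "lk A (st B a E) = st (B - A) a (lk A E)" by (rule lk_st[OF True BA aA])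
    have "B - A \<in> lk A E" unfolding lk_def mem_Collect_eq BAe using True by blast
    moreover have "Gw (st (B - A) a (lk A K)) (st (B - A) a (lk A E))" using Gw_lk[OF g A1] unfolding e eE .
    moreover have "Gw (lk (B - A) (lk A K)) (lk (B - A) (lk A E))"
     unfolding lk_lk[OF BAe(2)] BAe(3) using True by (intro gB) auto
    ultimately show ?thesis using BA B(3)
     by (intro wc_st_bwd[of "lk A K" "lk A E" "B - A" a] cx_lk K AK A lk_mono notin_lk) auto
   next
    case AB': False
    have eE: "lk A (st B a E) = lk A E" by (rule lk_st_off[OF K(2) AB' aA aE])
    have "smv (lk A E) (lk A K) (st (B - A) a (lk A K))"
    proof (rule smvI[OF cx_lk[OF K(1) AK] _ _ _ notin_lk[OF B(3)] notin_lk[OF aE]])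
     show "B - A \<in> lk A K" unfolding lk_def mem_Collect_eq BAe using AB by blast
     show "B - A ~: lk A E" unfolding lk_def mem_Collect_eq BAe using AB' by blast
     show "B - A ~= {}" using BA by blast
    qed
    from wc_seq[OF seq1[OF this]] show ?thesis using GwD(4)[OF g A1] unfolding e eE by simp
   qed
  qed
 qed
 then show ?thesis unfolding Gw_def using K by blast
qed

section \<open>Balls and spheres\<close>

text \<open>Only the empty face is protected, so this is unrestricted stellar equivalence.\<close>

definition sph :: "int => 'v set set => bool" where
 "sph d K \<longleftrightarrow> (\<exists>V. finite V & V ~= {} & int (card V) = d + 2 & seq {{}} (bd V) K)"

definition bal :: "int => 'v set set => bool" where
 "bal d K \<longleftrightarrow> (\<exists>V. finite V & V ~= {} & int (card V) = d + 1 & seq {{}} (Pow V) K)"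

lemma sph_seq: "seq {{}} K K' ==> sph d K \<longleftrightarrow> sph d K'"
 unfolding sph_def by (meson seq_sym seq_trans)

lemma bal_seq: "seq {{}} K K' ==> bal d K \<longleftrightarrow> bal d K'"
 unfolding bal_def by (meson seq_sym seq_trans)

text \<open>Adding or removing \<open>x\<close> pairs off the faces of the closed star.\<close>

lemma card_cst_even:
 assumes "cx K" "si \<in> K" "x \<in> si" shows "even (card (cst si K))"
proof -
 let ?X = "{rh \<in> cst si K. x ~: rh}"
 have "cst si K = ?X Un insert x ` ?X"
 proof (rule set_eqI)
  fix rh
  have "rh - {x} Un si = rh Un si" "insert x rh Un si = rh Un si" for rh using assms(3) by auto
  then have 1: "rh - {x} \<in> cst si K \<longleftrightarrow> rh \<in> cst si K" "insert x rh \<in> cst si K \<longleftrightarrow> rh \<in> cst si K" for rh by (simp_all add: cst_def)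
  have "rh \<in> insert x ` ?X \<longleftrightarrow> rh \<in> cst si K & x \<in> rh"
  proof
   assume "rh \<in> cst si K & x \<in> rh"
   then have "rh = insert x (rh - {x})" "rh - {x} \<in> ?X" using 1 by auto
   then show "rh \<in> insert x ` ?X" by (rule image_eqI)
  qed (use 1 in auto)
  then show "rh \<in> cst si K \<longleftrightarrow> rh \<in> ?X Un insert x ` ?X" by auto
 qed
 moreover have "card (?X Un insert x ` ?X) = card ?X + card (insert x ` ?X)"
  using cx_finite[OF cx_cst[OF assms(1,2)]] by (intro card_Un_disjoint) auto
 moreover have "card (insert x ` ?X) = card ?X"
  by (rule card_image) (auto simp: inj_on_def dest: insert_ident)
 ultimately show ?thesis by simp
qed

text \<open>Starring trades the faces containing \<open>si\<close> for those of
  \<open>ob si K\<close> with \<open>a\<close> added. Together these two sets are as numerous as the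
  closed star, an even number.\<close>

lemma card_st_parity:
 assumes "cx K" "si \<in> K" "si ~= {}" "a ~: \<Union>K"
 shows "even (card (st si a K)) \<longleftrightarrow> even (card K)"
proof -
 let ?N = "{ta \<in> K. ~ si <= ta}" and ?U = "{ta \<in> K. si <= ta}"
 have a: "a ~: si" "\<And>rh. rh \<in> ob si K ==> a ~: rh" "\<And>rh. rh \<in> K ==> a ~: rh" using assms(2,4) by (auto simp: ob_def)
 have fin: "finite K" "finite (ob si K)" using cx_finite assms(1) cx_ob[OF assms(1-3)] by blast+
 have "st si a K = ?N Un insert a ` ob si K"
 proof (rule set_eqI)
  fix rh
  have "rh \<in> insert a ` ob si K \<longleftrightarrow> a \<in> rh & rh - {a} \<in> ob si K"
  proof
   assume "a \<in> rh & rh - {a} \<in> ob si K"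
   moreover have "a \<in> rh ==> rh = insert a (rh - {a})" by auto
   ultimately show "rh \<in> insert a ` ob si K" by (intro image_eqI[of _ _ "rh - {a}"]) auto
  qed (use a(2) in auto)
  then show "rh \<in> st si a K \<longleftrightarrow> rh \<in> ?N Un insert a ` ob si K"
   using a(1,3) by (cases "a \<in> rh") (auto simp: st_def ob_def)
 qed
 then have s: "card (st si a K) = card ?N + card (insert a ` ob si K)"
  using fin a(3) card_Un_disjoint[of ?N "insert a ` ob si K"] by auto
 have o: "card (insert a ` ob si K) = card (ob si K)"
  by (rule card_image) (use a(2) in \<open>auto simp: inj_on_def dest: insert_ident\<close>)
 have "K = ?N Un ?U" by auto
 then have k: "card K = card ?N + card ?U" using card_Un_disjoint[of ?N ?U] fin by auto
 have "cst si K = ob si K Un ?U"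
 proof (rule set_eqI)
  fix rh show "rh \<in> cst si K \<longleftrightarrow> rh \<in> ob si K Un ?U"
   by (cases "si <= rh") (simp_all add: cst_def ob_def Un_absorb2)
 qed
 moreover have "ob si K Int ?U = {}" by (auto simp: ob_def)
 ultimately have c: "card (cst si K) = card (ob si K) + card ?U" using fin card_Un_disjoint[of "ob si K" ?U] by simp
 obtain x where "x \<in> si" using assms(3) by blast
 then have "even (card (cst si K))" by (rule card_cst_even[OF assms(1,2)])
 then show ?thesis unfolding s o k c by simp
qed

text \<open>As the empty face is counted, this parity is the reduced Euler characteristic modulo 2.
  It is even for balls and odd for spheres, which is how the two are told apart.\<close>

lemma seq_parity: "seq S K K' ==> even (card K) \<longleftrightarrow> even (card K')"
proof (induction rule: equivclp_induct)
 case (step y z)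
 have "even (card K) \<longleftrightarrow> even (card K')" if "smv S K K'" for K K' :: "'a set set"
  using that unfolding smv_def by (elim exE conjE) (simp add: card_st_parity)
 then show ?case using step by blast
qed simp

lemma bal_even: assumes "bal d K" shows "even (card K)"
proof -
 obtain V where "finite V" "V ~= {}" "seq {{}} (Pow V) K" using assms by (auto simp: bal_def)
 moreover have "even (card (Pow V))" using calculation by (simp add: card_Pow card_gt_0_iff)
 ultimately show ?thesis using seq_parity by blast
qed

lemma sph_odd: assumes "sph d K" shows "odd (card K)"
proof -
 obtain V where V: "finite V" "V ~= {}" "seq {{}} (bd V) K" using assms by (auto simp: sph_def)
 have "card (bd V) = 2 ^ card V - 1" unfolding bd_def using V by (subst card_Diff_singleton) (auto simp: card_Pow)
 moreover have "even ((2::nat) ^ card V)" using V by (simp add: card_gt_0_iff)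
 ultimately have "odd (card (bd V))" by simp
 then show ?thesis using seq_parity[OF V(3)] by blast
qed

lemma jn_bd: assumes "C ~= {}" "C Int \<Union>X = {}" shows "jn (bd C) X = {rh. ~ C <= rh & rh - C \<in> X}"
proof (cases "\<exists>v. C = {v}")
 case True
 then obtain v where v: "C = {v}" ..
 have "bd {v} = {{}}" by (auto simp: bd_def)
 then have j: "jn (bd C) X = X" unfolding v by (simp add: jn_def)
 have i: "v ~: rh & rh - {v} \<in> X \<longleftrightarrow> rh \<in> X" for rh
 proof (cases "v \<in> rh")
  case True then show ?thesis using assms(2) v by blast
 next
  case False then show ?thesis by simp
 qed
 show ?thesis unfolding v by (rule set_eqI) (simp only: j[unfolded v] mem_Collect_eq insert_subset empty_subsetI simp_thms i)
next
 case False
 then have "\<Union>(bd C) = C" by (simp add: bd_vertices)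
 moreover have "rh Int C \<in> bd C \<longleftrightarrow> ~ C <= rh" for rh by (auto simp: bd_def)
 ultimately show ?thesis unfolding jn_def by simp
qed

lemma im_bd: assumes "bij p" shows "im p (bd V) = bd (p ` V)"
proof -
 have "inj ((`) p)" by (simp add: inj_def inj_image_eq_iff[OF bij_is_inj[OF assms]])
 then have "im p (Pow V - {V}) = im p (Pow V) - im p {V}" by (rule image_set_diff)
 then show ?thesis using im_Pow[OF assms, of V] by (simp add: bd_def)
qed

lemma st_bd:
 assumes "a ~: C" "a ~: V" "C Int V = {}" "V ~= {}" "C ~= {}"
 shows "st C a (bd (C Un V)) = jn (bd C) (bd (insert a V))"
proof -
 have "C Int \<Union>(bd (insert a V)) = {}" using assms by (auto simp: bd_def)
 note j = jn_bd[OF assms(5) this]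
 show ?thesis
 proof (rule set_eqI)
  fix rh
  show "rh \<in> st C a (bd (C Un V)) \<longleftrightarrow> rh \<in> jn (bd C) (bd (insert a V))"
  proof (cases "a \<in> rh")
   case True
   have "rh - {a} Un C \<in> bd (C Un V) \<longleftrightarrow> rh - C \<in> bd (insert a V)" using assms(1-3) True unfolding bd_def by blast
   then show ?thesis unfolding j st_def using True by simp
  next
   case False
   have "~ C <= rh ==> rh \<in> bd (C Un V) \<longleftrightarrow> rh - C \<in> bd (insert a V)" using assms(1-3) False unfolding bd_def by blast
   then show ?thesis unfolding j st_def using False by auto
  qed
 qed
qed

lemma st_Pow:
 assumes "a ~: C" "a ~: V" "C Int V = {}" "C ~= {}"
 shows "st C a (Pow (C Un V)) = jn (bd C) (Pow (insert a V))"
proof -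
 have "C Int \<Union>(Pow (insert a V)) = {}" using assms by auto
 note j = jn_bd[OF assms(4) this]
 show ?thesis
 proof (rule set_eqI)
  fix rh
  show "rh \<in> st C a (Pow (C Un V)) \<longleftrightarrow> rh \<in> jn (bd C) (Pow (insert a V))"
   unfolding j st_def using assms by (cases "a \<in> rh") auto
 qed
qed

lemma sph_bd: assumes "finite V" "V ~= {}" shows "sph (int (card V) - 2) (bd V)"
 unfolding sph_def using assms by (intro exI[of _ V]) simp

lemma bal_Pow: assumes "finite V" "V ~= {}" shows "bal (int (card V) - 1) (Pow V)"
 unfolding bal_def using assms by (intro exI[of _ V]) simp

lemma seq_nil_jn:
 fixes L :: "'v::infinite set set"
 assumes "seq {{}} X L" "cx X" "cx L" "cx J" "\<Union>J Int (\<Union>X Un \<Union>L) = {}"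
 shows "seq {{}} (jn J X) (jn J L)"
 by (rule seq_jn[OF assms(1,2,4)]) (use assms(5) in auto)

lemma rename_apart:
 fixes L :: "'v::infinite set set"
 assumes "cx L" "finite V" "finite C" "C Int \<Union>L = {}"
 shows "\<exists>p. bij p & im p L = L & p ` V Int C = {}"
proof -
 obtain p where "bij p" "\<forall>v\<in>\<Union>L. p v = v" "p ` V Int C = {}"
  using ex_bij_avoid[OF cx_finite_vertices[OF assms(1)] assms(2,3,4)] by blast
 then show ?thesis using im_fix[of L p] by blast
qed

text \<open>By \<open>st_bd\<close>, the join of two simplex boundaries is a starring of the
  boundary of a larger simplex.\<close>

lemma sph_jn:
 fixes L :: "'v::infinite set set"
 assumes "sph e L" "cx L" "finite C" "C ~= {}" "C Int \<Union>L = {}"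
 shows "sph (e + int (card C) - 1) (jn (bd C) L)"
proof -
 obtain V0 where V0: "finite V0" "V0 ~= {}" "int (card V0) = e + 2" "seq {{}} (bd V0) L" using assms(1) by (auto simp: sph_def)
 from rename_apart[OF assms(2) V0(1) assms(3,5)] obtain p where p0: "bij p & im p L = L & p ` V0 Int C = {}" ..
 note p = p0[THEN conjunct1] p0[THEN conjunct2, THEN conjunct1] p0[THEN conjunct2, THEN conjunct2]
 define V where "V = p ` V0"
 have V: "finite V" "V ~= {}" "int (card V) = e + 2" "V Int C = {}"
  unfolding V_def using V0(1-3) p(3) card_image[OF inj_on_subset[OF bij_is_inj[OF p(1)] subset_UNIV], of V0] by simp_all
 have s: "seq {{}} (bd V) L" using seq_im[OF p(1) V0(4)] p(2) im_bd[OF p(1)] by (simp add: V_def)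
 have cV: "cx (bd V)" using V by (intro cx_bd)
 have "\<Union>(bd C) Int (\<Union>(bd V) Un \<Union>L) = {}" using V(4) assms(5) unfolding bd_def by blast
 then have 1: "seq {{}} (jn (bd C) (bd V)) (jn (bd C) L)"
  using s cV assms(2-4) by (intro seq_nil_jn cx_bd[OF assms(3,4)])
 \<comment> \<open>The vertex \<open>a\<close> plays the new vertex of that starring; the larger
   simplex is therefore spanned by \<open>C\<close> and \<open>V - {a}\<close>, which accounts for
   the shift by one in the dimension.\<close>
 obtain a where a: "a \<in> V" using V(2) by blast
 let ?V = "V - {a}"
 have cd: "int (card V) = int (card ?V) + 1" using card_Suc_Diff1[OF V(1) a] by simp
 show ?thesis
 proof (cases "?V = {}")
  case True
  then have "V = {a}" using a by blast
  then have "bd V = {{}}" by (auto simp: bd_def)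
  moreover have "jn (bd C) {{}} = bd C" using jn_bd[OF assms(4), of "{{}}"] by (auto simp: bd_def)
  ultimately have "seq {{}} (bd C) (jn (bd C) L)" using 1 by simp
  from sph_seq[OF this] sph_bd[OF assms(3,4)] have "sph (int (card C) - 2) (jn (bd C) L)" by simp
  moreover have "int (card C) - 2 = e + int (card C) - 1" using V(3) \<open>V = {a}\<close> by simp
  ultimately show ?thesis by simp
 next
  case False
  have aC: "a ~: C" using a V(4) by blast
  have "smv {{}} (bd (C Un ?V)) (st C a (bd (C Un ?V)))"
   using False V assms aC by (intro smvI cx_bd) (auto simp: bd_def)
  moreover have "C Int ?V = {}" "insert a ?V = V" using V(4) a by blast+
  then have "st C a (bd (C Un ?V)) = jn (bd C) (bd V)"
   using st_bd[of a C ?V] aC False assms(4) by simp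
  ultimately have "seq {{}} (bd (C Un ?V)) (jn (bd C) (bd V))" by (simp add: seq1)
  from sph_seq[OF seq_trans[OF this 1]] have iff: "sph d (bd (C Un ?V)) \<longleftrightarrow> sph d (jn (bd C) L)" for d .
  have "sph (int (card (C Un ?V)) - 2) (bd (C Un ?V))" using assms(3,4) V(1) by (intro sph_bd) auto
  moreover have "card (C Un ?V) = card C + card ?V" using V(1,4) assms(3) by (intro card_Un_disjoint) auto
  then have "int (card (C Un ?V)) - 2 = e + int (card C) - 1" using cd V(3) by simp
  ultimately show ?thesis unfolding iff by simp
 qed
qed

lemma bal_jn:
 fixes L :: "'v::infinite set set"
 assumes "bal e L" "cx L" "finite C" "C ~= {}" "C Int \<Union>L = {}"
 shows "bal (e + int (card C) - 1) (jn (bd C) L)"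
proof -
 obtain V0 where V0: "finite V0" "V0 ~= {}" "int (card V0) = e + 1" "seq {{}} (Pow V0) L" using assms(1) by (auto simp: bal_def)
 from rename_apart[OF assms(2) V0(1) assms(3,5)] obtain p where p0: "bij p & im p L = L & p ` V0 Int C = {}" ..
 note p = p0[THEN conjunct1] p0[THEN conjunct2, THEN conjunct1] p0[THEN conjunct2, THEN conjunct2]
 define V where "V = p ` V0"
 have V: "finite V" "V ~= {}" "int (card V) = e + 1" "V Int C = {}"
  unfolding V_def using V0(1-3) p(3) card_image[OF inj_on_subset[OF bij_is_inj[OF p(1)] subset_UNIV], of V0] by simp_all
 have s: "seq {{}} (Pow V) L" using seq_im[OF p(1) V0(4)] p(2) im_Pow[OF p(1)] by (simp add: V_def)
 have "\<Union>(bd C) Int (\<Union>(Pow V) Un \<Union>L) = {}" using V(4) assms(5) unfolding bd_def by blast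
 then have 1: "seq {{}} (jn (bd C) (Pow V)) (jn (bd C) L)"
  using s V assms by (intro seq_nil_jn cx_bd cx_Pow)
 obtain a where a: "a \<in> V" using V(2) by blast
 let ?V = "V - {a}"
 have cd: "int (card V) = int (card ?V) + 1" using card_Suc_Diff1[OF V(1) a] by simp
 have aC: "a ~: C" using a V(4) by blast
 have "smv {{}} (Pow (C Un ?V)) (st C a (Pow (C Un ?V)))"
  using V assms aC by (intro smvI cx_Pow) auto
 moreover have "C Int ?V = {}" "insert a ?V = V" using V(4) a by blast+
 then have "st C a (Pow (C Un ?V)) = jn (bd C) (Pow V)"
  using st_Pow[of a C ?V] aC assms(4) by simp
 ultimately have "seq {{}} (Pow (C Un ?V)) (jn (bd C) (Pow V))" by (simp add: seq1)
 from bal_seq[OF seq_trans[OF this 1]] have iff: "bal d (Pow (C Un ?V)) \<longleftrightarrow> bal d (jn (bd C) L)" for d .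
 have "bal (int (card (C Un ?V)) - 1) (Pow (C Un ?V))" using assms(3,4) V(1) by (intro bal_Pow) auto
 moreover have "card (C Un ?V) = card C + card ?V" using V(1,4) assms(3) by (intro card_Un_disjoint) auto
 then have "int (card (C Un ?V)) - 1 = e + int (card C) - 1" using cd V(3) by simp
 ultimately show ?thesis unfolding iff by simp
qed

section \<open>Balls with their boundary\<close>

definition mb :: "'v set set => 'v set set" where
 "mb K = {A \<in> K. \<nexists>e. sph e (lk A K)}"

text \<open>The strengthened notion of a ball that can be carried through star moves in both
  directions: beyond the links, it records that the boundary bounds \<open>K\<close> as a
  cell.\<close>

definition bs :: "int => 'v set set => bool" where
 "bs d K \<longleftrightarrow> Gw K (mb K) & (\<forall>A\<in>K. A ~: mb K --> sph (d - int (card A)) (lk A K)) &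
  (\<forall>A\<in>mb K. bal (d - int (card A)) (lk A K))"

lemma bsD: assumes "bs d K"
 shows "Gw K (mb K)" "A \<in> K ==> A ~: mb K ==> sph (d - int (card A)) (lk A K)"
  "A \<in> mb K ==> bal (d - int (card A)) (lk A K)" "cx K" "cx (mb K)" "mb K <= K"
 using assms GwD[of K "mb K"] by (auto simp: bs_def)

lemma bs_bal: "bs d K ==> bal d K"
 using bsD(3)[of d K "{}"] bsD(5)[of d K] by simp

lemma bal_not_sph: "bal d K ==> ~ sph e K"
 using bal_even sph_odd by blast

lemma seq_lk_st:
 assumes "cx K" "B \<in> K" "B ~= {}" "a ~: \<Union>K" "A \<in> K" "~ B <= A"
 shows "seq {{}} (lk A K) (lk A (st B a K))"
proof -
 have aA: "a ~: A" using assms by blast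
 show ?thesis
 proof (cases "A Un B \<in> K")
  case False
  then show ?thesis using lk_st_off[OF assms(1) False aA assms(4)] by simp
 next
  case True
  have e: "B - A Un A = A Un B" by blast
  have "smv {{}} (lk A K) (st (B - A) a (lk A K))"
  proof (rule smvI[OF cx_lk[OF assms(1,5)] _ _ _ notin_lk[OF assms(4)]])
   show "B - A \<in> lk A K" unfolding lk_def mem_Collect_eq e using True by blast
  qed (use assms(6) in auto)
  then show ?thesis unfolding lk_st[OF True assms(6) aA] by (rule seq1)
 qed
qed

lemma lk_st_jn:
 assumes "cx K" "a ~: \<Union>K" "a ~: A" "A Un B \<in> K" "~ B <= A"
 shows "lk (insert a A) (st B a K) = jn (bd (B - A)) (lk (A Un B) K)"
proof -
 have aB: "a ~: B" using assms(2,4) by blast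
 have e: "A Int (B - A) = {}" "A Un (B - A) = A Un B" by blast+
 show ?thesis unfolding lk_st_new[OF assms(2,3) aB assms(5)] ob_jn lk_lk[OF e(1)] e(2) ..
qed

lemma lk_st_face:
 assumes "cx K" "a ~: \<Union>K" "A \<in> K" "B <= A" "y \<in> B"
 shows "lk (insert a (A - {y})) (st B a K) = lk A K" "insert a (A - {y}) \<in> st B a K"
proof -
 have aA: "a ~: A - {y}" "~ B <= A - {y}" "a ~: B" "B - (A - {y}) = {y}" "A - {y} Un B = A" using assms by blast+
 show "insert a (A - {y}) \<in> st B a K" using aA assms(3) by (auto simp: st_def)
 have "bd {y} = {{}}" by (auto simp: bd_def)
 then have "jn (bd {y}) (lk A K) = lk A K" by (simp add: jn_def)
 then show "lk (insert a (A - {y})) (st B a K) = lk A K"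
  using lk_st_jn[OF assms(1,2) aA(1) _ aA(2)] aA(4,5) assms(3) by simp
qed

text \<open>Links at old faces change by a star move at most, and links at faces through
  \<open>a\<close> are joins of a simplex boundary with an old link. So spheres stay spheres and
  balls stay balls, and parity keeps them apart. The boundary is therefore starred along with
  \<open>K\<close>, or untouched if \<open>B\<close> is interior.\<close>

lemma bs_st:
 fixes K :: "'v::infinite set set"
 assumes K: "cx K" "B \<in> K" "B ~= {}" "a ~: \<Union>K" and h: "bs d K \<or> bs d (st B a K)"
 shows "bs d K & bs d (st B a K) & mb (st B a K) = (if B \<in> mb K then st B a (mb K) else mb K)"
proof -
 let ?K = "st B a K"
 have aB: "a ~: B" using K by blast
 have cK: "cx ?K" by (rule cx_st[OF K(1-3)])
 obtain y where y: "y \<in> B" using K(3) by blast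
 have old: "sph e (lk A ?K) \<longleftrightarrow> sph e (lk A K)" "bal e (lk A ?K) \<longleftrightarrow> bal e (lk A K)" if "A \<in> K" "~ B <= A" for A e
  using sph_seq[OF seq_lk_st[OF K that]] bal_seq[OF seq_lk_st[OF K that]] by auto
 have face: "lk (insert a (A - {y})) ?K = lk A K" "insert a (A - {y}) \<in> ?K" "card (insert a (A - {y})) = card A" if "A \<in> K" "B <= A" for A
 proof -
  show "lk (insert a (A - {y})) ?K = lk A K" "insert a (A - {y}) \<in> ?K" using lk_st_face[OF K(1,4) that y] by auto
  have "a ~: A" "finite A" "y \<in> A" using that K y cx_face_finite[OF K(1)] by auto
  then show "card (insert a (A - {y})) = card A" using card_Suc_Diff1[of A y] by simp
 qed
 have new: "(sph (d - int (card (A Un B))) (lk (A Un B) K) --> sph (d - int (card (insert a A))) (lk (insert a A) ?K)) &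
  (bal (d - int (card (A Un B))) (lk (A Un B) K) --> bal (d - int (card (insert a A))) (lk (insert a A) ?K))"
  if A: "a ~: A" "A Un B \<in> K" "~ B <= A" for A
 proof -
  have fin: "finite A" "finite (B - A)" using cx_face_finite[OF K(1) A(2)] by auto
  have "card (A Un B) = card A + card (B - A)" using card_Un_disjoint[OF fin] by (simp add: Un_Diff_cancel)
  then have d: "d - int (card (A Un B)) + int (card (B - A)) - 1 = d - int (card (insert a A))" using fin A(1) by simp
  have "B - A ~= {}" "(B - A) Int \<Union>(lk (A Un B) K) = {}" using A(3) unfolding lk_def by blast+
  then show ?thesis unfolding lk_st_jn[OF K(1,4) A] d[symmetric]
   using sph_jn[OF _ cx_lk[OF K(1) A(2)] fin(2)] bal_jn[OF _ cx_lk[OF K(1) A(2)] fin(2)] by blast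
 qed
 \<comment> \<open>A face above \<open>B\<close> disappears in the starred complex, but its link
   survives at the face with \<open>y\<close> exchanged for \<open>a\<close>.\<close>
 have ab: "sph (d - int (card A)) (lk A K) \<or> bal (d - int (card A)) (lk A K)" if A: "A \<in> K" "B <= A" for A
  using h
 proof
  assume "bs d K" then show ?thesis using bsD(2,3)[of d K A] A(1) by blast
 next
  assume "bs d ?K" then show ?thesis using bsD(2,3)[of d ?K "insert a (A - {y})"] face[OF A] by auto
 qed
 have mb_face: "A \<in> mb K \<longleftrightarrow> bal (d - int (card A)) (lk A K)" "A ~: mb K \<longleftrightarrow> sph (d - int (card A)) (lk A K)" if A: "A \<in> K" "B <= A" for A
  using ab[OF A] bal_not_sph A(1) unfolding mb_def by blast+
 have mb_old: "A \<in> mb ?K \<longleftrightarrow> A \<in> mb K & ~ B <= A" if "a ~: A" for A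
 proof -
  have "A \<in> ?K \<longleftrightarrow> A \<in> K & ~ B <= A" using that by (auto simp: st_def)
  then show ?thesis unfolding mb_def mem_Collect_eq using old(1)[of A] by blast
 qed
 have mb_new: "insert a A \<in> mb ?K \<longleftrightarrow> A Un B \<in> mb K & ~ B <= A" if "a ~: A" for A
 proof (cases "A Un B \<in> K & ~ B <= A")
  case True
  have in': "insert a A \<in> ?K" using True that aB by (auto simp: st_def)
  show ?thesis
  proof (cases "A Un B \<in> mb K")
   case T: True
   then have "bal (d - int (card (A Un B))) (lk (A Un B) K)" using mb_face(1) True by blast
   then have "bal (d - int (card (insert a A))) (lk (insert a A) ?K)" using new[OF that] True by blast
   then show ?thesis using T True in' bal_not_sph unfolding mb_def by blast
  next
   case F: False
   then have "sph (d - int (card (A Un B))) (lk (A Un B) K)" using mb_face(2) True by blast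
   then have "sph (d - int (card (insert a A))) (lk (insert a A) ?K)" using new[OF that] True by blast
   then show ?thesis using F unfolding mb_def by blast
  qed
 next
  case False
  moreover have "A Un B \<in> mb K ==> A Un B \<in> K" by (simp add: mb_def)
  moreover have "insert a A \<in> mb ?K ==> A Un B \<in> K & ~ B <= A" using that aB by (auto simp: mb_def st_def)
  ultimately show ?thesis by blast
 qed
 have down: "B \<in> mb K" if A: "A \<in> mb K" "B <= A" for A
  using h
 proof
  assume "bs d K" then show ?thesis using cx_sub[OF bsD(5) A] by blast
 next
  assume b: "bs d ?K"
  have "~ B <= A - {y}" "a ~: A - {y}" "A - {y} Un B = A" using A y K(4) by (auto simp: mb_def)
  then have "insert a (A - {y}) \<in> mb ?K" using mb_new[of "A - {y}"] A(1) by auto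
  then have "insert a (B - {y}) \<in> mb ?K" by (rule cx_sub[OF bsD(5)[OF b]]) (use A(2) in auto)
  then have "B - {y} Un B \<in> mb K" using mb_new[of "B - {y}"] aB by auto
  then show ?thesis by (simp add: Un_absorb1)
 qed
 have mbe: "mb ?K = (if B \<in> mb K then st B a (mb K) else mb K)"
 proof (rule set_eqI)
  fix A
  show "A \<in> mb ?K \<longleftrightarrow> A \<in> (if B \<in> mb K then st B a (mb K) else mb K)"
  proof (cases "a \<in> A")
   case True
   then have e: "A = insert a (A - {a})" by blast
   have "A \<in> mb ?K \<longleftrightarrow> A - {a} Un B \<in> mb K & ~ B <= A - {a}" using mb_new[of "A - {a}"] e by auto
   moreover have "B <= A - {a} \<longleftrightarrow> B <= A" using aB by blast
   moreover have "A ~: mb K" using True K(4) by (auto simp: mb_def)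
   moreover have "A - {a} Un B \<in> mb K ==> B \<in> mb K" by (erule down) blast
   ultimately show ?thesis using True by (auto simp: st_def)
  next
   case False
   then show ?thesis using mb_old[OF False] down[of A] by (auto simp: st_def)
  qed
 qed
 \<comment> \<open>If only the starred complex is known, a face of \<open>mb K\<close> is compared
   with a face of \<open>mb ?K\<close>, with a vertex of \<open>B\<close> exchanged for
   \<open>a\<close> where necessary.\<close>
 have cE: "cx (mb K)"
  using h
 proof
  assume "bs d K" then show ?thesis by (rule bsD)
 next
  assume b: "bs d ?K"
  have sub: "A' \<in> mb K" if A: "A \<in> mb K" "A' <= A" for A A'
  proof (cases "B <= A'")
   case True
   have A'K: "A' \<in> K" using A cx_sub[OF K(1)] by (auto simp: mb_def)
   have "~ B <= A - {y}" "a ~: A - {y}" "A - {y} Un B = A" using A y K(4) True by (auto simp: mb_def)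
   then have "insert a (A - {y}) \<in> mb ?K" using mb_new[of "A - {y}"] A(1) by auto
   then have "insert a (A' - {y}) \<in> mb ?K" by (rule cx_sub[OF bsD(5)[OF b]]) (use A(2) in auto)
   moreover have "~ B <= A' - {y}" "a ~: A' - {y}" "A' - {y} Un B = A'" using A'K y K(4) True by auto
   ultimately show ?thesis using mb_new[of "A' - {y}"] by auto
  next
   case False
   then obtain x where x: "x \<in> B" "x ~: A'" by blast
   have aA: "a ~: A" using A K(4) by (auto simp: mb_def)
   have "insert a (A - {x}) \<in> mb ?K \<or> A \<in> mb ?K"
   proof (cases "B <= A")
    case True
    then have "~ B <= A - {x}" "A - {x} Un B = A" using x by auto
    then show ?thesis using mb_new[of "A - {x}"] A(1) aA by auto
   next
    case False
    then show ?thesis using mb_old[OF aA] A(1) by blast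
   qed
   then have "A' \<in> mb ?K"
   proof
    assume "insert a (A - {x}) \<in> mb ?K"
    then show ?thesis by (rule cx_sub[OF bsD(5)[OF b]]) (use A(2) x in auto)
   next
    assume "A \<in> mb ?K" then show ?thesis using A(2) by (rule cx_sub[OF bsD(5)[OF b]])
   qed
   then show ?thesis using mb_old[of A'] aA A(2) by blast
  qed
  have "{} \<in> mb ?K" using bsD(5)[OF b] by simp
  then have "{} \<in> mb K" using mb_old[of "{}"] by blast
  moreover have "finite (\<Union>K)" "\<And>si. si \<in> mb K ==> si <= \<Union>K" using cx_finite_vertices[OF K(1)] by (auto simp: mb_def)
  ultimately show ?thesis using sub by (intro cxI[of "\<Union>K"])
 qed
 have mbK: "mb K <= K" by (auto simp: mb_def)
 \<comment> \<open>A starring at a boundary face also stars the boundary; one at an interior face is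
   a move off the boundary.\<close>
 have G: "Gw K (mb K) \<longleftrightarrow> Gw ?K (mb ?K)"
 proof (cases "B \<in> mb K")
  case True
  then show ?thesis unfolding mbe using Gw_st[of K "mb K" B a] Gw_st_rev[OF K(1) cE mbK, of B a] K by auto
 next
  case False
  have "a ~: \<Union>(mb K)" using K(4) mbK by blast
  then have "smv (mb K) K ?K" using K False by (intro smvI)
  from Gw_off[OF this cx_dn[OF cE]] show ?thesis unfolding mbe using False by simp
 qed
 have S: "sph (d - int (card A)) (lk A K)" if b: "bs d ?K" and A: "A \<in> K" "A ~: mb K" for A
 proof (cases "B <= A")
  case True then show ?thesis using mb_face(2) A by blast
 next
  case False
  have "a ~: A" using A K(4) by blast
  then have "A \<in> ?K" "A ~: mb ?K" using A False mb_old by (auto simp: st_def)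
  then show ?thesis using bsD(2)[OF b] old(1)[OF A(1) False] by blast
 qed
 have L: "bal (d - int (card A)) (lk A K)" if b: "bs d ?K" and A: "A \<in> mb K" for A
 proof (cases "B <= A")
  case True then show ?thesis using mb_face(1) A mbK by blast
 next
  case False
  have AK: "A \<in> K" using A mbK by blast
  then have "a ~: A" using K(4) by blast
  then have "A \<in> mb ?K" using A False mb_old by blast
  then show ?thesis using bsD(3)[OF b] old(2)[OF AK False] by blast
 qed
 have S': "sph (d - int (card A)) (lk A ?K)" if b: "bs d K" and A: "A \<in> ?K" "A ~: mb ?K" for A
 proof (cases "a \<in> A")
  case True
  then have e: "insert a (A - {a}) = A" by blast
  have k: "A - {a} Un B \<in> K" "~ B <= A - {a}" using A(1) True by (auto simp: st_def)
  have "A - {a} Un B ~: mb K" using mb_new[of "A - {a}"] A(2) k e by auto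
  then show ?thesis using new[of "A - {a}"] k bsD(2)[OF b k(1)] e by auto
 next
  case False
  then have "A \<in> K" "~ B <= A" using A(1) by (auto simp: st_def)
  then show ?thesis using mb_old[OF False] A(2) old(1) bsD(2)[OF b] by blast
 qed
 have L': "bal (d - int (card A)) (lk A ?K)" if b: "bs d K" and A: "A \<in> mb ?K" for A
 proof (cases "a \<in> A")
  case True
  then have e: "insert a (A - {a}) = A" by blast
  have k: "A - {a} Un B \<in> mb K" "~ B <= A - {a}" using mb_new[of "A - {a}"] A e by auto
  then have "A - {a} Un B \<in> K" using mbK by blast
  then show ?thesis using new[of "A - {a}"] k bsD(3)[OF b k(1)] e by auto
 next
  case False
  then have m: "A \<in> mb K" "~ B <= A" using mb_old A by blast+
  then have "A \<in> K" using mbK by blast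
  then show ?thesis using m old(2) bsD(3)[OF b] by blast
 qed
 show ?thesis using h G S L S' L' mbe unfolding bs_def by blast
qed

lemma lk_Pow: "A <= V ==> lk A (Pow V) = Pow (V - A)"
 by (auto simp: lk_def)

lemma lk_bd: "A <= V ==> lk A (bd V) = bd (V - A)"
 by (auto simp: lk_def bd_def)

text \<open>One star move at the top face gives the cone over the boundary.\<close>

lemma wc_Pow:
 fixes W :: "'v::infinite set"
 assumes "finite W" "W ~= {}" shows "wc (Pow W) (bd W)"
proof -
 from fresh_vertex[OF assms(1)] obtain v where v: "v ~: W" ..
 have "st W v (Pow W) = cone v (bd W)"
 proof (rule set_eqI)
  fix rh show "rh \<in> st W v (Pow W) \<longleftrightarrow> rh \<in> cone v (bd W)"
   using v by (cases "v \<in> rh") (auto simp: st_def cone_def bd_def)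
 qed
 moreover have "smv (bd W) (Pow W) (st W v (Pow W))"
  using assms v by (intro smvI cx_Pow) (auto simp: bd_def)
 ultimately have "seq (bd W) (Pow W) (cone v (bd W))" by (simp add: seq1)
 moreover have "v ~: \<Union>(bd W)" using v by (auto simp: bd_def)
 ultimately show ?thesis unfolding wc_def by blast
qed

lemma bs_Pow:
 fixes V :: "'v::infinite set"
 assumes "finite V" "V ~= {}"
 shows "bs (int (card V) - 1) (Pow V)" "mb (Pow V) = bd V"
proof -
 have nil: "sph (- 1) ({{}} :: 'v set set)"
 proof -
  have "bd {undefined :: 'v} = {{}}" by (auto simp: bd_def)
  then show ?thesis using sph_bd[of "{undefined :: 'v}"] by simp
 qed
 have b: "bal (int (card V) - 1 - int (card A)) (lk A (Pow V))" if "A \<in> bd V" for A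
 proof -
  have A: "A <= V" "V - A ~= {}" "finite (V - A)" using that assms by (auto simp: bd_def)
  have "card (V - A) = card V - card A" "card A \<le> card V" using A assms by (auto simp: card_Diff_subset finite_subset card_mono)
  then have "int (card (V - A)) - 1 = int (card V) - 1 - int (card A)" by simp
  from bal_Pow[OF A(3,2), unfolded this] show ?thesis unfolding lk_Pow[OF A(1)] .
 qed
 have V: "lk V (Pow V) = {{}}" by (auto simp: lk_Pow)
 show m: "mb (Pow V) = bd V"
 proof (rule set_eqI)
  fix A
  show "A \<in> mb (Pow V) \<longleftrightarrow> A \<in> bd V"
  proof (cases "A = V")
   case True
   then show ?thesis using nil V by (auto simp: mb_def bd_def)
  next
   case False
   then show ?thesis using b[of A] bal_not_sph unfolding mb_def bd_def by blast
  qed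
 qed
 have "Gw (Pow V) (bd V)"
  unfolding Gw_def
 proof (intro conjI ballI)
  show "cx (Pow V)" "cx (bd V)" "bd V <= Pow V"
   using cx_Pow[OF assms(1)] cx_bd[OF assms] by (simp_all add: bd_def)
  fix A assume "A \<in> bd V"
  then have "A <= V" "V - A ~= {}" "finite (V - A)" using assms by (auto simp: bd_def)
  then show "wc (lk A (Pow V)) (lk A (bd V))" by (simp add: lk_Pow lk_bd wc_Pow)
 qed
 moreover have "sph (int (card V) - 1 - int (card A)) (lk A (Pow V))" if "A \<in> Pow V" "A ~: bd V" for A
 proof -
  have "A = V" using that by (auto simp: bd_def)
  then show ?thesis using V nil by simp
 qed
 ultimately show "bs (int (card V) - 1) (Pow V)" unfolding bs_def m using b by blast
qed

lemma bs_smv: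
 fixes K :: "'v::infinite set set"
 assumes "smv S K K'" shows "bs d K \<longleftrightarrow> bs d K'"
 using assms bs_st unfolding smv_def by blast

lemma bs_seq:
 fixes K :: "'v::infinite set set"
 assumes "seq S K K'" shows "bs d K \<longleftrightarrow> bs d K'"
 using assms by (induction rule: equivclp_induct) (auto dest: bs_smv[of S _ _ d])

theorem bal_bs:
 fixes K :: "'v::infinite set set"
 assumes "bal d K" shows "bs d K"
proof -
 obtain V where V: "finite V" "V ~= {}" "int (card V) = d + 1" "seq {{}} (Pow V) K" using assms by (auto simp: bal_def)
 show ?thesis using bs_Pow(1)[OF V(1,2)] bs_seq[OF V(4), of d] V(3) by simp
qed

section \<open>Renaming and change of vertex type\<close>

text \<open>The vertices are renamed one after the other, each by starring it.\<close>

lemma seq_rename_fresh: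
 fixes K :: "'v::infinite set set"
 assumes K: "cx K" and g: "inj_on g (\<Union>K)" "g ` \<Union>K Int \<Union>K = {}"
 shows "seq {{}} K (im g K)"
proof -
 have "seq {{}} K (im (%v. if v \<in> X then g v else v) K)" if "X <= \<Union>K" for X
  using finite_subset[OF that cx_finite_vertices[OF K]] that
 proof (induction X)
  case empty
  then show ?case by simp
 next
  case (insert v X)
  let ?h = "%w. if w \<in> X then g w else w" and ?h' = "%w. if w \<in> insert v X then g w else w"
  let ?K = "im ?h K"
  have vK: "v \<in> \<Union>K" using insert by blast
  have "{v} \<in> K" using vK cx_vertex[OF K, of v] by simp
  from imageI[OF this, of "%si. ?h ` si"] have v: "{v} \<in> ?K" using insert.hyps(2) by simp
  have gv: "g v ~: \<Union>?K"
  proof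
   assume "g v \<in> \<Union>?K"
   then obtain w where w: "w \<in> \<Union>K" "g v = ?h w" unfolding Union_im by (rule imageE) simp
   then have "g v = g w \<or> g v \<in> \<Union>K" "g v = g w --> w \<in> X \<or> g v \<in> \<Union>K" by (auto split: if_splits)
   moreover have "g v ~: \<Union>K" using g(2) imageI[OF vK, of g] by (metis IntI emptyE)
   ultimately have "w = v" "w \<in> X" using inj_onD[OF g(1), of v w] vK w(1) by auto
   then show False using insert.hyps(2) by simp
  qed
  have c: "cx ?K" using K by (rule cx_im)
  have "st {v} (g v) ?K = im ?h' K"
   unfolding st_vertex[OF c v gv] im_comp
  proof (rule im_cong)
   fix w assume w: "w \<in> \<Union>K"
   have "g w ~= v" using g(2) w vK by (metis IntI emptyE imageI)
   moreover have "g w = g v ==> w = v" using inj_onD[OF g(1)] w vK by metis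
   moreover have "w ~= g v" using g(2) w vK by (metis IntI emptyE imageI)
   ultimately show "(Transposition.transpose v (g v) \<circ> ?h) w = ?h' w"
    using insert.hyps(2) by (auto simp: Transposition.transpose_def)
  qed
  moreover have "smv {{}} ?K (st {v} (g v) ?K)" using c v gv by (intro smvI) auto
  ultimately have "seq {{}} ?K (im ?h' K)" by (simp add: seq1)
  moreover have "seq {{}} K ?K" using insert by simp
  ultimately show ?case by (rule seq_trans[rotated])
 qed
 from this[OF order_refl] show ?thesis
  using im_cong[of K "%v. if v \<in> \<Union>K then g v else v" g] by simp
qed

text \<open>An image that overlaps the old vertices is reached through a third copy that is disjoint
  from both.\<close>

lemma seq_rename:
 fixes K :: "'v::infinite set set"
 assumes K: "cx K" and f: "inj_on f (\<Union>K)"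
 shows "seq {{}} K (im f K)"
proof -
 have fin: "finite (\<Union>K)" using K by (rule cx_finite_vertices)
 then have "finite (\<Union>K Un f ` \<Union>K)" by simp
 from ex_bij_avoid[OF finite.emptyI fin this] obtain p where p: "bij p" "p ` \<Union>K Int (\<Union>K Un f ` \<Union>K) = {}" by auto
 have ip: "inj_on p (\<Union>K)" using p(1) by (meson bij_is_inj inj_on_subset subset_UNIV)
 have 1: "seq {{}} K (im p K)" using K ip p(2) by (intro seq_rename_fresh) blast+
 let ?g = "f \<circ> inv p"
 have V: "\<Union>(im p K) = p ` \<Union>K" by (rule Union_im)
 have gp: "?g ` p ` \<Union>K = f ` \<Union>K" using p(1) by (simp add: image_image bij_is_inj)
 have "inj_on ?g (p ` \<Union>K)" using f p(1)
  by (intro inj_on_imageI) (simp add: comp_def bij_is_inj)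
 moreover have "?g ` p ` \<Union>K Int p ` \<Union>K = {}" unfolding gp using p(2) by blast
 ultimately have 2: "seq {{}} (im p K) (im ?g (im p K))"
  using cx_im[OF K, of p] unfolding V[symmetric] by (intro seq_rename_fresh)
 have "im ?g (im p K) = im f K" unfolding im_comp using p(1) by (simp add: comp_def bij_is_inj)
 then show ?thesis using seq_trans[OF 1 2] by simp
qed

lemma im_st_inj:
 assumes "inj_on f U" "insert a (\<Union>K) <= U" "si \<in> K" "a ~: \<Union>K"
 shows "im f (st si a K) = st (f ` si) (f a) (im f K)"
proof (rule set_eqI)
 fix rh
 have U: "a \<in> U" "\<And>ta. ta \<in> K ==> ta <= U" using assms(2) by blast+
 note in1 = inj_on_image_eq_iff[OF assms(1)]
 have in2: "f ` A <= f ` B \<longleftrightarrow> A <= B" if "A <= U" "B <= U" for A B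
  using inj_on_image_mem_iff[OF assms(1) _ that(2)] that(1) unfolding image_subset_iff by blast
 have sU: "si <= U" by (rule U(2)[OF assms(3)])
 have fa: "f a \<in> f ` ta \<longleftrightarrow> a \<in> ta" if "ta <= U" for ta using inj_on_image_mem_iff[OF assms(1) U(1) that] .
 have diff: "f ` ta - {f a} Un f ` si = f ` (ta - {a} Un si)" if "ta <= U" for ta
  using inj_on_image_set_diff[OF assms(1), of ta "{a}"] subset_trans[OF Diff_subset that] U(1) by (simp add: image_Un)
 have imK: "f ` ta \<in> im f K \<longleftrightarrow> ta \<in> K" if "ta <= U" for ta
  using in1[OF that U(2)] by blast
 show "rh \<in> im f (st si a K) \<longleftrightarrow> rh \<in> st (f ` si) (f a) (im f K)"
 proof
  assume "rh \<in> im f (st si a K)"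
  then obtain ta where t: "ta \<in> st si a K" "rh = f ` ta" by auto
  have tU: "ta <= U" using t(1) U st_vertices[of si a K] assms(2) by blast
  have "ta - {a} Un si <= U" using tU sU by blast
  then show "rh \<in> st (f ` si) (f a) (im f K)"
   using t(1) unfolding t(2) st_def mem_Collect_eq fa[OF tU] diff[OF tU] in2[OF sU tU] by (simp add: imK tU)
 next
  assume r: "rh \<in> st (f ` si) (f a) (im f K)"
  have "rh <= insert (f a) (\<Union>(im f K))" using r st_vertices[of "f ` si" "f a" "im f K"] by blast
  then have "rh <= f ` U" unfolding Union_im using assms(2) by blast
  then obtain ta where tU: "ta <= U" and t: "rh = f ` ta" by (auto simp: subset_image_iff)
  have d: "ta - {a} Un si <= U" using tU sU by blast
  have "ta \<in> st si a K"
   using r unfolding t st_def mem_Collect_eq fa[OF tU] diff[OF tU] in2[OF sU tU] imK[OF d] imK[OF tU] .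
  then show "rh \<in> im f (st si a K)" unfolding t by (rule imageI)
 qed
qed

text \<open>As a path has finitely many vertices, a map injective on a finite set carries it to
  another vertex type.\<close>

lemma seq_inj:
 fixes K :: "'u set set"
 assumes "seq {{}} K K'" "cx K"
 shows "\<exists>U. finite U & \<Union>K <= U & \<Union>K' <= U & (\<forall>f :: 'u => 'w. inj_on f U --> seq {{}} (im f K) (im f K'))"
 using assms(1)
proof (induction rule: equivclp_induct)
 case base
 show ?case using cx_finite_vertices[OF assms(2)] by (intro exI[of _ "\<Union>K"]) auto
next
 case (step y z)
 obtain U where U: "finite U" "\<Union>K <= U" "\<Union>y <= U" "\<And>f :: 'u => 'w. inj_on f U ==> seq {{}} (im f K) (im f y)"
  using step(3) by (elim exE conjE) blast
 have one: "smv {{}} (im f K) (im f K')" if m: "smv {{}} K K'" and f: "inj_on f (\<Union>K Un \<Union>K')" for f :: "'u => 'w" and K K'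
 proof -
  obtain si a where *: "cx K" "si \<in> K" "si ~= {}" "a ~: \<Union>K" "K' = st si a K" using m unfolding smv_def by blast
  have aK': "a \<in> \<Union>K'" unfolding *(5) by (rule st_vertices'(2)[OF *(1-4)])
  then have sub: "insert a (\<Union>K) <= \<Union>K Un \<Union>K'" by blast
  have "f a ~: \<Union>(im f K)" unfolding Union_im using inj_on_image_mem_iff[OF f, of a "\<Union>K"] aK' *(4) by blast
  moreover have "f ` si \<in> im f K" using *(2) by (rule imageI)
  ultimately have "smv {{}} (im f K) (st (f ` si) (f a) (im f K))"
   using *(3) cx_im[OF *(1), of f] by (intro smvI) auto
  then show ?thesis unfolding *(5) im_st_inj[OF f sub *(2,4)] .
 qed
 have "cx y" "cx z" using step(2) smv_cx[of "{{}}" y z] smv_cx[of "{{}}" z y] by auto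
 then have fin: "finite (U Un \<Union>y Un \<Union>z)" using U(1) cx_finite_vertices by (metis finite_UnI)
 have "seq {{}} (im f K) (im f z)" if f: "inj_on f (U Un \<Union>y Un \<Union>z)" for f :: "'u => 'w"
 proof -
  have 1: "seq {{}} (im f K) (im f y)" using f by (intro U(4)) (rule inj_on_subset, auto)
  have f1: "inj_on f (\<Union>y Un \<Union>z)" "inj_on f (\<Union>z Un \<Union>y)" using f by (auto intro: inj_on_subset simp del: Union_iff)
  have "seq {{}} (im f y) (im f z)" using step(2) one[OF _ f1(1)] one[OF _ f1(2)] seq1 seq1' by blast
  then show ?thesis by (rule seq_trans[OF 1])
 qed
 then show ?case using fin U(2) by (intro exI[of _ "U Un \<Union>y Un \<Union>z"]) (intro conjI allI impI; blast)
qed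

lemma ex_inj_on:
 assumes "finite (U :: 'u set)" shows "\<exists>f :: 'u => 'w::infinite. inj_on f U"
proof -
 obtain T :: "'w set" where "finite T" "card T = card U" using infinite_arbitrarily_large[OF infinite_UNIV] by blast
 then show ?thesis using assms finite_same_card_bij[of U T] by (auto simp: bij_betw_def)
qed

text \<open>The two ends may be embedded by unrelated maps: each is compared, by a renaming, with a
  single embedding \<open>h\<close> of the whole path.\<close>

lemma seq_transport:
 fixes K :: "'u set set" and f f' :: "'u => 'w::infinite"
 assumes s: "seq {{}} K K'" and K: "cx K" and f: "inj_on f (\<Union>K)" "inj_on f' (\<Union>K')"
 shows "seq {{}} (im f K) (im f' K')"
proof -
 obtain U where U: "finite U" "\<Union>K <= U" "\<Union>K' <= U" "\<And>f :: 'u => 'w. inj_on f U ==> seq {{}} (im f K) (im f K')"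
  using seq_inj[OF s K] by (elim exE conjE) blast
 obtain h :: "'u => 'w" where h: "inj_on h U" using ex_inj_on[OF U(1)] by blast
 have ren: "seq {{}} (im h L) (im g L)" if "cx L" "\<Union>L <= U" "inj_on g (\<Union>L)" for L and g :: "'u => 'w"
 proof -
  have hL: "inj_on h (\<Union>L)" using h that(2) by (rule inj_on_subset)
  let ?q = "g \<circ> inv_into (\<Union>L) h"
  have q: "?q (h v) = g v" if "v \<in> \<Union>L" for v using inv_into_f_f[OF hL that] by simp
  have "inj_on ?q (\<Union>(im h L))" unfolding Union_im
  proof (rule inj_onI)
   fix x y assume "x \<in> h ` \<Union>L" "y \<in> h ` \<Union>L" "?q x = ?q y"
   then obtain u v where "u \<in> \<Union>L" "x = h u" "v \<in> \<Union>L" "y = h v" "?q (h u) = ?q (h v)" by (elim imageE) simp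
   then show "x = y" using q[of u] q[of v] inj_onD[OF that(3), of u v] by simp
  qed
  then have "seq {{}} (im h L) (im ?q (im h L))" using cx_im[OF that(1), of h] by (intro seq_rename)
  moreover have "im ?q (im h L) = im g L" unfolding im_comp using q by (intro im_cong) simp
  ultimately show ?thesis by simp
 qed
 have K': "cx K'" using s K seq_cx by blast
 show ?thesis
  by (rule seq_trans[OF seq_trans[OF seq_sym[OF ren[OF K U(2) f(1)]] U(4)[OF h]] ren[OF K' U(3) f(2)]])
qed

lemma bal_im:
 fixes K :: "'u::infinite set set" and f :: "'u => 'w::infinite"
 assumes "cx K" "inj_on f (\<Union>K)"
 shows "bal d (im f K) \<longleftrightarrow> bal d K"
proof
 assume "bal d K"
 then obtain V where V: "finite V" "V ~= {}" "int (card V) = d + 1" "seq {{}} (Pow V) K" by (auto simp: bal_def)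
 obtain h :: "'u => 'w" where h: "inj_on h V" using ex_inj_on[OF V(1)] by blast
 have "seq {{}} (im h (Pow V)) (im f K)" using V h assms by (intro seq_transport cx_Pow) auto
 moreover have "im h (Pow V) = Pow (h ` V)" by (simp add: image_Pow_surj)
 ultimately show "bal d (im f K)" unfolding bal_def using V h by (intro exI[of _ "h ` V"]) (simp add: card_image)
next
 assume "bal d (im f K)"
 then obtain V where V: "finite V" "V ~= {}" "int (card V) = d + 1" "seq {{}} (Pow V) (im f K)" by (auto simp: bal_def)
 obtain h :: "'w => 'u" where h: "inj_on h V" using ex_inj_on[OF V(1)] by blast
 have "inj_on (inv_into (\<Union>K) f) (\<Union>(im f K))" unfolding Union_im by (rule inj_on_inv_into) simp
 then have "seq {{}} (im h (Pow V)) (im (inv_into (\<Union>K) f) (im f K))" using V h assms by (intro seq_transport cx_Pow) auto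
 moreover have "im (inv_into (\<Union>K) f) (im f K) = K" unfolding im_comp
  using inv_into_f_f[OF assms(2)] by (intro im_fix) simp
 moreover have "im h (Pow V) = Pow (h ` V)" by (simp add: image_Pow_surj)
 ultimately show "bal d K" unfolding bal_def using V h by (intro exI[of _ "h ` V"]) (simp add: card_image)
qed

subsection \<open>Labelled star moves\<close>

text \<open>With the label of the starred face on the new vertex, every subcomplex cut out by a
  bound on labels is starred along with \<open>K\<close>. The vertex \<open>x\<close> is the value
  at \<open>a\<close> of a retraction; the condition on \<open>\<pi>\<close> says that this
  retraction commutes with the map read off from labels.\<close>

definition lmv :: "('w => 's set) => ('s set => 'p) => 'w set set => 'w set set => bool" where
 "lmv l \<pi> K K' \<longleftrightarrow> (\<exists>si a x. cx K & si \<in> K & x \<in> si & a ~: \<Union>K & l a = \<Union>(l ` si) &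
  \<pi> (l x) = \<pi> (l a) & K' = st si a K)"

text \<open>Used to give the auxiliary vertices of a path names in \<open>I\<close>, a set of
  vertices with prescribed label.\<close>

lemma ex_bij_into:
 fixes A :: "'v set"
 assumes "finite A" "finite U" "infinite I"
 shows "\<exists>p. bij p & (\<forall>v\<in>A. p v = v) & p ` (U - A) <= I"
 using assms(2)
proof (induction U)
 case empty
 show ?case by (rule exI[of _ "%x. x"]) (auto simp: bij_betw_def)
next
 case (insert u U)
 then obtain p where p: "bij p" "\<forall>v\<in>A. p v = v" "p ` (U - A) <= I" by auto
 show ?case
 proof (cases "u \<in> A")
  case True
  then show ?thesis using p by (intro exI[of _ p]) auto
 next
  case False
  have "finite (insert (p u) (A Un p ` U))" using assms insert by simp
  then have "infinite (I - insert (p u) (A Un p ` U))" using assms(3) by simp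
  then have "I - insert (p u) (A Un p ` U) ~= {}" using infinite_imp_nonempty by blast
  then obtain i where i: "i \<in> I" "i ~= p u" "i ~: A" "i ~: p ` U" by blast
  let ?q = "Transposition.transpose (p u) i \<circ> p"
  have inj: "p v = p u \<longleftrightarrow> v = u" for v using bij_is_inj[OF p(1)] by (auto simp: inj_eq)
  have "bij ?q" using p(1) by (simp add: bij_comp)
  moreover have "?q v = v" if "v \<in> A" for v
  proof -
   have "v ~= p u" using inj[of v] p(2) that False by auto
   moreover have "v ~= i" using that i(3) by blast
   ultimately show ?thesis using p(2) that by simp
  qed
  moreover have "?q v \<in> I" if "v \<in> insert u U - A" for v
  proof (cases "v = u")
   case True then show ?thesis using i(1) by simp
  next
   case ne: False
   then have "v \<in> U - A" using that by blast
   then have "p v \<in> I" "p v ~= i" using p(3) i(4) by auto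
   then show ?thesis using ne inj[of v] by simp
  qed
  ultimately show ?thesis by (intro exI[of _ ?q]) blast
 qed
qed

lemma smv_Pow_const:
 assumes "smv (Pow V) X X'"
 shows "X' Int Pow V = X Int Pow V"
proof -
 obtain si a where *: "si \<in> X" "~ si <= V" "a ~: V" "X' = st si a X"
  using assms by (auto simp: smv_def)
 have "rh \<in> X' \<longleftrightarrow> rh \<in> X" if "rh <= V" for rh
 proof -
  have "~ si <= rh" "a ~: rh" using that * by blast+
  then show ?thesis by (simp add: *(4) st_def)
 qed
 then show ?thesis by blast
qed

text \<open>Each new face contains \<open>a\<close>, so faces on the vertices of \<open>E\<close>
  can be destroyed but not created.\<close>

lemma smv_Pow_sub:
 assumes "smv E X X'" "V = \<Union>E"
 shows "X' Int Pow V <= X"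
proof -
 obtain si a where *: "a ~: V" "X' = st si a X"
  using assms by (auto simp: smv_def)
 have "rh \<in> X" if "rh <= V" "rh \<in> X'" for rh
 proof -
  have "a ~: rh" using that * by blast
  then show ?thesis using that(2) by (simp add: *(2) st_def)
 qed
 then show ?thesis by blast
qed

text \<open>A star move inside the cell of label \<open>q\<close> and off its boundary \<open>E\<close> is automatically a labelled
  move: the starred face contains either a vertex of label \<open>q\<close> or is an interior face of the cell.\<close>

lemma lmv_cell:
 assumes m: "smv E X X'" and V: "\<Union>X Un \<Union>X' <= V" and X: "X Int Pow (\<Union>E) <= C"
  and R: "cx R" "\<Union>R <= W" "R Int C <= E" and W: "W Int V <= \<Union>E"
  and J: "cx J" "\<Union>J <= W" "\<Union>J Int V = {}"
  and l: "\<And>v. v \<in> V ==> v ~: \<Union>E ==> l v = q" "\<And>v. v \<in> \<Union>E ==> l v <= q"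
   "\<And>ka. ka \<in> C ==> ka ~: E ==> \<Union>(l ` ka) = q & (\<exists>x\<in>ka. \<pi> (l x) = \<pi> q)"
 shows "lmv l \<pi> (jn J X Un R) (jn J X' Un R)"
proof -
 obtain si a where *: "cx X" "si \<in> X" "si ~= {}" "si ~: E" "a ~: \<Union>X" "a ~: \<Union>E" and X': "X' = st si a X"
  using m by (auto simp: smv_def)
 have "a \<in> \<Union>X'" using st_vertices'(2)[OF *(1-3,5)] X' by simp
 then have aV: "a \<in> V" using V by blast
 then have aW: "a ~: W" using W *(6) by blast
 have la: "l a = q" using l(1) aV *(6) by blast
 have sV: "si <= V" using *(2) V by blast
 have sl: "\<Union>(l ` si) = q & (\<exists>x\<in>si. \<pi> (l x) = \<pi> q) & si ~: R"
 proof (cases "si <= \<Union>E")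
  case True
  then have "si \<in> C" using X *(2) by blast
  then show ?thesis using l(3)[OF _ *(4)] R(3) *(4) by blast
 next
  case False
  then obtain v where v: "v \<in> si" "v ~: \<Union>E" by blast
  then have "v \<in> V" "l v = q" "v ~: W" using sV l(1)[of v] W by blast+
  moreover have "l u <= q" if "u \<in> si" for u using l(1)[of u] l(2)[of u] that sV by blast
  ultimately show ?thesis using v R(2) by blast
 qed
 have nR: "~ si <= rh" if "rh \<in> R" for rh using sl cx_sub[OF R(1) that] by blast
 have "st si a (jn J X Un R) = st si a (jn J X) Un R"
  using nR aW R(2) by (intro st_Un) auto
 also have "st si a (jn J X) = jn J (st si a X)"
  using sV J(2,3) aW by (intro st_jn) auto
 finally have e: "jn J X' Un R = st si a (jn J X Un R)" by (simp add: X')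
 have "si Int \<Union>J = {}" "si - \<Union>J = si" using sV J(3) by blast+
 then have sj: "si \<in> jn J X" using *(2) J(1) by (simp add: jn_def)
 have "a ~: \<Union>(jn J X Un R)" using jn_vertices[of J X] *(5) aW J(2) R(2) by blast
 moreover have "cx (jn J X Un R)" using cx_Un cx_jn *(1) J(1) R(1) by blast
 moreover obtain x where "x \<in> si" "\<pi> (l x) = \<pi> q" using sl by blast
 ultimately show ?thesis unfolding lmv_def e
  by (intro exI[of _ si] exI[of _ a] exI[of _ x]) (use sl la sj in simp)
qed

lemma equivclp_trans: "equivclp r x y ==> equivclp r y z ==> equivclp r x z"
 by (rule transpD[OF transp_equivclp])

text \<open>The two stages of \<open>cW\<close> are renamed so that their auxiliary vertices carry
  the label \<open>q\<close> and avoid the rest of the complex. By \<open>lmv_cell\<close> the moves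
  are then labelled moves of the whole complex.\<close>

lemma cone_cell:
 fixes C :: "'w::infinite set set"
 assumes g: "Gw C E" and R: "cx R" "R Int C <= E" "\<Union>R Int \<Union>C <= \<Union>E"
  and J: "cx J" "\<Union>J Int \<Union>C = {}"
  and v: "l v = q" "v ~: \<Union>C" "v ~: \<Union>R" "v ~: \<Union>J"
  and l: "infinite {w. l w = q}" "\<And>v. v \<in> \<Union>E ==> l v <= q"
   "\<And>ka. ka \<in> C ==> ka ~: E ==> \<Union>(l ` ka) = q & (\<exists>x\<in>ka. \<pi> (l x) = \<pi> q)"
 shows "equivclp (lmv l \<pi>) (jn J C Un R) (jn J (cone v E) Un R)"
proof -
 note G = GwD[OF g]
 have EC: "\<Union>E <= \<Union>C" using G(3) by blast
 define W where "W = \<Union>R Un \<Union>J"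
 have W: "finite W" using R(1) J(1) cx_finite_vertices unfolding W_def by blast
 obtain K' w where K': "(smv E)\<^sup>*\<^sup>* C K'" "w ~: \<Union>E" "seq (Pow (\<Union>E)) K' (cone w E)"
  using Gw_cW[OF g] by (auto simp: cW_def)
 have vE: "v ~: \<Union>E" using v(2) EC by blast
 have s: "seq (Pow (\<Union>E)) K' (cone v E)"
  using seq_trans[OF K'(3) cone_rename[OF G(2) K'(2) vE]] .
 have cK': "cx K'" using seq_cx[OF fwd_seq[OF K'(1)]] G(1) by simp
 obtain U1 where U1: "finite U1" "\<And>W. W Int U1 = {} ==> (smvA W E)\<^sup>*\<^sup>* C K'"
  using fwd_bounded[OF K'(1) G(1)] by blast
 obtain U2 where U2: "finite U2" "\<And>W. W Int U2 = {} ==> equivclp (smvA W (Pow (\<Union>E))) K' (cone v E)"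
  using seq_bounded[OF s cK'] by blast
 define A where "A = insert v (\<Union>C)"
 define U where "U = U1 Un U2"
 define I where "I = {w. l w = q} - W"
 have fin: "finite A" "finite U" "infinite I"
  using U1(1) U2(1) cx_finite_vertices[OF G(1)] W l(1) by (simp_all add: A_def U_def I_def)
 obtain p where p: "bij p" "\<forall>v\<in>A. p v = v" "p ` (U - A) <= I" using ex_bij_into[OF fin] by blast
 have pU: "p ` U <= A Un I"
 proof
  fix y assume "y \<in> p ` U"
  then obtain u where u: "u \<in> U" "y = p u" ..
  show "y \<in> A Un I"
  proof (cases "u \<in> A")
   case True
   then show ?thesis using p(2) u(2) by simp
  next
   case False
   then have "p u \<in> p ` (U - A)" using u(1) by simp
   then show ?thesis using p(3) u(2) by auto
  qed
 qed
 have neg: "p ` (- U) = - (p ` U)" using p(1) by (simp add: bij_image_Compl_eq)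
 have fixE: "p ` rh = rh" if "rh <= A" for rh using that p(2) by force
 have "\<Union>E <= A" "\<Union>C <= A" using EC by (auto simp: A_def)
 then have iE: "im p E = E" "im p C = C" "im p (Pow (\<Union>E)) = Pow (\<Union>E)"
  using im_fix[of E p] im_fix[of C p] p(2) fixE[of "\<Union>E"] im_Pow[OF p(1), of "\<Union>E"]
  by (simp_all add: subset_iff)
 have ic: "im p (cone v E) = cone v E" using im_cone[OF p(1), of v E] iE(1) p(2) by (simp add: A_def)
 have V: "W Int (A Un I) <= \<Union>E" "\<Union>J Int (A Un I) = {}"
  using R(3) v J(2) unfolding W_def A_def I_def by auto
 have lV: "l u = q" if "u \<in> A Un I" "u ~: \<Union>E" for u
 proof -
  from that(1) consider "u = v" | "u \<in> I" | "u \<in> \<Union>C" by (auto simp: A_def)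
  then show ?thesis
  proof cases
   case 3
   then have "{u} \<in> C" using cx_vertex[OF G(1), of u] by simp
   moreover have "{u} ~: E" using that(2) by blast
   ultimately show ?thesis using l(3)[of "{u}"] by simp
  qed (use v(1) in \<open>auto simp: I_def\<close>)
 qed
 have RW: "\<Union>R <= W" "\<Union>J <= W" by (auto simp: W_def)
 have step_lmv: "lmv l \<pi> (jn J X Un R) (jn J X' Un R)"
  if "smv E X X'" "(\<Union>X Un \<Union>X') Int - (p ` U) = {}" "X Int Pow (\<Union>E) <= C" for X X'
 proof -
  have "\<Union>X Un \<Union>X' <= A Un I" using that(2) pU by blast
  from lmv_cell[OF that(1) this that(3) R(1) RW(1) R(2) V(1) J(1) RW(2) V(2) lV l(2,3)]
  show ?thesis by blast
 qed
 \<comment> \<open>To avoid \<open>- U\<close> means to use vertices of \<open>U\<close>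
   only.\<close>
 have "(smvA (- U) E)\<^sup>*\<^sup>* C K'" using U1(2) by (auto simp: U_def)
 then have "(smvA (p ` (- U)) (im p E))\<^sup>*\<^sup>* (im p C) (im p K')"
  by (rule rtranclp_lift[where f = "im p"]) (rule r_into_rtranclp, erule smvA_im[OF p(1)])
 then have f: "(smvA (- (p ` U)) E)\<^sup>*\<^sup>* C (im p K')" unfolding iE neg .
 then have 1: "equivclp (lmv l \<pi>) (jn J C Un R) (jn J (im p K') Un R) & im p K' Int Pow (\<Union>E) <= C"
 proof (induction rule: rtranclp_induct)
  case base show ?case by (auto simp: equivclp_def)
 next
  case (step y z)
  then have m: "smv E y z" "(\<Union>y Un \<Union>z) Int - (p ` U) = {}" by (auto simp: smvA_def)
  from step_lmv[OF m] step(3) have "lmv l \<pi> (jn J y Un R) (jn J z Un R)" by blast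
  moreover have "z Int Pow (\<Union>E) <= C" using smv_Pow_sub[OF m(1) refl] step(3) by blast
  ultimately show ?case using equivclp_trans[OF step(3)[THEN conjunct1] r_into_equivclp] by (intro conjI)
 qed
 have "equivclp (smvA (- U) (Pow (\<Union>E))) K' (cone v E)" using U2(2) by (auto simp: U_def)
 then have "equivclp (smvA (p ` (- U)) (im p (Pow (\<Union>E)))) (im p K') (im p (cone v E))"
  by (rule equivclp_lift[where f = "im p"]) (rule r_into_equivclp, erule smvA_im[OF p(1)])
 then have "equivclp (smvA (- (p ` U)) (Pow (\<Union>E))) (im p K') (cone v E)" unfolding iE neg ic .
 then have 2: "equivclp (lmv l \<pi>) (jn J (im p K') Un R) (jn J (cone v E) Un R) & cone v E Int Pow (\<Union>E) <= C"
 proof (induction rule: equivclp_induct)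
  case base show ?case using 1 by (auto simp: equivclp_def)
 next
  case (step y z)
  have "E <= Pow (\<Union>E)" by blast
  note mono = smv_mono[OF this]
  from step(2) show ?case
  proof
   assume "smvA (- (p ` U)) (Pow (\<Union>E)) y z"
   then have m: "smv (Pow (\<Union>E)) y z" "(\<Union>y Un \<Union>z) Int - (p ` U) = {}" by (auto simp: smvA_def)
   from smv_Pow_const[OF this(1)] have z: "z Int Pow (\<Union>E) <= C" using step(3) by simp
   from step_lmv[OF mono[OF m(1)] m(2)] step(3) have "lmv l \<pi> (jn J y Un R) (jn J z Un R)" by blast
   from equivclp_trans[OF step(3)[THEN conjunct1] r_into_equivclp[of "lmv l \<pi>", OF this]] z show ?thesis by (rule conjI)
  next
   assume "smvA (- (p ` U)) (Pow (\<Union>E)) z y"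
   then have m: "smv (Pow (\<Union>E)) z y" "(\<Union>z Un \<Union>y) Int - (p ` U) = {}" by (auto simp: smvA_def)
   from smv_Pow_const[OF this(1)] have z: "z Int Pow (\<Union>E) <= C" using step(3) by simp
   from step_lmv[OF mono[OF m(1)] m(2)] z have "lmv l \<pi> (jn J z Un R) (jn J y Un R)" by blast
   from equivclp_trans[OF step(3)[THEN conjunct1] equivclp_sym[OF r_into_equivclp[of "lmv l \<pi>", OF this]]] z show ?thesis by (rule conjI)
  qed
 qed
 from equivclp_trans[OF 1[THEN conjunct1] 2[THEN conjunct1]] show ?thesis .
qed

text \<open>Alexander's trick: the cells, taken in decreasing order, are replaced by cones over their
  boundaries. What remains depends on the set \<open>Q\<close> of labels only.\<close>

theorem alexander_trick:
 fixes K :: "'w::infinite set set"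
 assumes K: "cx K" and Q: "finite Q"
  and lQ: "\<And>ka. ka \<in> K ==> ka ~= {} ==> \<Union>(l ` ka) \<in> Q & (\<exists>x\<in>ka. \<pi> (l x) = \<pi> (\<Union>(l ` ka)))"
  and g: "\<And>q. q \<in> Q ==> Gw {ka \<in> K. \<Union>(l ` ka) <= q} {ka \<in> K. ka = {} \<or> \<Union>(l ` ka) < q}"
  and inf: "\<And>q. q \<in> Q ==> infinite {w. l w = q}"
  and v: "\<And>q. q \<in> Q ==> l (v q) = q" "v ` Q Int \<Union>K = {}"
 shows "equivclp (lmv l \<pi>) K {rh. rh <= v ` Q & chain_subset (l ` rh)}"
proof -
 define f where "f ka = \<Union>(l ` ka)" for ka
 define V where "V = \<Union>K"
 have KV: "ka <= V" if "ka \<in> K" for ka using that by (auto simp: V_def)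
 have fl: "l u <= f ka" if "u \<in> ka" for u ka using that by (auto simp: f_def)
 note lQ = lQ[folded f_def] and g = g[folded f_def]
 \<comment> \<open>The complex after the cells with labels in \<open>\<W>\<close> have been coned:
   the old vertices of a face span a face of \<open>K\<close> with an untreated label, and its cone
   points form a chain of treated labels above that one.\<close>
 define T where "T \<W> = {rh. rh Int V \<in> K & rh - V <= v ` \<W> & chain_subset (l ` (rh - V)) &
  (rh Int V = {} \<or> f (rh Int V) ~: \<W>) & (\<forall>u\<in>rh - V. f (rh Int V) <= l u)}" for \<W>
 \<comment> \<open>Treated labels form an up-set, so a cell is intact when its turn comes.\<close>
 define up where "up \<W> \<longleftrightarrow> \<W> <= Q & (\<forall>q\<in>\<W>. \<forall>q'\<in>Q. q <= q' --> q' \<in> \<W>)" for \<W>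
 have mono: "f ka <= f ka'" if "ka <= ka'" for ka ka' using that by (auto simp: f_def)
 have chs: "chain_subset B" if "chain_subset A" "B <= A" for A B :: "'s set set"
  using that by (auto simp: chain_subset_def)
 have vV: "v q ~: V" if "q \<in> Q" for q using v(2) that by (auto simp: V_def)
 have Tsub: "rh' \<in> T \<W>" if "rh \<in> T \<W>" "rh' <= rh" "up \<W>" for rh rh' \<W>
 proof -
  have r: "rh Int V \<in> K" "rh - V <= v ` \<W>" "chain_subset (l ` (rh - V))"
   "rh Int V = {} \<or> f (rh Int V) ~: \<W>" "\<forall>u\<in>rh - V. f (rh Int V) <= l u"
   using that(1) unfolding T_def by blast+
  have s: "rh' Int V <= rh Int V" "rh' - V <= rh - V" using that(2) by blast+
  have "rh' Int V = {} \<or> f (rh' Int V) ~: \<W>"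
  proof (rule ccontr)
   assume "~ ?thesis"
   then have n: "rh' Int V ~= {}" "f (rh' Int V) \<in> \<W>" by blast+
   then have "f (rh Int V) \<in> Q" using lQ[OF r(1)] s(1) by blast
   then have "f (rh Int V) \<in> \<W>" using n(2) mono[OF s(1)] that(3) unfolding up_def by blast
   then show False using r(4) n(1) s(1) by blast
  qed
  moreover have "rh' Int V \<in> K" using cx_sub[OF K r(1) s(1)] .
  moreover have "chain_subset (l ` (rh' - V))" by (rule chs[OF r(3) image_mono[OF s(2)]])
  moreover have "\<forall>u\<in>rh' - V. f (rh' Int V) <= l u" using r(5) s mono[OF s(1)] by blast
  ultimately show ?thesis using r(2) s(2) unfolding T_def by blast
 qed
 have Tv: "rh <= V Un v ` Q" if "rh \<in> T \<W>" "up \<W>" for rh \<W>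
 proof -
  have "rh - V <= v ` \<W>" using that(1) unfolding T_def by simp
  moreover have "v ` \<W> <= v ` Q" using that(2) unfolding up_def by (intro image_mono) simp
  ultimately show ?thesis by blast
 qed
 have fin: "finite (V Un v ` Q)" using cx_finite_vertices[OF K] Q by (simp add: V_def)
 have T0: "{} \<in> T \<W>" for \<W> using K by (simp add: T_def chain_subset_def)
 have step: "equivclp (lmv l \<pi>) (T \<W>) (T (insert q \<W>))"
  if up: "up \<W>" and q: "q \<in> Q" "q ~: \<W>" and max: "\<And>q'. q' \<in> Q ==> q < q' ==> q' \<in> \<W>" for \<W> q
 proof -
  \<comment> \<open>The faces meeting the interior of the cell \<open>C\<close> are joined with the
    chains \<open>J\<close> of cone points of larger labels; \<open>R\<close> is the rest. Hence the
    complex is \<open>jn J C Un R\<close>, the form that \<open>cone_cell\<close> treats.\<close>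
  define C where "C = {ka \<in> K. f ka <= q}"
  define E where "E = {ka \<in> K. ka = {} \<or> f ka < q}"
  define V' where "V' = v ` {q' \<in> Q. q < q'}"
  define J where "J = {rh. rh <= V' & chain_subset (l ` rh)}"
  define R where "R = {rh \<in> T \<W>. rh Int V = {} \<or> f (rh Int V) ~= q}"
  have WQ: "\<W> <= Q" and Wup: "\<And>q1 q2. q1 \<in> \<W> ==> q2 \<in> Q ==> q1 <= q2 ==> q2 \<in> \<W>"
   using up unfolding up_def by blast+
  have UJ: "\<Union>J = V'"
  proof
   show "\<Union>J <= V'" by (auto simp: J_def)
   have "{u} \<in> J" if "u \<in> V'" for u using that by (simp add: J_def chain_subset_def)
   then show "V' <= \<Union>J" by blast
  qed
  have V'V: "V' Int V = {}" using vV unfolding V'_def by blast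
  have V'l: "q < l u & l u \<in> Q & l u \<in> \<W> & u = v (l u)" if "u \<in> V'" for u
  proof -
   from that obtain q' where q': "q' \<in> Q" "q < q'" "u = v q'" unfolding V'_def by blast
   then show ?thesis using v(1)[OF q'(1)] max[OF q'(1,2)] by simp
  qed
  have vq: "v q ~: V'" using V'l[of "v q"] v(1)[OF q(1)] by auto
  have inW: "u \<in> V'" if "u \<in> v ` \<W>" "q <= l u" for u
  proof -
   from that(1) obtain q' where q': "q' \<in> \<W>" "u = v q'" by blast
   then have "l u = q'" "q' \<in> Q" using v(1) WQ by blast+
   then have "q < q'" using that(2) q' q(2) by blast
   then show ?thesis using q' \<open>q' \<in> Q\<close> unfolding V'_def by blast
  qed
  have cJ: "cx J"
  proof (rule cxI[of V'])
   show "finite V'" using Q by (simp add: V'_def)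
   show "{} \<in> J" by (simp add: J_def chain_subset_def)
   fix si ta assume "si \<in> J" "ta <= si"
   then show "ta \<in> J" using chs[of "l ` si" "l ` ta"] by (auto simp: J_def)
  qed (auto simp: J_def)
  have cR: "cx R"
  proof (rule cxI[OF fin])
   show "{} \<in> R" using T0 by (simp add: R_def)
   fix si assume s: "si \<in> R"
   then show "si <= V Un v ` Q" using Tv up unfolding R_def by blast
   fix ta assume t: "ta <= si"
   have sT: "si \<in> T \<W>" and s': "si Int V = {} \<or> f (si Int V) ~= q" using s unfolding R_def by blast+
   have "ta Int V = {} \<or> f (ta Int V) ~= q"
   proof (rule ccontr)
    assume "~ ?thesis"
    then have n: "ta Int V ~= {}" "f (ta Int V) = q" by blast+
    have ts: "ta Int V <= si Int V" using t by blast
    then have ne: "si Int V ~= {}" using n(1) by blast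
    then have "f (si Int V) \<in> Q" "f (si Int V) ~: \<W>" using lQ[of "si Int V"] sT unfolding T_def by blast+
    moreover have "q < f (si Int V)" using s' ne mono[OF ts] n(2) by blast
    ultimately show False using max by blast
   qed
   then show "ta \<in> R" using Tsub[OF sT t up] unfolding R_def by blast
  qed
  have gC: "Gw C E" using g[OF q(1)] unfolding C_def E_def .
  have CV: "\<Union>C <= V" using KV by (auto simp: C_def)
  have lq: "f ka ~: \<W>" if "f ka <= q" for ka using Wup[OF _ q(1) that] q(2) by blast
  have RC: "R Int C <= E"
  proof
   fix ka assume k: "ka \<in> R Int C"
   then have "ka \<in> K" "ka Int V = ka" "f ka <= q" using KV[of ka] by (auto simp: C_def)
   then show "ka \<in> E" using k unfolding R_def E_def by auto
  qed
  have RCV: "\<Union>R Int \<Union>C <= \<Union>E"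
  proof
   fix u assume "u \<in> \<Union>R Int \<Union>C"
   then have "{u} \<in> R" "{u} \<in> C" using cx_vertex[OF cR, of u] cx_vertex[OF GwD(1)[OF gC], of u] by auto
   then show "u \<in> \<Union>E" using RC by blast
  qed
  have vqR: "v q ~: \<Union>R"
  proof
   assume "v q \<in> \<Union>R"
   then obtain rh where "rh \<in> T \<W>" "v q \<in> rh" unfolding R_def by blast
   then have "v q \<in> v ` \<W>" using vV[OF q(1)] unfolding T_def by blast
   then obtain q' where "q' \<in> \<W>" "v q = v q'" by blast
   then have "q = q'" using v(1)[OF q(1)] v(1)[of q'] WQ by auto
   then show False using \<open>q' \<in> \<W>\<close> q(2) by blast
  qed
  have vqC: "v q ~: \<Union>C" using vV[OF q(1)] CV by blast
  have EC: "f ka = q & (\<exists>x\<in>ka. \<pi> (l x) = \<pi> q)" if "ka \<in> C" "ka ~: E" for ka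
  proof -
   have "ka \<in> K" "ka ~= {}" "f ka = q" using that unfolding C_def E_def by blast+
   then show ?thesis using lQ[of ka] by simp
  qed
  have El: "l u <= q" if "u \<in> \<Union>E" for u using that fl unfolding E_def by blast
  have JC: "\<Union>J Int \<Union>C = {}" using V'V CV UJ by blast
  have vqJ: "v q ~: \<Union>J" using vq UJ by simp
  have main: "equivclp (lmv l \<pi>) (jn J C Un R) (jn J (cone (v q) E) Un R)"
   using cone_cell[OF gC cR RC RCV cJ JC v(1)[OF q(1)] vqC vqR vqJ inf[OF q(1)] El EC[unfolded f_def]] by blast
  have jC: "rh \<in> T \<W>" if "rh \<in> jn J C" for rh
  proof -
   have r: "rh Int V' \<in> J" "rh - V' \<in> C" using that unfolding jn_def UJ by blast+
   have e: "rh Int V = rh - V'" "rh - V = rh Int V'" using r(2) CV V'V by blast+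
   have "f (rh - V') <= q" "rh - V' \<in> K" using r(2) unfolding C_def by blast+
   moreover have "u \<in> v ` \<W> & q <= l u" if "u \<in> rh Int V'" for u using V'l[of u] that by blast
   ultimately show ?thesis using lq[of "rh - V'"] r(1) unfolding T_def e mem_Collect_eq J_def by blast
  qed
  have e1: "T \<W> = jn J C Un R"
  proof
   show "jn J C Un R <= T \<W>" using jC unfolding R_def by blast
   show "T \<W> <= jn J C Un R"
   proof
    fix rh assume r: "rh \<in> T \<W>"
    show "rh \<in> jn J C Un R"
    proof (cases "rh \<in> R")
     case False
     then have f: "f (rh Int V) = q" using r unfolding R_def by blast
     have "u \<in> V'" if "u \<in> rh - V" for u using inW[of u] that r f unfolding T_def by blast
     then have e: "rh Int V' = rh - V" "rh - V' = rh Int V" using V'V by blast+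
     have "chain_subset (l ` (rh Int V'))" unfolding e(1) using r unfolding T_def by simp
     then have "rh Int V' \<in> J" unfolding J_def by simp
     moreover have "rh - V' \<in> C" using r f unfolding C_def e T_def by blast
     ultimately show ?thesis unfolding jn_def UJ by blast
    qed blast
   qed
  qed
  have e2: "T (insert q \<W>) = jn J (cone (v q) E) Un R"
  proof
   show "jn J (cone (v q) E) Un R <= T (insert q \<W>)"
   proof
    fix rh assume "rh \<in> jn J (cone (v q) E) Un R"
    then show "rh \<in> T (insert q \<W>)"
    proof
     assume "rh \<in> R"
     then show ?thesis unfolding R_def T_def by blast
    next
     assume "rh \<in> jn J (cone (v q) E)"
     then have r: "rh Int V' \<in> J" "rh - V' - {v q} \<in> E" unfolding jn_def UJ cone_def by blast+
     let ?k = "rh - V' - {v q}"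
     have kK: "?k \<in> K" "?k = {} \<or> f ?k < q" using r(2) unfolding E_def by blast+
     have e: "rh Int V = ?k" using KV[OF kK(1)] V'V vV[OF q(1)] by blast
     have d: "rh - V <= insert (v q) (rh Int V')" using e by blast
     have lu: "u \<in> v ` insert q \<W> & q <= l u" if "u \<in> rh - V" for u
      using V'l[of u] v(1)[OF q(1)] d that by blast
     have "chain_subset (l ` (rh Int V'))" using r(1) unfolding J_def by blast
     then have "chain_subset (insert q (l ` (rh Int V')))"
     proof -
      have "q <= l u" if "u \<in> rh Int V'" for u using V'l[of u] that by blast
      then have "\<forall>c\<in>l ` (rh Int V'). q <= c" by auto
      then show ?thesis using \<open>chain_subset (l ` (rh Int V'))\<close> unfolding chain_subset_def by blast
     qed
     moreover have "l ` (rh - V) <= insert q (l ` (rh Int V'))" using d v(1)[OF q(1)] by auto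
     ultimately have "chain_subset (l ` (rh - V))" using chs by blast
     moreover have "?k = {} \<or> f ?k ~: insert q \<W>" using kK(2) lq[of ?k] by blast
     moreover have "f ?k <= q"
     proof (cases "?k = {}")
      case True
      show ?thesis unfolding True by (simp add: f_def)
     next
      case False
      then show ?thesis using kK(2) by (intro psubset_imp_subset) simp
     qed
     ultimately show ?thesis using kK(1) lu unfolding T_def e mem_Collect_eq by blast
    qed
   qed
   show "T (insert q \<W>) <= jn J (cone (v q) E) Un R"
   proof
    fix rh assume r: "rh \<in> T (insert q \<W>)"
    show "rh \<in> jn J (cone (v q) E) Un R"
    proof (cases "v q \<in> rh")
     case False
     then have "rh - V <= v ` \<W>" using r unfolding T_def by blast
     then have "rh \<in> R" using r unfolding R_def T_def by blast
     then show ?thesis by blast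
    next
     case True
     have vqd: "v q \<in> rh - V" using True vV[OF q(1)] by blast
     have u: "u \<in> insert (v q) V'" if "u \<in> rh - V" for u
     proof (cases "u = v q")
      case ne: False
      then have uW: "u \<in> v ` \<W>" using that r unfolding T_def by blast
      then obtain q' where q': "q' \<in> \<W>" "u = v q'" by blast
      then have lu: "l u = q'" using v(1) WQ by blast
      have "q <= l u \<or> l u <= q"
       using r vqd that v(1)[OF q(1)] unfolding T_def chain_subset_def by (metis (lifting) imageI mem_Collect_eq)
      then have "q <= l u" using Wup[OF q'(1) q(1)] lu q(2) by blast
      then show ?thesis using inW[OF uW] by blast
     qed simp
     have e: "rh Int V' = rh - V - {v q}" "rh - V' - {v q} = rh Int V"
      using u V'V vq vV[OF q(1)] by blast+
     have "chain_subset (l ` (rh Int V'))" using chs[of "l ` (rh - V)" "l ` (rh Int V')"] r e unfolding T_def by blast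
     then have "rh Int V' \<in> J" unfolding J_def by blast
     moreover have "f (rh Int V) <= q" using r vqd v(1)[OF q(1)] unfolding T_def by blast
     then have "rh - V' - {v q} \<in> E" using r unfolding e E_def T_def by blast
     ultimately show ?thesis unfolding jn_def UJ cone_def by blast
    qed
   qed
  qed
  show ?thesis unfolding e1 e2 by (rule main)
 qed
 have "equivclp (lmv l \<pi>) (T \<W>) (T Q)" if "up \<W>" for \<W>
  using that
 proof (induction "card (Q - \<W>)" arbitrary: \<W> rule: less_induct)
  case less
  show ?case
  proof (cases "Q - \<W> = {}")
   case True
   then have "\<W> = Q" using less(2) unfolding up_def by blast
   then show ?thesis by (simp add: equivclp_def)
  next
   case False
   have f: "finite (Q - \<W>)" using Q by simp
   from finite_has_maximal[OF f False] obtain q where q: "q \<in> Q - \<W>" "\<forall>b\<in>Q - \<W>. q <= b --> q = b" by blast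
   then have max: "q' \<in> \<W>" if "q' \<in> Q" "q < q'" for q' using that by blast
   have up': "up (insert q \<W>)" using less(2) q(1) max unfolding up_def by blast
   have "Q - insert q \<W> < Q - \<W>" using q(1) by blast
   then have "card (Q - insert q \<W>) < card (Q - \<W>)" by (rule psubset_card_mono[OF f])
   from less(1)[OF this up'] have "equivclp (lmv l \<pi>) (T (insert q \<W>)) (T Q)" .
   from equivclp_trans[OF step[OF less(2) _ _ max] this] show ?thesis using q(1) by simp
  qed
 qed
 moreover have "up {}" by (simp add: up_def)
 ultimately have "equivclp (lmv l \<pi>) (T {}) (T Q)" by blast
 moreover have "T {} = K"
 proof
  show "T {} <= K"
  proof
   fix rh assume r: "rh \<in> T {}"
   then have "rh Int V = rh" unfolding T_def by blast
   then show "rh \<in> K" using r unfolding T_def by auto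
  qed
  show "K <= T {}"
  proof
   fix rh assume r: "rh \<in> K"
   then have e: "rh Int V = rh" "rh - V = {}" using KV by blast+
   show "rh \<in> T {}" using r unfolding T_def mem_Collect_eq e by (simp add: chain_subset_def)
  qed
 qed
 moreover have "T Q = {rh. rh <= v ` Q & chain_subset (l ` rh)}"
 proof
  show "T Q <= {rh. rh <= v ` Q & chain_subset (l ` rh)}"
  proof
   fix rh assume r: "rh \<in> T Q"
   then have "rh Int V = {}" using lQ[of "rh Int V"] unfolding T_def by blast
   then have "rh - V = rh" by blast
   then show "rh \<in> {rh. rh <= v ` Q & chain_subset (l ` rh)}" using r unfolding T_def by auto
  qed
  show "{rh. rh <= v ` Q & chain_subset (l ` rh)} <= T Q"
  proof
   fix rh assume "rh \<in> {rh. rh <= v ` Q & chain_subset (l ` rh)}"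
   then have r: "rh <= v ` Q" "chain_subset (l ` rh)" by blast+
   then have e: "rh Int V = {}" "rh - V = rh" using v(2) unfolding V_def by blast+
   show "rh \<in> T Q" using r K unfolding T_def mem_Collect_eq e by (simp add: f_def)
  qed
 qed
 ultimately show ?thesis by simp
qed

subsection \<open>Order complexes and dual cells\<close>

instance set :: (infinite) infinite
proof
 have "infinite (range (%x :: 'a. {x}))" using finite_imageD[of "%x :: 'a. {x}" UNIV] infinite_UNIV by auto
 then show "infinite (UNIV :: 'a set set)" using infinite_super[OF subset_UNIV] by metis
qed

definition ord :: "'v set set => 'v set set set" where
 "ord P = {C. C <= P & finite C & chain_subset C}"

lemma chain_subset_sub: "chain_subset A ==> B <= A ==> chain_subset B"
 by (auto simp: chain_subset_def)

lemma chain_insert: "chain_subset (insert x C) \<longleftrightarrow> chain_subset C & (\<forall>c\<in>C. c <= x \<or> x <= c)"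
 unfolding chain_subset_def by (simp add: ball_conj_distrib) (subst disj_commute, argo)

lemma ord_sub: "C \<in> ord P ==> B <= C ==> B \<in> ord P"
 by (auto simp: ord_def intro: finite_subset chain_subset_sub)

lemma cx_ord: assumes "finite P" shows "cx (ord P)"
proof (rule cxI[OF assms])
 show "ta \<in> ord P" if "si \<in> ord P" "ta <= si" for si ta by (rule ord_sub[OF that])
qed (auto simp: ord_def chain_subset_def)

lemma ord_vertices [simp]: "\<Union>(ord P) = P"
proof
 show "\<Union>(ord P) <= P" by (auto simp: ord_def)
 have "{x} \<in> ord P" if "x \<in> P" for x using that by (simp add: ord_def chain_subset_def)
 then show "P <= \<Union>(ord P)" by blast
qed

lemma ord_insert: "insert x C \<in> ord P \<longleftrightarrow> C \<in> ord P & x \<in> P & (\<forall>c\<in>C. c <= x \<or> x <= c)"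
 by (auto simp: ord_def chain_insert)

lemma chain_ends:
 assumes "finite C" "C ~= {}" "chain_subset C"
 shows "\<Union>C \<in> C" "\<Inter>C \<in> C"
proof -
 have "\<Union>C \<in> C & \<Inter>C \<in> C" using assms
 proof (induction rule: finite_ne_induct)
  case (insert x F)
  then have i: "\<Union>F \<in> F" "\<Inter>F \<in> F" and c: "\<forall>c\<in>F. c <= x \<or> x <= c" by (auto simp: chain_insert)
  from c i have "\<Union>F <= x \<or> x <= \<Union>F" "\<Inter>F <= x \<or> x <= \<Inter>F" by blast+
  then have "\<Union>(insert x F) = x \<or> \<Union>(insert x F) = \<Union>F" "\<Inter>(insert x F) = x \<or> \<Inter>(insert x F) = \<Inter>F"
   by (auto simp: Un_absorb1 Un_absorb2 Int_absorb1 Int_absorb2)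
  then show ?case using i by (metis insert_iff)
 qed simp
 then show "\<Union>C \<in> C" "\<Inter>C \<in> C" by blast+
qed

lemma ord_ends: assumes "C \<in> ord P" "C ~= {}" shows "\<Union>C \<in> C" "\<Inter>C \<in> C"
 using assms chain_ends by (auto simp: ord_def)

text \<open>On a single vertex a star move, in either direction, can only rename it.\<close>

lemma seq_point:
 assumes "seq {{}} {{}, {v}} K" shows "\<exists>u. K = {{}, {u}}"
 using assms
proof (induction rule: equivclp_induct)
 case (step y z)
 then obtain u where y: "y = {{}, {u}}" by blast
 from step(2) show ?case
 proof
  assume "smv {{}} y z"
  then obtain si a where *: "si \<in> y" "si ~= {}" "a ~: \<Union>y" "z = st si a y" by (auto simp: smv_def)
  then have s: "si = {u}" "a ~= u" using y by auto
  have "z = {{}, {a}}"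
  proof (rule set_eqI)
   fix rh
   have "a \<in> rh ==> rh - {a} Un {u} = {u} ==> u ~: rh ==> rh = {a}" by auto
   then show "rh \<in> z \<longleftrightarrow> rh \<in> {{}, {a}}" using s(2) unfolding *(4) s(1) y st_def by auto
  qed
  then show ?thesis by blast
 next
  assume "smv {{}} z y"
  then obtain si a where *: "cx z" "si \<in> z" "si ~= {}" "a ~: \<Union>z" "y = st si a z" by (auto simp: smv_def)
  obtain t where t: "t \<in> si" using *(3) by blast
  have k: "ta <= {t}" if "ta \<in> z" for ta
  proof (cases "si <= ta")
   case True
   then have "insert a (ta - {t}) \<in> y" using lk_st_face(2)[OF *(1,4) that True t] *(5) by simp
   then have "insert a (ta - {t}) = {u}" using y by auto
   moreover have "a ~: ta" using *(4) that by blast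
   ultimately show ?thesis by blast
  next
   case False
   have a: "a ~: ta" using *(4) that by blast
   then have "ta \<in> y" using that False unfolding *(5) st_def by simp
   moreover have "insert a (si - {t}) \<in> y" using lk_st_face(2)[OF *(1,4,2) subset_refl t] *(5) by simp
   ultimately show ?thesis using y a by auto
  qed
  have "{t} \<in> z" using cx_sub[OF *(1,2), of "{t}"] t by blast
  moreover have "z <= {{}, {t}}" using k by (auto simp: subset_singleton_iff)
  ultimately have "z = {{}, {t}}" using cx_empty[OF *(1)] by blast
  then show ?thesis by blast
 qed
qed blast

text \<open>Maximality makes the boundary of the link equal to \<open>{{}}\<close>, and the link is
  equivalent to a cone over that, a point.\<close>

lemma mb_maximal:
 fixes K :: "'v::infinite set set"
 assumes "bs d K" "B \<in> mb K" "\<And>B'. B' \<in> mb K ==> B <= B' ==> B' = B"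
 shows "\<exists>v. lk B K = {{}, {v}}"
proof -
 have "lk B (mb K) = {{}}"
 proof (rule set_eqI)
  fix rh
  have "rh = {}" if "rh Int B = {}" "rh Un B \<in> mb K" using assms(3)[OF that(2)] that(1) by blast
  then show "rh \<in> lk B (mb K) \<longleftrightarrow> rh \<in> {{}}" using assms(2) unfolding lk_def by auto
 qed
 then have "wc (lk B K) {{}}" using GwD(4)[OF bsD(1)[OF assms(1)] assms(2)] by simp
 then obtain v where "seq {{}} (lk B K) (cone v {{}})" unfolding wc_def by blast
 moreover have "cone v {{}} = {{}, {v}}" by (auto simp: cone_def)
 ultimately show ?thesis using seq_point[OF seq_sym] by metis
qed

lemma mb_single: assumes "B \<in> K" "lk B K = {{}, {v}}" shows "B \<in> mb K"
proof -
 have "~ sph e (lk B K)" for e using sph_odd[of e "lk B K"] assms(2) by auto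
 then show ?thesis using assms(1) by (simp add: mb_def)
qed

lemma sph_two:
 assumes "sph e L" "cx L" "{v} \<in> L" shows "\<exists>u. u ~= v & {u} \<in> L"
proof (rule ccontr)
 assume n: "~ ?thesis"
 have "rh <= {v}" if "rh \<in> L" for rh using n cx_sub[OF assms(2) that] by blast
 then have "L = {{}, {v}}" using assms(2,3) by auto
 then show False using sph_odd[OF assms(1)] by simp
qed

lemma lk_singleI:
 assumes "cx D" "T ~: B" "insert T B \<in> D" "\<And>f. f ~: B ==> insert f B \<in> D ==> f = T"
 shows "lk B D = {{}, {T}}"
proof (rule set_eqI)
 fix rh
 have "rh <= {T}" if "rh Int B = {}" "rh Un B \<in> D"
 proof
  fix f assume f: "f \<in> rh"
  then have "insert f B \<in> D" using cx_sub[OF assms(1) that(2), of "insert f B"] by blast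
  then show "f \<in> {T}" using assms(4)[of f] f that(1) by blast
 qed
 moreover have "B \<in> D" using cx_sub[OF assms(1,3)] by blast
 ultimately show "rh \<in> lk B D \<longleftrightarrow> rh \<in> {{}, {T}}" using assms(2,3) unfolding lk_def by auto
qed

lemma ex_maximal_in:
 assumes "finite F" "c \<in> F" shows "\<exists>B. B \<in> F & c \<subseteq> B & (\<forall>B'. B' \<in> F --> B \<subseteq> B' --> B' = B)"
 using finite_has_maximal2[OF assms] by metis

text \<open>Codimension-one faces of a dual cell are counted by the ways of inserting one more element into
  the chain: in the interior there are always two.\<close>

lemma dual_cell_boundary:
 fixes M :: "'v::infinite set set" and P rh g
 defines "P \<equiv> {ta \<in> M. rh <= g ` ta}"
 assumes M: "bs d M" and D: "bs e (ord P)" and r: "rh ~= {}"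
 shows "mb (ord P) = {c \<in> ord P. (\<forall>ta\<in>c. ta \<in> mb M) \<or> (\<forall>ta\<in>c. g ` ta ~= rh)}"
proof -
 note cM = bsD(4)[OF M] and cS = bsD(5)[OF M] and SM = bsD(6)[OF M]
 have finP: "finite P" using cx_finite[OF cM] by (simp add: P_def)
 note cD = cx_ord[OF finP] and cB = bsD(5)[OF D]
 have finD: "finite (ord P)" by (rule cx_finite[OF cD])
 have Pup: "ta' \<in> P" if "ta \<in> P" "ta <= ta'" "ta' \<in> M" for ta ta' using that unfolding P_def by blast
 have PM: "ta \<in> M" "rh <= g ` ta" if "ta \<in> P" for ta using that unfolding P_def by blast+
 have insD: "insert f B \<in> ord P" if "B \<in> ord P" "f \<in> P" "\<And>b. b \<in> B ==> b <= f \<or> f <= b" for f B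
  using that by (simp add: ord_insert)
 have cmp: "f \<in> P & (\<forall>b\<in>B. b <= f \<or> f <= b)" if "insert f B \<in> ord P" for f B using that by (simp add: ord_insert)
 have bP: "b \<in> P" if "B \<in> ord P" "b \<in> B" for b B using that by (auto simp: ord_def)
 \<comment> \<open>A maximal chain \<open>B\<close> of boundary faces ends in a maximal boundary
   face \<open>t\<close> of \<open>M\<close>, whose link is a single vertex \<open>v\<close>.
   Appending \<open>insert v t\<close> is the only way to extend \<open>B\<close>.\<close>
 have F: "c \<in> mb (ord P)" if c: "c \<in> ord P" "c ~= {}" "\<forall>ta\<in>c. ta \<in> mb M" for c
 proof -
  define F where "F = {c \<in> ord P. \<forall>ta\<in>c. ta \<in> mb M}"
  have "finite F" "c \<in> F" using finD c by (simp_all add: F_def)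
  from ex_maximal_in[OF this] obtain B where B': "B \<in> F & c <= B & (\<forall>B'. B' \<in> F --> B <= B' --> B' = B)" ..
  note B = B'[THEN conjunct1] B'[THEN conjunct2, THEN conjunct1] B'[THEN conjunct2, THEN conjunct2, rule_format]
  have BD: "B \<in> ord P" and BS: "\<And>b. b \<in> B ==> b \<in> mb M" using B(1) unfolding F_def by blast+
  have Bm: "f \<in> B" if "insert f B \<in> ord P" "f \<in> mb M" for f
   using B(3)[of "insert f B"] that BS unfolding F_def by blast
  have ne: "B ~= {}" using B(2) c(2) by blast
  define t where "t = \<Union>B"
  have t: "t \<in> B" and tb: "\<And>b. b \<in> B ==> b <= t" using ord_ends(1)[OF BD ne] by (auto simp: t_def)
  have tm: "t' = t" if t': "t' \<in> mb M" "t <= t'" for t'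
  proof -
   have "t' \<in> P" using Pup[OF bP[OF BD t] t'(2)] SM t'(1) by blast
   then have "insert t' B \<in> ord P" using insD[OF BD] tb t'(2) by blast
   then have "t' \<in> B" using Bm t'(1) by blast
   then show ?thesis using tb t'(2) by blast
  qed
  obtain v where v: "lk t M = {{}, {v}}" using mb_maximal[OF M BS[OF t] tm] by blast
  have "{v} \<in> lk t M" using v by simp
  then have vt: "v ~: t" "insert v t \<in> M" unfolding lk_def by auto
  have TP: "insert v t \<in> P" using Pup[OF bP[OF BD t] _ vt(2)] by blast
  have "lk B (ord P) = {{}, {insert v t}}"
  proof (rule lk_singleI[OF cD])
   show "insert v t ~: B" using tb vt(1) by blast
   show "insert (insert v t) B \<in> ord P" using insD[OF BD TP] tb by blast
   fix f assume f: "f ~: B" "insert f B \<in> ord P"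
   have fS: "f ~: mb M" using Bm f by blast
   have fP: "f \<in> P" and "t <= f \<or> f <= t" using cmp[OF f(2)] t by blast+
   then have tf: "t <= f" using cx_sub[OF cS BS[OF t], of f] fS by blast
   have "f - t \<in> lk t M" using PM(1)[OF fP] tf unfolding lk_def by (simp add: Un_absorb2) blast
   then have "f - t = {} \<or> f - t = {v}" unfolding v by simp
   then have "f = t \<or> f = insert v t" using tf by blast
   then show "f = insert v t" using f(1) t by blast
  qed
  from mb_single[OF BD this] show ?thesis using cx_sub[OF cB _ B(2)] by blast
 qed
 \<comment> \<open>A maximal chain whose members all have images strictly above \<open>rh\<close>
   starts with a face \<open>t\<close> having exactly one vertex \<open>y\<close> mapped outside
   \<open>rh\<close>. Prepending \<open>t - {y}\<close> is the only way to extend it.\<close>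
 have E: "c \<in> mb (ord P)" if c: "c \<in> ord P" "c ~= {}" "\<forall>ta\<in>c. g ` ta ~= rh" for c
 proof -
  define F where "F = {c \<in> ord P. \<forall>ta\<in>c. g ` ta ~= rh}"
  have "finite F" "c \<in> F" using finD c by (simp_all add: F_def)
  from ex_maximal_in[OF this] obtain B where B': "B \<in> F & c <= B & (\<forall>B'. B' \<in> F --> B <= B' --> B' = B)" ..
  note B = B'[THEN conjunct1] B'[THEN conjunct2, THEN conjunct1] B'[THEN conjunct2, THEN conjunct2, rule_format]
  have BD: "B \<in> ord P" and BS: "\<And>b. b \<in> B ==> g ` b ~= rh" using B(1) unfolding F_def by blast+
  have Bm: "f \<in> B" if "insert f B \<in> ord P" "g ` f ~= rh" for f
   using B(3)[of "insert f B"] that BS unfolding F_def by blast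
  have ne: "B ~= {}" using B(2) c(2) by blast
  define t where "t = \<Inter>B"
  have t: "t \<in> B" and tb: "\<And>b. b \<in> B ==> t <= b" using ord_ends(2)[OF BD ne] by (auto simp: t_def)
  have tP: "t \<in> P" by (rule bP[OF BD t])
  have "rh < g ` t" using BS[OF t] PM(2)[OF tP] by blast
  then obtain y where y: "y \<in> t" "g y ~: rh" by blast
  have down: "insert f B \<in> ord P" if "f <= t" "rh <= g ` f" for f
  proof -
   have "f \<in> P" using that cx_sub[OF cM PM(1)[OF tP]] unfolding P_def by blast
   then show ?thesis using insD[OF BD] tb that(1) by blast
  qed
  have tm: "~ rh <= g ` (t - {u})" if u: "u \<in> t" "u ~= y" for u
  proof
   assume a: "rh <= g ` (t - {u})"
   have "g y \<in> g ` (t - {u})" using y(1) u(2) by blast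
   then have "g ` (t - {u}) ~= rh" using y(2) by blast
   then have "t - {u} \<in> B" using Bm down[OF _ a] by blast
   then show False using tb u(1) by blast
  qed
  have rT: "rh <= g ` (t - {y})" using PM(2)[OF tP] y(2) by blast
  have "lk B (ord P) = {{}, {t - {y}}}"
  proof (rule lk_singleI[OF cD])
   show "t - {y} ~: B" using tb y(1) by blast
   show "insert (t - {y}) B \<in> ord P" using down[OF _ rT] by blast
   fix f assume f: "f ~: B" "insert f B \<in> ord P"
   then have gf: "g ` f = rh" using Bm by blast
   have "t <= f \<or> f <= t" using cmp[OF f(2)] t by blast
   then have ft: "f <= t" using gf y by blast
   have "y ~: f" using gf y(2) by blast
   moreover have "u \<in> f" if "u \<in> t" "u ~= y" for u
   proof (rule ccontr)
    assume "u ~: f"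
    then have "f <= t - {u}" using ft by blast
    then have "rh <= g ` (t - {u})" using gf by blast
    then show False using tm[OF that] by blast
   qed
   ultimately show "f = t - {y}" using ft by blast
  qed
  from mb_single[OF BD this] show ?thesis using cx_sub[OF cB _ B(2)] by blast
 qed
 \<comment> \<open>Otherwise \<open>B\<close> reaches from the level of \<open>rh\<close> to an
   interior face of \<open>M\<close>. Wherever its only extension \<open>T\<close> sits, above,
   below or between two members, a second extension exists.\<close>
 have conv: "(\<forall>ta\<in>B. ta \<in> mb M) \<or> (\<forall>ta\<in>B. g ` ta ~= rh)"
  if B: "B \<in> mb (ord P)" "\<And>B'. B' \<in> mb (ord P) ==> B <= B' ==> B' = B" "B ~= {}" for B
 proof (rule ccontr)
  assume "~ ?thesis"
  then obtain t1 t2 where t12: "t1 \<in> B" "t1 ~: mb M" "t2 \<in> B" "g ` t2 = rh" by blast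
  have BD: "B \<in> ord P" using B(1) bsD(6)[OF D] by blast
  obtain T where T: "lk B (ord P) = {{}, {T}}" using mb_maximal[OF D B(1,2)] by blast
  have "{T} \<in> lk B (ord P)" using T by simp
  then have TB: "T ~: B" "insert T B \<in> ord P" unfolding lk_def by auto
  have uni: "f = T" if "f ~: B" "insert f B \<in> ord P" for f
  proof -
   have "{f} \<in> lk B (ord P)" using that unfolding lk_def by simp
   then show ?thesis using T by simp
  qed
  define t where "t = \<Union>B"
  define s where "s = \<Inter>B"
  have t: "t \<in> B" "\<And>b. b \<in> B ==> b <= t" using ord_ends(1)[OF BD B(3)] by (auto simp: t_def)
  have s: "s \<in> B" "\<And>b. b \<in> B ==> s <= b" using ord_ends(2)[OF BD B(3)] by (auto simp: s_def)
  have tS: "t ~: mb M" using cx_sub[OF cS] t(2)[OF t12(1)] t12(2) by blast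
  have gs: "g ` s = rh" using s(2)[OF t12(3)] t12(4) PM(2)[OF bP[OF BD s(1)]] by blast
  have TP: "T \<in> P" and Tb: "\<And>b. b \<in> B ==> b < T \<or> T < b" using cmp[OF TB(2)] TB(1) by blast+
  consider "t < T" | "T < s" | "~ t < T" "~ T < s" by blast
  then show False
  proof cases
   case 1
   have tM: "t \<in> M" by (rule PM(1)[OF bP[OF BD t(1)]])
   have sp: "sph (d - int (card t)) (lk t M)" by (rule bsD(2)[OF M tM tS])
   have up: "insert (insert u t) B \<in> ord P & insert u t ~: B" if "{u} \<in> lk t M" for u
   proof -
    have u: "u ~: t" "insert u t \<in> M" using that unfolding lk_def by auto
    then have "insert u t \<in> P" using Pup[OF bP[OF BD t(1)]] by blast
    then show ?thesis using insD[OF BD] t(2) u(1) by blast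
   qed
   obtain v where v: "v \<in> T" "v ~: t" using 1 by blast
   have "insert v t \<in> M" using cx_sub[OF cM PM(1)[OF TP]] 1 v(1) by blast
   then have vl: "{v} \<in> lk t M" using v(2) unfolding lk_def by simp
   then obtain u where u: "u ~= v" "{u} \<in> lk t M" using sph_two[OF sp cx_lk[OF cM tM]] by blast
   have "insert v t = T" "insert u t = T" using up[OF vl] up[OF u(2)] uni by blast+
   then have "v \<in> insert u t" by blast
   then show False using u(1) v(2) by simp
  next
   case 2
   have dn: "f = T" if "f < s" "rh <= g ` f" for f
   proof -
    have "f \<in> P" using that cx_sub[OF cM PM(1)[OF bP[OF BD s(1)]]] unfolding P_def by blast
    then have "insert f B \<in> ord P" using insD[OF BD] s(2) that(1) by blast
    moreover have "f ~: B" using s(2) that(1) by blast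
    ultimately show ?thesis using uni by blast
   qed
   have gT: "g ` T = rh" using PM(2)[OF TP] 2 gs by blast
   obtain u where u: "u \<in> s" "u ~: T" using 2 by blast
   then have "g u \<in> g ` T" using gT gs by blast
   then obtain w where w: "w \<in> T" "g w = g u" by force
   \<comment> \<open>The vertices \<open>u\<close> and \<open>w\<close> of \<open>s\<close> have the
     same image, so \<open>w\<close> may be dropped instead of \<open>u\<close>.\<close>
   have "rh <= g ` (s - {w})"
   proof
    fix z assume "z \<in> rh"
    then obtain z' where z': "z' \<in> T" "z = g z'" using gT by blast
    show "z \<in> g ` (s - {w})"
    proof (cases "z' = w")
     case True then show ?thesis using w u z' by auto
    next
     case False then show ?thesis using z' 2 by blast
    qed
   qed
   then have "s - {w} = T" using dn[of "s - {w}"] w(1) 2 by blast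
   then show False using w(1) by blast
  next
   case 3
   define Lo where "Lo = {b \<in> B. b < T}"
   define Hi where "Hi = {b \<in> B. T < b}"
   have LH: "Lo ~= {}" "Hi ~= {}" using 3 Tb[OF t(1)] Tb[OF s(1)] t(1) s(1) unfolding Lo_def Hi_def by blast+
   have LB: "Lo <= B" "Hi <= B" unfolding Lo_def Hi_def by blast+
   define lo where "lo = \<Union>Lo"
   define hi where "hi = \<Inter>Hi"
   have Lo: "b <= lo" if "b \<in> Lo" for b using that by (auto simp: lo_def)
   have Hi: "hi <= b" if "b \<in> Hi" for b using that by (auto simp: hi_def)
   have l: "lo \<in> Lo" using ord_ends(1)[OF ord_sub[OF BD LB(1)] LH(1), folded lo_def] .
   have h: "hi \<in> Hi" using ord_ends(2)[OF ord_sub[OF BD LB(2)] LH(2), folded hi_def] .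
   obtain x where x: "x \<in> T" "x ~: lo" using l unfolding Lo_def by blast
   obtain y where y: "y \<in> hi" "y ~: T" using h unfolding Hi_def by blast
   \<comment> \<open>The second face between \<open>lo\<close> and \<open>hi\<close>: a vertex that
     \<open>T\<close> has beyond \<open>lo\<close> is exchanged for one that \<open>T\<close> lacks
     in \<open>hi\<close>.\<close>
   let ?f = "insert y (T - {x})"
   have hB: "hi \<in> B" "T < hi" and lB: "lo \<in> B" using h l unfolding Hi_def Lo_def by blast+
   have fh: "?f <= hi" using hB(2) y(1) by blast
   have fM: "?f \<in> M" using cx_sub[OF cM PM(1)[OF bP[OF BD hB(1)]] fh] .
   have lf: "lo <= ?f" using x(2) l unfolding Lo_def by blast
   have fP: "?f \<in> P" using Pup[OF bP[OF BD lB] lf fM] .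
   have "b <= ?f \<or> ?f <= b" if "b \<in> B" for b
   proof (cases "b < T")
    case True
    then have "b \<in> Lo" using that unfolding Lo_def by blast
    then have "b <= lo" by (rule Lo)
    then show ?thesis using lf by blast
   next
    case False
    then have "b \<in> Hi" using Tb[OF that] that unfolding Hi_def by blast
    then show ?thesis using fh Hi by blast
   qed
   then have "insert ?f B \<in> ord P" using insD[OF BD fP] by blast
   moreover have "?f ~: B" using Tb[of ?f] x(1) y(2) by blast
   ultimately have "?f = T" using uni by blast
   then show False using y(2) by blast
  qed
 qed
 show ?thesis
 proof (rule set_eqI, rule iffI)
  fix c assume c: "c \<in> mb (ord P)"
  have "finite (mb (ord P))" by (rule cx_finite[OF cB])
  from ex_maximal_in[OF this c] obtain B where B': "B \<in> mb (ord P) & c <= B & (\<forall>B'. B' \<in> mb (ord P) --> B <= B' --> B' = B)" ..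
  note B = B'[THEN conjunct1] B'[THEN conjunct2, THEN conjunct1] B'[THEN conjunct2, THEN conjunct2, rule_format]
  have "(\<forall>ta\<in>c. ta \<in> mb M) \<or> (\<forall>ta\<in>c. g ` ta ~= rh)"
   using conv[OF B(1,3)] B(2) by (cases "B = {}") blast+
  then show "c \<in> {c \<in> ord P. (\<forall>ta\<in>c. ta \<in> mb M) \<or> (\<forall>ta\<in>c. g ` ta ~= rh)}" using c bsD(6)[OF D] by blast
 next
  fix c assume "c \<in> {c \<in> ord P. (\<forall>ta\<in>c. ta \<in> mb M) \<or> (\<forall>ta\<in>c. g ` ta ~= rh)}"
  then show "c \<in> mb (ord P)" using F[of c] E[of c] cx_empty[OF cB] by (cases "c = {}") auto
 qed
qed

subsection \<open>Injective images and cones\<close>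

lemma lk_im_inj:
 assumes "inj_on f (\<Union>K)" "A \<in> K"
 shows "lk (f ` A) (im f K) = im f (lk A K)"
proof (rule set_eqI, rule iffI)
 fix rh assume "rh \<in> lk (f ` A) (im f K)"
 then obtain ta where t: "rh Int f ` A = {}" "ta \<in> K" "rh Un f ` A = f ` ta" unfolding lk_def by auto
 have AV: "A <= \<Union>K" "ta <= \<Union>K" using assms(2) t(2) by blast+
 have "f ` A <= f ` ta" using t(3) by blast
 then have At: "A <= ta" using inj_on_image_mem_iff[OF assms(1) _ AV(2)] AV(1) by blast
 have "f ` (ta - A) = f ` ta - f ` A" using inj_on_image_set_diff[OF assms(1) subset_trans[OF Diff_subset AV(2)] AV(1)] .
 moreover have "rh = (rh Un f ` A) - f ` A" using t(1) by blast
 ultimately have "rh = f ` (ta - A)" unfolding t(3) by simp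
 moreover have "ta - A \<in> lk A K" using t(2) At by (simp add: lk_def Un_absorb2) blast
 ultimately show "rh \<in> im f (lk A K)" by blast
next
 fix rh assume "rh \<in> im f (lk A K)"
 then obtain ta where t: "rh = f ` ta" "ta Int A = {}" "ta Un A \<in> K" unfolding lk_def by auto
 have "f ` ta Int f ` A = f ` (ta Int A)" using inj_on_image_Int[OF assms(1), of ta A] t(3) by blast
 moreover have "f ` ta Un f ` A = f ` (ta Un A)" by blast
 ultimately show "rh \<in> lk (f ` A) (im f K)" using t unfolding lk_def by auto
qed

lemma sph_cx: "sph d K ==> cx K"
 unfolding sph_def using seq_cx cx_bd by blast

lemma bal_cx: "bal d K ==> cx K"
 unfolding bal_def using seq_cx cx_Pow by blast

lemma sph_im_dir:
 fixes K :: "'u set set" and f :: "'u => 'w::infinite"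
 assumes "sph d K" "inj_on f (\<Union>K)"
 shows "sph d (im f K)"
proof -
 obtain V where V: "finite V" "V ~= {}" "int (card V) = d + 2" "seq {{}} (bd V) K"
  using assms(1) by (auto simp: sph_def)
 obtain h :: "'u => 'w" where h: "inj_on h V" using ex_inj_on[OF V(1)] by blast
 have "\<Union>(bd V) <= V" by (auto simp: bd_def)
 then have "inj_on h (\<Union>(bd V))" using h inj_on_subset by blast
 from seq_transport[OF V(4) cx_bd[OF V(1,2)] this assms(2)]
 have "seq {{}} (im h (bd V)) (im f K)" .
 moreover have "im h (bd V) = bd (h ` V)"
 proof -
  have "im h (Pow V - {V}) = im h (Pow V) - im h {V}"
   using inj_on_image_Pow[OF h] by (intro inj_on_image_set_diff) auto
  then show ?thesis by (simp add: bd_def image_Pow_surj)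
 qed
 ultimately show ?thesis unfolding sph_def using V h
  by (intro exI[of _ "h ` V"]) (auto simp: card_image)
qed

lemma sph_im:
 fixes K :: "'u::infinite set set" and f :: "'u => 'w::infinite"
 assumes "cx K" "inj_on f (\<Union>K)"
 shows "sph d (im f K) \<longleftrightarrow> sph d K"
proof
 assume s: "sph d (im f K)"
 let ?h = "the_inv_into (\<Union>K) f"
 have "inj_on ?h (\<Union>(im f K))" unfolding Union_im using inj_on_the_inv_into[OF assms(2)] .
 from sph_im_dir[OF s this] have "sph d (im ?h (im f K))" .
 moreover have "im ?h (im f K) = im (%x. x) K" unfolding im_comp
  by (rule im_cong) (simp add: the_inv_into_f_f[OF assms(2)])
 ultimately show "sph d K" by simp
qed (rule sph_im_dir[OF _ assms(2)])

lemma mb_im: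
 fixes K :: "'u::infinite set set" and f :: "'u => 'w::infinite"
 assumes "cx K" "inj_on f (\<Union>K)"
 shows "mb (im f K) = im f (mb K)"
proof -
 have "sph e (lk (f ` A) (im f K)) \<longleftrightarrow> sph e (lk A K)" if "A \<in> K" for A e
 proof -
  have "\<Union>(lk A K) <= \<Union>K" unfolding lk_def by blast
  then have "inj_on f (\<Union>(lk A K))" using assms(2) inj_on_subset by blast
  then show ?thesis unfolding lk_im_inj[OF assms(2) that] using sph_im cx_lk[OF assms(1) that] by blast
 qed
 then show ?thesis unfolding mb_def by blast
qed

lemma cone_eq_jn: "z ~: \<Union>L ==> {} \<in> L ==> cone z L = jn (Pow {z}) L"
 by (auto simp: cone_def jn_def)

text \<open>The cone over a simplex boundary is the simplex starred at its top face, and the cone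
  over a simplex is a simplex; equivalences of the base extend to the cones.\<close>

lemma bal_cone:
 fixes L :: "'v::infinite set set"
 assumes L: "sph d L \<or> bal d L" and z: "z ~: \<Union>L"
 shows "bal (d + 1) (cone z L)"
proof -
 have cL: "cx L" using L sph_cx bal_cx by blast
 have key: "seq {{}} (cone z X) (cone z L)" if "seq {{}} X L" "cx X" "z ~: \<Union>X" for X
  using seq_nil_jn[OF that(1,2) cL cx_Pow[of "{z}"]] that z cL by (simp add: cone_eq_jn)
 have zL: "{z} Int \<Union>L = {}" using z by blast
 from L show ?thesis
 proof
  assume "sph d L"
  then obtain V0 where V0: "finite V0" "V0 ~= {}" "int (card V0) = d + 2" "seq {{}} (bd V0) L" by (auto simp: sph_def)
  from rename_apart[OF cL V0(1) _ zL] obtain p where p: "bij p" "im p L = L" "p ` V0 Int {z} = {}" by auto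
  define V where "V = p ` V0"
  have V: "finite V" "V ~= {}" "int (card V) = d + 2" "z ~: V"
   unfolding V_def using V0(1-3) p(3) card_image[OF inj_on_subset[OF bij_is_inj[OF p(1)] subset_UNIV], of V0] by auto
  have "seq {{}} (bd V) L" using seq_im[OF p(1) V0(4)] p(2) im_bd[OF p(1)] by (simp add: V_def)
  moreover have zb: "z ~: \<Union>(bd V)" using V(4) by (auto simp: bd_def)
  ultimately have "seq {{}} (cone z (bd V)) (cone z L)" using key cx_bd[OF V(1,2)] by blast
  moreover have "st V z (Pow V) = cone z (bd V)"
  proof (rule set_eqI)
   fix rh show "rh \<in> st V z (Pow V) \<longleftrightarrow> rh \<in> cone z (bd V)"
    using V(4) unfolding st_def cone_def bd_def by auto
  qed
  moreover have "smv {{}} (Pow V) (st V z (Pow V))" using V by (intro smvI cx_Pow) auto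
  ultimately have "seq {{}} (Pow V) (cone z L)" using seq_trans[OF seq1] by metis
  then show ?thesis unfolding bal_def using V by (intro exI[of _ V]) auto
 next
  assume "bal d L"
  then obtain V0 where V0: "finite V0" "V0 ~= {}" "int (card V0) = d + 1" "seq {{}} (Pow V0) L" by (auto simp: bal_def)
  from rename_apart[OF cL V0(1) _ zL] obtain p where p: "bij p" "im p L = L" "p ` V0 Int {z} = {}" by auto
  define V where "V = p ` V0"
  have V: "finite V" "V ~= {}" "int (card V) = d + 1" "z ~: V"
   unfolding V_def using V0(1-3) p(3) card_image[OF inj_on_subset[OF bij_is_inj[OF p(1)] subset_UNIV], of V0] by auto
  have "seq {{}} (Pow V) L" using seq_im[OF p(1) V0(4)] p(2) im_Pow[OF p(1)] by (simp add: V_def)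
  then have "seq {{}} (cone z (Pow V)) (cone z L)" using key[of "Pow V"] cx_Pow[OF V(1)] V(4) by simp
  moreover have "cone z (Pow V) = Pow (insert z V)" by (auto simp: cone_def)
  ultimately show ?thesis unfolding bal_def using V by (intro exI[of _ "insert z V"]) auto
 qed
qed

subsection \<open>Barycentric subdivision as an order complex\<close>

lemma lmv_smv: "lmv l \<pi> K K' ==> smv {{}} K K'"
 unfolding lmv_def smv_def by auto

lemma lmv_seq: "equivclp (lmv l \<pi>) K K' ==> seq {{}} K K'"
 by (erule equivclp_lift[where f = "%x. x"]) (rule r_into_equivclp, erule lmv_smv)

text \<open>Vertices are taken as pairs of a name and a label, so that every label has the infinite
  supply of vertices that \<open>alexander_trick\<close> asks for.\<close>

lemma infinite_snd: "infinite {w :: 'b::infinite \<times> 's. snd w = q}"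
proof -
 have "{w :: 'b \<times> 's. snd w = q} = (%b. (b, q)) ` UNIV" by auto
 moreover have "inj (%b :: 'b. (b, q))" by (simp add: inj_on_def)
 ultimately show ?thesis using finite_imageD[of "%b :: 'b. (b, q)" UNIV] infinite_UNIV by auto
qed

lemma im_Pair_ord:
 assumes "finite Q"
 shows "{rh. rh <= Pair b ` Q & chain_subset (snd ` rh)} = im (Pair b) (ord Q)"
proof (rule set_eqI, rule iffI)
 fix rh assume "rh \<in> {rh. rh <= Pair b ` Q & chain_subset (snd ` rh)}"
 then have r: "rh <= Pair b ` Q" "chain_subset (snd ` rh)" by simp_all
 have e: "rh = Pair b ` snd ` rh" using r(1) by force
 have "snd ` rh <= Q" using r(1) by auto
 then have "snd ` rh \<in> ord Q" using r(2) finite_subset[OF _ assms] by (simp add: ord_def)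
 then show "rh \<in> im (Pair b) (ord Q)" using e by (rule rev_image_eqI)
next
 fix rh assume "rh \<in> im (Pair b) (ord Q)"
 then obtain c where c: "c \<in> ord Q" "rh = Pair b ` c" by blast
 have "snd ` Pair b ` c = c" by (simp add: image_image)
 then show "rh \<in> {rh. rh <= Pair b ` Q & chain_subset (snd ` rh)}" using c by (auto simp: ord_def)
qed

text \<open>Alexander's trick with the label \<open>{v}\<close> at each vertex \<open>v\<close>: the
  cells are the simplexes of \<open>L\<close>, and coning all of them off is barycentric
  subdivision. A constant \<open>\<pi>\<close> serves, as no map is to be followed.\<close>

lemma sd_seq:
 fixes L :: "'v::infinite set set" and i :: "'v => 'b::infinite" and j :: "'v set => 'b"
 assumes L: "cx L" and i: "inj_on i (\<Union>L)" and j: "inj_on j (L - {{}})"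
 shows "seq {{}} (im i L) (im j (ord (L - {{}})))"
proof -
 define e where "e v = (v, {v})" for v :: 'v
 have ie: "inj_on e V" for V by (auto simp: e_def inj_on_def)
 have se: "\<Union>(snd ` e ` ka) = ka" for ka by (auto simp: e_def)
 have cK: "cx (im e L)" by (rule cx_im[OF L])
 have finQ: "finite (L - {{}})" using cx_finite[OF L] by simp
 from fresh_vertex[OF cx_finite_vertices[OF L]] obtain b where b: "b ~: \<Union>L" ..
 have "equivclp (lmv snd (%_. ())) (im e L) {rh. rh <= Pair b ` (L - {{}}) & chain_subset (snd ` rh)}"
 proof (rule alexander_trick[OF cK finQ])
  fix ka assume k: "ka \<in> im e L" "ka ~= {}"
  then obtain c where c: "c \<in> L" "ka = e ` c" by blast
  then show "\<Union>(snd ` ka) \<in> L - {{}} & (\<exists>x\<in>ka. () = ())" using k(2) se[of c] by auto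
 next
  fix q assume q: "q \<in> L - {{}}"
  have 1: "{ka \<in> im e L. \<Union>(snd ` ka) <= q} = Pow (e ` q)"
  proof (rule set_eqI, rule iffI)
   fix ka assume "ka \<in> {ka \<in> im e L. \<Union>(snd ` ka) <= q}"
   then obtain c where c: "ka = e ` c" "\<Union>(snd ` ka) <= q" by blast
   then show "ka \<in> Pow (e ` q)" using se[of c] by auto
  next
   fix ka assume "ka \<in> Pow (e ` q)"
   then obtain c where c: "c <= q" "ka = e ` c" by (auto simp: subset_image_iff)
   then show "ka \<in> {ka \<in> im e L. \<Union>(snd ` ka) <= q}" using se[of c] cx_sub[OF L, of q c] q by auto
  qed
  have 2: "{ka \<in> im e L. ka = {} \<or> \<Union>(snd ` ka) < q} = bd (e ` q)"
  proof (rule set_eqI)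
   fix ka
   show "ka \<in> {ka \<in> im e L. ka = {} \<or> \<Union>(snd ` ka) < q} \<longleftrightarrow> ka \<in> bd (e ` q)"
   proof (cases "ka \<in> Pow (e ` q)")
    case True
    then obtain c where c: "c <= q" "ka = e ` c" by (auto simp: subset_image_iff)
    have "e ` c = e ` q \<longleftrightarrow> c = q" using inj_image_eq_iff[of e c q] ie[of UNIV] by simp
    moreover have "ka \<in> im e L" using c cx_sub[OF L, of q c] q by auto
    moreover have "\<Union>(snd ` ka) = c" using se c(2) by simp
    moreover have "ka = {} \<longleftrightarrow> c = {}" using c(2) by simp
    ultimately show ?thesis using True c q by (auto simp: bd_def)
   next
    case False
    have "~ \<Union>(snd ` ka) <= q" if "ka \<in> im e L"
    proof
     assume "\<Union>(snd ` ka) <= q"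
     then have "ka \<in> {ka \<in> im e L. \<Union>(snd ` ka) <= q}" using that by simp
     then show False unfolding 1 using False by simp
    qed
    then show ?thesis using False by (auto simp: bd_def)
   qed
  qed
  have "finite (e ` q)" "e ` q ~= {}" using q cx_face_finite[OF L] by auto
  from bs_Pow[OF this] have "Gw (Pow (e ` q)) (bd (e ` q))" using bsD(1) by metis
  then show "Gw {ka \<in> im e L. \<Union>(snd ` ka) <= q} {ka \<in> im e L. ka = {} \<or> \<Union>(snd ` ka) < q}"
   unfolding 1 2 .
 next
  fix q :: "'v set" show "infinite {w :: 'v \<times> 'v set. snd w = q}" by (rule infinite_snd)
  show "snd (b, q) = q" by simp
  show "Pair b ` (L - {{}}) Int \<Union>(im e L) = {}" using b unfolding Union_im by (auto simp: e_def)
 qed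
 then have s: "seq {{}} (im e L) (im (Pair b) (ord (L - {{}})))"
  unfolding im_Pair_ord[OF finQ] by (rule lmv_seq)
 have "inj_on (i \<circ> fst) (\<Union>(im e L))" unfolding Union_im
  by (rule inj_on_imageI) (use i in \<open>simp add: comp_def e_def\<close>)
 moreover have "inj_on (j \<circ> snd) (\<Union>(im (Pair b) (ord (L - {{}}))))" unfolding Union_im ord_vertices
  by (rule inj_on_imageI) (use j in \<open>simp add: comp_def\<close>)
 ultimately have "seq {{}} (im (i \<circ> fst) (im e L)) (im (j \<circ> snd) (im (Pair b) (ord (L - {{}}))))"
  by (rule seq_transport[OF s cK])
 then show ?thesis unfolding im_comp by (simp add: comp_def e_def)
qed

lemma sph_bal_ord:
 fixes L :: "'v::infinite set set"
 assumes "cx L"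
 shows "sph d (ord (L - {{}})) \<longleftrightarrow> sph d L" "bal d (ord (L - {{}})) \<longleftrightarrow> bal d L"
proof -
 have i: "inj_on (%v. {v}) V" for V :: "'v set" by (simp add: inj_on_def)
 have "seq {{}} (im (%v. {v}) L) (im (%x. x) (ord (L - {{}})))"
  by (rule sd_seq[OF assms i inj_on_id2])
 then have "seq {{}} (im (%v. {v}) L) (ord (L - {{}}))" by simp
 from sph_seq[OF this] bal_seq[OF this] sph_im[OF assms i] bal_im[OF assms i]
 show "sph d (ord (L - {{}})) \<longleftrightarrow> sph d L" "bal d (ord (L - {{}})) \<longleftrightarrow> bal d L" by blast+
qed

lemma ord_shift:
 assumes "\<And>ta. ta \<in> P ==> ta Int rh = {}"
 shows "ord ((%ta. ta Un rh) ` P) = im (%ta. ta Un rh) (ord P)" "inj_on (%ta. ta Un rh) P"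
proof -
 let ?s = "%ta. ta Un rh"
 show inj: "inj_on ?s P" by (rule inj_on_inverseI[of _ "%ta. ta - rh"]) (use assms in blast)
 have sub: "?s x <= ?s y \<longleftrightarrow> x <= y" if "x \<in> P" "y \<in> P" for x y using assms[OF that(1)] assms[OF that(2)] by blast
 have ch: "chain_subset (?s ` c) \<longleftrightarrow> chain_subset c" if "c <= P" for c
  unfolding chain_subset_def using sub that by (auto simp: subset_iff)
 show "ord (?s ` P) = im ?s (ord P)"
 proof (rule set_eqI, rule iffI)
  fix C assume C: "C \<in> ord (?s ` P)"
  then obtain c where c: "c <= P" "C = ?s ` c" unfolding ord_def by (auto simp: subset_image_iff)
  have "finite c" using C c finite_imageD[of ?s c] inj_on_subset[OF inj c(1)] by (auto simp: ord_def)
  then have "c \<in> ord P" using C c ch[OF c(1)] by (simp add: ord_def)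
  then show "C \<in> im ?s (ord P)" using c(2) by (rule rev_image_eqI)
 next
  fix C assume "C \<in> im ?s (ord P)"
  then obtain c where c: "c \<in> ord P" "C = ?s ` c" by blast
  then show "C \<in> ord (?s ` P)" using ch[of c] by (auto simp: ord_def)
 qed
qed

text \<open>As an ordered set, the faces strictly above \<open>rh\<close> are the nonempty faces of
  its link.\<close>

lemma up_link:
 fixes K :: "'v::infinite set set"
 assumes K: "bs d K" "rh \<in> K"
 shows "sph (d - int (card rh)) (ord {ta \<in> K. rh < ta}) \<or> bal (d - int (card rh)) (ord {ta \<in> K. rh < ta})"
proof -
 note cK = bsD(4)[OF K(1)]
 let ?P = "lk rh K - {{}}" and ?s = "%ta. ta Un rh"
 have d: "ta Int rh = {}" if "ta \<in> ?P" for ta using that by (simp add: lk_def)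
 have e: "?s ` ?P = {ta \<in> K. rh < ta}"
 proof (rule set_eqI, rule iffI)
  fix ta assume "ta \<in> ?s ` ?P" then show "ta \<in> {ta \<in> K. rh < ta}" by (auto simp: lk_def)
 next
  fix ta assume t: "ta \<in> {ta \<in> K. rh < ta}"
  then have "ta = ?s (ta - rh)" by blast
  moreover from this t have "ta - rh \<in> ?P" by (auto simp: lk_def)
  ultimately show "ta \<in> ?s ` ?P" by (rule image_eqI)
 qed
 have f: "cx (ord ?P)" using cx_finite[OF cx_lk[OF cK K(2)]] by (intro cx_ord) simp
 have e2: "ord {ta \<in> K. rh < ta} = im ?s (ord ?P)" unfolding e[symmetric] by (rule ord_shift(1)[OF d])
 have i: "inj_on ?s (\<Union>(ord ?P))" unfolding ord_vertices by (rule ord_shift(2)[OF d])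
 have "sph (d - int (card rh)) (lk rh K) \<or> bal (d - int (card rh)) (lk rh K)" using bsD(2,3)[OF K(1)] K(2) by blast
 then show ?thesis
  using sph_bal_ord[OF cx_lk[OF cK K(2)]] sph_im[OF f i] bal_im[OF f i] unfolding e2 by blast
qed

lemma ord_cone:
 assumes "finite P" "\<And>ta. ta \<in> P ==> rh < ta"
 shows "ord (insert rh P) = cone rh (ord P)"
proof (rule set_eqI)
 fix c
 have n: "rh ~: P" using assms(2) by blast
 have "c \<in> ord (insert rh P) \<longleftrightarrow> c - {rh} \<in> ord P"
 proof (cases "rh \<in> c")
  case True
  then have c: "c = insert rh (c - {rh})" by blast
  have "c - {rh} \<in> ord (insert rh P) \<longleftrightarrow> c - {rh} \<in> ord P" by (auto simp: ord_def)
  moreover have "\<forall>x\<in>c - {rh}. x <= rh \<or> rh <= x" if "c - {rh} \<in> ord P" using that assms(2) by (auto simp: ord_def)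
  ultimately show ?thesis using ord_insert[of rh "c - {rh}" "insert rh P"] c by auto
 next
  case False
  then show ?thesis by (auto simp: ord_def)
 qed
 then show "c \<in> ord (insert rh P) \<longleftrightarrow> c \<in> cone rh (ord P)" by (simp add: cone_def)
qed

lemma up_ball:
 fixes K :: "'v::infinite set set"
 assumes K: "bs d K" "rh \<in> K"
 shows "bal (d - int (card rh) + 1) (ord {ta \<in> K. rh <= ta})"
proof -
 let ?P = "{ta \<in> K. rh < ta}"
 have "insert rh ?P = {ta \<in> K. rh <= ta}" using K(2) by blast
 moreover have "finite ?P" using cx_finite[OF bsD(4)[OF K(1)]] by simp
 then have "ord (insert rh ?P) = cone rh (ord ?P)" by (rule ord_cone) blast
 ultimately have "ord {ta \<in> K. rh <= ta} = cone rh (ord ?P)" by simp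
 then show ?thesis using bal_cone[OF up_link[OF K]] by simp
qed

subsection \<open>Stratified simplexes and cellular maps\<close>

text \<open>The counterpart of \<open>stellar_simplex\<close> for complexes with the empty face (see
  \<open>stellar_SS\<close>); indices outside \<open>{0..n}\<close> are left unconstrained.\<close>

definition SS :: "nat => (nat set => 'v set set) => bool" where
 "SS n A \<longleftrightarrow> A {} = {{}} &
  (\<forall>X\<subseteq>{0..n}. X ~= {} --> bal (int (card X) - 1) (A X) & mb (A X) = (\<Union>Z\<in>{Z. Z < X}. A Z)) &
  (\<forall>X Y. X <= {0..n} --> Y <= {0..n} --> A (X Int Y) = A X Int A Y)"

text \<open>Cellularity on every stratum. Dual cells appear as order complexes of sets of faces,
  which permits source and target of different vertex types.\<close>

definition cel :: "nat => (nat set => 'v set set) => (nat set => 'w set set) => ('v => 'w) => bool" where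
 "cel n A B g \<longleftrightarrow> SS n A & SS n B & (\<forall>X\<subseteq>{0..n}. im g (A X) = B X) &
  (\<forall>X\<subseteq>{0..n}. X ~= {} --> (\<forall>rh\<in>B X. rh ~= {} --> (\<exists>e. bal e (ord {ta \<in> A X. rh <= g ` ta}))))"

lemma SS_mono: assumes "SS n A" "X <= Y" "Y <= {0..n}" shows "A X <= A Y"
proof -
 have "X <= {0..n}" "X Int Y = X" using assms by blast+
 then have "A X = A X Int A Y" using assms(1,3) unfolding SS_def by metis
 then show ?thesis by blast
qed

lemma SS_bal: "SS n A ==> X <= {0..n} ==> X ~= {} ==> bal (int (card X) - 1) (A X)"
 by (simp add: SS_def)

lemma SS_mb: "SS n A ==> X <= {0..n} ==> X ~= {} ==> mb (A X) = (\<Union>Z\<in>{Z. Z < X}. A Z)"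
 by (simp add: SS_def)

lemma SS_Int: "SS n A ==> X <= {0..n} ==> Y <= {0..n} ==> A (X Int Y) = A X Int A Y"
 unfolding SS_def by (elim conjE) simp

lemma SS_empty: "SS n A ==> A {} = {{}}"
 by (simp add: SS_def)

lemma SS_cx: assumes "SS n A" "X <= {0..n}" shows "cx (A X)"
 using assms bal_cx[OF SS_bal[OF assms]] SS_empty[OF assms(1)] by (cases "X = {}") (auto simp: cx_def)

text \<open>The smallest stratum that contains \<open>ta\<close>; the intersection property of the
  family makes it one of the strata that do.\<close>

definition lab :: "nat => (nat set => 'v set set) => 'v set => nat set" where
 "lab n A ta = \<Inter>{Z. Z <= {0..n} & ta \<in> A Z}"

lemma lab_in:
 assumes "SS n A" "ta \<in> A {0..n}"
 shows "lab n A ta <= {0..n}" "ta \<in> A (lab n A ta)"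
proof -
 let ?Z = "{Z. Z <= {0..n} & ta \<in> A Z}"
 have fin: "finite ?Z" by (rule finite_subset[of _ "Pow {0..n}"]) auto
 have "\<Inter>F \<in> ?Z" if "finite F" "F ~= {}" "F <= ?Z" for F
  using that
 proof (induction rule: finite_ne_induct)
  case (insert x F)
  then have "x \<in> ?Z" "\<Inter>F \<in> ?Z" by simp_all
  then show ?case using SS_Int[OF assms(1), of x "\<Inter>F"] by auto
 qed simp
 moreover have "?Z ~= {}" using assms(2) by blast
 ultimately have "lab n A ta \<in> ?Z" unfolding lab_def using fin by blast
 then show "lab n A ta <= {0..n}" "ta \<in> A (lab n A ta)" by simp_all
qed

lemma lab_iff:
 assumes "SS n A" "ta \<in> A {0..n}" "Z <= {0..n}"
 shows "ta \<in> A Z \<longleftrightarrow> lab n A ta <= Z"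
proof
 assume "ta \<in> A Z" then show "lab n A ta <= Z" using assms(3) by (auto simp: lab_def)
next
 assume "lab n A ta <= Z"
 then show "ta \<in> A Z" using lab_in(2)[OF assms(1,2)] SS_mono[OF assms(1) _ assms(3)] by blast
qed

lemma lab_mono:
 assumes "SS n A" "ta' \<in> A {0..n}" "ta <= ta'"
 shows "lab n A ta <= lab n A ta'"
proof -
 have "ta \<in> A (lab n A ta')" using cx_sub[OF SS_cx[OF assms(1) lab_in(1)[OF assms(1,2)]] lab_in(2)[OF assms(1,2)] assms(3)] .
 then show ?thesis using lab_in(1)[OF assms(1,2)] by (auto simp: lab_def)
qed

lemma lab_ne:
 assumes "SS n A" "ta \<in> A {0..n}" "ta ~= {}"
 shows "lab n A ta ~= {}"
 using lab_in(2)[OF assms(1,2)] SS_empty[OF assms(1)] assms(3) by auto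

lemma SS_mb_iff:
 assumes "SS n A" "Z <= {0..n}" "Z ~= {}" "ta \<in> A Z"
 shows "ta \<in> mb (A Z) \<longleftrightarrow> lab n A ta ~= Z"
proof -
 have t: "ta \<in> A {0..n}" using SS_mono[OF assms(1,2)] assms(4) by blast
 have lZ: "lab n A ta <= Z" using lab_iff[OF assms(1) t assms(2)] assms(4) by simp
 show ?thesis
 proof
  assume "ta \<in> mb (A Z)"
  then obtain Z' where z: "Z' < Z" "ta \<in> A Z'" using SS_mb[OF assms(1-3)] by blast
  then have "lab n A ta <= Z'" using lab_iff[OF assms(1) t, of Z'] assms(2) by blast
  then show "lab n A ta ~= Z" using z(1) by blast
 next
  assume "lab n A ta ~= Z"
  then have "lab n A ta < Z" using lZ by blast
  then show "ta \<in> mb (A Z)" using SS_mb[OF assms(1-3)] lab_in(2)[OF assms(1) t] by blast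
 qed
qed

text \<open>Complementing the face reverses its inclusions: a larger label means a larger stratum
  and a smaller face, and a union of labels unites strata and intersects faces. This is the order in
  which dual cells contain one another.\<close>

definition enc :: "nat set => 'n set => (nat + 'n) set" where
 "enc Z rh = Inl ` Z Un Inr ` (- rh)"

definition dec :: "(nat + 'n) set => 'n set" where
 "dec s = {y. Inr y ~: s}"

lemma enc_sub: "enc Z rh <= enc Z' rh' \<longleftrightarrow> Z <= Z' & rh' <= rh"
 by (auto simp: enc_def)

lemma enc_eq: "enc Z rh = enc Z' rh' \<longleftrightarrow> Z = Z' & rh = rh'"
 using enc_sub[of Z rh Z' rh'] enc_sub[of Z' rh' Z rh] by blast

lemma dec_enc [simp]: "dec (enc Z rh) = rh"
 by (auto simp: enc_def dec_def)

lemma UN_enc: "c ~= {} ==> (\<Union>ta\<in>c. enc (F ta) (G ta)) = enc (\<Union>ta\<in>c. F ta) (\<Inter>ta\<in>c. G ta)"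
 by (auto simp: enc_def)

text \<open>A face becomes a vertex with name \<open>i ta\<close>; the label records its stratum and
  its image.\<close>

definition embd :: "nat => (nat set => 'm set set) => ('m => 'n) => ('m set => 'b) => 'm set => 'b \<times> (nat + 'n) set" where
 "embd n A g i ta = (i ta, enc (lab n A ta) (g ` ta))"

lemma embd_chain:
 assumes A: "SS n A" "c <= A {0..n}" and c: "finite c" "chain_subset c" "c ~= {}"
 shows "\<Union>(snd ` embd n A g i ` c) = enc (lab n A (\<Union>c)) (g ` \<Inter>c)"
proof -
 note ends = chain_ends[OF c(1,3,2)]
 have "\<Union>(snd ` embd n A g i ` c) = enc (\<Union>ta\<in>c. lab n A ta) (\<Inter>ta\<in>c. g ` ta)"
  unfolding image_image embd_def snd_conv by (rule UN_enc[OF c(3)])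
 moreover have "(\<Union>ta\<in>c. lab n A ta) = lab n A (\<Union>c)"
 proof
  have "lab n A ta <= lab n A (\<Union>c)" if "ta \<in> c" for ta
   using lab_mono[OF A(1), of "\<Union>c" ta] ends(1) A(2) that by blast
  then show "(\<Union>ta\<in>c. lab n A ta) <= lab n A (\<Union>c)" by blast
  show "lab n A (\<Union>c) <= (\<Union>ta\<in>c. lab n A ta)" using ends(1) by blast
 qed
 moreover have "(\<Inter>ta\<in>c. g ` ta) = g ` \<Inter>c"
 proof
  show "(\<Inter>ta\<in>c. g ` ta) <= g ` \<Inter>c" using ends(2) by blast
  show "g ` \<Inter>c <= (\<Inter>ta\<in>c. g ` ta)" by blast
 qed
 ultimately show ?thesis by simp
qed

text \<open>The cell of \<open>enc Z rh\<close> is the order complex of the faces of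
  \<open>A Z\<close> whose image contains \<open>rh\<close>, a ball by assumption. By
  \<open>dual_cell_boundary\<close> its boundary consists of the chains with smaller label. So
  Alexander's trick applies, and its outcome depends on \<open>A\<close> and \<open>g\<close> no
  longer.\<close>

theorem cells_to_labels:
 fixes A :: "nat set => 'm::infinite set set" and B :: "nat set => 'n set set" and i :: "'m set => 'b::infinite"
 defines "Q \<equiv> %X U. {enc Z rh | Z rh. Z <= X & Z ~= {} & rh \<in> U & rh \<in> B Z}"
 assumes A: "SS n A" and X: "X <= {0..n}" and U: "{} ~: U" "\<And>rh rh'. rh \<in> U ==> rh' \<in> B X ==> rh <= rh' ==> rh' \<in> U"
  and g: "\<And>Z. Z <= X ==> im g (A Z) = B Z"
  and cells: "\<And>Z rh. Z <= X ==> Z ~= {} ==> rh \<in> U ==> rh \<in> B Z ==> \<exists>e. bal e (ord {ta \<in> A Z. rh <= g ` ta})"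
  and i: "inj_on i {ta \<in> A X. g ` ta \<in> U}" "b ~: i ` {ta \<in> A X. g ` ta \<in> U}"
 shows "equivclp (lmv snd dec) (im (embd n A g i) (ord {ta \<in> A X. g ` ta \<in> U})) (im (Pair b) (ord (Q X U)))"
proof -
 define P where "P = {ta \<in> A X. g ` ta \<in> U}"
 define e where "e = embd n A g i"
 let ?Q = "Q X U"
 have Xn: "Z <= {0..n}" if "Z <= X" for Z using that X by blast
 have finA: "finite (A X)" using cx_finite[OF SS_cx[OF A X]] .
 have finP: "finite P" using finA by (simp add: P_def)
 have PA: "ta \<in> A X" "g ` ta \<in> U" "ta ~= {}" "ta \<in> A {0..n}" if "ta \<in> P" for ta
  using that U(1) SS_mono[OF A X] unfolding P_def by auto
 have finQ: "finite ?Q"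
 proof (rule finite_subset)
  show "?Q <= (%(Z, rh). enc Z rh) ` (Pow X \<times> B X)"
  proof
   fix q assume "q \<in> ?Q"
   then obtain Z rh where q: "q = enc Z rh" "Z <= X" "rh \<in> B Z" unfolding Q_def by blast
   have "B Z <= B X" unfolding g[OF q(2), symmetric] g[OF subset_refl, symmetric]
    by (rule image_mono[OF SS_mono[OF A q(2) X]])
   then have "rh \<in> B X" using q(3) by blast
   then show "q \<in> (%(Z, rh). enc Z rh) ` (Pow X \<times> B X)" using q(1,2) by force
  qed
  have "finite (B X)" using finA g[of X] by (metis finite_imageI subset_refl)
  moreover have "finite X" using X finite_subset by blast
  ultimately show "finite ((%(Z, rh). enc Z rh) ` (Pow X \<times> B X))" by simp
 qed
 have inj: "inj_on e P" using i(1) unfolding P_def e_def embd_def by (auto simp: inj_on_def)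
 have cP: "cx (ord P)" by (rule cx_ord[OF finP])
 have cK: "cx (im e (ord P))" by (rule cx_im[OF cP])
 have fc: "\<Union>(snd ` e ` c) = enc (lab n A (\<Union>c)) (g ` \<Inter>c)" if "c \<in> ord P" "c ~= {}" for c
  unfolding e_def by (rule embd_chain[OF A]) (use that PA in \<open>auto simp: ord_def\<close>)
 have main: "equivclp (lmv snd dec) (im e (ord P)) {rh. rh <= Pair b ` ?Q & chain_subset (snd ` rh)}"
 proof (rule alexander_trick[OF cK finQ])
  fix ka assume k: "ka \<in> im e (ord P)" "ka ~= {}"
  then obtain c where c: "c \<in> ord P" "ka = e ` c" "c ~= {}" by blast
  note ends = ord_ends[OF c(1,3)]
  have cP: "c <= P" using c(1) by (simp add: ord_def)
  have f: "\<Union>(snd ` ka) = enc (lab n A (\<Union>c)) (g ` \<Inter>c)" using fc[OF c(1,3)] c(2) by simp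
  have tP: "\<Union>c \<in> P" "\<Inter>c \<in> P" using ends cP by blast+
  have l: "lab n A (\<Union>c) <= X" using lab_iff[OF A PA(4)[OF tP(1)] X] PA(1)[OF tP(1)] by simp
  have "\<Inter>c <= \<Union>c" using c(3) by blast
  then have "\<Inter>c \<in> A (lab n A (\<Union>c))"
   using lab_in[OF A PA(4)[OF tP(1)]] cx_sub[OF SS_cx[OF A]] by blast
  then have "g ` \<Inter>c \<in> B (lab n A (\<Union>c))" using g[OF l] by blast
  then have "enc (lab n A (\<Union>c)) (g ` \<Inter>c) \<in> ?Q"
   unfolding Q_def using l lab_ne[OF A PA(4,3)[OF tP(1)]] PA(2)[OF tP(2)] by blast
  \<comment> \<open>The least member of a chain determines the image part of the label of the chain,
    so it is the vertex with the same target face.\<close>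
  moreover have "e (\<Inter>c) \<in> ka" "dec (snd (e (\<Inter>c))) = g ` \<Inter>c" using ends(2) c(2) by (auto simp: e_def embd_def)
  ultimately show "\<Union>(snd ` ka) \<in> ?Q & (\<exists>x\<in>ka. dec (snd x) = dec (\<Union>(snd ` ka)))" unfolding f by auto
 next
  fix q assume "q \<in> ?Q"
  then obtain Z rh where q: "q = enc Z rh" and Z: "Z <= X" "Z ~= {}" and r: "rh \<in> U" "rh \<in> B Z" unfolding Q_def by blast
  define PZ where "PZ = {ta \<in> A Z. rh <= g ` ta}"
  have PZP: "PZ <= P"
  proof
   fix ta assume t: "ta \<in> PZ"
   then have "ta \<in> A X" using SS_mono[OF A Z(1) X] unfolding PZ_def by blast
   moreover from this have "g ` ta \<in> B X" using g[of X] by blast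
   ultimately show "ta \<in> P" using U(2)[OF r(1)] t unfolding PZ_def P_def by blast
  qed
  have oPZ: "c \<in> ord P" if "c \<in> ord PZ" for c using that PZP by (auto simp: ord_def)
  have PZn: "ta \<in> A {0..n}" if "ta \<in> PZ" for ta using PA(4) PZP that by blast
  have 1: "{ka \<in> im e (ord P). \<Union>(snd ` ka) <= q} = im e (ord PZ)"
  proof (rule set_eqI, rule iffI)
   fix ka assume "ka \<in> {ka \<in> im e (ord P). \<Union>(snd ` ka) <= q}"
   then obtain c where c: "c \<in> ord P" "ka = e ` c" "\<Union>(snd ` e ` c) <= q" by blast
   have cP: "c <= P" using c(1) by (simp add: ord_def)
   have "ta \<in> PZ" if t: "ta \<in> c" for ta
   proof -
    have ne: "c ~= {}" using t by blast
    have l: "lab n A (\<Union>c) <= Z" "rh <= g ` \<Inter>c" using c(3) fc[OF c(1) ne] q by (simp_all add: enc_sub)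
    have top: "\<Union>c \<in> A {0..n}" using PA(4) cP ord_ends(1)[OF c(1) ne] by blast
    have "ta <= \<Union>c" using t by blast
    then have "lab n A ta <= Z" using lab_mono[OF A top] l(1) by blast
    moreover have "ta \<in> A {0..n}" using PA(4) cP t by blast
    ultimately have "ta \<in> A Z" using lab_iff[OF A _ Xn[OF Z(1)]] by blast
    moreover have "rh <= g ` ta" using l(2) t by blast
    ultimately show ?thesis unfolding PZ_def by blast
   qed
   then have "c \<in> ord PZ" using c(1) by (auto simp: ord_def)
   then show "ka \<in> im e (ord PZ)" using c(2) by (rule rev_image_eqI)
  next
   fix ka assume "ka \<in> im e (ord PZ)"
   then obtain c where c: "c \<in> ord PZ" "ka = e ` c" by blast
   have "\<Union>(snd ` e ` c) <= q"
   proof (cases "c = {}")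
    case False
    note ends = ord_ends[OF c(1) False]
    have "\<Union>c \<in> PZ" "\<Inter>c \<in> PZ" using ends c(1) by (auto simp: ord_def)
    then have "lab n A (\<Union>c) <= Z" "rh <= g ` \<Inter>c"
     using lab_iff[OF A PZn Xn[OF Z(1)]] unfolding PZ_def by blast+
    then show ?thesis using fc[OF oPZ[OF c(1)] False] q by (simp add: enc_sub)
   qed simp
   then show "ka \<in> {ka \<in> im e (ord P). \<Union>(snd ` ka) <= q}" using oPZ[OF c(1)] c(2) by blast
  qed
  obtain d where d: "bal d (ord PZ)" using cells[OF Z r] unfolding PZ_def by blast
  have rne: "rh ~= {}" using U(1) r(1) by blast
  have bA: "bs (int (card Z) - 1) (A Z)" using bal_bs[OF SS_bal[OF A Xn[OF Z(1)] Z(2)]] .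
  have mbD: "mb (ord PZ) = {c \<in> ord PZ. (\<forall>ta\<in>c. ta \<in> mb (A Z)) \<or> (\<forall>ta\<in>c. g ` ta ~= rh)}"
   using dual_cell_boundary[OF bA _ rne, of d g] bal_bs[OF d] unfolding PZ_def by blast
  have mbc: "c \<in> mb (ord PZ) \<longleftrightarrow> \<Union>(snd ` e ` c) ~= q" if c: "c \<in> ord PZ" "c ~= {}" for c
  proof -
   note ends = ord_ends[OF c]
   have cZ: "c <= PZ" using c(1) by (auto simp: ord_def)
   have tZ: "\<Union>c \<in> A Z" "rh <= g ` \<Inter>c" using ends cZ unfolding PZ_def by blast+
   have "(\<forall>ta\<in>c. ta \<in> mb (A Z)) \<longleftrightarrow> \<Union>c \<in> mb (A Z)"
   proof
    assume "\<Union>c \<in> mb (A Z)"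
    then show "\<forall>ta\<in>c. ta \<in> mb (A Z)" using cx_sub[OF bsD(5)[OF bA]] by blast
   qed (use ends(1) in blast)
   also have "\<dots> \<longleftrightarrow> lab n A (\<Union>c) ~= Z" using SS_mb_iff[OF A Xn[OF Z(1)] Z(2) tZ(1)] .
   finally have 1: "(\<forall>ta\<in>c. ta \<in> mb (A Z)) \<longleftrightarrow> lab n A (\<Union>c) ~= Z" .
   have 2: "(\<forall>ta\<in>c. g ` ta ~= rh) \<longleftrightarrow> g ` \<Inter>c ~= rh"
   proof
    assume n: "g ` \<Inter>c ~= rh"
    show "\<forall>ta\<in>c. g ` ta ~= rh"
    proof
     fix ta assume "ta \<in> c"
     then have "g ` \<Inter>c <= g ` ta" by blast
     then show "g ` ta ~= rh" using n tZ(2) by blast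
    qed
   qed (use ends(2) in blast)
   show ?thesis unfolding mbD fc[OF oPZ[OF c(1)] c(2)] q enc_eq using 1 2 c(1) by blast
  qed
  have 2: "{ka \<in> im e (ord P). ka = {} \<or> \<Union>(snd ` ka) < q} = im e (mb (ord PZ))"
  proof (rule set_eqI, rule iffI)
   fix ka assume k: "ka \<in> {ka \<in> im e (ord P). ka = {} \<or> \<Union>(snd ` ka) < q}"
   show "ka \<in> im e (mb (ord PZ))"
   proof (cases "ka = {}")
    case True
    then show ?thesis using cx_empty[OF bsD(5)[OF bal_bs[OF d]]] by force
   next
    case False
    have k1: "ka \<in> im e (ord P)" "\<Union>(snd ` ka) < q" using k False by simp_all
    then have "ka \<in> {ka \<in> im e (ord P). \<Union>(snd ` ka) <= q}" by (simp add: psubset_imp_subset)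
    then have "ka \<in> im e (ord PZ)" "\<Union>(snd ` ka) ~= q" unfolding 1 using k1(2) by simp_all
    then obtain c where "c \<in> ord PZ" "ka = e ` c" by blast
    then show ?thesis using mbc[of c] False \<open>\<Union>(snd ` ka) ~= q\<close> by blast
   qed
  next
   fix ka assume "ka \<in> im e (mb (ord PZ))"
   then obtain c where c: "c \<in> mb (ord PZ)" "ka = e ` c" by blast
   have cD: "c \<in> ord PZ" using c(1) unfolding mbD by blast
   have "ka \<in> {ka \<in> im e (ord P). \<Union>(snd ` ka) <= q}" unfolding 1 using c(2) cD by simp
   then have "ka \<in> im e (ord P)" "\<Union>(snd ` ka) <= q" by simp_all
   then show "ka \<in> {ka \<in> im e (ord P). ka = {} \<or> \<Union>(snd ` ka) < q}" using mbc[OF cD] c by (cases "c = {}") auto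
  qed
  have ci: "cx (ord PZ)" "inj_on e (\<Union>(ord PZ))"
   using bal_cx[OF d] inj_on_subset[OF inj PZP] by simp_all
  have "bal d (im e (ord PZ))" using bal_im[OF ci] d by simp
  from bsD(1)[OF bal_bs[OF this]] have "Gw (im e (ord PZ)) (im e (mb (ord PZ)))" unfolding mb_im[OF ci] .
  then show "Gw {ka \<in> im e (ord P). \<Union>(snd ` ka) <= q} {ka \<in> im e (ord P). ka = {} \<or> \<Union>(snd ` ka) < q}"
   unfolding 1 2 .
 next
  fix q :: "(nat + 'n) set" show "infinite {w :: 'b \<times> (nat + 'n) set. snd w = q}" by (rule infinite_snd)
  show "snd (b, q) = q" by simp
  show "Pair b ` ?Q Int \<Union>(im e (ord P)) = {}" using i(2) unfolding Union_im ord_vertices P_def e_def embd_def by auto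
 qed
 then show ?thesis unfolding im_Pair_ord[OF finQ] P_def e_def .
qed

lemma id_cell:
 fixes B :: "nat set => 'n::infinite set set"
 assumes "SS n B" "Z <= {0..n}" "Z ~= {}" "rh \<in> B Z"
 shows "\<exists>e. bal e (ord {ta \<in> B Z. rh <= (%x. x) ` ta})"
 using up_ball[OF bal_bs[OF SS_bal[OF assms(1-3)]] assms(4)] by auto

text \<open>The map \<open>g\<close> and the identity of \<open>B\<close> lead to the same complex
  of labels; one of the two paths is reversed.\<close>

theorem upper_path:
 fixes A :: "nat set => 'm::infinite set set" and B :: "nat set => 'n::infinite set set"
  and i :: "'m set => 'b::infinite" and j :: "'n set => 'b"
 assumes A: "SS n A" "SS n B" and X: "X <= {0..n}" and U: "U <= B X" "{} ~: U" "\<And>rh rh'. rh \<in> U ==> rh' \<in> B X ==> rh <= rh' ==> rh' \<in> U"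
  and g: "\<And>Z. Z <= X ==> im g (A Z) = B Z"
  and cells: "\<And>Z rh. Z <= X ==> Z ~= {} ==> rh \<in> U ==> rh \<in> B Z ==> \<exists>e. bal e (ord {ta \<in> A Z. rh <= g ` ta})"
  and i: "inj_on i {ta \<in> A X. g ` ta \<in> U}" and j: "inj_on j U"
 shows "equivclp (lmv snd dec) (im (embd n B (%x. x) j) (ord U)) (im (embd n A g i) (ord {ta \<in> A X. g ` ta \<in> U}))"
proof -
 let ?P = "{ta \<in> A X. g ` ta \<in> U}"
 have "finite ?P" "finite U"
  using cx_finite[OF SS_cx[OF A(1) X]] cx_finite[OF SS_cx[OF A(2) X]] finite_subset[OF U(1)] by auto
 then have "finite (i ` ?P Un j ` U)" by simp
 from fresh_vertex[OF this] obtain b where b: "b ~: i ` ?P Un j ` U" ..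
 have e: "{ta \<in> B X. (%x. x) ` ta \<in> U} = U" using U(1) by auto
 let ?Q = "{enc Z rh | Z rh. Z <= X & Z ~= {} & rh \<in> U & rh \<in> B Z}"
 have 1: "equivclp (lmv snd dec) (im (embd n A g i) (ord ?P)) (im (Pair b) (ord ?Q))"
  using cells_to_labels[of n A X U B g i b] A(1) X U(2,3) g cells i b by auto
 have "equivclp (lmv snd dec) (im (embd n B (%x. x) j) (ord {ta \<in> B X. (%x. x) ` ta \<in> U})) (im (Pair b) (ord ?Q))"
 proof (rule cells_to_labels[of n B X U B "%x. x" j b])
  show "SS n B" "X <= {0..n}" "{} ~: U" by fact+
  show "im (%x. x) (B Z) = B Z" for Z by simp
  show "inj_on j {ta \<in> B X. (%x. x) ` ta \<in> U}" "b ~: j ` {ta \<in> B X. (%x. x) ` ta \<in> U}" unfolding e using j b by auto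
  show "\<exists>e. bal e (ord {ta \<in> B Z. rh <= (%x. x) ` ta})" if "Z <= X" "Z ~= {}" "rh \<in> U" "rh \<in> B Z" for Z rh
   using id_cell[OF A(2)] that X by blast
 qed (use U(3) in blast)
 then show ?thesis unfolding e using equivclp_trans[OF _ equivclp_sym[OF 1]] by blast
qed

lemma upper_seq:
 fixes A :: "nat set => 'm::infinite set set" and B :: "nat set => 'n::infinite set set"
  and i :: "'m set => 'b::infinite" and j :: "'n set => 'b"
 assumes A: "SS n A" "SS n B" and X: "X <= {0..n}" and U: "U <= B X" "{} ~: U" "\<And>rh rh'. rh \<in> U ==> rh' \<in> B X ==> rh <= rh' ==> rh' \<in> U"
  and g: "\<And>Z. Z <= X ==> im g (A Z) = B Z"
  and cells: "\<And>Z rh. Z <= X ==> Z ~= {} ==> rh \<in> U ==> rh \<in> B Z ==> \<exists>e. bal e (ord {ta \<in> A Z. rh <= g ` ta})"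
  and i: "inj_on i {ta \<in> A X. g ` ta \<in> U}" and j: "inj_on j U"
 shows "seq {{}} (im j (ord U)) (im i (ord {ta \<in> A X. g ` ta \<in> U}))"
proof -
 let ?P = "{ta \<in> A X. g ` ta \<in> U}"
 have s: "seq {{}} (im (embd n B (%x. x) j) (ord U)) (im (embd n A g i) (ord ?P))"
  using upper_path[OF A X U g cells i j] by (intro lmv_seq) auto
 have "finite U" using cx_finite[OF SS_cx[OF A(2) X]] finite_subset[OF U(1)] by auto
 then have c: "cx (im (embd n B (%x. x) j) (ord U))" by (intro cx_im cx_ord)
 have "inj_on fst (\<Union>(im (embd n B (%x. x) j) (ord U)))" "inj_on fst (\<Union>(im (embd n A g i) (ord ?P)))"
  unfolding Union_im ord_vertices
  by (rule inj_on_imageI; use i j in \<open>simp add: comp_def embd_def\<close>)+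
 from seq_transport[OF s c this] show ?thesis unfolding im_comp by (simp add: comp_def embd_def)
qed

subsection \<open>Complements of open vertex stars\<close>

text \<open>The links are joins of a fixed complex with a simplex and with its boundary, so
  \<open>wc_Pow\<close> and \<open>wc_jn\<close> apply.\<close>

lemma Gw_join:
 fixes L :: "'v::infinite set set"
 assumes L: "cx L" and X: "finite X" "X ~= {}" "X Int \<Union>L = {}"
 shows "Gw {rh. rh - X \<in> L} {rh. rh - X \<in> L & ~ X <= rh}"
proof -
 have cH: "cx {rh. rh - X \<in> L}"
 proof (rule cxI[of "X Un \<Union>L"])
  show "finite (X Un \<Union>L)" using X(1) cx_finite_vertices[OF L] by simp
  show "ta \<in> {rh. rh - X \<in> L}" if "si \<in> {rh. rh - X \<in> L}" "ta <= si" for si ta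
   using cx_sub[OF L, of "si - X" "ta - X"] that by blast
 qed (use L in auto)
 have "cx ({rh. rh - X \<in> L} Int {rh. ~ X <= rh})" using X(2) by (intro cx_Int[OF cH]) (auto simp: dn_def)
 moreover have "{rh. rh - X \<in> L} Int {rh. ~ X <= rh} = {rh. rh - X \<in> L & ~ X <= rh}" by blast
 ultimately have cE: "cx {rh. rh - X \<in> L & ~ X <= rh}" by simp
 have "wc (lk A {rh. rh - X \<in> L}) (lk A {rh. rh - X \<in> L & ~ X <= rh})" if A: "A - X \<in> L" "~ X <= A" for A
 proof -
  define L' where "L' = lk (A - X) L"
  define X' where "X' = X - A"
  have cL': "cx L'" unfolding L'_def by (rule cx_lk[OF L A(1)])
  have UL: "\<Union>L' <= \<Union>L" unfolding L'_def lk_def by blast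
  have d: "\<Union>L' Int X = {}" using UL X(3) by blast
  have X': "finite X'" "X' ~= {}" "X' <= X" using X(1) A(2) unfolding X'_def by auto
  have mem: "rh \<in> lk A {rh. rh - X \<in> L} \<longleftrightarrow> rh - X \<in> L' & rh Int X <= X'" for rh
  proof -
   have "(rh Un A) - X = (rh - X) Un (A - X)" by blast
   then show ?thesis unfolding lk_def L'_def X'_def by auto
  qed
  have jm: "rh \<in> jn L' Y \<longleftrightarrow> rh - X \<in> L' & rh Int X \<in> Y" if Y: "Y <= Pow X'" for rh Y
  proof
   assume r: "rh \<in> jn L' Y"
   then have r': "rh Int \<Union>L' \<in> L'" "rh - \<Union>L' \<in> Y" unfolding jn_def by blast+
   have "rh - X = rh Int \<Union>L'" "rh Int X = rh - \<Union>L'" using r'(2) Y X'(3) d by blast+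
   then show "rh - X \<in> L' & rh Int X \<in> Y" using r' by simp
  next
   assume r: "rh - X \<in> L' & rh Int X \<in> Y"
   then have "rh - X <= \<Union>L'" by blast
   then have "rh - X = rh Int \<Union>L'" "rh Int X = rh - \<Union>L'" using d by blast+
   then show "rh \<in> jn L' Y" using r unfolding jn_def by simp
  qed
  have bP: "bd X' <= Pow X'" by (auto simp: bd_def)
  have 1: "lk A {rh. rh - X \<in> L} = jn L' (Pow X')"
   by (rule set_eqI) (simp add: mem jm[OF subset_refl])
  have 2: "lk A {rh. rh - X \<in> L & ~ X <= rh} = jn L' (bd X')"
  proof (rule set_eqI)
   fix rh
   have "rh \<in> lk A {rh. rh - X \<in> L & ~ X <= rh} \<longleftrightarrow> rh \<in> lk A {rh. rh - X \<in> L} & ~ X <= rh Un A" unfolding lk_def by blast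
   moreover have "~ X <= rh Un A \<longleftrightarrow> rh Int X ~= X'" if "rh Int X <= X'" using that unfolding X'_def by blast
   ultimately show "rh \<in> lk A {rh. rh - X \<in> L & ~ X <= rh} \<longleftrightarrow> rh \<in> jn L' (bd X')"
    unfolding mem jm[OF bP] by (auto simp: bd_def)
  qed
  have "\<Union>L' Int \<Union>(Pow X') = {}" using d X'(3) by auto
  then show ?thesis unfolding 1 2
   by (intro wc_jn wc_Pow cx_Pow cx_bd bP X'(1,2) cL')
 qed
 then show ?thesis unfolding Gw_def using cH cE by blast
qed

lemma Gw_off_seq: "seq E K K' ==> dn E ==> Gw K E \<longleftrightarrow> Gw K' E"
proof (induction rule: equivclp_induct)
 case (step y z)
 then show ?case using Gw_off[of E y z] Gw_off[of E z y] by blast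
qed simp

text \<open>As in \<open>wc_st_fwd\<close>, re-coning shows that \<open>K\<close> with the block and
  the starred \<open>K\<close> differ by moves off the new boundary; \<open>Gw_st\<close> treats the
  latter.\<close>

lemma Gw_add_cone:
 fixes K :: "'v::infinite set set"
 assumes g: "Gw K E" and B: "B \<in> E" "B ~= {}" "a ~: \<Union>K"
 shows "Gw (K Un cone a (cst B E)) (st B a E)"
proof -
 note G = GwD[OF g]
 from fresh_vertex[of "insert a (\<Union>K)"] cx_finite_vertices[OF G(1)] obtain z where z0: "z ~: insert a (\<Union>K)" by auto
 then have z: "z ~: \<Union>K" "z ~= a" by auto
 have BK: "B \<in> K" using B(1) G(3) by blast
 have aE: "a ~: \<Union>E" using B(3) G(3) by blast
 let ?R = "{rh \<in> K. ~ B <= rh} Un cone a (ob B E)" and ?Y = "K Un cone a (cst B E)"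
 note id = st_fwd_id[OF G(1-3) B z]
 have obE: "ob B E <= ob B K" "ob B K <= {rh \<in> K. ~ B <= rh}"
  using G(3) cx_sub[OF G(1)] unfolding ob_def by blast+
 have aO: "a ~: \<Union>(ob B K)" using obE(2) B(3) by blast
 have c1: "cx {rh \<in> K. ~ B <= rh}"
 proof -
  have "cx (K Int {rh. ~ B <= rh})" using B(2) by (intro cx_Int[OF G(1)]) (auto simp: dn_def)
  then show ?thesis by (simp add: Int_def)
 qed
 have cR: "cx ?R" by (rule cx_Un[OF c1 cx_cone[OF cx_ob[OF G(2) B(1,2)]]])
 have "pctx (ob B K) (ob B E) a z ?R ?R"
  unfolding pctx_def
 proof (intro conjI)
  show "cx ?R" "?R <= ?R" "dn ?R" "finite (\<Union>?R)" using cR cx_dn cx_finite_vertices by blast+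
  show "a ~: \<Union>(ob B K)" by (rule aO)
  show "ob B K Un cone a (ob B E) <= ?R" using obE(2) by blast
  show "?R Int cone a (ob B K) <= ob B K Un cone a (ob B E)"
  proof
   fix rh assume r: "rh \<in> ?R Int cone a (ob B K)"
   show "rh \<in> ob B K Un cone a (ob B E)"
   proof (cases "rh \<in> cone a (ob B E)")
    case False
    then have "rh \<in> K" using r by blast
    then have "rh - {a} = rh" using B(3) by blast
    then show ?thesis using r unfolding cone_def by auto
   qed blast
  qed
  show "z ~: \<Union>?R" using z obE by (auto simp: cone_def)
 qed
 then have "seq ?R (cone a (ob B K) Un ?R) (cone z (ob B K Un cone a (ob B E)) Un ?R)"
  using PC_ob[OF g B(1,2)] unfolding PC_def by blast
 then have s1: "seq ?R (st B a K) (st B z ?Y)" unfolding id[symmetric] .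
 have "st B a E <= ?R"
 proof
  fix rh assume "rh \<in> st B a E"
  then have r: "~ B <= rh" "if a \<in> rh then rh - {a} Un B \<in> E else rh \<in> E" by (simp_all add: st_def)
  have "~ B <= rh - {a}" using r(1) by blast
  then show "rh \<in> ?R" using r G(3) by (cases "a \<in> rh") (auto simp: cone_def ob_def)
 qed
 then have s2: "seq (st B a E) (st B a K) (st B z ?Y)" by (rule seq_mono[OF s1])
 have cY: "cx ?Y" by (rule cx_Un[OF G(1) cx_cone[OF cx_cst[OF G(2) B(1)]]])
 have "z ~: \<Union>?Y" using z G(3) by (auto simp: cone_def cst_def)
 moreover have "z ~: \<Union>(st B a E)" using st_vertices[of B a E] z G(3) by blast
 moreover have "B ~: st B a E" by (simp add: st_def)
 ultimately have "smv (st B a E) ?Y (st B z ?Y)" using cY BK B(2) by (intro smvI) auto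
 then have "seq (st B a E) (st B a K) ?Y" using seq_trans[OF s2 seq1'] by blast
 moreover have "dn (st B a E)" by (rule cx_dn[OF cx_st[OF G(2) B(1,2)]])
 ultimately show ?thesis using Gw_off_seq Gw_st[OF g B] by blast
qed

text \<open>The complement of the open star of \<open>v\<close> is a cell bounded by the link of
  \<open>v\<close>. The property passes to the barycentric subdivision (\<open>Pv_ord\<close>),
  where \<open>star_edge\<close> uses it.\<close>

definition Pv :: "'v => 'v set set => bool" where
 "Pv v K \<longleftrightarrow> Gw {ta \<in> K. v ~: ta} (lk {v} K)"

text \<open>If \<open>v\<close> is not in the starred face, complement and link are starred
  together, or the move is off the link. If it is, the complement gains a block over a star in the
  link, the case of \<open>Gw_add_cone\<close>.\<close>

lemma Pv_st:
 fixes K :: "'v::infinite set set"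
 assumes P: "Pv v K" and K: "cx K" "ta \<in> K" "ta ~= {}" "ta ~= {v}" "a ~: \<Union>K" "{v} \<in> K"
 shows "Pv v (st ta a K)"
proof -
 let ?H = "{ta \<in> K. v ~: ta}" and ?E = "lk {v} K"
 have g: "Gw ?H ?E" using P by (simp add: Pv_def)
 have av: "a ~= v" "a ~: {v}" using K(5,6) by auto
 have aH: "a ~: \<Union>?H" using K(5) by blast
 have ns: "~ ta <= {v}" using K(3,4) by blast
 show ?thesis
 proof (cases "v \<in> ta")
  case False
  have H: "{rh \<in> st ta a K. v ~: rh} = st ta a ?H"
   using False av by (auto simp: st_def)
  show ?thesis
  proof (cases "{v} Un ta \<in> K")
   case True
   then have "lk {v} (st ta a K) = st ta a ?E" using lk_st[OF True ns av(2)] False by simp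
   moreover have "ta \<in> ?E" using True False by (simp add: lk_def Un_commute)
   ultimately show ?thesis unfolding Pv_def H using Gw_st[OF g _ K(3) aH] by simp
  next
   case n: False
   then have e: "lk {v} (st ta a K) = ?E" using lk_st_off[OF K(1) n av(2) K(5)] by simp
   have t: "ta ~: ?E" using n by (simp add: lk_def Un_commute)
   have "a ~: \<Union>?E" using K(5) unfolding lk_def by blast
   then have "smv ?E ?H (st ta a ?H)" using GwD(1)[OF g] K(2,3) False t aH by (intro smvI) auto
   then show ?thesis unfolding Pv_def H e using Gw_off[OF _ cx_dn[OF GwD(2)[OF g]]] g by blast
  qed
 next
  case True
  define B where "B = ta - {v}"
  have B: "B ~= {}" "v ~: B" "ta = insert v B" using True ns unfolding B_def by blast+
  have BE: "B \<in> ?E" using K(2) B by (simp add: lk_def)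
  have "{v} Un ta = ta" using True by blast
  then have E: "lk {v} (st ta a K) = st B a ?E" using lk_st[of "{v}" ta K a] K(2) ns av(2) by (simp add: B_def)
  have H: "{rh \<in> st ta a K. v ~: rh} = ?H Un cone a (cst B ?E)"
  proof (rule set_eqI)
   fix rh
   show "rh \<in> {rh \<in> st ta a K. v ~: rh} \<longleftrightarrow> rh \<in> ?H Un cone a (cst B ?E)"
   proof (cases "a \<in> rh")
    case a: True
    have "rh ~: K" using a K(5) by blast
    moreover have "rh - {a} Un B Un {v} = rh - {a} Un ta" using B(3) by blast
    moreover have "v \<in> rh - {a} Un B \<longleftrightarrow> v \<in> rh" using B(2) av(1) by blast
    ultimately show ?thesis using a True by (auto simp: st_def cone_def cst_def lk_def)
   next
    case a: False
    have "rh \<in> ?H" if "rh \<in> cst B ?E" using that cx_sub[OF K(1), of "rh Un B Un {v}" rh] by (auto simp: cst_def lk_def)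
    then show ?thesis using a True by (auto simp: st_def cone_def)
   qed
  qed
  show ?thesis unfolding Pv_def E H by (rule Gw_add_cone[OF g BE B(1) aH])
 qed
qed

text \<open>The barycentric subdivision as a sequence of forward star moves, from large faces to small ones;
  \<open>W\<close> is the set of faces already starred.\<close>

definition sdp :: "'v set set => 'v set set => 'v set set set" where
 "sdp W K = {rh. finite rh & rh - W <= (%v. {v}) ` UNIV & chain_subset (rh Int W) &
  \<Union>(rh - W) \<in> K & \<Union>(rh - W) ~: W & (\<forall>ta\<in>rh Int W. \<Union>(rh - W) <= ta)}"

text \<open>Old vertices appear as singletons, hence \<open>W\<close> contains none. As all larger
  faces have been treated, \<open>ta\<close> is still present as the set of its vertices, and
  starring it adds the vertex \<open>ta\<close>.\<close>

lemma sdp_step: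
 assumes K: "cx K" and W: "W <= K" "\<And>ta ta'. ta \<in> W ==> ta' \<in> K ==> ta <= ta' ==> ta' \<in> W" "\<And>v. {v} ~: W"
  and t: "ta \<in> K" "ta ~: W" "\<And>v. ta ~= {v}" and max: "\<And>ta'. ta' \<in> K ==> ta < ta' ==> ta' \<in> W"
 shows "st ((%v. {v}) ` ta) ta (sdp W K) = sdp (insert ta W) K"
proof (rule set_eqI)
 fix rh
 let ?T = "(%v. {v}) ` ta" and ?S = "range (%v. {v})"
 have fT: "finite ?T" using cx_face_finite[OF K t(1)] by simp
 have TW: "?T Int W = {}" using W(3) by blast
 have tS: "ta ~: ?S" using t(3) by blast
 have tT: "ta ~: ?T" using t(3) by blast
 show "rh \<in> st ?T ta (sdp W K) \<longleftrightarrow> rh \<in> sdp (insert ta W) K"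
 proof (cases "ta \<in> rh")
  case False
  define e where "e = \<Union>(rh - W)"
  have 1: "rh Int insert ta W = rh Int W" "rh - insert ta W = rh - W" using False by blast+
  have "?T <= rh \<longleftrightarrow> e = ta" if "rh - W <= ?S" "e \<in> K" "e ~: W"
  proof
   assume "?T <= rh"
   then have "?T <= rh - W" using TW by blast
   then have "ta <= e" unfolding e_def by blast
   then show "e = ta" using max[OF that(2)] that(3) by blast
  next
   assume e: "e = ta"
   show "?T <= rh"
   proof
    fix y assume "y \<in> ?T"
    then obtain v where v: "y = {v}" "v \<in> e" using e by blast
    then obtain s where "s \<in> rh - W" "v \<in> s" unfolding e_def by blast
    then show "y \<in> rh" using that(1) v(1) by auto
   qed
  qed
  then show ?thesis unfolding st_def sdp_def mem_Collect_eq 1 e_def[symmetric] using False by auto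
 next
  case True
  define R where "R = rh - W - {ta}"
  define e where "e = \<Union>R"
  have i: "rh - {ta} Un ?T - W = R Un ?T" "(rh - {ta} Un ?T) Int W = rh Int W"
   "rh - insert ta W = R" "rh Int insert ta W = insert ta (rh Int W)"
   using TW t(2) True unfolding R_def by blast+
  have U: "\<Union>(R Un ?T) = e Un ta" unfolding e_def by auto
  have fin: "finite (rh - {ta} Un ?T) \<longleftrightarrow> finite rh" using fT by simp
  have cov: "?T <= rh \<longleftrightarrow> ta <= e" if "R <= ?S"
  proof
   assume "?T <= rh"
   then have "?T <= R" using TW tT unfolding R_def by blast
   then show "ta <= e" unfolding e_def by blast
  next
   assume s: "ta <= e"
   show "?T <= rh"
   proof
    fix y assume "y \<in> ?T"
    then obtain v where v: "y = {v}" "v \<in> e" using s by blast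
    then obtain s where "s \<in> R" "v \<in> s" unfolding e_def by blast
    then show "y \<in> rh" using that v(1) unfolding R_def by auto
   qed
  qed
  have L: "rh \<in> st ?T ta (sdp W K) \<longleftrightarrow> ~ ?T <= rh & finite rh & R <= ?S & chain_subset (rh Int W) &
    e Un ta \<in> K & e Un ta ~: W & (\<forall>s\<in>rh Int W. e Un ta <= s)"
  proof -
   have "?T <= ?S" by blast
   then show ?thesis unfolding st_def sdp_def mem_Collect_eq if_P[OF True] i U fin
    by (simp only: Un_subset_iff[of R ?T ?S] simp_thms)
  qed
  have Rr: "rh \<in> sdp (insert ta W) K \<longleftrightarrow> finite rh & R <= ?S & chain_subset (rh Int W) & (\<forall>s\<in>rh Int W. s <= ta \<or> ta <= s) &
    e \<in> K & e ~= ta & e ~: W & e <= ta & (\<forall>s\<in>rh Int W. e <= s)"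
   unfolding sdp_def mem_Collect_eq i chain_insert e_def[symmetric] by auto
  show ?thesis
  proof
   assume l: "rh \<in> st ?T ta (sdp W K)"
   then have l': "~ ta <= e" "e Un ta \<in> K" "e Un ta ~: W" "\<forall>s\<in>rh Int W. e Un ta <= s" unfolding L using cov by blast+
   have "e Un ta = ta" using max[OF l'(2)] l'(3) by blast
   then have et: "e <= ta" by blast
   have "e \<in> K" using cx_sub[OF K t(1) et] .
   moreover have "e ~: W" using W(2)[OF _ t(1) et] t(2) by blast
   moreover have "e ~= ta" using l'(1) by blast
   ultimately show "rh \<in> sdp (insert ta W) K" using l l'(4) et unfolding L Rr by blast
  next
   assume r: "rh \<in> sdp (insert ta W) K"
   then have r': "e <= ta" "e ~= ta" "R <= ?S" unfolding Rr by blast+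
   have et: "e Un ta = ta" using r'(1) by blast
   have "ta <= s" if "s \<in> rh Int W" for s
    using that r W(2)[of s ta] t(1,2) unfolding Rr by blast
   then show "rh \<in> st ?T ta (sdp W K)" using r r' cov t(1,2) unfolding L et Rr by blast
  qed
 qed
qed

lemma sdp_empty: "cx K ==> sdp {} K = im (%v. {v}) K"
proof (rule set_eqI, rule iffI)
 fix rh assume "rh \<in> sdp {} K"
 then have r: "rh <= range (%v. {v})" "\<Union>rh \<in> K" by (simp_all add: sdp_def)
 have "s \<in> (%v. {v}) ` \<Union>rh" if "s \<in> rh" for s
 proof -
  obtain v where "s = {v}" using r(1) \<open>s \<in> rh\<close> by blast
  then show ?thesis using that by blast
 qed
 moreover have "(%v. {v}) ` \<Union>rh <= rh" using r(1) by auto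
 ultimately have "rh = (%v. {v}) ` \<Union>rh" by blast
 then show "rh \<in> im (%v. {v}) K" using r(2) by blast
next
 fix rh assume K: "cx K" and "rh \<in> im (%v. {v}) K"
 then obtain ka where "ka \<in> K" "rh = (%v. {v}) ` ka" by blast
 then show "rh \<in> sdp {} K" using cx_face_finite[OF K] by (auto simp: sdp_def chain_subset_def)
qed

lemma sdp_full:
 assumes "cx K" shows "sdp {ta \<in> K. ta ~= {} & (\<forall>v. ta ~= {v})} K = ord (K - {{}})"
proof (rule set_eqI)
 fix rh
 let ?W = "{ta \<in> K. ta ~= {} & (\<forall>v. ta ~= {v})}"
 define e where "e = \<Union>(rh - ?W)"
 show "rh \<in> sdp ?W K \<longleftrightarrow> rh \<in> ord (K - {{}})"
 proof
  assume "rh \<in> sdp ?W K"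
  then have r: "finite rh" "rh - ?W <= range (%v. {v})" "chain_subset (rh Int ?W)" "e \<in> K" "e ~: ?W" "\<And>s. s \<in> rh Int ?W ==> e <= s"
   unfolding sdp_def e_def by blast+
  have s: "s = e" if s: "s \<in> rh - ?W" for s
  proof -
   obtain v where v: "s = {v}" using r(2) s by blast
   then have "v \<in> e" using s unfolding e_def by blast
   then have "e = {v}" using r(4,5) by auto
   then show ?thesis using v by simp
  qed
  have "rh <= K - {{}}"
  proof
   fix s assume sr: "s \<in> rh"
   show "s \<in> K - {{}}" using s[of s] r(2,4) sr by (cases "s \<in> ?W") auto
  qed
  moreover have "A <= B \<or> B <= A" if "A \<in> rh" "B \<in> rh" for A B
  proof (cases "A \<in> ?W & B \<in> ?W")
   case True then show ?thesis using r(3) that unfolding chain_subset_def by blast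
  next
   case False
   then show ?thesis using s[of A] s[of B] r(6)[of A] r(6)[of B] that by blast
  qed
  ultimately show "rh \<in> ord (K - {{}})" using r(1) by (simp add: ord_def chain_subset_def)
 next
  assume "rh \<in> ord (K - {{}})"
  then have r: "finite rh" "rh <= K - {{}}" "\<And>A B. A \<in> rh ==> B \<in> rh ==> A <= B \<or> B <= A"
   by (simp_all add: ord_def chain_subset_def)
  have s: "\<exists>v. s = {v}" if "s \<in> rh - ?W" for s using that r(2) by blast
  have e: "e = {} \<or> e \<in> rh - ?W"
  proof (cases "rh - ?W = {}")
   case True show ?thesis unfolding e_def True by simp
  next
   case False
   then have "e \<in> rh - ?W" unfolding e_def using r
    by (intro chain_ends(1)) (auto simp: chain_subset_def)
   then show ?thesis ..
  qed
  have e1: "e \<in> K" using e r(2) cx_empty[OF assms] by blast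
  have e2: "e ~: ?W" using e by blast
  have e3: "e <= t" if t: "t \<in> rh Int ?W" for t
  proof (cases "e = {}")
   case False
   then have er: "e \<in> rh - ?W" using e by blast
   then obtain v where v: "e = {v}" using s by blast
   have "e <= t \<or> t <= e" using r(3) er t by blast
   then show ?thesis using v t by auto
  qed simp
  have "rh - ?W <= range (%v. {v})" using s by blast
  moreover have "chain_subset (rh Int ?W)" using r(3) unfolding chain_subset_def by blast
  ultimately show "rh \<in> sdp ?W K" using r(1) e1 e2 e3 unfolding sdp_def e_def by blast
 qed
qed

text \<open>None of the forward star moves that produce the subdivision is at the vertex
  \<open>{v}\<close>, so \<open>Pv_st\<close> applies to each of them.\<close>

lemma Pv_ord:
 fixes K :: "'v set set" and nm :: "'v set => 'b::infinite"
 assumes K: "cx K" "{v} \<in> K" and nm: "inj_on nm (K - {{}})" and P: "Pv (nm {v}) (im nm (im (%v. {v}) K))"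
 shows "Pv (nm {v}) (im nm (ord (K - {{}})))"
proof -
 let ?F = "{ta \<in> K. ta ~= {} & (\<forall>v. ta ~= {v})}"
 define up where "up W \<longleftrightarrow> W <= ?F & (\<forall>ta\<in>W. \<forall>ta'\<in>K. ta <= ta' --> ta' \<in> W)" for W
 have finF: "finite ?F" using cx_finite[OF K(1)] by simp
 have key: "Pv (nm {v}) (im nm (ord (K - {{}})))"
  if "up W" "cx (sdp W K)" "\<Union>(sdp W K) <= K - {{}}" "{{v}} \<in> sdp W K" "Pv (nm {v}) (im nm (sdp W K))" for W
  using that
 proof (induction "card (?F - W)" arbitrary: W rule: less_induct)
  case less
  show ?case
  proof (cases "?F - W = {}")
   case True
   then have "W = ?F" using less(2) unfolding up_def by blast
   then show ?thesis using less(6) sdp_full[OF K(1)] by simp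
  next
   case False
   have f: "finite (?F - W)" using finF by simp
   from finite_has_maximal[OF f False] obtain ta where t: "ta \<in> ?F - W" "\<forall>b\<in>?F - W. ta <= b --> ta = b" by blast
   have tK: "ta \<in> K" "ta ~: W" "ta ~= {}" "\<And>v. ta ~= {v}" using t(1) by blast+
   have max: "ta' \<in> W" if "ta' \<in> K" "ta < ta'" for ta'
   proof (rule ccontr)
    assume n: "ta' ~: W"
    have "ta' ~= {}" using that(2) by blast
    moreover have "ta' ~= {u}" for u using that(2) tK(3) by blast
    ultimately show False using t(2) that n by blast
   qed
   have W: "W <= ?F" "\<And>ta ta'. ta \<in> W ==> ta' \<in> K ==> ta <= ta' ==> ta' \<in> W" using less(2) unfolding up_def by blast+
   have Wv: "{u} ~: W" for u using W(1) by blast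
   let ?X = "sdp W K" and ?T = "(%v. {v}) ` ta"
   have st: "st ?T ta ?X = sdp (insert ta W) K"
    by (rule sdp_step[OF K(1) _ W(2) Wv tK(1,2,4) max]) (use W(1) in auto)
   have TX: "?T \<in> ?X"
   proof -
    have "?T - W = ?T" "?T Int W = {}" using Wv by blast+
    moreover have "\<Union>?T = ta" by blast
    ultimately show ?thesis using tK cx_face_finite[OF K(1)] by (auto simp: sdp_def chain_subset_def)
   qed
   have T: "?T ~= {}" "?T ~= {{v}}" using tK(3,4) by auto
   have tX: "ta ~: \<Union>?X"
   proof
    assume "ta \<in> \<Union>?X"
    then obtain rh where "rh \<in> ?X" "ta \<in> rh - W" using tK(2) by blast
    then show False using tK(4) unfolding sdp_def by blast
   qed
   have UV: "insert ta (\<Union>?X) <= K - {{}}" using less(4) tK by blast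
   have ist: "im nm (sdp (insert ta W) K) = st (nm ` ?T) (nm ta) (im nm ?X)"
    unfolding st[symmetric] by (rule im_st_inj[OF nm UV TX tX])
   have up': "up (insert ta W)" using W max tK unfolding up_def by blast
   have c': "cx (sdp (insert ta W) K)" unfolding st[symmetric] by (rule cx_st[OF less(3) TX T(1)])
   have v': "\<Union>(sdp (insert ta W) K) <= K - {{}}" unfolding st[symmetric] using st_vertices[of ?T ta ?X] UV by blast
   have "~ ?T <= {{v}}" using tK(3,4) by (auto simp: subset_singleton_iff)
   moreover have "ta ~= {v}" by (rule tK(4))
   ultimately have vv: "{{v}} \<in> sdp (insert ta W) K" unfolding st[symmetric] st_def using less(5) by simp
   have nmv: "nm ` ?T ~= {nm {v}}"
   proof
    assume a: "nm ` ?T = {nm {v}}"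
    have "?T = {{v}}"
    proof (rule inj_on_image_eq_iff[OF nm, THEN iffD1])
     show "nm ` ?T = nm ` {{v}}" using a by simp
     show "?T <= K - {{}}" using less(4) TX by blast
     show "{{v}} <= K - {{}}" using K(2) by simp
    qed
    then show False using T(2) by simp
   qed
   have nt: "nm ta ~: \<Union>(im nm ?X)"
    unfolding Union_im using inj_on_image_mem_iff[OF nm, of ta "\<Union>?X"] UV tX by blast
   have "{nm {v}} \<in> im nm ?X" using less(5) by force
   then have P': "Pv (nm {v}) (im nm (sdp (insert ta W) K))"
    unfolding ist using less(6) cx_im[OF less(3)] TX T(1) nmv nt by (intro Pv_st) auto
   have "?F - insert ta W < ?F - W" using t(1) by blast
   then have "card (?F - insert ta W) < card (?F - W)" by (rule psubset_card_mono[OF f])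
   from less(1)[OF this up' c' v' vv P'] show ?thesis .
  qed
 qed
 show ?thesis
 proof (rule key[of "{}"])
  have e: "sdp {} K = im (%v. {v}) K" by (rule sdp_empty[OF K(1)])
  show "up {}" by (simp add: up_def)
  show "cx (sdp {} K)" unfolding e by (rule cx_im[OF K(1)])
  have "{u} \<in> K" if "u \<in> \<Union>K" for u using cx_vertex[OF K(1), of u] that by simp
  then show "\<Union>(sdp {} K) <= K - {{}}" unfolding e Union_im by blast
  show "{{v}} \<in> sdp {} K" unfolding e using K(2) by force
  show "Pv (nm {v}) (im nm (sdp {} K))" unfolding e by (rule P)
 qed
qed

subsection \<open>The neighbourhood of an edge\<close>

text \<open>\<open>ord P\<close> is the derived neighbourhood of the edge. Undoing the starring at
  the barycentre of the edge gives \<open>D0\<close>, made of a cone at \<open>{x}\<close> and a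
  cone at \<open>{a}\<close>. By \<open>PC\<close> the cone at \<open>{a}\<close> is a re-coning of
  a cone at \<open>{x}\<close>, which joins with the first to the cone over
  \<open>ord P'\<close>.\<close>

lemma edge_nbhd:
 fixes K :: "'v::infinite set set"
 assumes K: "cx K" "{x, a} \<in> K" "x ~= a"
 defines "P \<equiv> {ta \<in> K. x \<in> ta \<or> a \<in> ta}"
 defines "P' \<equiv> P - {{x}, {a}, {x, a}}"
 assumes g: "Gw (ord {ta \<in> P'. a \<in> ta}) (ord {ta \<in> P'. x \<in> ta & a \<in> ta})"
 shows "seq {{}} (ord P) (cone {x} (ord P'))"
proof -
 define G1 where "G1 = ord {ta \<in> P'. x \<in> ta}"
 define G2 where "G2 = ord {ta \<in> P'. a \<in> ta}"
 define G12 where "G12 = ord {ta \<in> P'. x \<in> ta & a \<in> ta}"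
 have finP: "finite P'" using cx_finite[OF K(1)] by (simp add: P'_def P_def)
 have cG: "cx G1" "cx G2" "cx G12" using finP by (auto simp: G1_def G2_def G12_def intro!: cx_ord)
 have G12e: "c \<in> G12 \<longleftrightarrow> c \<in> G1 & c \<in> G2" for c unfolding G1_def G2_def G12_def ord_def by blast
 have n: "{x} ~: P'" "{a} ~: P'" "{x, a} ~: P'" by (simp_all add: P'_def)
 have oP': "c \<in> ord P' \<longleftrightarrow> c \<in> G1 \<or> c \<in> G2" for c
 proof
  assume c: "c \<in> ord P'"
  show "c \<in> G1 \<or> c \<in> G2"
  proof (cases "c = {}")
   case True then show ?thesis using cG(1) by simp
  next
   case False
   then have "\<Inter>c \<in> P'" using ord_ends(2)[OF c] c by (auto simp: ord_def)
   then have "x \<in> \<Inter>c \<or> a \<in> \<Inter>c" unfolding P'_def P_def by blast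
   then show ?thesis using c unfolding G1_def G2_def ord_def by blast
  qed
 qed (auto simp: G1_def G2_def ord_def)
 have V: "c <= P'" if "c \<in> G1 \<or> c \<in> G2" for c using that unfolding oP'[symmetric] by (simp add: ord_def)
 have cW: "cW G2 G12" using Gw_cW[OF g] by (simp add: G2_def G12_def)
 have "G12 <= G2" using G12e by blast
 from cW_PC[OF cG(2,3) this cW] have PCG: "PC G2 G12" .
 let ?R = "cone {x} G1 Un G2"
 have cR: "cx ?R" by (intro cx_Un cx_cone cG)
 have nx: "{x} ~: c" "{a} ~: c" "{x, a} ~: c" if "c \<in> G1 \<or> c \<in> G2" for c using V[OF that] n by blast+
 have "pctx G2 G12 {x} {a} ?R ?R"
  unfolding pctx_def
 proof (intro conjI)
  show "cx ?R" "?R <= ?R" "dn ?R" "finite (\<Union>?R)" using cR cx_dn cx_finite_vertices by blast+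
  show "{x} ~: \<Union>G2" using nx by blast
  show "G2 Un cone {x} G12 <= ?R" using G12e unfolding cone_def by blast
  show "?R Int cone {x} G2 <= G2 Un cone {x} G12" using G12e unfolding cone_def by blast
  show "{a} ~: \<Union>?R"
  proof
   assume "{a} \<in> \<Union>?R"
   then obtain c where c: "{a} \<in> c" "c - {{x}} \<in> G1 \<or> c \<in> G2" unfolding cone_def by blast
   have "{a} \<in> c - {{x}}" using c(1) K(3) by simp
   then show False using c nx(2) by blast
  qed
 qed
 then have s: "seq ?R (cone {x} G2 Un ?R) (cone {a} (G2 Un cone {x} G12) Un ?R)"
  using PCG unfolding PC_def by blast
 have D1: "cone {x} G2 Un ?R = cone {x} (ord P')"
  using cone_supset[OF cG(2), of "{x}"] by (auto simp: cone_def oP')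
 define D0 where "D0 = cone {a} (G2 Un cone {x} G12) Un ?R"
 have D0mem: "c \<in> D0 \<longleftrightarrow> (if {x} \<in> c then (if {a} \<in> c then c - {{x}, {a}} \<in> G12 else c - {{x}} \<in> G1)
   else (if {a} \<in> c then c - {{a}} \<in> G2 else c \<in> ord P'))" for c
 proof -
  have xa: "{x} ~= {a}" using K(3) by simp
  have e: "c - {{a}} - {{x}} = c - {{x}, {a}}" by blast
  have m: "c \<in> D0 \<longleftrightarrow> c - {{a}} \<in> G2 \<or> c - {{x}, {a}} \<in> G12 \<or> c - {{x}} \<in> G1 \<or> c \<in> G2"
   unfolding D0_def Un_iff cone_def mem_Collect_eq e by blast
  show ?thesis
  proof (cases "{x} \<in> c"; cases "{a} \<in> c")
   assume a: "{x} \<in> c" "{a} \<in> c"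
   then have "c - {{a}} ~: G2" "c - {{x}} ~: G1" "c ~: G2" using nx xa by blast+
   then show ?thesis using a m by simp
  next
   assume a: "{x} \<in> c" "{a} ~: c"
   then have "c - {{a}} = c" "c - {{x}, {a}} = c - {{x}}" "c ~: G2" using nx by blast+
   then show ?thesis using a m G12e by auto
  next
   assume a: "{x} ~: c" "{a} \<in> c"
   then have "c - {{x}} = c" "c - {{x}, {a}} = c - {{a}}" "c ~: G2" "c ~: G1" using nx by blast+
   then show ?thesis using a m G12e by auto
  next
   assume a: "{x} ~: c" "{a} ~: c"
   then have "c - {{x}} = c" "c - {{x}, {a}} = c" "c - {{a}} = c" by blast+
   then show ?thesis using a m G12e oP' by auto
  qed
 qed
 have P: "P = P' Un {{x}, {a}, {x, a}}" "{x} \<in> P" "{a} \<in> P" "{x, a} \<in> P"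
  using K cx_sub[OF K(1,2)] unfolding P'_def P_def by auto
 have ordP: "c \<in> ord P \<longleftrightarrow> (if {x, a} \<in> c then ~ ({x} \<in> c & {a} \<in> c) & c - {{x}, {a}, {x, a}} \<in> G12 else c \<in> D0 & ~ ({x} \<in> c & {a} \<in> c))" for c
 proof -
  define d where "d = c - {{x}, {a}, {x, a}}"
  have dP: "d \<in> ord P' \<longleftrightarrow> finite c & c <= P & chain_subset d"
   unfolding ord_def d_def using P(1) n by auto
  have cmp1: "(t <= {x} \<or> {x} <= t) \<longleftrightarrow> x \<in> t" if "t \<in> P'" for t using that unfolding P'_def P_def by (auto simp: subset_singleton_iff)
  have cmp2: "(t <= {a} \<or> {a} <= t) \<longleftrightarrow> a \<in> t" if "t \<in> P'" for t using that unfolding P'_def P_def by (auto simp: subset_singleton_iff)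
  have cmp3: "(t <= {x, a} \<or> {x, a} <= t) \<longleftrightarrow> x \<in> t & a \<in> t" if t: "t \<in> P'" for t
  proof -
   have "~ t <= {x, a}"
   proof
    assume "t <= {x, a}"
    then have "t \<in> {{}, {x}, {a}, {x, a}}" by (cases "x \<in> t"; cases "a \<in> t") blast+
    then show False using t unfolding P'_def P_def by auto
   qed
   then show ?thesis by blast
  qed
  have ins: "insert t d' \<in> ord P \<longleftrightarrow> d' \<in> ord P & t \<in> P & (\<forall>u\<in>d'. u <= t \<or> t <= u)" for t d' by (rule ord_insert)
  have dd: "d \<in> ord P \<longleftrightarrow> d \<in> ord P'" unfolding d_def ord_def using P(1) by blast
  have G1d: "d \<in> G1 \<longleftrightarrow> d \<in> ord P' & (\<forall>t\<in>d. x \<in> t)" and G2d: "d \<in> G2 \<longleftrightarrow> d \<in> ord P' & (\<forall>t\<in>d. a \<in> t)"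
   and G12d: "d \<in> G12 \<longleftrightarrow> d \<in> ord P' & (\<forall>t\<in>d. x \<in> t & a \<in> t)"
   unfolding G1_def G2_def G12_def ord_def by blast+
  have dP': "t \<in> P'" if "d \<in> ord P'" "t \<in> d" for t using that by (auto simp: ord_def)
  have c1: "insert {x} d \<in> ord P \<longleftrightarrow> d \<in> G1" unfolding ins dd G1d using P(2) cmp1 dP' by blast
  have c2: "insert {a} d \<in> ord P \<longleftrightarrow> d \<in> G2" unfolding ins dd G2d using P(3) cmp2 dP' by blast
  have c3: "insert {x, a} d \<in> ord P \<longleftrightarrow> d \<in> G12" unfolding ins dd G12d using P(4) cmp3 dP' by blast
  have c13: "insert {x, a} (insert {x} d) \<in> ord P \<longleftrightarrow> d \<in> G12" "insert {x, a} (insert {a} d) \<in> ord P \<longleftrightarrow> d \<in> G12"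
   using c1 c2 c3 P(2-4) G12e unfolding ins by auto
  have xa: "~ ({x} \<in> c & {a} \<in> c)" if "c \<in> ord P"
  proof
   assume m: "{x} \<in> c & {a} \<in> c"
   have "A <= B \<or> B <= A" if "A \<in> c" "B \<in> c" for A B
    using \<open>c \<in> ord P\<close> that by (simp add: ord_def chain_subset_def)
   from this[of "{x}" "{a}"] show False using m K(3) by simp
  qed
  have cd: "c = d Un (c Int {{x}, {a}, {x, a}})" unfolding d_def by blast
  have ne: "{x} ~= {a}" "{x} ~= {x, a}" "{a} ~= {x, a}" using K(3) by auto
  show ?thesis
  proof (cases "{x} \<in> c & {a} \<in> c")
   case True then show ?thesis using xa by auto
  next
   case F: False
   show ?thesis
   proof (cases "{x, a} \<in> c")
    case e: True
    consider "{x} \<in> c" "{a} ~: c" | "{x} ~: c" "{a} \<in> c" | "{x} ~: c" "{a} ~: c" using F by blast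
    then have "c \<in> ord P \<longleftrightarrow> d \<in> G12"
    proof cases
     case 1
     then have "c = insert {x, a} (insert {x} d)" using e unfolding d_def by blast
     then show ?thesis using c13(1) by simp
    next
     case 2
     then have "c = insert {x, a} (insert {a} d)" using e unfolding d_def by blast
     then show ?thesis using c13(2) by simp
    next
     case 3
     then have "c = insert {x, a} d" using e unfolding d_def by blast
     then show ?thesis using c3 by simp
    qed
    then show ?thesis using e F by (simp add: d_def)
   next
    case e: False
    consider "{x} \<in> c" "{a} ~: c" | "{x} ~: c" "{a} \<in> c" | "{x} ~: c" "{a} ~: c" using F by blast
    then have "c \<in> ord P \<longleftrightarrow> c \<in> D0"
    proof cases
     case 1
     then have "c = insert {x} d" "c - {{x}} = d" using e unfolding d_def by blast+
     then show ?thesis using c1 1 by (simp add: D0mem)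
    next
     case 2
     then have "c = insert {a} d" "c - {{a}} = d" using e unfolding d_def by blast+
     then show ?thesis using c2 2 by (simp add: D0mem)
    next
     case 3
     then have "c = d" using e unfolding d_def by blast
     then show ?thesis using dd 3 by (simp add: D0mem)
    qed
    then show ?thesis using e F by simp
   qed
  qed
 qed
 have D0v: "{x, a} ~: \<Union>D0"
 proof
  assume "{x, a} \<in> \<Union>D0"
  then obtain c where c: "c \<in> D0" "{x, a} \<in> c" by blast
  have ne: "{x, a} ~= {x}" "{x, a} ~= {a}" using K(3) by auto
  then have m: "{x, a} \<in> c - {{x}}" "{x, a} \<in> c - {{a}}" "{x, a} \<in> c - {{x}, {a}}" using c(2) by simp_all
  show False using c m nx(3)[of c] nx(3)[of "c - {{x}}"] nx(3)[of "c - {{a}}"] nx(3)[of "c - {{x}, {a}}"] G12e[of "c - {{x}, {a}}"] oP'[of c]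
   unfolding D0mem by (auto split: if_splits)
 qed
 have st: "st {{x}, {a}} {x, a} D0 = ord P"
 proof (rule set_eqI)
  fix c
  have ne: "{x} ~= {x, a}" "{a} ~= {x, a}" using K(3) by auto
  have "c - {{x, a}} Un {{x}, {a}} - {{x}, {a}} = c - {{x}, {a}, {x, a}}" by blast
  then have "c - {{x, a}} Un {{x}, {a}} \<in> D0 \<longleftrightarrow> c - {{x}, {a}, {x, a}} \<in> G12" by (simp add: D0mem)
  then show "c \<in> st {{x}, {a}} {x, a} D0 \<longleftrightarrow> c \<in> ord P"
   unfolding ordP st_def mem_Collect_eq by auto
 qed
 have cD0: "cx D0" unfolding D0_def by (intro cx_Un cx_cone cG)
 have "{{x}, {a}} \<in> D0" using cG(3) K(3) by (simp add: D0mem)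
 then have "smv {{}} D0 (ord P)" unfolding st[symmetric] using cD0 D0v by (intro smvI) auto
 moreover have "seq {{}} (cone {x} (ord P')) D0"
  using seq_mono[OF s, of "{{}}"] cx_empty[OF cR] unfolding D1 D0_def by simp
 ultimately show ?thesis using seq_trans[OF seq1' seq_sym] by blast
qed

text \<open>What \<open>edge_nbhd\<close> asks about the faces through \<open>a\<close> concerns the
  link of \<open>a\<close>, which is \<open>ob s G\<close>. Off \<open>x\<close> this is the join of
  the simplex on \<open>s - {x}\<close> with the link of \<open>s\<close>, a cell by
  \<open>Gw_join\<close>; \<open>Pv_ord\<close> carries the property to the subdivision.\<close>

lemma star_edge:
 fixes G :: "'v::infinite set set"
 assumes G: "cx G" "s \<in> G" "x \<in> s" "s ~= {x}" "a ~: \<Union>G"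
 defines "P \<equiv> {ta \<in> st s a G. x \<in> ta \<or> a \<in> ta}"
 shows "seq {{}} (ord P) (cone {x} (ord (P - {{x}, {a}, {x, a}})))"
proof -
 let ?K = "st s a G"
 define s' where "s' = s - {x}"
 have s': "finite s'" "s' ~= {}" "x ~: s'" "s = insert x s'" using G(3,4) cx_face_finite[OF G(1,2)] unfolding s'_def by auto
 have as: "a ~: s" using G(2,5) by blast
 have xa: "x ~= a" using as G(3) by blast
 have sne: "s ~= {}" using G(3) by blast
 have cK: "cx ?K" by (rule cx_st[OF G(1,2) sne])
 have "~ s <= {x, a}" using G(4) s'(2-4) as by auto
 moreover have "{x, a} - {a} Un s = s" using G(3) by blast
 ultimately have xaK: "{x, a} \<in> ?K" using G(2) by (simp add: st_def)
 define L where "L = lk s G"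
 have cL: "cx L" unfolding L_def by (rule cx_lk[OF G(1,2)])
 define La where "La = ob s G"
 have cLa: "cx La" unfolding La_def by (rule cx_ob[OF G(1,2) sne])
 have aLa: "a ~: ta" if "ta \<in> La" for ta using that G(5) unfolding La_def ob_def by blast
 have lka: "ta \<in> La \<longleftrightarrow> a ~: ta & insert a ta \<in> ?K" for ta
 proof (cases "a \<in> ta")
  case True then show ?thesis using aLa by blast
 next
  case False
  then have "s <= insert a ta \<longleftrightarrow> s <= ta" "insert a ta - {a} Un s = ta Un s" using as by auto
  then show ?thesis using False by (simp add: La_def ob_def st_def)
 qed
 define nm where "nm \<mu> = \<mu> Un {a}" for \<mu> :: "'v set"
 have dis: "ta Int {a} = {}" if "ta \<in> La - {{}}" for ta using that aLa by blast
 have inj: "inj_on nm (La - {{}})" unfolding nm_def by (rule ord_shift(2)[OF dis])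
 have ordLa: "im nm (ord (La - {{}})) = ord (nm ` (La - {{}}))" unfolding nm_def by (rule ord_shift(1)[OF dis, symmetric])
 have nmLa: "nm ` (La - {{}}) = {ta \<in> ?K. {a} < ta}"
 proof (rule set_eqI, rule iffI)
  fix ta assume "ta \<in> nm ` (La - {{}})"
  then obtain \<mu> where m: "\<mu> \<in> La" "\<mu> ~= {}" "ta = insert a \<mu>" unfolding nm_def by auto
  then show "ta \<in> {ta \<in> ?K. {a} < ta}" using lka[of \<mu>] by auto
 next
  fix ta assume "ta \<in> {ta \<in> ?K. {a} < ta}"
  then have t: "ta \<in> ?K" "{a} < ta" by blast+
  then have e: "insert a (ta - {a}) = ta" "ta - {a} ~= {}" by blast+
  then have "ta - {a} \<in> La" using lka[of "ta - {a}"] t(1) by simp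
  moreover have "nm (ta - {a}) = ta" using e(1) by (simp add: nm_def)
  ultimately show "ta \<in> nm ` (La - {{}})" using e(2) by (metis DiffI image_eqI singletonD)
 qed
 have L: "\<Union>L Int s = {}" unfolding L_def lk_def by blast
 have La1: "ta \<in> La & x ~: ta \<longleftrightarrow> ta - s' \<in> L" for ta
 proof -
  have "(ta - s') Un s = ta Un s" using s'(4) by blast
  moreover have "(ta - s') Int s = {} \<longleftrightarrow> x ~: ta" using s'(3,4) by blast
  ultimately show ?thesis using G(3) by (auto simp: La_def ob_def L_def lk_def)
 qed
 have La2: "ta \<in> lk {x} La \<longleftrightarrow> ta - s' \<in> L & ~ s' <= ta" for ta
 proof -
  have "(ta - s') Un s = ta Un {x} Un s" using s'(4) by blast
  moreover have "(ta - s') Int s = {} \<longleftrightarrow> x ~: ta" using s'(3,4) by blast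
  moreover have "s <= ta Un {x} \<longleftrightarrow> s' <= ta" using s'(3,4) by blast
  ultimately show ?thesis by (auto simp: La_def ob_def L_def lk_def)
 qed
 have vx: "{x} \<in> La" using lka[of "{x}"] xa xaK by (simp add: insert_commute)
 define sg where "sg y = nm {y}" for y
 have sgi: "inj_on sg (\<Union>La)" unfolding sg_def nm_def using aLa by (intro inj_onI) (metis Un_insert_left Un_empty_left UnionE doubleton_eq_iff)
 have ysg: "sg ` ta \<in> im sg F \<longleftrightarrow> ta \<in> F" if "F <= La" "ta <= \<Union>La" for F ta
 proof
  assume "sg ` ta \<in> im sg F"
  then obtain ka where k: "ka \<in> F" "sg ` ta = sg ` ka" by blast
  then have "ka <= \<Union>La" using that(1) by blast
  then have "ta = ka" using inj_on_image_eq_iff[OF sgi that(2)] k(2) by blast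
  then show "ta \<in> F" using k(1) by simp
 qed blast
 have im2: "im nm (im (%v. {v}) La) = im sg La" unfolding im_comp by (simp add: sg_def comp_def)
 have LLa: "L <= La"
 proof
  fix ta assume t: "ta \<in> L"
  then have "ta - s' = ta" using L s'(4) by blast
  then show "ta \<in> La" using La1[of ta] t by simp
 qed
 have s'La: "s' \<in> La"
 proof -
  have "s' - s' = {}" by blast
  then show ?thesis using La1[of s'] cL by simp
 qed
 have Pv: "Pv (sg x) (im sg La)"
 proof -
  have m: "rh - sg ` s' \<in> im sg L \<longleftrightarrow> (\<exists>ta. rh = sg ` ta & ta - s' \<in> L)" for rh
  proof
   assume "rh - sg ` s' \<in> im sg L"
   then obtain ka where k: "ka \<in> L" "rh - sg ` s' = sg ` ka" by blast
   let ?t = "ka Un {y \<in> s'. sg y \<in> rh}"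
   have "rh = sg ` ?t" using k(2) by blast
   moreover have "?t - s' = ka" using k(1) L s'(4) by blast
   ultimately show "\<exists>ta. rh = sg ` ta & ta - s' \<in> L" using k(1) by metis
  next
   assume "\<exists>ta. rh = sg ` ta & ta - s' \<in> L"
   then obtain ta where t: "rh = sg ` ta" "ta - s' \<in> L" by blast
   then have "ta \<in> La" using La1 by blast
   then have "ta - s' <= \<Union>La" "s' <= \<Union>La" using s'La by blast+
   then have "sg ` ta - sg ` s' = sg ` (ta - s')" by (rule inj_on_image_set_diff[OF sgi, symmetric])
   then show "rh - sg ` s' \<in> im sg L" using t by blast
  qed
  have xV: "x \<in> \<Union>La" "s' <= \<Union>La" using vx s'La by blast+
  have H: "{rh \<in> im sg La. sg x ~: rh} = {rh. rh - sg ` s' \<in> im sg L}"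
  proof (rule set_eqI)
   fix rh
   have "sg x \<in> sg ` ta \<longleftrightarrow> x \<in> ta" if "ta \<in> La" for ta using inj_on_image_mem_iff[OF sgi xV(1)] that by blast
   then have "rh \<in> {rh \<in> im sg La. sg x ~: rh} \<longleftrightarrow> (\<exists>ta. rh = sg ` ta & ta \<in> La & x ~: ta)" by blast
   then show "rh \<in> {rh \<in> im sg La. sg x ~: rh} \<longleftrightarrow> rh \<in> {rh. rh - sg ` s' \<in> im sg L}" unfolding La1 using m[of rh] by simp
  qed
  have "lk (sg ` {x}) (im sg La) = im sg (lk {x} La)" by (rule lk_im_inj[OF sgi vx])
  then have "lk {sg x} (im sg La) = im sg (lk {x} La)" by simp
  also have "\<dots> = {rh. rh - sg ` s' \<in> im sg L & ~ sg ` s' <= rh}"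
  proof (rule set_eqI)
   fix rh
   have "sg ` s' <= sg ` ta \<longleftrightarrow> s' <= ta" if "ta - s' \<in> L" for ta
   proof -
    have tV: "ta <= \<Union>La" using La1 that by blast
    have "sg y \<in> sg ` ta \<longleftrightarrow> y \<in> ta" if "y \<in> s'" for y
     using inj_on_image_mem_iff[OF sgi subsetD[OF xV(2) that] tV] .
    then show ?thesis unfolding image_subset_iff by blast
   qed
   then have "(\<exists>ta. rh = sg ` ta & ta - s' \<in> L & ~ s' <= ta) \<longleftrightarrow> (\<exists>ta. rh = sg ` ta & ta - s' \<in> L) & ~ sg ` s' <= rh"
    by (metis (no_types, lifting))
   moreover have "rh \<in> im sg (lk {x} La) \<longleftrightarrow> (\<exists>ta. rh = sg ` ta & ta - s' \<in> L & ~ s' <= ta)"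
    unfolding La2[symmetric] by blast
   ultimately show "rh \<in> im sg (lk {x} La) \<longleftrightarrow> rh \<in> {rh. rh - sg ` s' \<in> im sg L & ~ sg ` s' <= rh}" using m[of rh] by simp
  qed
  finally have E: "lk {sg x} (im sg La) = {rh. rh - sg ` s' \<in> im sg L & ~ sg ` s' <= rh}" .
  have "sg ` s' Int sg ` \<Union>L = sg ` (s' Int \<Union>L)" using inj_on_image_Int[OF sgi xV(2), of "\<Union>L"] LLa by blast
  moreover have "s' Int \<Union>L = {}" using L s'(4) by blast
  ultimately have "sg ` s' Int \<Union>(im sg L) = {}" unfolding Union_im by simp
  then show ?thesis unfolding Pv_def H E using cx_im[OF cL] s'(1,2) by (intro Gw_join) auto
 qed
 have nmx: "nm {x} = {x, a}" by (auto simp: nm_def)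
 have "Pv (nm {x}) (im nm (ord (La - {{}})))"
  by (rule Pv_ord[OF cLa vx inj]) (use Pv in \<open>simp add: im2 sg_def\<close>)
 then have g: "Gw {c \<in> ord {ta \<in> ?K. {a} < ta}. {x, a} ~: c} (lk {{x, a}} (ord {ta \<in> ?K. {a} < ta}))"
  unfolding Pv_def ordLa nmLa nmx .
 let ?P' = "P - {{x}, {a}, {x, a}}"
 have 1: "{ta \<in> ?P'. a \<in> ta} = {ta \<in> ?K. {a} < ta} - {{x, a}}"
  using xa unfolding P_def by auto
 have e1: "{c \<in> ord {ta \<in> ?K. {a} < ta}. {x, a} ~: c} = ord {ta \<in> ?P'. a \<in> ta}"
  unfolding 1 ord_def by blast
 have 2: "ta \<in> ?P' & x \<in> ta & a \<in> ta \<longleftrightarrow> ta \<in> ?K & {x, a} < ta" for ta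
  using xa unfolding P_def by auto
 have e2: "lk {{x, a}} (ord {ta \<in> ?K. {a} < ta}) = ord {ta \<in> ?P'. x \<in> ta & a \<in> ta}"
 proof (rule set_eqI)
  fix c
  have "c \<in> lk {{x, a}} (ord {ta \<in> ?K. {a} < ta}) \<longleftrightarrow>
    {x, a} ~: c & c \<in> ord {ta \<in> ?K. {a} < ta} & (\<forall>t\<in>c. t <= {x, a} \<or> {x, a} <= t)"
   using xaK xa by (auto simp: lk_def ord_insert)
  also have "\<dots> \<longleftrightarrow> c \<in> ord {ta \<in> ?K. {x, a} < ta}"
  proof
   assume l: "{x, a} ~: c & c \<in> ord {ta \<in> ?K. {a} < ta} & (\<forall>t\<in>c. t <= {x, a} \<or> {x, a} <= t)"
   have "t \<in> {ta \<in> ?K. {x, a} < ta}" if t: "t \<in> c" for t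
   proof -
    have tt: "t \<in> ?K" "{a} < t" "t ~= {x, a}" "t <= {x, a} \<or> {x, a} <= t" using l t by (auto simp: ord_def)
    then have "{x, a} <= t" by blast
    then show ?thesis using tt by blast
   qed
   then show "c \<in> ord {ta \<in> ?K. {x, a} < ta}" using l unfolding ord_def by blast
  next
   assume "c \<in> ord {ta \<in> ?K. {x, a} < ta}"
   then have c: "\<And>t. t \<in> c ==> t \<in> ?K & {x, a} < t" "finite c" "chain_subset c" unfolding ord_def by blast+
   have "{a} < t" if "t \<in> c" for t using c(1)[OF that] by auto
   then show "{x, a} ~: c & c \<in> ord {ta \<in> ?K. {a} < ta} & (\<forall>t\<in>c. t <= {x, a} \<or> {x, a} <= t)"
    using c unfolding ord_def by blast
  qed
  finally show "c \<in> lk {{x, a}} (ord {ta \<in> ?K. {a} < ta}) \<longleftrightarrow> c \<in> ord {ta \<in> ?P'. x \<in> ta & a \<in> ta}" unfolding 2 .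
 qed
 show ?thesis unfolding P_def
  by (rule edge_nbhd[OF cK xaK xa]) (use g in \<open>simp only: e1 e2 P_def\<close>)
qed

subsection \<open>Families cut out by labels\<close>

definition strat :: "nat => (nat set => 's set => bool) => bool" where
 "strat n D \<longleftrightarrow> (\<forall>X\<subseteq>{0..n}. D X {} & (\<forall>s t. D X s --> t <= s --> D X t)) &
  (\<forall>X Y s. X <= {0..n} --> Y <= {0..n} --> (D (X Int Y) s \<longleftrightarrow> D X s & D Y s))"

definition fam :: "('w => 's set) => (nat set => 's set => bool) => 'w set set => nat set => 'w set set" where
 "fam l D K X = {ka \<in> K. D X (\<Union>(l ` ka))}"

lemma cx_fam: assumes "strat n D" "cx K" "X <= {0..n}" shows "cx (fam l D K X)"
proof (rule cxI[OF cx_finite_vertices[OF assms(2)]])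
 show "{} \<in> fam l D K X" using assms by (simp add: fam_def strat_def)
 show "si <= \<Union>K" if "si \<in> fam l D K X" for si using that by (auto simp: fam_def)
 show "ta \<in> fam l D K X" if s: "si \<in> fam l D K X" "ta <= si" for si ta
 proof -
  have "\<Union>(l ` ta) <= \<Union>(l ` si)" using s(2) by blast
  moreover have "D X (\<Union>(l ` si))" "si \<in> K" using s(1) by (simp_all add: fam_def)
  ultimately show ?thesis using assms cx_sub[OF assms(2) _ s(2)] unfolding fam_def strat_def by blast
 qed
qed

text \<open>As \<open>a\<close> has the label of \<open>si\<close>, a face through \<open>a\<close>
  has the same label after \<open>a\<close> is replaced by \<open>si\<close>.\<close>

lemma fam_st:
 assumes "l a = \<Union>(l ` si)"
 shows "fam l D (st si a K) X = st si a (fam l D K X)"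
proof (rule set_eqI)
 fix rh
 have "\<Union>(l ` (rh - {a} Un si)) = \<Union>(l ` rh)" if "a \<in> rh"
 proof -
  have "l ` rh = insert (l a) (l ` (rh - {a}))" using that by blast
  then show ?thesis unfolding image_Un by (simp add: assms Un_commute)
 qed
 then show "rh \<in> fam l D (st si a K) X \<longleftrightarrow> rh \<in> st si a (fam l D K X)" by (auto simp: fam_def st_def)
qed

lemma st_notin:
 assumes "cx F" "si ~: F" "a ~: \<Union>F"
 shows "st si a F = F"
proof (rule set_eqI)
 fix rh
 have "~ si <= rh" if "rh \<in> F" using that assms(2) cx_sub[OF assms(1)] by blast
 moreover have "rh - {a} Un si ~: F" using assms(2) cx_sub[OF assms(1), of "rh - {a} Un si" si] by blast
 moreover have "a ~: rh" if "rh \<in> F" using that assms(3) by blast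
 ultimately show "rh \<in> st si a F \<longleftrightarrow> rh \<in> F" by (auto simp: st_def)
qed

text \<open>A face containing \<open>si\<close> is recovered from the face in which \<open>y\<close>
  is exchanged for \<open>a\<close>.\<close>

lemma st_inject:
 assumes "y \<in> si" "a ~: \<Union>F" "a ~: \<Union>F'" "a ~: si" "st si a F = st si a F'"
 shows "F = F'"
proof (rule set_eqI)
 fix rh
 show "rh \<in> F \<longleftrightarrow> rh \<in> F'"
 proof (cases "a \<in> rh")
  case True then show ?thesis using assms(2,3) by blast
 next
  case a: False
  show ?thesis
  proof (cases "si <= rh")
   case True
   have "insert a (rh - {y}) - {a} Un si = rh" using True a assms(1) by blast
   moreover have "~ si <= insert a (rh - {y})" using assms(1,4) by blast
   ultimately have "insert a (rh - {y}) \<in> st si a H \<longleftrightarrow> rh \<in> H" for H by (simp add: st_def)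
   then show ?thesis using assms(5) by metis
  next
   case False
   then have "rh \<in> st si a H \<longleftrightarrow> rh \<in> H" for H using a by (simp add: st_def)
   then show ?thesis using assms(5) by metis
  qed
 qed
qed

lemma st_UN: "st si a (\<Union>i\<in>I. F i) = (\<Union>i\<in>I. st si a (F i))"
 by (auto simp: st_def)

lemma mb_st:
 fixes F :: "'v::infinite set set"
 assumes F: "cx F" "si ~= {}" "a ~: \<Union>F" and h: "bs d F \<or> bs d (st si a F)"
 shows "bs d F & bs d (st si a F) & mb (st si a F) = st si a (mb F)"
proof (cases "si \<in> F")
 case True
 from bs_st[OF F(1) True F(2,3) h] have b: "bs d F" "bs d (st si a F)" "mb (st si a F) = (if si \<in> mb F then st si a (mb F) else mb F)"
  by blast+
 have "a ~: \<Union>(mb F)" using F(3) bsD(6)[OF b(1)] by blast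
 then have "si ~: mb F ==> st si a (mb F) = mb F" using st_notin[OF bsD(5)[OF b(1)]] by blast
 then show ?thesis using b by auto
next
 case False
 have e: "st si a F = F" by (rule st_notin[OF F(1) False F(3)])
 then have b: "bs d F" using h by simp
 have "a ~: \<Union>(mb F)" "si ~: mb F" using F(3) False bsD(6)[OF b] by blast+
 then have "st si a (mb F) = mb F" using st_notin[OF bsD(5)[OF b]] by blast
 then show ?thesis using e b by simp
qed

text \<open>All members of the family are starred at once. Balls and boundaries are transferred by
  \<open>mb_st\<close>, and equalities are pulled back by \<open>st_inject\<close>.\<close>

lemma SS_fam_st:
 fixes K :: "'w::infinite set set"
 assumes D: "strat n D" and K: "cx K" "si \<in> K" "x \<in> si" "a ~: \<Union>K" and la: "l a = \<Union>(l ` si)"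
 shows "SS n (fam l D K) \<longleftrightarrow> SS n (fam l D (st si a K))"
proof -
 let ?F = "fam l D K" and ?F' = "fam l D (st si a K)"
 have e: "?F' X = st si a (?F X)" for X by (rule fam_st[where l = l, OF la])
 have c: "cx (?F X)" "a ~: \<Union>(?F X)" if "X <= {0..n}" for X using cx_fam[OF D K(1) that] K(4) by (auto simp: fam_def)
 have ne: "si ~= {}" and as: "a ~: si" using K by blast+
 have inj: "st si a H = st si a H' \<longleftrightarrow> H = H'" if "a ~: \<Union>H" "a ~: \<Union>H'" for H H'
  using st_inject[OF K(3) that as] by blast
 have 0: "?F' {} = {{}} \<longleftrightarrow> ?F {} = {{}}"
 proof -
  have "st si a {{}} = {{}}" using ne by (auto simp: st_def)
  then have "?F' {} = {{}} \<longleftrightarrow> st si a (?F {}) = st si a {{}}" unfolding e by simp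
  also have "\<dots> \<longleftrightarrow> ?F {} = {{}}" by (rule inj) (use c[of "{}"] in auto)
  finally show ?thesis .
 qed
 have 1: "bal d (?F' X) & mb (?F' X) = (\<Union>Z\<in>{Z. Z < X}. ?F' Z) \<longleftrightarrow> bal d (?F X) & mb (?F X) = (\<Union>Z\<in>{Z. Z < X}. ?F Z)"
  if X: "X <= {0..n}" for X d
 proof (cases "bs d (?F X) \<or> bs d (?F' X)")
  case True
  from mb_st[OF c(1)[OF X] ne c(2)[OF X]] True have b: "bs d (?F X)" "bs d (?F' X)" "mb (?F' X) = st si a (mb (?F X))"
   unfolding e by blast+
  have aU: "a ~: \<Union>(mb (?F X))" "a ~: \<Union>(\<Union>Z\<in>{Z. Z < X}. ?F Z)"
   using bsD(6)[OF b(1)] K(4) by (auto simp: fam_def)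
  have "(\<Union>Z\<in>{Z. Z < X}. ?F' Z) = st si a (\<Union>Z\<in>{Z. Z < X}. ?F Z)" unfolding e st_UN ..
  then show ?thesis using b inj[OF aU] bs_bal[OF b(1)] bs_bal[OF b(2)] by simp
 next
  case False
  then show ?thesis using bal_bs[of d "?F X"] bal_bs[of d "?F' X"] by blast
 qed
 have 2: "?F (X Int Y) = ?F X Int ?F Y" "?F' (X Int Y) = ?F' X Int ?F' Y" if "X <= {0..n}" "Y <= {0..n}" for X Y
  using D that unfolding strat_def fam_def by blast+
 show ?thesis unfolding SS_def 0 using 1 2 by simp
qed

subsection \<open>Elementary retractions are cellular\<close>

lemma im_retract:
 assumes "cx F" "x \<in> si" "a ~: \<Union>F" "a ~: si"
 shows "im (%v. if v = a then x else v) (st si a F) = F"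
proof -
 let ?r = "%v. if v = a then x else v"
 have r1: "?r ` rh = rh" if "a ~: rh" for rh using that by (auto simp: image_iff)
 have r2: "?r ` rh = insert x (rh - {a})" if "a \<in> rh" for rh using that by (auto simp: image_iff)
 show ?thesis
 proof (rule set_eqI, rule iffI)
  fix ta assume "ta \<in> im ?r (st si a F)"
  then obtain rh where r: "rh \<in> st si a F" "ta = ?r ` rh" by blast
  show "ta \<in> F"
  proof (cases "a \<in> rh")
   case True
   then have "rh - {a} Un si \<in> F" using r(1) by (simp add: st_def)
   then show ?thesis unfolding r(2) r2[OF True] by (rule cx_sub[OF assms(1)]) (use assms(2) in blast)
  next
   case False
   then show ?thesis using r r1 by (simp add: st_def)
  qed
 next
  fix ta assume t: "ta \<in> F"
  then have a: "a ~: ta" using assms(3) by blast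
  show "ta \<in> im ?r (st si a F)"
  proof (cases "si <= ta")
   case False
   then have "ta \<in> st si a F" using t a by (simp add: st_def)
   then have "?r ` ta \<in> im ?r (st si a F)" by (rule imageI)
   then show ?thesis unfolding r1[OF a] .
  next
   case True
   let ?r' = "insert a (ta - {x})"
   have "?r' - {a} Un si = ta" using True a assms(2) by blast
   moreover have "~ si <= ?r'" using assms(2,4) by blast
   ultimately have "?r' \<in> st si a F" using t by (simp add: st_def)
   moreover have "ta = ?r ` ?r'" unfolding r2[OF insertI1] using True a assms(2) by blast
   ultimately show ?thesis by (rule rev_image_eqI)
  qed
 qed
qed

text \<open>Downward induction on the face \<open>ka\<close>. In the difficult case one passes to
  the link of \<open>ka - {x}\<close>, where the dual cell is a neighbourhood of the edge
  \<open>{x, a}\<close>, equivalent to a cone over \<open>ord P'\<close> by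
  \<open>star_edge\<close>. The base comes from the faces mapped strictly above \<open>ka\<close>;
  by the induction hypothesis and \<open>upper_seq\<close> it is equivalent to the order complex of
  the faces above \<open>ka\<close>, a sphere or a ball.\<close>

theorem retraction_cel:
 fixes K :: "'w::infinite set set"
 assumes D: "strat n D" and K: "cx K" "si \<in> K" "x \<in> si" "a ~: \<Union>K" and la: "l a = \<Union>(l ` si)"
  and S: "SS n (fam l D K)"
 shows "cel n (fam l D (st si a K)) (fam l D K) (%v. if v = a then x else v)"
proof -
 define r where "r v = (if v = a then x else v)" for v
 have rl: "(%v. if v = a then x else v) = r" by (simp add: r_def fun_eq_iff)
 note imr = im_retract[where a = a and x = x, unfolded rl]
 let ?F = "fam l D K" and ?F' = "fam l D (st si a K)"
 have as: "a ~: si" and ne: "si ~= {}" using K by blast+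
 have e: "?F' X = st si a (?F X)" for X by (rule fam_st[where l = l, OF la])
 have S': "SS n ?F'" using SS_fam_st[where l = l, OF D K la] S by simp
 have aF: "a ~: \<Union>(?F X)" for X using K(4) by (auto simp: fam_def)
 have im: "im r (?F' X) = ?F X" if "X <= {0..n}" for X
  unfolding e by (rule imr[OF SS_cx[OF S that] K(3) aF as])
 have cell: "\<exists>d. bal d (ord {ta \<in> ?F' X. ka <= r ` ta})"
  if "X <= {0..n}" "X ~= {}" "ka \<in> ?F X" "ka ~= {}" for X ka
  using that
 proof (induction "card (\<Union>K - ka)" arbitrary: X ka rule: less_induct)
  case less
  note X = less(2,3) and k = less(4,5)
  define F where "F = ?F X"
  have F': "?F' X = st si a F" unfolding e F_def ..
  have kF: "ka \<in> F" using k(1) by (simp add: F_def)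
  have bF: "bs (int (card X) - 1) F" unfolding F_def by (rule bal_bs[OF SS_bal[OF S X]])
  have bF': "bs (int (card X) - 1) (st si a F)" unfolding F'[symmetric] by (rule bal_bs[OF SS_bal[OF S' X]])
  have cF: "cx F" and aF': "a ~: \<Union>F" using bsD(4)[OF bF] aF by (simp_all add: F_def)
  have ak: "a ~: ka" using kF aF' by blast
  have rx: "u \<in> r ` ta \<longleftrightarrow> (u ~= a & u \<in> ta) \<or> (u = x & a \<in> ta)" for u ta using K(3) as by (auto simp: image_iff r_def)
  show ?case
  proof (cases "x \<in> ka")
   case False
   have eq: "ka <= r ` ta \<longleftrightarrow> ka <= ta" for ta
   proof -
    have "u \<in> r ` ta \<longleftrightarrow> u \<in> ta" if "u \<in> ka" for u
    proof -
     have "u ~= x" "u ~= a" using that False ak by blast+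
     then show ?thesis using rx[of u ta] by simp
    qed
    then show ?thesis by blast
   qed
   have "ka \<in> st si a F" using False K(3) ak kF by (auto simp: st_def)
   from up_ball[OF bF' this] show ?thesis unfolding F' eq by blast
  next
   case xk: True
   \<comment> \<open>A face of the starred complex whose image contains \<open>ka\<close> contains
     either \<open>ka\<close> or this copy, in which \<open>a\<close> stands for
     \<open>x\<close>.\<close>
   define ka' where "ka' = insert a (ka - {x})"
   have kk: "ka <= r ` ta \<longleftrightarrow> ka <= ta \<or> ka' <= ta" for ta
   proof -
    have k: "ka <= r ` ta \<longleftrightarrow> ka - {x} <= ta & (x \<in> ta \<or> a \<in> ta)"
    proof -
     have "u \<in> r ` ta \<longleftrightarrow> u \<in> ta" if "u \<in> ka - {x}" for u
     proof -
      have "u ~= x" "u ~= a" using that ak by blast+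
      then show ?thesis using rx[of u ta] by simp
     qed
     moreover have "x \<in> r ` ta \<longleftrightarrow> x \<in> ta \<or> a \<in> ta" using rx[of x ta] K(3) as by auto
     ultimately show ?thesis using xk by blast
    qed
    show ?thesis unfolding k ka'_def using xk by blast
   qed
   have k'F: "ka' \<in> st si a F \<longleftrightarrow> ka Un si \<in> F"
   proof -
    have "ka' - {a} Un si = ka Un si" "~ si <= ka'" "a \<in> ka'" using K(3) as ak unfolding ka'_def by blast+
    then show ?thesis by (simp add: st_def)
   qed
   consider "si <= ka" | "~ si <= ka" "ka Un si ~: F" | "~ si <= ka" "ka Un si \<in> F" by blast
   then show ?thesis
   proof cases
    case 1
    then have "ka Un si = ka" by blast
    then have kin: "ka' \<in> st si a F" using k'F kF by simp
    have eq: "{ta \<in> st si a F. ka <= r ` ta} = {ta \<in> st si a F. ka' <= ta}" unfolding kk using 1 by (auto simp: st_def)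
    show ?thesis unfolding F' eq using up_ball[OF bF' kin] by blast
   next
    case 2
    then have kin: "ka \<in> st si a F" using kF ak by (simp add: st_def)
    have "~ ka' <= ta" if "ta \<in> st si a F" for ta
    proof
     assume s: "ka' <= ta"
     then have "ka' \<in> st si a F" using cx_sub[OF bsD(4)[OF bF'] that] by blast
     then show False using k'F 2(2) by blast
    qed
    then have eq: "{ta \<in> st si a F. ka <= r ` ta} = {ta \<in> st si a F. ka <= ta}" unfolding kk by blast
    show ?thesis unfolding F' eq using up_ball[OF bF' kin] by blast
   next
    \<comment> \<open>Both \<open>ka\<close> and \<open>ka'\<close> are faces of the starred
      complex, so the dual cell is not the set of faces above a single one.\<close>
    case 3
    define ka0 where "ka0 = ka - {x}"
    define s where "s = si - ka0"
    define G where "G = lk ka0 F"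
    have k0: "ka0 \<in> F" "ka0 Un si \<in> F" "~ si <= ka0" "a ~: ka0"
     using cx_sub[OF cF kF, of ka0] cx_sub[OF cF 3(2), of "ka0 Un si"] K(3) ak unfolding ka0_def by blast+
    have lkK: "lk ka0 (st si a F) = st s a G" unfolding G_def s_def by (rule lk_st[OF k0(2-4)])
    have cG: "cx G" unfolding G_def by (rule cx_lk[OF cF k0(1)])
    have sG: "s \<in> G" using k0(2) unfolding s_def G_def lk_def by (auto simp: Un_commute)
    have xs1: "x \<in> s" using K(3) unfolding s_def ka0_def by simp
    obtain y where y: "y \<in> si" "y ~: ka" using 3(1) by blast
    then have "y \<in> s" "y ~= x" using xk unfolding s_def ka0_def by auto
    then have "s ~= {x}" by blast
    note xs = xs1 this
    have aG: "a ~: \<Union>G" using aF' unfolding G_def lk_def by blast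
    define P where "P = {ta \<in> st s a G. x \<in> ta \<or> a \<in> ta}"
    define P' where "P' = P - {{x}, {a}, {x, a}}"
    have sq: "seq {{}} (ord P) (cone {x} (ord P'))"
     unfolding P'_def P_def by (rule star_edge[OF cG sG xs aG])
    let ?s = "%ta. ta Un ka0"
    have x0: "x ~: ka0" unfolding ka0_def by blast
    have kx: "ka = insert x ka0" "ka' = insert a ka0" using xk unfolding ka0_def ka'_def by blast+
    have kk2: "ka <= r ` ta \<longleftrightarrow> (x \<in> ta \<or> a \<in> ta) & ka0 <= ta" for ta
     unfolding kk unfolding kx by blast
    have Pd: "ta Int ka0 = {}" if "ta \<in> P" for ta using that unfolding P_def lkK[symmetric] lk_def by blast
    have PD: "?s ` P = {ta \<in> st si a F. ka <= r ` ta}"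
    proof (rule set_eqI, rule iffI)
     fix ta assume "ta \<in> ?s ` P"
     then obtain \<mu> where m: "\<mu> \<in> P" "ta = \<mu> Un ka0" by blast
     then have "ta \<in> st si a F" "x \<in> \<mu> \<or> a \<in> \<mu>" unfolding P_def lkK[symmetric] lk_def by blast+
     then show "ta \<in> {ta \<in> st si a F. ka <= r ` ta}" unfolding mem_Collect_eq kk2 using m(2) by blast
    next
     fix ta assume "ta \<in> {ta \<in> st si a F. ka <= r ` ta}"
     then have t: "ta \<in> st si a F" "x \<in> ta \<or> a \<in> ta" "ka0 <= ta" unfolding mem_Collect_eq kk2 by blast+
     have e: "ta - ka0 Un ka0 = ta" using t(3) by blast
     have "ta - ka0 \<in> st s a G" unfolding lkK[symmetric] lk_def using t(1) e by auto
     then have "ta - ka0 \<in> P" using t(2) x0 k0(4) unfolding P_def by blast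
     then show "ta \<in> ?s ` P" using e by (metis image_eqI)
    qed
    define U where "U = {ka1 \<in> F. ka < ka1}"
    have PD': "?s ` P' = {ta \<in> st si a F. r ` ta \<in> U}"
    proof -
     have iP: "inj_on ?s P" by (rule ord_shift(2)[OF Pd])
     have k0r: "r ` ka0 = ka0" using k0(4) by (auto simp: image_iff r_def)
     have "\<mu> \<in> P' \<longleftrightarrow> r ` (\<mu> Un ka0) ~= ka" if m: "\<mu> \<in> P" for \<mu>
     proof -
      have mxa: "x \<in> \<mu> \<or> a \<in> \<mu>" using m unfolding P_def by blast
      have md: "\<mu> Int ka0 = {}" by (rule Pd[OF m])
      have rm: "r ` (\<mu> Un ka0) = r ` \<mu> Un ka0" unfolding image_Un k0r ..
      have e1: "r ` \<mu> Un ka0 = insert x ka0 \<longleftrightarrow> \<mu> <= {x, a}"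
      proof
       assume q: "r ` \<mu> Un ka0 = insert x ka0"
       show "\<mu> <= {x, a}"
       proof
        fix u assume u: "u \<in> \<mu>"
        have "r u \<in> insert x ka0" using u unfolding q[symmetric] by blast
        then show "u \<in> {x, a}" using u md by (cases "u = a") (auto simp: r_def)
       qed
      next
       assume q: "\<mu> <= {x, a}"
       then have "r ` \<mu> <= {x}" by (auto simp: r_def)
       moreover have "x \<in> r ` \<mu>" using mxa rx[of x \<mu>] K(3) as by blast
       ultimately show "r ` \<mu> Un ka0 = insert x ka0" by blast
      qed
      have e2: "\<mu> <= {x, a} \<longleftrightarrow> \<mu> \<in> {{x}, {a}, {x, a}}" using mxa by auto
      have e3: "\<mu> \<in> P' \<longleftrightarrow> ~ \<mu> \<in> {{x}, {a}, {x, a}}" using m unfolding P'_def by blast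
      show ?thesis unfolding rm kx(1) using e1 e2 e3 by argo
     qed
     moreover have "P' <= P" unfolding P'_def by blast
     ultimately have "?s ` P' = {ta \<in> ?s ` P. r ` ta ~= ka}" by blast
     also have "\<dots> = {ta \<in> st si a F. r ` ta \<in> U}"
     proof -
      have "r ` ta \<in> F" if "ta \<in> st si a F" for ta using imr[OF cF K(3) aF' as] that by blast
      then show ?thesis unfolding PD U_def by blast
     qed
     finally show ?thesis .
    qed
    have Kf: "finite (\<Union>K)" by (rule cx_finite_vertices[OF K(1)])
    let ?i = "%ta. ta - ka0"
    have P'P: "P' <= P" unfolding P'_def by blast
    have isp: "?i (?s ta) = ta" if "ta \<in> P'" for ta using Pd[of ta] that P'P by blast
    have inji: "inj_on ?i {ta \<in> ?F' X. r ` ta \<in> U}"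
     unfolding F' PD'[symmetric] by (rule inj_on_imageI) (use isp in \<open>simp add: inj_on_def comp_def\<close>)
    \<comment> \<open>All faces in \<open>U\<close> are strictly larger than \<open>ka\<close>, so
      the induction hypothesis covers their dual cells.\<close>
    have US: "seq {{}} (im (%x. x) (ord U)) (im ?i (ord {ta \<in> ?F' X. r ` ta \<in> U}))"
    proof (rule upper_seq[OF S' S X(1)])
     show "U <= ?F X" "{} ~: U" unfolding U_def F_def by blast+
     show "rh' \<in> U" if "rh \<in> U" "rh' \<in> ?F X" "rh <= rh'" for rh rh' using that unfolding U_def F_def by blast
     show "im r (?F' Z) = ?F Z" if "Z <= X" for Z by (rule im[OF subset_trans[OF that X(1)]])
     show "\<exists>d. bal d (ord {ta \<in> ?F' Z. rh <= r ` ta})" if Z: "Z <= X" "Z ~= {}" "rh \<in> U" "rh \<in> ?F Z" for Z rh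
     proof -
      have r: "ka < rh" "rh <= \<Union>K" using Z(3) unfolding U_def F_def fam_def by blast+
      then have "\<Union>K - rh < \<Union>K - ka" by blast
      then have "card (\<Union>K - rh) < card (\<Union>K - ka)" using Kf by (intro psubset_card_mono) auto
      moreover have "Z <= {0..n}" "rh ~= {}" using Z(1) X(1) r(1) by blast+
      ultimately show ?thesis using less(1) Z(2,4) by blast
     qed
     show "inj_on ?i {ta \<in> ?F' X. r ` ta \<in> U}" by (rule inji)
    qed simp
    have "ord {ta \<in> ?F' X. r ` ta \<in> U} = im ?s (ord P')"
     unfolding F' PD'[symmetric] by (rule ord_shift(1)) (use Pd P'P in blast)
    then have "im ?i (ord {ta \<in> ?F' X. r ` ta \<in> U}) = im (?i \<circ> ?s) (ord P')" unfolding im_comp[symmetric] by simp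
    also have "\<dots> = ord P'" by (rule im_fix) (use isp in simp)
    finally have US': "seq {{}} (ord U) (ord P')" using US by simp
    let ?d = "int (card X) - 1 - int (card ka)"
    have "sph ?d (ord U) \<or> bal ?d (ord U)" unfolding U_def by (rule up_link[OF bF kF])
    then have "sph ?d (ord P') \<or> bal ?d (ord P')" using sph_seq[OF US'] bal_seq[OF US'] by blast
    moreover have "{x} ~: \<Union>(ord P')" unfolding ord_vertices P'_def by blast
    ultimately have "bal (?d + 1) (cone {x} (ord P'))" by (rule bal_cone)
    then have bP: "bal (?d + 1) (ord P)" using bal_seq[OF sq] by simp
    have "bal (?d + 1) (im ?s (ord P))"
     using bal_im[OF bal_cx[OF bP], of ?s] ord_shift(2)[OF Pd] bP by simp
    moreover have "im ?s (ord P) = ord {ta \<in> st si a F. ka <= r ` ta}"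
     unfolding PD[symmetric] by (rule ord_shift(1)[OF Pd, symmetric])
    ultimately show ?thesis unfolding F' by auto
   qed
  qed
 qed
 show ?thesis unfolding cel_def rl using S S' im cell by blast
qed

subsection \<open>Compositions, isomorphisms and paths of cellular maps\<close>

lemma celD:
 assumes "cel n A B g"
 shows "SS n A" "SS n B" "X <= {0..n} ==> im g (A X) = B X"
  "X <= {0..n} ==> X ~= {} ==> rh \<in> B X ==> rh ~= {} ==> \<exists>e. bal e (ord {ta \<in> A X. rh <= g ` ta})"
 using assms unfolding cel_def by simp_all

lemma upper_iff:
 fixes A :: "nat set => 'm::infinite set set" and B :: "nat set => 'n::infinite set set"
 assumes c: "cel n A B f" and X: "X <= {0..n}"
  and U: "U <= B X" "{} ~: U" "\<And>rh rh'. rh \<in> U ==> rh' \<in> B X ==> rh <= rh' ==> rh' \<in> U"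
 shows "bal e (ord {ta \<in> A X. f ` ta \<in> U}) \<longleftrightarrow> bal e (ord U)"
proof -
 let ?P = "{ta \<in> A X. f ` ta \<in> U}"
 have fin: "finite ?P" using cx_finite[OF SS_cx[OF celD(1)[OF c] X]] by simp
 obtain i :: "'m set => 'n set" where i: "inj_on i ?P" using ex_inj_on[OF fin] by blast
 have s: "seq {{}} (im (%x. x) (ord U)) (im i (ord ?P))"
 proof (rule upper_seq[OF celD(1,2)[OF c] X U])
  show "im f (A Z) = B Z" if "Z <= X" for Z by (rule celD(3)[OF c subset_trans[OF that X]])
  show "\<exists>e. bal e (ord {ta \<in> A Z. rh <= f ` ta})" if "Z <= X" "Z ~= {}" "rh \<in> U" "rh \<in> B Z" for Z rh
  proof -
   have "Z <= {0..n}" "rh ~= {}" using that X U(2) by blast+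
   then show ?thesis using celD(4)[OF c] that by blast
  qed
  show "inj_on i ?P" by (rule i)
 qed simp_all
 have "bal e (im i (ord ?P)) \<longleftrightarrow> bal e (ord ?P)" by (rule bal_im[OF cx_ord[OF fin]]) (simp add: i)
 moreover have "bal e (ord U) \<longleftrightarrow> bal e (im i (ord ?P))" using bal_seq[OF s] by simp
 ultimately show ?thesis by blast
qed

text \<open>A dual cell of the composite is the preimage under \<open>f\<close> of a dual cell of
  \<open>g\<close>, which is closed upwards; by \<open>upper_iff\<close> a cellular \<open>f\<close>
  preserves and reflects being a ball of a given dimension.\<close>

lemma comp_cell:
 fixes A :: "nat set => 'm::infinite set set" and B :: "nat set => 'n::infinite set set"
 assumes c: "cel n A B f" and X: "X <= {0..n}" and r: "rh ~= {}"
 shows "bal e (ord {ta \<in> A X. rh <= (%v. g (f v)) ` ta}) \<longleftrightarrow> bal e (ord {\<beta> \<in> B X. rh <= g ` \<beta>})"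
proof -
 let ?U = "{\<beta> \<in> B X. rh <= g ` \<beta>}"
 have fB: "f ` ta \<in> B X" if "ta \<in> A X" for ta using celD(3)[OF c X] that by blast
 have "{ta \<in> A X. rh <= (%v. g (f v)) ` ta} = {ta \<in> A X. f ` ta \<in> ?U}"
  using fB by (auto simp: image_image[symmetric])
 moreover have "bal e (ord {ta \<in> A X. f ` ta \<in> ?U}) \<longleftrightarrow> bal e (ord ?U)"
 proof (rule upper_iff[OF c X])
  show "rh' \<in> ?U" if a: "\<beta> \<in> ?U" "rh' \<in> B X" "\<beta> <= rh'" for \<beta> rh'
  proof -
   have "g ` \<beta> <= g ` rh'" by (rule image_mono[OF a(3)])
   then show ?thesis using a(1,2) by auto
  qed
 qed (use r in auto)
 ultimately show ?thesis by simp
qed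

lemma cel_comp:
 fixes A :: "nat set => 'm::infinite set set" and B :: "nat set => 'n::infinite set set"
 assumes f: "cel n A B f" and g: "cel n B C g"
 shows "cel n A C (%v. g (f v))"
 unfolding cel_def
proof (intro conjI allI impI ballI)
 show "SS n A" "SS n C" using celD(1)[OF f] celD(2)[OF g] .
 fix X assume X: "X <= {0..n}"
 show "im (%v. g (f v)) (A X) = C X"
  unfolding celD(3)[OF g X, symmetric] celD(3)[OF f X, symmetric] by (simp add: image_image)
 fix rh assume a: "X ~= {}" "rh \<in> C X" "rh ~= {}"
 show "\<exists>e. bal e (ord {ta \<in> A X. rh <= (%v. g (f v)) ` ta})"
  unfolding comp_cell[OF f X a(3), of _ g] by (rule celD(4)[OF g X a])
qed

text \<open>The equivalence in \<open>comp_cell\<close> read backwards. This cancellation makes it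
  possible to follow a path against its star moves.\<close>

lemma cel_comp_rev:
 fixes A :: "nat set => 'm::infinite set set" and B :: "nat set => 'n::infinite set set"
 assumes f: "cel n A B f" and gf: "cel n A C (%v. g (f v))"
 shows "cel n B C g"
 unfolding cel_def
proof (intro conjI allI impI ballI)
 show "SS n B" "SS n C" using celD(2)[OF f] celD(2)[OF gf] .
 fix X assume X: "X <= {0..n}"
 show "im g (B X) = C X"
  unfolding celD(3)[OF gf X, symmetric] celD(3)[OF f X, symmetric] by (simp add: image_image)
 fix rh assume a: "X ~= {}" "rh \<in> C X" "rh ~= {}"
 show "\<exists>e. bal e (ord {ta \<in> B X. rh <= g ` ta})"
  unfolding comp_cell[OF f X a(3), of _ g, symmetric] by (rule celD(4)[OF gf X a])
qed

lemma SS_ext: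
 assumes "\<And>X. X <= {0..n} ==> A X = A' X" shows "SS n A \<longleftrightarrow> SS n A'"
proof -
 have u: "(\<Union>Z\<in>{Z. Z < X}. A Z) = (\<Union>Z\<in>{Z. Z < X}. A' Z)" if "X <= {0..n}" for X
  by (rule SUP_cong) (use assms that in blast)+
 have i: "A (X Int Y) = A' (X Int Y)" if "X <= {0..n}" for X Y using assms that by blast
 show ?thesis unfolding SS_def using assms u i by (simp cong: imp_cong)
qed

lemma cel_ext:
 assumes "\<And>X. X <= {0..n} ==> A X = A' X" "\<And>X. X <= {0..n} ==> B X = B' X"
 shows "cel n A B g \<longleftrightarrow> cel n A' B' g"
proof -
 have "SS n A \<longleftrightarrow> SS n A'" "SS n B \<longleftrightarrow> SS n B'" by (rule SS_ext, erule assms)+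
 then show ?thesis unfolding cel_def using assms by (simp cong: imp_cong)
qed

lemma cel_cong:
 assumes c: "cel n A B g" and e: "\<And>v. v \<in> \<Union>(A {0..n}) ==> g v = g' v"
 shows "cel n A B g'"
proof -
 have i: "g' ` ta = g ` ta" if t: "ta \<in> A X" "X <= {0..n}" for ta X
 proof -
  have "ta \<in> A {0..n}" using SS_mono[OF celD(1)[OF c] t(2)] t(1) by blast
  then have "g' x = g x" if "x \<in> ta" for x using e[OF UnionI[OF _ that]] by simp
  then show ?thesis by (rule image_cong[OF refl])
 qed
 have "im g' (A X) = im g (A X)" if "X <= {0..n}" for X by (rule image_cong[OF refl i[OF _ that]])
 moreover have "{ta \<in> A X. rh <= g' ` ta} = {ta \<in> A X. rh <= g ` ta}" if "X <= {0..n}" for X rh using i that by auto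
 ultimately show ?thesis using c unfolding cel_def by simp
qed

lemma SS_verts: "SS n A ==> X <= {0..n} ==> \<Union>(A X) <= \<Union>(A {0..n})"
 using SS_mono[of n A X "{0..n}"] by blast

lemma SS_im:
 fixes A :: "nat set => 'm::infinite set set" and i :: "'m => 'b::infinite"
 assumes S: "SS n A" and i: "inj_on i (\<Union>(A {0..n}))"
 shows "SS n (%X. im i (A X))"
proof -
 have ii: "inj_on i (\<Union>(A X))" if "X <= {0..n}" for X by (rule inj_on_subset[OF i SS_verts[OF S that]])
 have 1: "bal (int (card X) - 1) (im i (A X))" "mb (im i (A X)) = (\<Union>Z\<in>{Z. Z < X}. im i (A Z))" if X: "X <= {0..n}" "X ~= {}" for X
 proof -
  note c = SS_cx[OF S X(1)]
  show "bal (int (card X) - 1) (im i (A X))" using bal_im[OF c ii[OF X(1)]] SS_bal[OF S X] by simp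
  show "mb (im i (A X)) = (\<Union>Z\<in>{Z. Z < X}. im i (A Z))"
   unfolding mb_im[OF c ii[OF X(1)]] SS_mb[OF S X] by blast
 qed
 have 2: "im i (A (X Int Y)) = im i (A X) Int im i (A Y)" if "X <= {0..n}" "Y <= {0..n}" for X Y
  unfolding SS_Int[OF S that]
 proof (rule inj_on_image_Int[OF inj_on_image_Pow[OF i]])
  show "A X <= Pow (\<Union>(A {0..n}))" "A Y <= Pow (\<Union>(A {0..n}))"
   using SS_verts[OF S that(1)] SS_verts[OF S that(2)] by blast+
 qed
 show ?thesis unfolding SS_def using 1 2 SS_empty[OF S] by simp
qed

lemma cel_iso:
 fixes A :: "nat set => 'm::infinite set set" and i :: "'m => 'b::infinite"
 assumes S: "SS n A" and i: "inj_on i (\<Union>(A {0..n}))"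
 shows "cel n A (%X. im i (A X)) i"
 unfolding cel_def
proof (intro conjI allI impI ballI)
 show "SS n A" "SS n (%X. im i (A X))" using S SS_im[OF S i] .
 fix X rh assume X: "X <= {0..n}" "X ~= {}" and r: "rh \<in> im i (A X)" "rh ~= {}"
 then obtain rh0 where r0: "rh0 \<in> A X" "rh = i ` rh0" by blast
 have v: "ta <= \<Union>(A {0..n})" if "ta \<in> A X" for ta using SS_verts[OF S X(1)] that by blast
 have "i ` rh0 <= i ` ta \<longleftrightarrow> rh0 <= ta" if "ta \<in> A X" for ta
 proof
  assume s: "i ` rh0 <= i ` ta"
  show "rh0 <= ta"
  proof
   fix u assume u: "u \<in> rh0"
   then have "i u \<in> i ` ta" "u \<in> \<Union>(A {0..n})" using s v[OF r0(1)] by blast+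
   then show "u \<in> ta" using inj_on_image_mem_iff[OF i _ v[OF that]] by blast
  qed
 qed blast
 then have "{ta \<in> A X. rh <= i ` ta} = {ta \<in> A X. rh0 <= ta}" unfolding r0(2) by blast
 then show "\<exists>e. bal e (ord {ta \<in> A X. rh <= i ` ta})" using up_ball[OF bal_bs[OF SS_bal[OF S X]] r0(1)] by auto
qed simp

lemma cel_iso':
 fixes A :: "nat set => 'm::infinite set set" and B :: "nat set => 'b::infinite set set"
 assumes S: "SS n A" and i: "\<And>v. v \<in> \<Union>(A {0..n}) ==> j (i v) = v" and B: "\<And>X. X <= {0..n} ==> B X = im i (A X)"
 shows "cel n A B i" "cel n B A j"
proof -
 have inj: "inj_on i (\<Union>(A {0..n}))" by (rule inj_on_inverseI[of _ j]) (rule i)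
 show 1: "cel n A B i" using cel_iso[OF S inj] cel_ext[of n A A "%X. im i (A X)" B i] B by simp
 have SB: "SS n B" by (rule celD(2)[OF 1])
 have injj: "inj_on j (\<Union>(B {0..n}))" using B[of "{0..n}"] i by (simp add: Union_im inj_on_def)
 have "im j (B X) = A X" if "X <= {0..n}" for X
 proof -
  have "im (%v. j (i v)) (A X) = A X" by (rule im_fix) (use i SS_verts[OF S that] in blast)
  then show ?thesis unfolding B[OF that] by (simp add: image_image)
 qed
 then show "cel n B A j" using cel_iso[OF SB injj] cel_ext[of n B B "%X. im j (B X)" A j] by simp
qed

section \<open>Cellularity along labelled paths\<close>

lemma lmvE:
 assumes "lmv l \<pi> K K'"
 obtains si a x where "cx K" "si \<in> K" "x \<in> si" "a ~: \<Union>K" "l a = \<Union>(l ` si)" "\<pi> (l x) = \<pi> (l a)" "K' = st si a K"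
 using assms unfolding lmv_def by blast

text \<open>The map read off from labels is unchanged by the retraction, so one direction is
  composition with it and the other is cancellation.\<close>

lemma lmv_cel:
 fixes K :: "'w::infinite set set" and C :: "nat set => 'p::infinite set set"
 assumes D: "strat n D" and m: "lmv l \<pi> K K'"
 shows "cel n (fam l D K) C (%v. \<pi> (l v)) \<longleftrightarrow> cel n (fam l D K') C (%v. \<pi> (l v))"
proof -
 obtain si a x where *: "cx K" "si \<in> K" "x \<in> si" "a ~: \<Union>K" "l a = \<Union>(l ` si)" and p: "\<pi> (l x) = \<pi> (l a)" and K': "K' = st si a K"
  using m by (rule lmvE)
 let ?r = "%v. if v = a then x else v"
 have h: "(%v. \<pi> (l (?r v))) = (%v. \<pi> (l v))" using p by auto
 show ?thesis
 proof
  assume c: "cel n (fam l D K) C (%v. \<pi> (l v))"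
  have "cel n (fam l D K') (fam l D K) ?r" unfolding K' by (rule retraction_cel[OF D * celD(1)[OF c]])
  from cel_comp[OF this c] show "cel n (fam l D K') C (%v. \<pi> (l v))" unfolding h .
 next
  assume c: "cel n (fam l D K') C (%v. \<pi> (l v))"
  have "SS n (fam l D K)" using SS_fam_st[where l = l, OF D *] celD(1)[OF c] unfolding K' by simp
  then have r: "cel n (fam l D K') (fam l D K) ?r" unfolding K' by (rule retraction_cel[OF D *])
  show "cel n (fam l D K) C (%v. \<pi> (l v))" by (rule cel_comp_rev[OF r]) (simp only: h c)
 qed
qed

lemma path_cel:
 fixes K :: "'w::infinite set set" and C :: "nat set => 'p::infinite set set"
 assumes D: "strat n D" and m: "equivclp (lmv l \<pi>) K K'" and c: "cel n (fam l D K) C (%v. \<pi> (l v))"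
 shows "cel n (fam l D K') C (%v. \<pi> (l v))"
 using m
proof (induction rule: equivclp_induct)
 case (step y z)
 from step(2) show ?case
 proof
  assume "lmv l \<pi> y z" then show ?thesis using lmv_cel[OF D, of l \<pi> y z C] step(3) by simp
 next
  assume "lmv l \<pi> z y" then show ?thesis using lmv_cel[OF D, of l \<pi> z y C] step(3) by simp
 qed
qed (rule c)

lemma strat_SS: "SS n A ==> strat n (%X s. s \<in> A X)"
 unfolding strat_def
proof (intro conjI allI impI)
 fix X s t assume S: "SS n A" and X: "X <= {0..n}"
 show "{} \<in> A X" by (rule cx_empty[OF SS_cx[OF S X]])
 show "t \<in> A X" if "s \<in> A X" "t <= s" by (rule cx_sub[OF SS_cx[OF S X] that])
next
 fix X Y s assume S: "SS n A" and "X <= {0..n}" "Y <= {0..n}"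
 then have "A (X Int Y) = A X Int A Y" by (intro SS_Int)
 then show "(s \<in> A (X Int Y)) = (s \<in> A X & s \<in> A Y)" by simp
qed

text \<open>Label each vertex of \<open>K1\<close> by the face of \<open>A\<close> that carries it.
  Alexander's trick on the subcomplexes carried by single faces ends at the barycentric subdivision
  of \<open>A\<close>. Along the way the map read off from labels is the identity of
  \<open>K1\<close> at the start and \<open>\<pi>\<close> at the end.\<close>

theorem carrier_cel:
 fixes A :: "nat set => 'v::infinite set set" and c :: "'v => 'v set"
 assumes S: "SS n A" and K1: "cx K1"
  and c1: "\<And>ka. ka \<in> K1 ==> ka ~= {} ==> \<Union>(c ` ka) \<in> A {0..n} - {{}} & (\<exists>x\<in>ka. \<pi> (c x) = \<pi> (\<Union>(c ` ka)))"
  and c2: "\<And>q. q \<in> A {0..n} - {{}} ==> (\<exists>d. bal d {ka \<in> K1. \<Union>(c ` ka) <= q}) &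
   mb {ka \<in> K1. \<Union>(c ` ka) <= q} = {ka \<in> K1. ka = {} \<or> \<Union>(c ` ka) < q}"
  and c3: "\<And>v. v \<in> \<Union>K1 ==> \<pi> (c v) = v"
  and S1: "SS n (%X. {ka \<in> K1. \<Union>(c ` ka) \<in> A X})"
 shows "cel n (%X. ord (A X - {{}})) (%X. {ka \<in> K1. \<Union>(c ` ka) \<in> A X}) \<pi>"
proof -
 define e where "e v = (v, c v)" for v
 let ?Q = "A {0..n} - {{}}" and ?D = "%X s. s \<in> A X" and ?K1 = "%X. {ka \<in> K1. \<Union>(c ` ka) \<in> A X}"
 note D = strat_SS[OF S]
 have ie: "inj_on e V" for V by (auto simp: e_def inj_on_def)
 have se: "snd ` e ` ka = c ` ka" for ka by (simp add: e_def image_image)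
 have finQ: "finite ?Q" using cx_finite[OF SS_cx[OF S subset_refl]] by simp
 from fresh_vertex[OF cx_finite_vertices[OF K1]] obtain b where b: "b ~: \<Union>K1" ..
 have path: "equivclp (lmv snd \<pi>) (im e K1) (im (Pair b) (ord ?Q))"
  unfolding im_Pair_ord[OF finQ, symmetric]
 proof (rule alexander_trick[OF cx_im[OF K1] finQ])
  fix ka assume k: "ka \<in> im e K1" "ka ~= {}"
  then obtain ka0 where k0: "ka0 \<in> K1" "ka = e ` ka0" "ka0 ~= {}" by blast
  obtain x where x: "x \<in> ka0" "\<pi> (c x) = \<pi> (\<Union>(c ` ka0))" using c1[OF k0(1,3)] by blast
  have "e x \<in> ka" "snd (e x) = c x" using x(1) k0(2) by (simp_all add: e_def)
  then show "\<Union>(snd ` ka) \<in> ?Q & (\<exists>x\<in>ka. \<pi> (snd x) = \<pi> (\<Union>(snd ` ka)))"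
   unfolding k0(2) se using c1[OF k0(1,3)] x(2) by metis
 next
  fix q assume q: "q \<in> ?Q"
  let ?C = "{ka \<in> K1. \<Union>(c ` ka) <= q}"
  have 1: "{ka \<in> im e K1. \<Union>(snd ` ka) <= q} = im e ?C"
   "{ka \<in> im e K1. ka = {} \<or> \<Union>(snd ` ka) < q} = im e {ka \<in> K1. ka = {} \<or> \<Union>(c ` ka) < q}"
  proof -
   have gen: "{ka \<in> im e K1. R ka} = im e {ka \<in> K1. R (e ` ka)}" for R by blast
   show "{ka \<in> im e K1. \<Union>(snd ` ka) <= q} = im e ?C"
    "{ka \<in> im e K1. ka = {} \<or> \<Union>(snd ` ka) < q} = im e {ka \<in> K1. ka = {} \<or> \<Union>(c ` ka) < q}"
    unfolding gen se image_is_empty by (rule refl)+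
  qed
  obtain d where d: "bal d ?C" using c2[OF q] by blast
  have "bal d (im e ?C)" using bal_im[OF bal_cx[OF d] ie] d by simp
  from bsD(1)[OF bal_bs[OF this]]
  show "Gw {ka \<in> im e K1. \<Union>(snd ` ka) <= q} {ka \<in> im e K1. ka = {} \<or> \<Union>(snd ` ka) < q}"
   unfolding 1 mb_im[OF bal_cx[OF d] ie] using c2[OF q] by simp
 next
  fix q :: "'v set" show "infinite {w :: 'v \<times> 'v set. snd w = q}" by (rule infinite_snd)
  show "snd (b, q) = q" by simp
  show "Pair b ` ?Q Int \<Union>(im e K1) = {}" using b unfolding Union_im by (auto simp: e_def)
 qed
 have f1: "fam snd ?D (im e K1) X = im e (?K1 X)" for X using se by (auto simp: fam_def)
 have v1: "\<pi> (snd (e v)) = v" if "v \<in> \<Union>(?K1 {0..n})" for v using c3[of v] that by (auto simp: e_def)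
 have "cel n (fam snd ?D (im e K1)) ?K1 (%v. \<pi> (snd v))"
  by (rule cel_iso'(2)[OF S1, where i = e]) (use v1 f1 in auto)
 from path_cel[OF D path this] have c: "cel n (fam snd ?D (im (Pair b) (ord ?Q))) ?K1 (%v. \<pi> (snd v))" .
 let ?F = "%X. ord (A X - {{}})"
 have f2: "fam snd ?D (im (Pair b) (ord ?Q)) X = im (Pair b) (?F X)" if X: "X <= {0..n}" for X
 proof -
  have "\<Union>C \<in> A X \<longleftrightarrow> C <= A X" if C: "C \<in> ord ?Q" for C
  proof (cases "C = {}")
   case True then show ?thesis using cx_empty[OF SS_cx[OF S X]] by simp
  next
   case False
   have "\<And>u. u \<in> C ==> u <= \<Union>C" by blast
   then show ?thesis using cx_sub[OF SS_cx[OF S X]] ord_ends(1)[OF C False] by blast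
  qed
  then have "{C \<in> ord ?Q. \<Union>C \<in> A X} = {C \<in> ord ?Q. C <= A X}" by blast
  also have "\<dots> = ?F X" using SS_mono[OF S X subset_refl] by (auto simp: ord_def)
  finally have "{C \<in> ord ?Q. \<Union>C \<in> A X} = ?F X" .
  moreover have sn: "snd ` Pair b ` C = C" for C :: "'v set set" by (simp add: image_image)
  moreover have "{ka \<in> im (Pair b) (ord ?Q). R ka} = im (Pair b) {ka \<in> ord ?Q. R (Pair b ` ka)}" for R by blast
  ultimately show ?thesis unfolding fam_def by (simp only:)
 qed
 have SF: "SS n ?F"
 proof -
  have "SS n (%X. im snd (fam snd ?D (im (Pair b) (ord ?Q)) X))"
  proof (rule SS_im[OF celD(1)[OF c]])
   show "inj_on snd (\<Union>(fam snd ?D (im (Pair b) (ord ?Q)) {0..n}))"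
    unfolding f2[OF subset_refl] Union_im by (auto simp: inj_on_def)
  qed
  moreover have "im snd (fam snd ?D (im (Pair b) (ord ?Q)) X) = ?F X" if "X <= {0..n}" for X
   unfolding f2[OF that] by (simp add: image_image)
  ultimately show ?thesis using SS_ext[of n "%X. im snd (fam snd ?D (im (Pair b) (ord ?Q)) X)" ?F] by simp
 qed
 have "cel n ?F (fam snd ?D (im (Pair b) (ord ?Q))) (Pair b)"
  by (rule cel_iso'(1)[OF SF, where j = snd]) (use f2 in auto)
 from cel_comp[OF this c] show ?thesis by simp
qed

section \<open>Selections are cellular\<close>

definition sdF :: "(nat set => 'v set set) => nat set => 'v set set set" where
 "sdF A X = ord (A X - {{}})"

text \<open>The carrier of a vertex is the vertex itself, and the cells are the simplexes of
  \<open>A\<close>.\<close>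

theorem selection_cel:
 fixes A :: "nat set => 'v::infinite set set"
 assumes S: "SS n A" and s: "\<And>ta. ta \<in> A {0..n} ==> ta ~= {} ==> s ta \<in> ta"
 shows "cel n (sdF A) A s"
proof -
 let ?T = "A {0..n}"
 have cT: "cx ?T" by (rule SS_cx[OF S subset_refl])
 have u: "\<Union>((%v. {v}) ` ka) = ka" for ka :: "'v set" by blast
 have e: "{ka \<in> ?T. \<Union>((%v. {v}) ` ka) \<in> A X} = A X" if "X <= {0..n}" for X
  unfolding u using SS_mono[OF S that subset_refl] by blast
 have s1: "s {v} = v" if "{v} \<in> ?T" for v using s[OF that] by simp
 have "cel n (%X. ord (A X - {{}})) (%X. {ka \<in> ?T. \<Union>((%v. {v}) ` ka) \<in> A X}) s"
 proof (rule carrier_cel[OF S cT])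
  fix ka assume k: "ka \<in> ?T" "ka ~= {}"
  have "{s ka} \<in> ?T" using cx_sub[OF cT k(1)] s[OF k] by blast
  then show "\<Union>((%v. {v}) ` ka) \<in> ?T - {{}} & (\<exists>x\<in>ka. s {x} = s (\<Union>((%v. {v}) ` ka)))"
   unfolding u using k s[OF k] s1[of "s ka"] by blast
 next
  fix q assume q: "q \<in> ?T - {{}}"
  have fq: "finite q" "q ~= {}" using q cx_face_finite[OF cT] by auto
  have 1: "{ka \<in> ?T. \<Union>((%v. {v}) ` ka) <= q} = Pow q" unfolding u using cx_sub[OF cT] q by blast
  have 2: "{ka \<in> ?T. ka = {} \<or> \<Union>((%v. {v}) ` ka) < q} = bd q"
   unfolding u bd_def using cx_sub[OF cT] q by blast
  show "(\<exists>d. bal d {ka \<in> ?T. \<Union>((%v. {v}) ` ka) <= q}) &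
   mb {ka \<in> ?T. \<Union>((%v. {v}) ` ka) <= q} = {ka \<in> ?T. ka = {} \<or> \<Union>((%v. {v}) ` ka) < q}"
   unfolding 1 2 using bal_Pow[OF fq] bs_Pow(2)[OF fq] by blast
 next
  fix v assume "v \<in> \<Union>?T"
  then show "s {v} = v" using s1 cx_vertex[OF cT, of v] by simp
 next
  show "SS n (%X. {ka \<in> ?T. \<Union>((%v. {v}) ` ka) \<in> A X})"
   using SS_ext[of n "%X. {ka \<in> ?T. \<Union>((%v. {v}) ` ka) \<in> A X}" A] e S by simp
 qed
 moreover have "sdF A = (%X. ord (A X - {{}}))" by (simp add: sdF_def fun_eq_iff)
 ultimately show ?thesis
  using cel_ext[of n "sdF A" "sdF A" "%X. {ka \<in> ?T. \<Union>((%v. {v}) ` ka) \<in> A X}" A s] e by simp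
qed

lemma SS_sdF:
 fixes A :: "nat set => 'v::infinite set set"
 assumes "SS n A" shows "SS n (sdF A)"
proof -
 have "cel n (sdF A) A (%ta. SOME x. x \<in> ta)" by (rule selection_cel[OF assms]) (simp add: some_in_eq)
 then show ?thesis by (rule celD(1))
qed

text \<open>The new vertex \<open>a\<close> is carried by \<open>si\<close>, and the cells are the
  simplexes of \<open>A\<close>, starred where they contain \<open>si\<close>. The map
  \<open>q\<close> is what a selection becomes when it is factored through the starred
  complex.\<close>

theorem star_selection_cel:
 fixes A :: "nat set => 'v::infinite set set"
 assumes S: "SS n A" and s: "si \<in> A {0..n}" "si ~= {}" "a ~: \<Union>(A {0..n})"
  and S1: "SS n (%X. st si a (A X))"
  and q1: "\<And>ta. ta \<in> A {0..n} ==> si <= ta ==> q ta = a"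
  and q2: "\<And>ta. ta \<in> A {0..n} ==> ~ si <= ta ==> ta ~= {} ==> q ta \<in> ta"
 shows "cel n (sdF A) (%X. st si a (A X)) q"
proof -
 let ?T = "A {0..n}"
 define c where "c v = (if v = a then si else {v})" for v
 let ?K = "st si a ?T"
 have cT: "cx ?T" by (rule SS_cx[OF S subset_refl])
 have as: "a ~: si" using s(1,3) by blast
 have u: "\<Union>(c ` ka) = (if a \<in> ka then ka - {a} Un si else ka)" for ka by (auto simp: c_def)
 have aA: "a ~: \<Union>(A X)" if "X <= {0..n}" for X using s(3) SS_verts[OF S that] by blast
 have uK: "\<Union>(c ` ka) \<in> ?T" if "ka \<in> ?K" for ka unfolding u using that by (auto simp: st_def)
 have e: "{ka \<in> ?K. \<Union>(c ` ka) \<in> A X} = st si a (A X)" if X: "X <= {0..n}" for X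
  unfolding u st_def using SS_mono[OF S X subset_refl] by auto
 have "cel n (%X. ord (A X - {{}})) (%X. {ka \<in> ?K. \<Union>(c ` ka) \<in> A X}) q"
 proof (rule carrier_cel[OF S cx_st[OF cT s(1,2)]])
  fix ka assume k: "ka \<in> ?K" "ka ~= {}"
  have kT: "\<Union>(c ` ka) \<in> ?T" by (rule uK[OF k(1)])
  show "\<Union>(c ` ka) \<in> ?T - {{}} & (\<exists>x\<in>ka. q (c x) = q (\<Union>(c ` ka)))"
  proof (cases "a \<in> ka")
   case True
   then have "si <= \<Union>(c ` ka)" by (auto simp: u)
   then have "q (\<Union>(c ` ka)) = a" "\<Union>(c ` ka) ~= {}" using q1[OF kT] s(2) by auto
   moreover have "q (c a) = a" using q1[OF s(1)] by (simp add: c_def)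
   ultimately show ?thesis using True kT by (intro conjI bexI[of _ a]) simp_all
  next
   case False
   then have c: "\<Union>(c ` ka) = ka" by (simp add: u)
   have n: "~ si <= ka" using k(1) by (simp add: st_def)
   have qk: "q ka \<in> ka" using q2[OF _ n k(2)] kT unfolding c by simp
   have "{q ka} \<in> ?T" using cx_sub[OF cT, of ka] kT qk unfolding c by blast
   moreover have "~ si <= {q ka}" using n qk by blast
   ultimately have "q {q ka} \<in> {q ka}" using q2 by blast
   moreover have "q ka ~= a" using qk False by blast
   ultimately have "q (c (q ka)) = q ka" by (simp add: c_def)
   then show ?thesis using qk kT k(2) unfolding c by blast
  qed
 next
  fix p assume p: "p \<in> ?T - {{}}"
  have fp: "finite p" "p ~= {}" using p cx_face_finite[OF cT] by auto
  have ap: "a ~: p" using p s(3) by blast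
  have 1: "{ka \<in> ?K. \<Union>(c ` ka) <= p} = st si a (Pow p)"
   unfolding u st_def using cx_sub[OF cT] p by auto
  have 2: "{ka \<in> ?K. ka = {} \<or> \<Union>(c ` ka) < p} = st si a (bd p)"
  proof (rule set_eqI)
   fix ka
   have "ka \<in> st si a (bd p) \<longleftrightarrow> ~ si <= ka & \<Union>(c ` ka) < p" unfolding u st_def bd_def by auto
   moreover have "ka \<in> ?K \<longleftrightarrow> ~ si <= ka & \<Union>(c ` ka) \<in> ?T" unfolding u st_def by auto
   moreover have "\<Union>(c ` ka) \<in> ?T" if "\<Union>(c ` ka) < p" using cx_sub[OF cT, of p] p that by blast
   moreover have "\<Union>(c ` ka) < p" if "ka = {}" unfolding that using fp(2) by auto
   ultimately show "ka \<in> {ka \<in> ?K. ka = {} \<or> \<Union>(c ` ka) < p} \<longleftrightarrow> ka \<in> st si a (bd p)" by blast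
  qed
  have "a ~: \<Union>(Pow p)" using ap by simp
  from mb_st[OF cx_Pow[OF fp(1)] s(2) this disjI1[OF bs_Pow(1)[OF fp]]]
  have "bs (int (card p) - 1) (st si a (Pow p))" "mb (st si a (Pow p)) = st si a (bd p)"
   unfolding bs_Pow(2)[OF fp] by blast+
  then show "(\<exists>d. bal d {ka \<in> ?K. \<Union>(c ` ka) <= p}) &
   mb {ka \<in> ?K. \<Union>(c ` ka) <= p} = {ka \<in> ?K. ka = {} \<or> \<Union>(c ` ka) < p}"
   unfolding 1 2 using bs_bal by blast
 next
  fix v assume "v \<in> \<Union>?K"
  then have vK: "{v} \<in> ?K" using cx_vertex[OF cx_st[OF cT s(1,2)], of v] by simp
  show "q (c v) = v"
  proof (cases "v = a")
   case True then show ?thesis using q1[OF s(1)] by (simp add: c_def)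
  next
   case False
   then have "{v} \<in> ?T" "~ si <= {v}" using vK by (simp_all add: st_def)
   then show ?thesis using q2[of "{v}"] False by (auto simp: c_def)
  qed
 next
  show "SS n (%X. {ka \<in> ?K. \<Union>(c ` ka) \<in> A X})"
   using SS_ext[of n "%X. {ka \<in> ?K. \<Union>(c ` ka) \<in> A X}" "%X. st si a (A X)"] e S1 by simp
 qed
 moreover have "sdF A = (%X. ord (A X - {{}}))" by (simp add: sdF_def fun_eq_iff)
 ultimately show ?thesis
  using cel_ext[of n "sdF A" "sdF A" "%X. {ka \<in> ?K. \<Union>(c ` ka) \<in> A X}" "%X. st si a (A X)" q] e by simp
qed

section \<open>Subdivided cellular maps\<close>

definition DL :: "nat set => (nat + 'n) set => bool" where
 "DL X s \<longleftrightarrow> {z. Inl z \<in> s} <= X"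

lemma strat_DL: "strat n DL"
 unfolding strat_def DL_def by blast

text \<open>The stratum of a chain is that of its largest member, so a bound on it bounds every
  member.\<close>

lemma fam_embd:
 assumes S: "SS n A" and X: "X <= {0..n}"
 shows "fam snd DL (im (embd n A g i) (ord (A {0..n} - {{}}))) X = im (embd n A g i) (sdF A X)"
proof -
 have "DL X (\<Union>(snd ` embd n A g i ` c)) \<longleftrightarrow> c <= A X" if c: "c \<in> ord (A {0..n} - {{}})" for c
 proof (cases "c = {}")
  case True then show ?thesis by (simp add: DL_def)
 next
  case False
  have c': "c <= A {0..n}" "finite c" "chain_subset c" using c by (auto simp: ord_def)
  have top: "\<Union>c \<in> c" by (rule chain_ends(1)[OF c'(2) False c'(3)])
  have "DL X (\<Union>(snd ` embd n A g i ` c)) \<longleftrightarrow> lab n A (\<Union>c) <= X"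
   unfolding embd_chain[OF S c' False] by (auto simp: DL_def enc_def)
  also have "\<dots> \<longleftrightarrow> \<Union>c \<in> A X" using lab_iff[OF S _ X] top c'(1) by blast
  also have "\<dots> \<longleftrightarrow> c <= A X"
  proof
   assume "\<Union>c \<in> A X"
   moreover have "\<And>u. u \<in> c ==> u <= \<Union>c" by blast
   ultimately show "c <= A X" using cx_sub[OF SS_cx[OF S X]] by blast
  qed (use top in blast)
  finally show ?thesis .
 qed
 then have "{c \<in> ord (A {0..n} - {{}}). DL X (\<Union>(snd ` embd n A g i ` c))} = {c \<in> ord (A {0..n} - {{}}). c <= A X}" by blast
 also have "\<dots> = sdF A X" using SS_mono[OF S X subset_refl] by (auto simp: ord_def sdF_def)
 finally show ?thesis unfolding fam_def by blast
qed

lemma sdF_verts: "\<Union>(sdF A X) = A X - {{}}"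
 by (simp add: sdF_def)

lemma labelled_path:
 fixes A :: "nat set => 'm::infinite set set" and B :: "nat set => 'n::infinite set set"
 assumes c: "cel n A B g"
 shows "\<exists>i :: 'm set => 'n set. inj_on i (A {0..n} - {{}}) &
  equivclp (lmv snd dec) (im (embd n B (%x. x) (%x. x)) (ord (B {0..n} - {{}}))) (im (embd n A g i) (ord (A {0..n} - {{}})))"
proof -
 let ?X = "{0..n}" and ?U = "B {0..n} - {{}}"
 have P: "{ta \<in> A ?X. g ` ta \<in> ?U} = A ?X - {{}}" using celD(3)[OF c subset_refl] by auto
 have "finite (A ?X - {{}})" using cx_finite[OF SS_cx[OF celD(1)[OF c] subset_refl]] by simp
 from ex_inj_on[OF this] obtain i :: "'m set => 'n set" where i: "inj_on i (A ?X - {{}})" by blast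
 have "equivclp (lmv snd dec) (im (embd n B (%x. x) (%x. x)) (ord ?U)) (im (embd n A g i) (ord {ta \<in> A ?X. g ` ta \<in> ?U}))"
 proof (rule upper_path[OF celD(1,2)[OF c] subset_refl])
  show "im g (A Z) = B Z" if "Z <= ?X" for Z using celD(3)[OF c that] .
  show "\<exists>e. bal e (ord {ta \<in> A Z. rh <= g ` ta})" if "Z <= ?X" "Z ~= {}" "rh \<in> ?U" "rh \<in> B Z" for Z rh
   using celD(4)[OF c that(1,2,4)] that(3) by blast
  show "inj_on i {ta \<in> A ?X. g ` ta \<in> ?U}" unfolding P by (rule i)
 qed auto
 then show ?thesis unfolding P using i by blast
qed

text \<open>Reading the target face off the labels is an isomorphism onto the subdivision of
  \<open>B\<close> at one end of the path and the subdivided map at the other;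
  \<open>path_cel\<close> connects them.\<close>

theorem sd_cel:
 fixes A :: "nat set => 'm::infinite set set" and B :: "nat set => 'n::infinite set set"
 assumes c: "cel n A B g"
 shows "cel n (sdF A) (sdF B) (%ta. g ` ta)"
proof -
 obtain i :: "'m set => 'n set" where i: "inj_on i (A {0..n} - {{}})" and
  p: "equivclp (lmv snd dec) (im (embd n B (%x. x) (%x. x)) (ord (B {0..n} - {{}}))) (im (embd n A g i) (ord (A {0..n} - {{}})))"
  using labelled_path[OF c] by blast
 let ?KB = "im (embd n B (%x. x) (%x. x)) (ord (B {0..n} - {{}}))" and ?KA = "im (embd n A g i) (ord (A {0..n} - {{}}))"
 note SA = celD(1)[OF c] and SB = celD(2)[OF c]
 have "cel n (fam snd DL ?KB) (sdF B) (%v. dec (snd v))"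
 proof (rule cel_iso'(2)[OF SS_sdF[OF SB], where i = "embd n B (%x. x) (%x. x)"])
  show "dec (snd (embd n B (%x. x) (%x. x) v)) = v" for v by (simp add: embd_def)
 qed (rule fam_embd[OF SB])
 from path_cel[OF strat_DL p this] have 1: "cel n (fam snd DL ?KA) (sdF B) (%v. dec (snd v))" .
 have inj: "inj_on (embd n A g i) (A {0..n} - {{}})" using i by (auto simp: inj_on_def embd_def)
 have "cel n (sdF A) (fam snd DL ?KA) (embd n A g i)"
 proof (rule cel_iso'(1)[OF SS_sdF[OF SA], where j = "the_inv_into (A {0..n} - {{}}) (embd n A g i)"])
  show "the_inv_into (A {0..n} - {{}}) (embd n A g i) (embd n A g i v) = v" if "v \<in> \<Union>(sdF A {0..n})" for v
   using the_inv_into_f_f[OF inj, of v] that unfolding sdF_verts .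
 qed (rule fam_embd[OF SA])
 from cel_comp[OF this 1] show ?thesis by (simp add: embd_def)
qed

subsection \<open>Domination by compositions of selections\<close>

instance vertex :: (type) infinite
proof
 have "infinite (range (Pt :: nat => 'a vertex))" using finite_imageD[of "Pt :: nat => 'a vertex" UNIV] by (auto simp: inj_on_def)
 then show "infinite (UNIV :: 'a vertex set)" using infinite_super[OF subset_UNIV] by metis
qed

definition unb :: "'a vertex => 'a vertex set" where
 "unb v = fset (bary_face v)"

lemma unb_bary: "finite si ==> unb (bary si) = si"
 by (simp add: unb_def bary_def Abs_fset_inverse)

definition sdA :: "(nat set => 'a vertex set set) => nat set => 'a vertex set set" where
 "sdA N X = im bary (sdF N X)"

lemma sdA_verts: "\<Union>(sdA N X) = bary ` (N X - {{}})"
 by (simp add: sdA_def Union_im sdF_verts)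

lemma sdA_iso:
 assumes S: "SS n N"
 shows "cel n (sdF N) (sdA N) bary" "cel n (sdA N) (sdF N) unb"
proof -
 have u: "unb (bary v) = v" if "v \<in> \<Union>(sdF N {0..n})" for v
  using that cx_face_finite[OF SS_cx[OF S subset_refl]] by (simp add: sdF_verts unb_bary)
 show "cel n (sdF N) (sdA N) bary" by (rule cel_iso'(1)[where i = bary and j = unb, OF SS_sdF[OF S] u]) (simp_all add: sdA_def)
 show "cel n (sdA N) (sdF N) unb" by (rule cel_iso'(2)[where i = bary and j = unb, OF SS_sdF[OF S] u]) (simp_all add: sdA_def)
qed

text \<open>\<open>M\<close> is an iterated subdivision of \<open>N\<close>, and \<open>w\<close> is
  a composite of selections leading back from \<open>M\<close> to \<open>N\<close>.\<close>

inductive selc :: "nat => (nat set => 'a vertex set set) => (nat set => 'a vertex set set) => ('a vertex => 'a vertex) => bool"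
 for n N where
 base: "selc n N N (%v. v)"
| step: "selc n N M w ==> (\<And>ta. ta \<in> M {0..n} ==> ta ~= {} ==> t (bary ta) \<in> ta) ==> selc n N (sdA M) (%v. w (t v))"

text \<open>The property carried along the path: some composite of selections factors as a cellular
  map into the family of \<open>K\<close>, followed by the map that reads the face off the
  label.\<close>

definition res :: "nat => (nat set => 'a vertex set set) => ('w \<times> (nat + 'a vertex) set) set set => bool" where
 "res n N K \<longleftrightarrow> (\<exists>M w g. selc n N M w & cel n M (fam snd DL K) g & (\<forall>v\<in>\<Union>(M {0..n}). bary (dec (snd (g v))) = w v))"

text \<open>Composing with the retraction leaves the face read off the label unchanged.\<close>

lemma res_unstar:
 fixes K :: "('w::infinite \<times> (nat + 'a vertex) set) set set"
 assumes m: "lmv snd dec K K'" and r: "res n N K'"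
 shows "res n N K"
proof -
 obtain si a x where *: "cx K" "si \<in> K" "x \<in> si" "a ~: \<Union>K" "snd a = \<Union>(snd ` si)" and p: "dec (snd x) = dec (snd a)" and K': "K' = st si a K"
  using m by (rule lmvE)
 let ?r = "%v. if v = a then x else v"
 obtain M w g where M: "selc n N M w" "cel n M (fam snd DL K') g" "\<And>v. v \<in> \<Union>(M {0..n}) ==> bary (dec (snd (g v))) = w v"
  using r unfolding res_def by blast
 have "SS n (fam snd DL K)" using SS_fam_st[OF strat_DL *] celD(2)[OF M(2)] unfolding K' by simp
 then have "cel n (fam snd DL K') (fam snd DL K) ?r" unfolding K' by (rule retraction_cel[OF strat_DL *])
 from cel_comp[OF M(2) this] have c: "cel n M (fam snd DL K) (%v. ?r (g v))" .
 have "dec (snd (?r u)) = dec (snd u)" for u using p by simp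
 then have "\<forall>v\<in>\<Union>(M {0..n}). bary (dec (snd (?r (g v)))) = w v" using M(3) by simp
 then show ?thesis unfolding res_def using M(1) c by blast
qed

text \<open>A selection on \<open>K\<close> factors through the starred complex; selections lift along simplicial maps.\<close>

lemma res_star:
 fixes K :: "('w::infinite \<times> (nat + 'a vertex) set) set set"
 assumes m: "lmv snd dec K K'" and r: "res n N K"
 shows "res n N K'"
proof -
 obtain si a x where *: "cx K" "si \<in> K" "x \<in> si" "a ~: \<Union>K" "snd a = \<Union>(snd ` si)" and p: "dec (snd x) = dec (snd a)" and K': "K' = st si a K"
  using m by (rule lmvE)
 let ?F = "fam snd DL K"
 obtain M w g where M: "selc n N M w" "cel n M ?F g" "\<And>v. v \<in> \<Union>(M {0..n}) ==> bary (dec (snd (g v))) = w v"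
  using r unfolding res_def by blast
 note SM = celD(1)[OF M(2)] and SF = celD(2)[OF M(2)]
 have e: "fam snd DL K' = (%X. st si a (?F X))" unfolding K' using fam_st[of snd a si DL K, OF *(5)] by (simp add: fun_eq_iff)
 have S': "SS n (fam snd DL K')" using SS_fam_st[OF strat_DL *] SF unfolding K' by simp
 have aF: "a ~: \<Union>(?F X)" for X using *(4) by (auto simp: fam_def)
 show ?thesis
 proof (cases "si \<in> ?F {0..n}")
  case False
  have "st si a (?F X) = ?F X" if X: "X <= {0..n}" for X
   by (rule st_notin[OF SS_cx[OF SF X] _ aF]) (use False SS_mono[OF SF X subset_refl] in blast)
  then have "cel n M (fam snd DL K') g" using M(2) cel_ext[of n M M ?F "fam snd DL K'" g] unfolding e by simp
  then show ?thesis unfolding res_def using M(1,3) by blast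
 next
  case True
  \<comment> \<open>The map \<open>q\<close> goes to the starred complex; followed by the retraction
    it becomes the selection \<open>t\<close>. Both read the same face off the label.\<close>
  define q where "q ta = (if si <= ta then a else SOME y. y \<in> ta)" for ta
  define t where "t ta = (if si <= ta then x else SOME y. y \<in> ta)" for ta
  have some: "(SOME y. y \<in> ta) \<in> ta" if "ta ~= {}" for ta :: "('w \<times> (nat + 'a vertex) set) set" using that by (simp add: some_in_eq)
  have tt: "t ta \<in> ta" if "ta ~= {}" for ta using some[OF that] *(3) by (auto simp: t_def)
  have qt: "dec (snd (q ta)) = dec (snd (t ta))" for ta using p by (simp add: q_def t_def)
  have ne: "si ~= {}" using *(3) by blast
  have "cel n (sdF ?F) (%X. st si a (?F X)) q"
   by (rule star_selection_cel[OF SF True ne aF S'[unfolded e]]) (use some in \<open>simp_all add: q_def\<close>)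
  from cel_comp[OF cel_comp[OF sdA_iso(2)[OF SM] sd_cel[OF M(2)]] this]
  have c: "cel n (sdA M) (fam snd DL K') (%v. q (g ` unb v))" unfolding e .
  \<comment> \<open>The lift of \<open>t\<close> along \<open>g\<close>: in each face of
    \<open>M\<close> a vertex is selected over the one that \<open>t\<close> selects in the image
    face.\<close>
  define t' where "t' v = (SOME y. y \<in> unb v & g y = t (g ` unb v))" for v
  have cM: "cx (M {0..n})" by (rule SS_cx[OF SM subset_refl])
  have t': "t' (bary ta) \<in> ta & g (t' (bary ta)) = t (g ` ta)" if "ta \<in> M {0..n}" "ta ~= {}" for ta
  proof -
   have u: "unb (bary ta) = ta" using cx_face_finite[OF cM that(1)] by (rule unb_bary)
   have "t (g ` ta) \<in> g ` ta" using that(2) by (intro tt) simp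
   then have "\<exists>y. y \<in> ta & g y = t (g ` ta)" by force
   from someI_ex[OF this] show ?thesis unfolding t'_def u .
  qed
  have s: "selc n N (sdA M) (%v. w (t' v))" by (rule selc.step[OF M(1)]) (use t' in blast)
  have "bary (dec (snd (q (g ` unb v)))) = w (t' v)" if v: "v \<in> \<Union>(sdA M {0..n})" for v
  proof -
   obtain ta where ta: "ta \<in> M {0..n}" "ta ~= {}" "v = bary ta" using v unfolding sdA_verts by blast
   have u: "unb v = ta" unfolding ta(3) using cx_face_finite[OF cM ta(1)] by (rule unb_bary)
   have "t' v \<in> \<Union>(M {0..n})" using t'[OF ta(1,2)] ta(1,3) by blast
   from M(3)[OF this] show ?thesis unfolding qt u using t'[OF ta(1,2)] ta(3) by simp
  qed
  then show ?thesis unfolding res_def using s c by blast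
 qed
qed

lemma res_path:
 fixes K :: "('w::infinite \<times> (nat + 'a vertex) set) set set"
 assumes "equivclp (lmv snd dec) K K'" "res n N K" shows "res n N K'"
 using assms(1)
proof (induction rule: equivclp_induct)
 case (step y z)
 from step(2) show ?case using res_star[OF _ step(3)] res_unstar[OF _ step(3)] by blast
qed (rule assms(2))

text \<open>At the \<open>B\<close> end of the path the identity has the property
  \<open>res\<close>; at the \<open>A\<close> end the property is the required factorisation, one
  subdivision up.\<close>

theorem selection_domination:
 fixes A B :: "nat set => 'a vertex set set"
 assumes c: "cel n A B f"
 shows "\<exists>M w g. selc n (sdA B) M w & cel n M (sdA A) g & (\<forall>v\<in>\<Union>(M {0..n}). bary (f ` unb (g v)) = w v)"
proof -
 obtain i :: "'a vertex set => 'a vertex set" where i: "inj_on i (A {0..n} - {{}})" and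
  p: "equivclp (lmv snd dec) (im (embd n B (%x. x) (%x. x)) (ord (B {0..n} - {{}}))) (im (embd n A f i) (ord (A {0..n} - {{}})))"
  using labelled_path[OF c] by blast
 let ?eB = "embd n B (%x. x) (%x. x)" and ?eA = "embd n A f i"
 let ?KB = "im ?eB (ord (B {0..n} - {{}}))" and ?KA = "im ?eA (ord (A {0..n} - {{}}))"
 note SA = celD(1)[OF c] and SB = celD(2)[OF c]
 have "cel n (sdF B) (fam snd DL ?KB) ?eB"
 proof (rule cel_iso'(1)[OF SS_sdF[OF SB], where j = "%v. dec (snd v)"])
  show "dec (snd (embd n B (%x. x) (%x. x) v)) = v" for v by (simp add: embd_def)
 qed (rule fam_embd[OF SB])
 from cel_comp[OF sdA_iso(2)[OF SB] this] have 1: "cel n (sdA B) (fam snd DL ?KB) (%v. ?eB (unb v))" .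
 have "bary (dec (snd (?eB (unb v)))) = v" if "v \<in> \<Union>(sdA B {0..n})" for v
 proof -
  obtain ta where "ta \<in> B {0..n}" "v = bary ta" using \<open>v \<in> _\<close> unfolding sdA_verts by blast
  then show ?thesis using unb_bary[OF cx_face_finite[OF SS_cx[OF SB subset_refl]]] by (simp add: embd_def)
 qed
 then have "res n (sdA B) ?KB" unfolding res_def using selc.base 1 by blast
 from res_path[OF p this] obtain M w g where M: "selc n (sdA B) M w" "cel n M (fam snd DL ?KA) g"
  "\<And>v. v \<in> \<Union>(M {0..n}) ==> bary (dec (snd (g v))) = w v" unfolding res_def by blast
 define j where "j = the_inv_into (A {0..n} - {{}}) ?eA"
 have inj: "inj_on ?eA (A {0..n} - {{}})" using i by (auto simp: inj_on_def embd_def)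
 have ji: "j (?eA ta) = ta" if "ta \<in> A {0..n} - {{}}" for ta unfolding j_def by (rule the_inv_into_f_f[OF inj that])
 have "cel n (fam snd DL ?KA) (sdF A) j"
 proof (rule cel_iso'(2)[OF SS_sdF[OF SA], where i = ?eA])
  show "j (?eA ta) = ta" if "ta \<in> \<Union>(sdF A {0..n})" for ta using ji[of ta] that unfolding sdF_verts .
 qed (rule fam_embd[OF SA])
 from cel_comp[OF M(2) cel_comp[OF this sdA_iso(1)[OF SA]]] have 2: "cel n M (sdA A) (%v. bary (j (g v)))" .
 have "bary (f ` unb (bary (j (g v)))) = w v" if v: "v \<in> \<Union>(M {0..n})" for v
 proof -
  have "g v \<in> \<Union>(im g (M {0..n}))" using v by blast
  then have "g v \<in> ?eA ` (A {0..n} - {{}})" unfolding celD(3)[OF M(2) subset_refl] fam_embd[OF SA subset_refl] Union_im sdF_verts .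
  then obtain ta where t: "ta \<in> A {0..n} - {{}}" "g v = ?eA ta" by blast
  have "unb (bary ta) = ta" using t(1) cx_face_finite[OF SS_cx[OF SA subset_refl]] by (simp add: unb_bary)
  then show ?thesis using M(3)[OF v] ji[OF t(1)] unfolding t(2) by (simp add: embd_def)
 qed
 then show ?thesis using M(1) 2 by blast
qed

subsection \<open>Stellar theory without the empty face\<close>

lemma abs_cx: "abs_complex K \<longleftrightarrow> cx (insert {} K) & {} ~: K"
proof
 assume a: "abs_complex K"
 have f: "finite K" "\<And>si. si \<in> K ==> finite si & si ~= {}"
  "\<And>si ta. si \<in> K ==> ta <= si ==> ta ~= {} ==> ta \<in> K"
  using a unfolding Defs.abs_complex_def by blast+
 have "ta \<in> insert {} K" if "si \<in> insert {} K" "ta <= si" for si ta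
  using that f(3)[of si ta] by (cases "ta = {}") auto
 moreover have "finite si" if "si \<in> insert {} K" for si using that f(2)[of si] by auto
 moreover have "{} ~: K" using f(2)[of "{}"] by blast
 ultimately show "cx (insert {} K) & {} ~: K" using f(1) unfolding cx_def by simp
next
 assume "cx (insert {} K) & {} ~: K"
 then have c: "cx (insert {} K)" "{} ~: K" by blast+
 show "abs_complex K" unfolding Defs.abs_complex_def
 proof (intro conjI ballI allI impI)
  show "finite K" using cx_finite[OF c(1)] by simp
  fix si assume s: "si \<in> K"
  show "finite si" using cx_face_finite[OF c(1)] s by simp
  show "si ~= {}" using s c(2) by blast
  fix ta assume "ta <= si & ta ~= {}"
  then show "ta \<in> K" using cx_sub[OF c(1), of si ta] s by blast
 qed
qed

lemma starring_st:
 assumes K: "abs_complex K" "si \<in> K" "a ~: \<Union>K"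
 shows "insert {} (starring K si a) = st si a (insert {} K)" "{} ~: starring K si a"
proof -
 have c: "cx (insert {} K)" "{} ~: K" using K(1) unfolding abs_cx by blast+
 have s: "si ~= {}" "finite si" using K(2) c(2) cx_face_finite[OF c(1)] by auto
 have as: "a ~: si" using K(2,3) by blast
 let ?J = "join (simplex_boundary si) (link K si)"
 have bd: "\<beta> \<in> insert {} (simplex_boundary si) \<longleftrightarrow> \<beta> < si" for \<beta>
  using s by (auto simp: simplex_boundary_def full_simplex_def intro: finite_subset)
 have J: "\<beta> \<in> insert {} ?J \<longleftrightarrow> ~ si <= \<beta> & \<beta> Un si \<in> K" for \<beta>
 proof
  assume "\<beta> \<in> insert {} ?J"
  then obtain \<beta>1 \<beta>2 where b: "\<beta> = \<beta>1 Un \<beta>2" "\<beta>1 < si" "\<beta>2 \<in> insert {} (link K si)"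
   unfolding join_def bd[symmetric] by blast
  have "\<beta>2 Int si = {}" "\<beta>2 Un si \<in> K" using b(3) K(2) by (auto simp: link_def)
  moreover have "\<beta> Un si = \<beta>2 Un si" using b(1,2) by blast
  ultimately show "~ si <= \<beta> & \<beta> Un si \<in> K" using b(1,2) by auto
 next
  assume b: "~ si <= \<beta> & \<beta> Un si \<in> K"
  have "\<beta> - si \<in> insert {} K" using cx_sub[OF c(1), of "\<beta> Un si" "\<beta> - si"] b by blast
  moreover have "(\<beta> - si) Un si = \<beta> Un si" "(\<beta> - si) Int si = {}" by blast+
  ultimately have "\<beta> - si \<in> insert {} (link K si)" using b by (simp add: link_def)
  moreover have "\<beta> Int si \<in> insert {} (simplex_boundary si)" unfolding bd using b by blast
  moreover have "\<beta> = (\<beta> Int si) Un (\<beta> - si)" by blast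
  ultimately show "\<beta> \<in> insert {} ?J" unfolding join_def by blast
 qed
 have fa: "\<alpha> \<in> insert {} (full_simplex {a}) \<longleftrightarrow> \<alpha> = {} \<or> \<alpha> = {a}" for \<alpha> by (auto simp: full_simplex_def)
 have aJ: "a ~: \<beta>" if "\<beta> \<in> insert {} ?J" for \<beta> using that K(3) unfolding J by blast
 have S: "rh \<in> starring K si a \<longleftrightarrow> rh ~= {} & ((rh \<in> K & ~ si <= rh) \<or> rh - {a} \<in> insert {} ?J)" for rh
 proof -
  have "rh \<in> join (full_simplex {a}) ?J \<longleftrightarrow> rh ~= {} & rh - {a} \<in> insert {} ?J"
  proof
   assume "rh \<in> join (full_simplex {a}) ?J"
   then obtain \<alpha> \<beta> where ab: "rh = \<alpha> Un \<beta>" "\<alpha> = {} \<or> \<alpha> = {a}" "\<beta> \<in> insert {} ?J" "rh ~= {}"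
    unfolding join_def[of "full_simplex {a}"] fa[symmetric] by blast
   have "rh - {a} = \<beta>" using ab(1,2) aJ[OF ab(3)] by auto
   then show "rh ~= {} & rh - {a} \<in> insert {} ?J" using ab by simp
  next
   assume r: "rh ~= {} & rh - {a} \<in> insert {} ?J"
   have "rh = (rh Int {a}) Un (rh - {a})" by blast
   moreover have "rh Int {a} \<in> insert {} (full_simplex {a})" unfolding fa by blast
   ultimately show "rh \<in> join (full_simplex {a}) ?J" using r unfolding join_def[of "full_simplex {a}"] by blast
  qed
  then show ?thesis unfolding starring_def using c(2) by blast
 qed
 show "{} ~: starring K si a" unfolding S by simp
 show "insert {} (starring K si a) = st si a (insert {} K)"
 proof (rule set_eqI)
  fix rh
  show "rh \<in> insert {} (starring K si a) \<longleftrightarrow> rh \<in> st si a (insert {} K)"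
  proof (cases "a \<in> rh")
   case True
   have "rh - {a} Un si ~= {}" "si <= rh - {a} \<longleftrightarrow> si <= rh" "rh ~: K" using s(1) as True K(3) by auto
   then show ?thesis using True unfolding insert_iff[of rh] S J st_def by auto
  next
   case False
   then have "rh - {a} = rh" by blast
   moreover have "rh \<in> K" if "rh Un si \<in> K" "rh ~= {}" using cx_sub[OF c(1), of "rh Un si" rh] that by blast
   ultimately show ?thesis using False s(1) unfolding insert_iff[of rh] S J st_def by auto
  qed
 qed
qed

text \<open>Star moves correspond by \<open>starring_st\<close>, and an isomorphism becomes a
  sequence of starrings at single vertices (\<open>seq_rename\<close>).\<close>

lemma stellar_seq:
 fixes K :: "'v::infinite set set"
 assumes K: "{} ~: K" "cx (insert {} K)"
 shows "stellar_equivalent K K' \<longleftrightarrow> seq {{}} (insert {} K) (insert {} K') & {} ~: K'"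
proof
 have mv: "seq {{}} (insert {} X) (insert {} X') & {} ~: X & {} ~: X'" if "stellar_move X X'" for X X' :: "'v set set"
  using that
 proof cases
  case (star si a)
  then have X: "cx (insert {} X)" "{} ~: X" unfolding abs_cx by blast+
  have "smv {{}} (insert {} X) (st si a (insert {} X))" using X star(3,4) by (intro smvI) auto
  then show ?thesis using starring_st[OF star(2-4)] X star(1) seq1 by metis
 next
  case (iso f)
  then have X: "cx (insert {} X)" "{} ~: X" unfolding abs_cx by blast+
  have "seq {{}} (insert {} X) (im f (insert {} X))" using iso(3) by (intro seq_rename[OF X(1)]) simp
  then show ?thesis using X(2) iso(1) by auto
 qed
 assume "stellar_equivalent K K'"
 then have "equivclp stellar_move K K'" by (simp add: stellar_equivalent_def)
 then show "seq {{}} (insert {} K) (insert {} K') & {} ~: K'"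
 proof (induction rule: equivclp_induct)
  case base show ?case using K(1) by simp
 next
  case (step y z)
  from step(2) show ?case using mv[of y z] mv[of z y] step(3) seq_trans seq_sym by blast
 qed
next
 assume a: "seq {{}} (insert {} K) (insert {} K') & {} ~: K'"
 then have "seq {{}} (insert {} K) (insert {} K')" ..
 then have "equivclp stellar_move (insert {} K - {{}}) (insert {} K' - {{}}) & {} \<in> insert {} K'"
 proof (induction rule: equivclp_induct)
  case base show ?case by (simp add: equivclp_def)
 next
  case (step y z)
  have mv: "stellar_move (X - {{}}) (X' - {{}})" if "smv {{}} X X'" for X X' :: "'v set set"
  proof -
   from that obtain si a where *: "cx X" "si \<in> X" "si ~= {}" "a ~: \<Union>X" "X' = st si a X" unfolding smv_def by blast
   have i: "insert {} (X - {{}}) = X" using *(1) by (simp add: insert_absorb)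
   have ab: "abs_complex (X - {{}})" unfolding abs_cx using *(1) i by simp
   have s: "si \<in> X - {{}}" "a ~: \<Union>(X - {{}})" using * by auto
   have "starring (X - {{}}) si a = X' - {{}}" using starring_st[OF ab s] unfolding i *(5) by blast
   then show ?thesis using stellar_move.star[OF ab s] by simp
  qed
  have zc: "{} \<in> z" using step(2) by (auto dest: smv_cx)
  have "equivclp stellar_move (y - {{}}) (z - {{}})" using step(2) mv r_into_equivclp equivclp_sym by metis
  from equivclp_trans[OF step(3)[THEN conjunct1] this] zc show ?case by (rule conjI)
 qed
 moreover have "insert {} K - {{}} = K" "insert {} K' - {{}} = K'" using K(1) a by blast+
 ultimately show "stellar_equivalent K K'" by (simp add: stellar_equivalent_def)
qed

lemma insert_full: "finite V ==> insert {} (full_simplex V) = Pow V"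
 by (auto simp: full_simplex_def intro: finite_subset)

lemma insert_boundary: "finite V ==> V ~= {} ==> insert {} (simplex_boundary V) = bd V"
 by (auto simp: simplex_boundary_def full_simplex_def bd_def intro: finite_subset)

lemma empty_notin: "{} ~: full_simplex V" "{} ~: simplex_boundary V"
 by (auto simp: simplex_boundary_def full_simplex_def)

lemma stellar_ball_bal:
 fixes K :: "'v::infinite set set"
 shows "stellar_ball d K \<longleftrightarrow> bal d (insert {} K) & {} ~: K"
proof -
 have "stellar_equivalent (full_simplex V) K \<longleftrightarrow> seq {{}} (Pow V) (insert {} K) & {} ~: K" if "finite V" for V
  using stellar_seq[OF empty_notin(1), of V K] cx_Pow[OF that] unfolding insert_full[OF that] by blast
 then show ?thesis unfolding stellar_ball_def bal_def by (auto cong: conj_cong)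
qed

lemma stellar_sphere_sph:
 fixes K :: "'v::infinite set set"
 shows "stellar_sphere d K \<longleftrightarrow> sph d (insert {} K) & {} ~: K"
proof -
 have "stellar_equivalent (simplex_boundary V) K \<longleftrightarrow> seq {{}} (bd V) (insert {} K) & {} ~: K" if "finite V" "V ~= {}" for V
  using stellar_seq[OF empty_notin(2), of V K] cx_bd[OF that] unfolding insert_boundary[OF that] by blast
 then show ?thesis unfolding stellar_sphere_def sph_def by (auto cong: conj_cong)
qed

lemma link_lk:
 assumes K: "cx (insert {} K)" "{} ~: K" "si \<in> K"
 shows "insert {} (link K si) = lk si (insert {} K)" "{} ~: link K si"
proof -
 show "{} ~: link K si" using K(2) by (simp add: link_def)
 show "insert {} (link K si) = lk si (insert {} K)"
 proof (rule set_eqI)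
  fix ta
  have s: "si ~= {}" using K(2,3) by blast
  have "ta \<in> K" if "ta Un si \<in> K" "ta ~= {}" using cx_sub[OF K(1), of "ta Un si" ta] that by blast
  then show "ta \<in> insert {} (link K si) \<longleftrightarrow> ta \<in> lk si (insert {} K)"
   using s K(3) unfolding link_def lk_def by auto
 qed
qed

lemma mb_boundary:
 fixes K :: "'v::infinite set set"
 assumes b: "bal d (insert {} K)" "{} ~: K"
 shows "mb (insert {} K) = insert {} (manifold_boundary K)" "{} ~: manifold_boundary K" "stellar_manifold d K"
proof -
 have c: "cx (insert {} K)" by (rule bal_cx[OF b(1)])
 have s: "stellar_sphere e (link K si) \<longleftrightarrow> sph e (lk si (insert {} K))"
  "stellar_ball e (link K si) \<longleftrightarrow> bal e (lk si (insert {} K))" if "si \<in> K" for si e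
  using stellar_sphere_sph[of e "link K si"] stellar_ball_bal[of e "link K si"] link_lk[OF c b(2) that] by simp_all
 show "{} ~: manifold_boundary K" using b(2) by (simp add: manifold_boundary_def)
 have "{} \<in> mb (insert {} K)" using bal_not_sph[OF b(1)] by (simp add: mb_def)
 moreover have "si \<in> mb (insert {} K) \<longleftrightarrow> si \<in> manifold_boundary K" if "si ~= {}" for si
  using that s(1)[of si] unfolding mb_def manifold_boundary_def by auto
 ultimately have "si \<in> mb (insert {} K) \<longleftrightarrow> si \<in> insert {} (manifold_boundary K)" for si by (cases "si = {}") simp_all
 then show "mb (insert {} K) = insert {} (manifold_boundary K)" by (rule set_eqI)
 have "sph (d - 1) (lk {v} (insert {} K)) \<or> bal (d - 1) (lk {v} (insert {} K))" if "{v} \<in> K" for v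
  using bsD(2,3)[OF bal_bs[OF b(1)], of "{v}"] that by auto
 moreover have "{v} \<in> K" if "v \<in> \<Union>K" for v using cx_vertex[OF c, of v] that by simp
 ultimately show "stellar_manifold d K" unfolding stellar_manifold_def abs_cx using c b(2) s by blast
qed

section \<open>Translation of stellar simplexes and arrows\<close>

definition aug :: "(nat set => 'v set set) => nat set => 'v set set" where
 "aug A X = insert {} (A X)"

lemma full_iff: "(X :: nat set) \<in> full_simplex {0..n} \<longleftrightarrow> X <= {0..n} & X ~= {}"
proof -
 have "finite X" if "X <= {0..n}" using finite_subset[OF that] by simp
 then show ?thesis by (auto simp: full_simplex_def)
qed

lemma stellar_SS:
 fixes A :: "nat set => 'v::infinite set set"
 assumes e: "\<And>X. X ~: full_simplex {0..n} ==> A X = {}" and n: "\<And>X. {} ~: A X"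
 shows "stellar_simplex n A \<longleftrightarrow> SS n (aug A)"
proof -
 have A0: "A {} = {}" using e[of "{}"] by (simp add: full_simplex_def)
 have 1: "stellar_ball (int (card X) - 1) (A X) \<longleftrightarrow> bal (int (card X) - 1) (aug A X)" for X
  unfolding stellar_ball_bal aug_def using n by simp
 have U: "(\<Union>Z\<in>{Z. Z < X}. aug A Z) = insert {} (\<Union>Z\<in>{Z. Z < X}. A Z)" if "X ~= {}" for X
  using that unfolding aug_def by blast
 have 2: "manifold_boundary (A X) = (\<Union>Z\<in>{Z. Z < X}. A Z) \<longleftrightarrow> mb (aug A X) = (\<Union>Z\<in>{Z. Z < X}. aug A Z)"
  if "X ~= {}" "bal d (aug A X)" for X d
 proof -
  note m = mb_boundary[OF that(2)[unfolded aug_def] n]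
  have "{} ~: (\<Union>Z\<in>{Z. Z < X}. A Z)" using n by blast
  then show ?thesis unfolding U[OF that(1)] unfolding aug_def m(1) using m(2) by (metis insert_ident)
 qed
 have 3: "A (X Int Y) = A X Int A Y \<longleftrightarrow> aug A (X Int Y) = aug A X Int aug A Y" for X Y
  unfolding aug_def using n[of X] n[of Y] n[of "X Int Y"] by (metis Int_iff insert_ident insert_inter_insert)
 have 4: "aug A (X Int Y) = aug A X Int aug A Y" if "X = {} \<or> Y = {}" for X Y
  using that A0 unfolding 3[symmetric] by auto
 show ?thesis
 proof
  assume s: "stellar_simplex n A"
  note c = s[unfolded stellar_simplex_def]
  note s2 = c[THEN conjunct2, THEN conjunct1, rule_format]
   and s3 = c[THEN conjunct2, THEN conjunct2, THEN conjunct1, rule_format]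
   and s4 = c[THEN conjunct2, THEN conjunct2, THEN conjunct2, rule_format]
  have b: "bal (int (card X) - 1) (aug A X)" if "X <= {0..n}" "X ~= {}" for X
   using s2[of X] that unfolding 1 full_iff by simp
  have "mb (aug A X) = (\<Union>Z\<in>{Z. Z < X}. aug A Z)" if X: "X <= {0..n}" "X ~= {}" for X
   using s4[of X] X 2[OF X(2) b[OF X]] unfolding full_iff by simp
  moreover have "aug A (X Int Y) = aug A X Int aug A Y" if "X <= {0..n}" "Y <= {0..n}" for X Y
   using s3[of X Y] that 4[of X Y] unfolding 3 full_iff by (cases "X = {} \<or> Y = {}") simp_all
  ultimately show "SS n (aug A)" unfolding SS_def using b A0 by (simp add: aug_def)
 next
  assume s: "SS n (aug A)"
  show "stellar_simplex n A"
   unfolding stellar_simplex_def 1 3 full_iff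
  proof (intro conjI allI impI ballI)
   fix X assume "~ (X <= {0..n} & X ~= {})" then show "A X = {}" using e unfolding full_iff by blast
  next
   fix X assume X: "X \<in> full_simplex {0..n}"
   then have X': "X <= {0..n}" "X ~= {}" unfolding full_iff by blast+
   show b: "bal (int (card X) - 1) (aug A X)" by (rule SS_bal[OF s X'])
   show "manifold_boundary (A X) = (\<Union>Z\<in>{Z. Z < X}. A Z)" using SS_mb[OF s X'] 2[OF X'(2) b] by blast
   fix Y assume "Y \<in> full_simplex {0..n}"
   then have "Y <= {0..n}" unfolding full_iff by blast
   then show "aug A (X Int Y) = aug A X Int aug A Y" by (rule SS_Int[OF s X'(1)])
  qed
 qed
qed

lemma stellar_simplexD:
 fixes A :: "nat set => 'v::infinite set set"
 assumes s: "stellar_simplex n A"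
 shows "{} ~: A X" "X ~: full_simplex {0..n} ==> A X = {}" "SS n (aug A)" "total A = A {0..n}"
proof -
 show e: "A X = {}" if "X ~: full_simplex {0..n}" for X
  using s[unfolded stellar_simplex_def, THEN conjunct1] that by simp
 show n: "{} ~: A X" for X
 proof (cases "X \<in> full_simplex {0..n}")
  case True
  then have "stellar_ball (int (card X) - 1) (A X)" using s unfolding stellar_simplex_def by blast
  then show ?thesis unfolding stellar_ball_bal by blast
 qed (use e in simp)
 show S: "SS n (aug A)" using stellar_SS[of n A] e n s by blast
 have "A X <= A {0..n}" for X
 proof (cases "X \<in> full_simplex {0..n}")
  case True
  then have "X <= {0..n}" unfolding full_iff by blast
  then have "aug A X <= aug A {0..n}" using SS_mono[OF S] by blast
  then show ?thesis unfolding aug_def using n by blast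
 qed (use e in simp)
 then show "total A = A {0..n}" unfolding total_def by blast
qed

lemma aug_verts: "\<Union>(aug A X) = \<Union>(A X)"
 by (simp add: aug_def)

lemma insert_sd: assumes "{} ~: K" "finite K" shows "insert {} (sd K) = im bary (ord K)"
proof (rule set_eqI)
 fix rh
 have "rh \<in> im bary (ord K) \<longleftrightarrow> (\<exists>c. rh = bary ` c & c <= K & finite c & chain_subset c)" unfolding ord_def by blast
 also have "\<dots> \<longleftrightarrow> rh = {} \<or> (\<exists>c. rh = bary ` c & c <= K & finite c & c ~= {} & chain_subset c)"
  by (auto simp: chain_subset_def)
 also have "\<dots> \<longleftrightarrow> rh \<in> insert {} (sd K)" unfolding sd_def by blast
 finally show "rh \<in> insert {} (sd K) \<longleftrightarrow> rh \<in> im bary (ord K)" by simp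
qed

lemma aug_sd:
 assumes s: "stellar_simplex n A" shows "aug (sd_family A) = sdA (aug A)"
proof
 fix X
 have n: "{} ~: A X" by (rule stellar_simplexD(1)[OF s])
 have "finite (A X)"
 proof (cases "X \<in> full_simplex {0..n}")
  case True
  then have "X <= {0..n}" unfolding full_iff by blast
  then have "finite (aug A X)" using cx_finite[OF SS_cx[OF stellar_simplexD(3)[OF s]]] by blast
  then show ?thesis by (simp add: aug_def)
 qed (simp add: stellar_simplexD(2)[OF s])
 from insert_sd[OF n this] show "aug (sd_family A) X = sdA (aug A) X"
  using n by (simp add: aug_def sd_family_def sdA_def sdF_def)
qed

lemma stellar_sd:
 assumes s: "stellar_simplex n A" shows "stellar_simplex n (sd_family A)"
proof -
 have "SS n (sdA (aug A))" using sdA_iso(1)[OF stellar_simplexD(3)[OF s]] celD(2) by blast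
 moreover have "sd_family A X = {}" if "X ~: full_simplex {0..n}" for X
  using stellar_simplexD(2)[OF s that] by (auto simp: sd_family_def sd_def)
 moreover have "{} ~: sd_family A X" for X by (auto simp: sd_family_def sd_def)
 ultimately show ?thesis using stellar_SS[of n "sd_family A"] unfolding aug_sd[OF s] by blast
qed

lemma stellar_sd_pow: "stellar_simplex n A ==> stellar_simplex n ((sd_family ^^ k) A)"
 by (induction k) (auto intro: stellar_sd)

text \<open>The least member of a chain has the smallest image, so the condition on it holds exactly
  if it holds for all members.\<close>

lemma dual_cell_ord:
 assumes "finite K" "{} ~: K" "si ~= {}"
 shows "insert {} (dual_cell si K f) = im bary (ord {ta \<in> insert {} K. si <= f ` ta})" "{} ~: dual_cell si K f"
proof -
 show "{} ~: dual_cell si K f" by (auto simp: dual_cell_def)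
 have P: "{ta \<in> insert {} K. si <= f ` ta} = {ta \<in> K. si <= f ` ta}" using assms(3) by auto
 let ?P = "{ta \<in> K. si <= f ` ta}"
 have "c <= K & si <= f ` (\<Inter>c) \<longleftrightarrow> c <= ?P" if c: "finite c" "c ~= {}" "chain_subset c" for c
 proof
  assume a: "c <= K & si <= f ` (\<Inter>c)"
  have "si <= f ` ta" if "ta \<in> c" for ta
  proof -
   have "f ` (\<Inter>c) <= f ` ta" by (rule image_mono) (use that in blast)
   then show ?thesis using a by blast
  qed
  then show "c <= ?P" using a by blast
 next
  assume "c <= ?P"
  then show "c <= K & si <= f ` (\<Inter>c)" using chain_ends(2)[OF c] by blast
 qed
 then have "dual_cell si K f = {bary ` c | c. c <= ?P & finite c & c ~= {} & chain_subset c}"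
  unfolding dual_cell_def by (intro Collect_cong ex_cong1) blast
 then have "dual_cell si K f = sd ?P" unfolding sd_def .
 then show "insert {} (dual_cell si K f) = im bary (ord {ta \<in> insert {} K. si <= f ` ta})"
  unfolding P using insert_sd[of ?P] assms(1,2) by simp
qed

text \<open>Dual cells are injective images under \<open>bary\<close> of the order complexes in
  \<open>cel\<close>, so the two are balls together; strata of stellar simplexes are manifolds by
  \<open>mb_boundary\<close>. From here on arrows are treated through \<open>cel\<close>.\<close>

lemma C_star_cel:
 "f \<in> C_star n \<longleftrightarrow> stellar_simplex n (src f) & stellar_simplex n (tgt f) &
  fn f \<in> extensional (\<Union>(total (src f))) & cel n (aug (src f)) (aug (tgt f)) (fn f)"
proof (cases "stellar_simplex n (src f) & stellar_simplex n (tgt f)")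
 case False
 then show ?thesis by (auto simp: C_star_def R_star_def)
next
 case True
 let ?A = "src f" and ?B = "tgt f" and ?f = "fn f"
 note A = stellar_simplexD[of n ?A] and B = stellar_simplexD[of n ?B]
 have SA: "SS n (aug ?A)" and SB: "SS n (aug ?B)" using True A(3) B(3) by blast+
 have nA: "{} ~: ?A X" and nB: "{} ~: ?B X" for X using True A(1) B(1) by blast+
 have im: "im ?f (?A X) = ?B X \<longleftrightarrow> im ?f (aug ?A X) = aug ?B X" for X
 proof -
  have "{} ~: im ?f (?A X)" using nA[of X] by auto
  then show ?thesis unfolding aug_def image_insert image_empty using nB[of X] by (metis insert_ident)
 qed
 have im0: "im ?f (aug ?A {}) = aug ?B {}" using SS_empty[OF SA] SS_empty[OF SB] by simp
 have dc: "(\<exists>d. stellar_ball d (dual_cell si (?A X) ?f)) \<longleftrightarrow> (\<exists>d. bal d (ord {ta \<in> aug ?A X. si <= ?f ` ta}))"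
  if X: "X <= {0..n}" and s: "si ~= {}" for si X
 proof -
  have c: "cx (aug ?A X)" by (rule SS_cx[OF SA X])
  then have fin: "finite (?A X)" using cx_finite[OF c] by (simp add: aug_def)
  note d = dual_cell_ord[OF fin nA s, of ?f, folded aug_def]
  have inj: "inj_on bary (\<Union>(ord {ta \<in> aug ?A X. si <= ?f ` ta}))"
   unfolding ord_vertices by (rule inj_on_inverseI[of _ unb]) (use cx_face_finite[OF c] unb_bary in blast)
  have "cx (ord {ta \<in> aug ?A X. si <= ?f ` ta})" using cx_finite[OF c] by (intro cx_ord) simp
  from bal_im[OF this inj] show ?thesis unfolding stellar_ball_bal d(1) using d(2) by simp
 qed
 have mA: "\<exists>d. stellar_manifold d (?A X)" and mB: "\<exists>d. stellar_manifold d (?B X)" if "X <= {0..n}" "X ~= {}" for X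
  using mb_boundary(3)[OF SS_bal[OF SA that, unfolded aug_def] nA] mb_boundary(3)[OF SS_bal[OF SB that, unfolded aug_def] nB] by blast+
 have sm: "simplicial_map (?A X) (?B X) ?f" if "im ?f (?A X) = ?B X" for X
  using that unfolding simplicial_map_def by blast
 have cell: "cellular (?A X) (?B X) ?f \<longleftrightarrow> (\<forall>rh\<in>aug ?B X. rh ~= {} --> (\<exists>d. bal d (ord {ta \<in> aug ?A X. rh <= ?f ` ta})))"
  if X: "X <= {0..n}" "X ~= {}" "im ?f (?A X) = ?B X" for X
 proof -
  define R where "R rh \<longleftrightarrow> (\<exists>d. bal d (ord {ta \<in> aug ?A X. rh <= ?f ` ta}))" for rh
  have ne: "si ~= {}" if "si \<in> ?B X" for si using nB[of X] that by metis
  have "(\<forall>si\<in>?B X. \<exists>d. stellar_ball d (dual_cell si (?A X) ?f)) \<longleftrightarrow> (\<forall>si\<in>?B X. R si)"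
   unfolding R_def by (rule ball_cong[OF refl dc[OF X(1) ne]])
  also have "\<dots> \<longleftrightarrow> (\<forall>rh\<in>aug ?B X. rh ~= {} --> R rh)" using ne by (auto simp: aug_def)
  finally have "(\<forall>si\<in>?B X. \<exists>d. stellar_ball d (dual_cell si (?A X) ?f)) \<longleftrightarrow>
    (\<forall>rh\<in>aug ?B X. rh ~= {} --> (\<exists>d. bal d (ord {ta \<in> aug ?A X. rh <= ?f ` ta})))" unfolding R_def .
  then show ?thesis unfolding cellular_def using mA[OF X(1,2)] mB[OF X(1,2)] sm[OF X(3)] by argo
 qed
 have tot: "total ?A = ?A {0..n}" "total ?B = ?B {0..n}" using True A(4) B(4) by blast+
 have top: "{0..n} <= {0..n}" "{0..n} ~= {}" by simp_all
 show ?thesis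
 proof
  assume f: "f \<in> C_star n"
  then have "f \<in> R_star n" and fc: "\<forall>X\<in>full_simplex {0..n}. cellular (?A X) (?B X) ?f" unfolding C_star_def by simp_all
  then have fi: "\<forall>X\<in>full_simplex {0..n}. im ?f (?A X) = ?B X" and fe: "?f \<in> extensional (\<Union>(total ?A))" unfolding R_star_def by simp_all
  have i: "im ?f (?A X) = ?B X" "cellular (?A X) (?B X) ?f" if "X <= {0..n}" "X ~= {}" for X
   using fi fc that full_iff[of X n] by simp_all
  have "im ?f (aug ?A X) = aug ?B X" if "X <= {0..n}" for X using i(1)[OF that] im[of X] im0 by (cases "X = {}") auto
  moreover have "\<forall>rh\<in>aug ?B X. rh ~= {} --> (\<exists>d. bal d (ord {ta \<in> aug ?A X. rh <= ?f ` ta}))" if X: "X <= {0..n}" "X ~= {}" for X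
   using cell[OF X i(1)[OF X]] i(2)[OF X] by blast
  ultimately have "cel n (aug ?A) (aug ?B) ?f" unfolding cel_def using SA SB by blast
  then show "stellar_simplex n ?A & stellar_simplex n ?B & ?f \<in> extensional (\<Union>(total ?A)) & cel n (aug ?A) (aug ?B) ?f"
   using True fe by simp
 next
  assume a: "stellar_simplex n ?A & stellar_simplex n ?B & ?f \<in> extensional (\<Union>(total ?A)) & cel n (aug ?A) (aug ?B) ?f"
  then have c: "cel n (aug ?A) (aug ?B) ?f" by blast
  have i: "im ?f (?A X) = ?B X" if "X <= {0..n}" for X using celD(3)[OF c that] im[of X] by simp
  have "cellular (?A X) (?B X) ?f" if X: "X <= {0..n}" "X ~= {}" for X
   using cell[OF X i[OF X(1)]] celD(4)[OF c X] by blast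
  moreover have "simplicial_map (total ?A) (total ?B) ?f" unfolding tot by (rule sm[OF i[OF top(1)]])
  ultimately show "f \<in> C_star n" using a i unfolding C_star_def R_star_def by (simp add: full_iff)
 qed
qed

section \<open>Closure properties of cellular arrows\<close>

lemma C_star_comp:
 fixes f g :: "'a vertex arrow"
 assumes "g \<in> C_star n" "f \<in> C_star n" "composable g f"
 shows "g \<odot> f \<in> C_star n"
proof -
 have g: "stellar_simplex n (tgt g)" "cel n (aug (src g)) (aug (tgt g)) (fn g)" and f: "stellar_simplex n (src f)" "cel n (aug (src f)) (aug (tgt f)) (fn f)"
  using assms(1,2) unfolding C_star_cel by blast+
 have "cel n (aug (tgt f)) (aug (tgt g)) (fn g)" using g(2) assms(3) by (simp add: composable_def)
 from cel_comp[OF f(2) this] have "cel n (aug (src f)) (aug (tgt g)) (compose (\<Union>(total (src f))) (fn g) (fn f))"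
  by (rule cel_cong) (use stellar_simplexD(4)[OF f(1)] in \<open>simp add: compose_def aug_verts\<close>)
 then show ?thesis unfolding C_star_cel using f(1) g(1) by (simp add: arrow_comp_def compose_def)
qed

lemma C_star_sd:
 fixes f :: "'a vertex arrow"
 assumes "f \<in> C_star n" shows "arrow_sd f \<in> C_star n"
proof -
 have f: "stellar_simplex n (src f)" "stellar_simplex n (tgt f)" "cel n (aug (src f)) (aug (tgt f)) (fn f)"
  using assms unfolding C_star_cel by blast+
 note S = celD(1,2)[OF f(3)]
 from cel_comp[OF cel_comp[OF sdA_iso(2)[OF S(1)] sd_cel[OF f(3)]] sdA_iso(1)[OF S(2)]]
 have "cel n (aug (sd_family (src f))) (aug (sd_family (tgt f))) (%v. bary (fn f ` unb v))"
  unfolding aug_sd[OF f(1)] aug_sd[OF f(2)] .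
 then have "cel n (aug (sd_family (src f))) (aug (sd_family (tgt f))) (restrict (sd_map (fn f)) (\<Union>(total (sd_family (src f)))))"
  by (rule cel_cong) (use stellar_simplexD(4)[OF stellar_sd[OF f(1)]] in \<open>simp add: aug_verts sd_map_def unb_def\<close>)
 then show ?thesis unfolding C_star_cel using stellar_sd[OF f(1)] stellar_sd[OF f(2)] by (simp add: arrow_sd_def)
qed

lemma cel_id: fixes A :: "nat set => 'v::infinite set set" assumes "SS n A" shows "cel n A A (%v. v)"
 using cel_iso[OF assms, of "%v. v"] by (simp add: inj_on_def)

lemma C_star_id: fixes A :: "'a vertex family" assumes "stellar_simplex n A" shows "arrow_id A \<in> C_star n"
proof -
 have "cel n (aug A) (aug A) (restrict (%v. v) (\<Union>(total A)))"
  by (rule cel_cong[OF cel_id[OF stellar_simplexD(3)[OF assms]]]) (use stellar_simplexD(4)[OF assms] in \<open>simp add: aug_verts\<close>)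
 then show ?thesis unfolding C_star_cel using assms by (simp add: arrow_id_def)
qed

lemma selection_arrow:
 assumes s: "stellar_simplex n M" and t: "\<And>ta. ta \<in> total M ==> t (bary ta) \<in> ta"
 shows "cel n (aug (sd_family M)) (aug M) t"
proof -
 note S = stellar_simplexD(3)[OF s]
 have T: "aug M {0..n} = insert {} (total M)" using stellar_simplexD(4)[OF s] by (simp add: aug_def)
 have "cel n (sdF (aug M)) (aug M) (%ta. t (bary ta))" by (rule selection_cel[OF S]) (use t T in auto)
 from cel_comp[OF sdA_iso(2)[OF S] this] have "cel n (sdA (aug M)) (aug M) (%v. t (bary (unb v)))" .
 then show ?thesis unfolding aug_sd[OF s]
  by (rule cel_cong) (use unb_bary[OF cx_face_finite[OF SS_cx[OF S subset_refl]]] in \<open>auto simp: sdA_verts\<close>)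
qed

lemma C_star_elem:
 fixes A :: "'a vertex family"
 assumes A: "stellar_simplex n A" and s: "s \<in> elem_selections A" shows "s \<in> C_star n"
proof -
 obtain k where k: "src s = (sd_family ^^ Suc k) A" "tgt s = (sd_family ^^ k) A"
  "fn s \<in> extensional (\<Union>(total (src s)))" "elementary_selection (total (tgt s)) (fn s)" using s unfolding elem_selections_def by blast
 have st: "stellar_simplex n (tgt s)" unfolding k(2) by (rule stellar_sd_pow[OF A])
 have e: "src s = sd_family (tgt s)" using k(1,2) by simp
 have "cel n (aug (sd_family (tgt s))) (aug (tgt s)) (fn s)"
  by (rule selection_arrow[OF st]) (use k(4) in \<open>simp add: elementary_selection_def\<close>)
 then show ?thesis unfolding C_star_cel using st stellar_sd[OF st] k(3) unfolding e by blast
qed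

lemma selections_C_star:
 fixes A :: "'a vertex family"
 assumes A: "stellar_simplex n A" shows "selections A <= C_star n"
proof
 fix f assume "f \<in> selections A" then show "f \<in> C_star n"
  by induction (auto intro: C_star_elem[OF A] C_star_id[OF A] C_star_comp C_star_sd)
qed

lemma selections_objects:
 assumes "f \<in> selections A"
 shows "(\<exists>j. src f = (sd_family ^^ j) A) & (\<exists>j. tgt f = (sd_family ^^ j) A)"
 using assms
proof induction
 case (elem s) then show ?case unfolding elem_selections_def by blast
next
 case ident
 have "A = (sd_family ^^ 0) A" by simp
 then show ?case unfolding arrow_id_def by (metis arrow.select_convs(1,2))
next
 case (comp g f) then show ?case by (simp add: arrow_comp_def)
next
 case (sd f)
 then obtain i j where "src f = (sd_family ^^ i) A" "tgt f = (sd_family ^^ j) A" by blast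
 then have "src (arrow_sd f) = (sd_family ^^ Suc i) A" "tgt (arrow_sd f) = (sd_family ^^ Suc j) A" by (simp_all add: arrow_sd_def)
 then show ?case by blast
qed

lemma comps_selections: "f \<in> elem_selection_comps A ==> f \<in> selections A"
 by (induction rule: elem_selection_comps.induct) (auto intro: selections.intros)

lemma comps_shift:
 assumes "f \<in> elem_selection_comps ((sd_family ^^ j) A)" shows "f \<in> elem_selection_comps A"
 using assms
proof (induction rule: elem_selection_comps.induct)
 case (elem s)
 then obtain k where k: "src s = (sd_family ^^ (Suc k + j)) A" "tgt s = (sd_family ^^ (k + j)) A"
  "fn s \<in> extensional (\<Union>(total (src s)))" "elementary_selection (total (tgt s)) (fn s)"
  unfolding elem_selections_def funpow_add comp_apply by blast
 then have "s \<in> elem_selections A" unfolding elem_selections_def by (metis (mono_tags, lifting) add_Suc mem_Collect_eq)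
 then show ?case by (rule elem_selection_comps.elem)
qed (rule elem_selection_comps.comp)

section \<open>Domination for arrows\<close>

lemma elem_arrow:
 fixes A :: "'a vertex family"
 assumes A: "stellar_simplex n A" and t: "\<And>ta. ta \<in> total ((sd_family ^^ k) A) ==> t (bary ta) \<in> ta"
 shows "\<lparr>src = (sd_family ^^ Suc k) A, tgt = (sd_family ^^ k) A,
  fn = restrict t (\<Union>(total ((sd_family ^^ Suc k) A)))\<rparr> \<in> elem_selections A"
proof -
 let ?M = "(sd_family ^^ k) A"
 have M: "stellar_simplex n ?M" by (rule stellar_sd_pow[OF A])
 let ?V = "\<Union>(total (sd_family ?M))" and ?t = "restrict t (\<Union>(total (sd_family ?M)))"
 have tot: "total (sd_family ?M) = sd (total ?M)"
  using stellar_simplexD(4)[OF M] stellar_simplexD(4)[OF stellar_sd[OF M]] by (simp add: sd_family_def)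
 have b: "bary ta \<in> ?V" if "ta \<in> total ?M" for ta
 proof -
  have "bary ` {ta} \<in> sd (total ?M)" unfolding sd_def using that by (fastforce simp: chain_subset_def)
  then show ?thesis unfolding tot by auto
 qed
 have c: "cel n (aug (sd_family ?M)) (aug ?M) t" by (rule selection_arrow[OF M t])
 have "simplicial_map (sd (total ?M)) (total ?M) ?t"
  unfolding simplicial_map_def
 proof
  fix rh assume r: "rh \<in> sd (total ?M)"
  then have "rh <= ?V" unfolding tot by blast
  then have e: "?t ` rh = t ` rh" by (intro image_cong) auto
  have "rh \<in> aug (sd_family ?M) {0..n}" using r stellar_simplexD(4)[OF stellar_sd[OF M]] unfolding tot[symmetric] aug_def by simp
  then have "t ` rh \<in> aug ?M {0..n}" using celD(3)[OF c subset_refl] by blast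
  moreover have "rh ~= {}" using r unfolding sd_def by auto
  ultimately show "?t ` rh \<in> total ?M" unfolding e stellar_simplexD(4)[OF M] aug_def by simp
 qed
 then have "elementary_selection (total ?M) ?t" unfolding elementary_selection_def using b t by simp
 then show ?thesis unfolding elem_selections_def by (intro CollectI exI[of _ k]) simp
qed

text \<open>\<open>selection_domination\<close> reaches only the first subdivision of
  \<open>B\<close>; the last step down to \<open>B\<close> is the selection
  \<open>s\<close>.\<close>

lemma selc_comps:
 fixes B :: "'a vertex family"
 assumes B: "stellar_simplex n B" and c: "selc n (sdA (aug B)) M w" and s: "\<And>ta. ta \<in> total B ==> s (bary ta) \<in> ta"
 shows "\<exists>k. M = aug ((sd_family ^^ Suc k) B) & \<lparr>src = (sd_family ^^ Suc k) B, tgt = B,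
  fn = restrict (%v. s (w v)) (\<Union>(total ((sd_family ^^ Suc k) B)))\<rparr> \<in> elem_selection_comps B"
 using c
proof (induction rule: selc.induct)
 case base
 have z: "(sd_family ^^ 0) B = B" by simp
 have e: "\<lparr>src = (sd_family ^^ Suc 0) B, tgt = B, fn = restrict (%v. s v) (\<Union>(total ((sd_family ^^ Suc 0) B)))\<rparr> \<in> elem_selections B"
  using elem_arrow[OF B, where k = 0 and t = s, unfolded z, OF s] .
 show ?case by (intro exI[of _ 0] conjI elem_selection_comps.elem[OF e]) (simp add: aug_sd[OF B])
next
 case (step M w t)
 then obtain k where k: "M = aug ((sd_family ^^ Suc k) B)" and p: "\<lparr>src = (sd_family ^^ Suc k) B, tgt = B,
  fn = restrict (%v. s (w v)) (\<Union>(total ((sd_family ^^ Suc k) B)))\<rparr> \<in> elem_selection_comps B" (is "?p \<in> _") by blast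
 let ?M = "(sd_family ^^ Suc k) B" and ?M' = "(sd_family ^^ Suc (Suc k)) B"
 have sM: "stellar_simplex n ?M" by (rule stellar_sd_pow[OF B])
 have tM: "t (bary ta) \<in> ta" if "ta \<in> total ?M" for ta
  using step(2)[of ta] that stellar_simplexD(1,4)[OF sM] unfolding k aug_def by auto
 let ?e = "\<lparr>src = ?M', tgt = ?M, fn = restrict t (\<Union>(total ?M'))\<rparr>"
 have e: "?e \<in> elem_selections B" by (rule elem_arrow[OF B tM])
 have co: "composable ?p ?e" by (simp add: composable_def)
 have tV: "t v \<in> \<Union>(total ?M)" if v: "v \<in> \<Union>(total ?M')" for v
 proof -
  have "?M' = sd_family ?M" by simp
  then have "aug ?M' = sdA (aug ?M)" using aug_sd[OF sM] by simp
  then have "v \<in> \<Union>(sdA (aug ?M) {0..n})"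
   using v stellar_simplexD(4)[OF stellar_sd_pow[OF B, of "Suc (Suc k)"]] by (metis aug_verts)
  then obtain ta where "ta \<in> total ?M" "v = bary ta" unfolding sdA_verts using stellar_simplexD(4)[OF sM] by (auto simp: aug_def)
  then show ?thesis using tM by blast
 qed
 have "?p \<odot> ?e = \<lparr>src = ?M', tgt = B, fn = restrict (%v. s (w (t v))) (\<Union>(total ?M'))\<rparr>"
 proof -
  have "compose (\<Union>(total ?M')) (restrict (%v. s (w v)) (\<Union>(total ?M))) (restrict t (\<Union>(total ?M'))) = restrict (%v. s (w (t v))) (\<Union>(total ?M'))"
   unfolding compose_def using tV by (intro restrict_ext) (simp only: restrict_apply if_True)
  then show ?thesis unfolding arrow_comp_def by simp
 qed
 then have "\<lparr>src = ?M', tgt = B, fn = restrict (%v. s (w (t v))) (\<Union>(total ?M'))\<rparr> \<in> elem_selection_comps B"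
  using elem_selection_comps.comp[OF p elem_selection_comps.elem[OF e] co] by simp
 moreover have "sdA M = aug ?M'" unfolding k aug_sd[OF sM, symmetric] by simp
 ultimately show ?case by blast
qed

text \<open>\<open>selection_domination\<close> gives the factorisation over the subdivided map. A
  selection \<open>s\<close> on \<open>B\<close> lifts along the arrow to a selection
  \<open>s'\<close> on \<open>A\<close>, which brings the factorisation down to the arrow
  itself.\<close>

theorem cellular_domination:
 fixes f :: "'a vertex arrow"
 assumes f: "f \<in> C_star n"
 shows "\<exists>g\<in>C_star n. composable f g & f \<odot> g \<in> elem_selection_comps (tgt f) & (\<exists>k. src g = (sd_family ^^ k) (tgt f))"
proof -
 let ?A = "src f" and ?B = "tgt f" and ?f = "fn f"
 have F: "stellar_simplex n ?A" "stellar_simplex n ?B" "cel n (aug ?A) (aug ?B) ?f"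
  using f unfolding C_star_cel by blast+
 obtain M w g where M: "selc n (sdA (aug ?B)) M w" "cel n M (sdA (aug ?A)) g" "\<And>v. v \<in> \<Union>(M {0..n}) ==> bary (?f ` unb (g v)) = w v"
  using selection_domination[OF F(3)] by blast
 have tA: "total ?A = ?A {0..n}" "total ?B = ?B {0..n}" using stellar_simplexD(4) F(1,2) by blast+
 have finA: "finite ta" if "ta \<in> total ?A" for ta
  using cx_face_finite[OF SS_cx[OF stellar_simplexD(3)[OF F(1)] subset_refl]] that tA by (simp add: aug_def)
 have finB: "finite ta" if "ta \<in> total ?B" for ta
  using cx_face_finite[OF SS_cx[OF stellar_simplexD(3)[OF F(2)] subset_refl]] that tA by (simp add: aug_def)
 define s where "s v = (SOME y. y \<in> unb v)" for v :: "'a vertex"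
 \<comment> \<open>In each face of \<open>?A\<close> select a vertex whose image is the one that
   \<open>s\<close> selects in the image face.\<close>
 define s' where "s' v = (SOME y. y \<in> unb v & ?f y = s (bary (?f ` unb v)))" for v
 have s: "s (bary ta) \<in> ta" if "ta \<in> total ?B" for ta
 proof -
  have "ta ~= {}" using stellar_simplexD(1)[OF F(2)] that tA by metis
  then show ?thesis unfolding s_def unb_bary[OF finB[OF that]] by (simp add: some_in_eq)
 qed
 have s': "s' (bary ta) \<in> ta & ?f (s' (bary ta)) = s (bary (?f ` ta))" if t: "ta \<in> total ?A" for ta
 proof -
  have "ta ~= {}" using stellar_simplexD(1)[OF F(1)] t tA by metis
  have "ta \<in> aug ?A {0..n}" using t tA by (simp add: aug_def)
  then have "?f ` ta \<in> im ?f (aug ?A {0..n})" by (rule imageI)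
  then have "?f ` ta \<in> aug ?B {0..n}" unfolding celD(3)[OF F(3) subset_refl] .
  moreover have "ta ~= {}" by fact
  ultimately have "?f ` ta \<in> total ?B" using tA by (simp add: aug_def)
  then have "s (bary (?f ` ta)) \<in> ?f ` ta" by (rule s)
  then have "\<exists>y. y \<in> ta & ?f y = s (bary (?f ` ta))" by force
  from someI_ex[OF this] show ?thesis unfolding s'_def unb_bary[OF finA[OF t]] .
 qed
 obtain k where k: "M = aug ((sd_family ^^ Suc k) ?B)" and p: "\<lparr>src = (sd_family ^^ Suc k) ?B, tgt = ?B,
  fn = restrict (%v. s (w v)) (\<Union>(total ((sd_family ^^ Suc k) ?B)))\<rparr> \<in> elem_selection_comps ?B"
  using selc_comps[OF F(2) M(1) s] by blast
 let ?M = "(sd_family ^^ Suc k) ?B"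
 have sM: "stellar_simplex n ?M" by (rule stellar_sd_pow[OF F(2)])
 have VM: "\<Union>(total ?M) = \<Union>(M {0..n})" unfolding k aug_verts stellar_simplexD(4)[OF sM] ..
 define h where "h = \<lparr>src = ?M, tgt = ?A, fn = restrict (%v. s' (g v)) (\<Union>(total ?M))\<rparr>"
 have "cel n (sdA (aug ?A)) (aug ?A) s'" using selection_arrow[OF F(1), of s'] s' unfolding aug_sd[OF F(1)] by blast
 from cel_comp[OF M(2) this] have "cel n (aug ?M) (aug ?A) (%v. s' (g v))" unfolding k .
 then have "cel n (aug ?M) (aug ?A) (restrict (%v. s' (g v)) (\<Union>(total ?M)))"
  by (rule cel_cong) (use stellar_simplexD(4)[OF sM] in \<open>simp add: aug_verts del: funpow.simps\<close>)
 then have hC: "h \<in> C_star n" unfolding C_star_cel h_def using sM F(1) by (simp del: funpow.simps)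
 have val: "?f (s' (g v)) = s (w v)" if v: "v \<in> \<Union>(total ?M)" for v
 proof -
  have vM: "v \<in> \<Union>(M {0..n})" using v unfolding VM .
  then have "g v \<in> \<Union>(im g (M {0..n}))" by blast
  then have "g v \<in> bary ` (aug ?A {0..n} - {{}})" unfolding celD(3)[OF M(2) subset_refl] sdA_verts .
  then obtain ta where t: "ta \<in> total ?A" "g v = bary ta" using tA by (auto simp: aug_def)
  have "w v = bary (?f ` ta)" using M(3)[OF vM] unfolding t(2) unb_bary[OF finA[OF t(1)]] by simp
  then show ?thesis using s'[OF t(1)] t(2) by simp
 qed
 have "f \<odot> h = \<lparr>src = ?M, tgt = ?B, fn = restrict (%v. s (w v)) (\<Union>(total ?M))\<rparr>"
 proof -
  have "compose (\<Union>(total ?M)) ?f (restrict (%v. s' (g v)) (\<Union>(total ?M))) = restrict (%v. s (w v)) (\<Union>(total ?M))"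
   unfolding compose_def using val by (intro restrict_ext) (simp only: restrict_apply if_True)
  then show ?thesis unfolding arrow_comp_def h_def by (simp del: funpow.simps)
 qed
 then have "f \<odot> h \<in> elem_selection_comps ?B" using p by simp
 moreover have "composable f h" by (simp add: composable_def h_def)
 moreover have "src h = ?M" by (simp only: h_def arrow.select_convs)
 ultimately show ?thesis using hC by blast
qed

section \<open>The standard simplex and the final theorem\<close>

lemma stellar_std: "stellar_simplex n (std_simplex n :: 'a vertex family)"
proof -
 let ?A = "std_simplex n :: 'a vertex family"
 have P: "inj_on Pt U" for U by (simp add: inj_on_def)
 have e: "?A X = {}" if "X ~: full_simplex {0..n}" for X
  using that unfolding full_iff by (auto simp: std_simplex_def full_simplex_def)
 have n: "{} ~: ?A X" for X by (simp add: std_simplex_def full_simplex_def)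
 have a: "aug ?A X = Pow (Pt ` X)" if "X <= {0..n}" for X
  using that insert_full[of "Pt ` X"] finite_subset[OF that] by (simp add: aug_def std_simplex_def)
 have "SS n (aug ?A)"
  unfolding SS_def
 proof (intro conjI allI impI)
  show "aug ?A {} = {{}}" using a[of "{}"] by simp
  fix X assume X: "X <= {0..n}" "X ~= {}"
  then have f: "finite (Pt ` X :: 'a vertex set)" "(Pt ` X :: 'a vertex set) ~= {}" "card (Pt ` X :: 'a vertex set) = card X"
   using finite_subset[OF X(1)] card_image[OF P] by auto
  show "bal (int (card X) - 1) (aug ?A X)" using bal_Pow[OF f(1,2)] unfolding a[OF X(1)] f(3) .
  have "(\<Union>Z\<in>{Z. Z < X}. aug ?A Z) = (\<Union>Z\<in>{Z. Z < X}. Pow (Pt ` Z) :: 'a vertex set set)"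
   by (rule SUP_cong) (use a X(1) in auto)
  also have "\<dots> = bd (Pt ` X)"
  proof
   show "(\<Union>Z\<in>{Z. Z < X}. Pow (Pt ` Z)) <= bd (Pt ` X :: 'a vertex set)"
   proof
    fix rh :: "'a vertex set" assume "rh \<in> (\<Union>Z\<in>{Z. Z < X}. Pow (Pt ` Z))"
    then obtain Z where Z: "Z < X" "rh <= Pt ` Z" by blast
    then have "Pt ` Z ~= (Pt ` X :: 'a vertex set)" "(Pt ` Z :: 'a vertex set) <= Pt ` X" using inj_on_image_eq_iff[OF P[of X], of Z X] by auto
    then show "rh \<in> bd (Pt ` X)" using Z(2) unfolding bd_def by blast
   qed
   show "bd (Pt ` X) <= (\<Union>Z\<in>{Z. Z < X}. Pow (Pt ` Z) :: 'a vertex set set)"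
   proof
    fix rh :: "'a vertex set" assume "rh \<in> bd (Pt ` X)"
    then have r: "rh <= Pt ` X" "rh ~= Pt ` X" unfolding bd_def by blast+
    then obtain Z where "Z <= X" "rh = Pt ` Z" by (auto simp: subset_image_iff)
    then show "rh \<in> (\<Union>Z\<in>{Z. Z < X}. Pow (Pt ` Z))" using r(2) by blast
   qed
  qed
  finally show "mb (aug ?A X) = (\<Union>Z\<in>{Z. Z < X}. aug ?A Z)" unfolding a[OF X(1)] bs_Pow(2)[OF f(1,2)] by simp
 next
  fix X Y :: "nat set" assume XY: "X <= {0..n}" "Y <= {0..n}"
  have "X Int Y <= {0..n}" using XY by blast
  moreover have "Pt ` (X Int Y) = (Pt ` X Int Pt ` Y :: 'a vertex set)" by (rule image_Int) (simp add: inj_on_def)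
  ultimately show "aug ?A (X Int Y) = aug ?A X Int aug ?A Y" unfolding a[OF XY(1)] a[OF XY(2)] using a by (simp add: Pow_Int_eq)
 qed
 then show ?thesis using stellar_SS[of n ?A] e n by blast
qed

lemma std_sd: "A \<in> std_objects n ==> (sd_family ^^ k) A \<in> std_objects n"
 unfolding std_objects_def by (auto simp: funpow_add[symmetric, THEN fun_cong, simplified] intro: exI[of _ "k + _"])

theorem theorem6p6:
  fixes n :: nat
  shows "(S_star n :: 'a vertex arrow set) \<subseteq> C_star n \<and>
         (S_std n :: 'a vertex arrow set) \<subseteq> C_std n \<and>
         (C_star n :: 'a vertex arrow set) \<subseteq> dom_closure (R_star n) (S_star n) \<and>
         (C_std n :: 'a vertex arrow set) \<subseteq> dom_closure (R_std n) (S_std n) \<and>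
         (\<forall>f \<in> (C_star n :: 'a vertex arrow set). \<exists>g \<in> C_star n. composable f g \<and>
            (\<exists>A. stellar_simplex n A \<and>
               (f \<odot> g \<in> elem_selection_comps A \<or> f \<odot> g = arrow_id A))) \<and>
         (\<forall>f \<in> (C_std n :: 'a vertex arrow set). \<exists>g \<in> C_std n. composable f g \<and>
            (f \<odot> g \<in> elem_selection_comps (std_simplex n) \<or>
             (\<exists>A \<in> std_objects n. f \<odot> g = arrow_id A)))"
proof -
 have 1: "(S_star n :: 'a vertex arrow set) <= C_star n" unfolding S_star_def using selections_C_star by blast
 have 2: "(S_std n :: 'a vertex arrow set) <= C_std n"
 proof
  fix f :: "'a vertex arrow" assume f: "f \<in> S_std n"
  then have "f \<in> C_star n" unfolding S_std_def using selections_C_star[OF stellar_std] by blast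
  moreover have "src f \<in> std_objects n" "tgt f \<in> std_objects n"
   using selections_objects[of f "std_simplex n"] f unfolding S_std_def std_objects_def by blast+
  ultimately show "f \<in> C_std n" by (simp add: C_std_def)
 qed
 have 5: "\<exists>g \<in> C_star n. composable f g & stellar_simplex n (tgt f) & f \<odot> g \<in> elem_selection_comps (tgt f)"
  if "f \<in> C_star n" for f :: "'a vertex arrow"
  using cellular_domination[OF that] that unfolding C_star_cel[of f] by blast
 have 6: "\<exists>g \<in> C_std n. composable f g & f \<odot> g \<in> elem_selection_comps (std_simplex n)"
  if f: "f \<in> C_std n" for f :: "'a vertex arrow"
 proof -
  have fC: "f \<in> C_star n" and o: "src f \<in> std_objects n" "tgt f \<in> std_objects n" using f unfolding C_std_def by blast+
  obtain g k where g: "g \<in> C_star n" "composable f g" "f \<odot> g \<in> elem_selection_comps (tgt f)" "src g = (sd_family ^^ k) (tgt f)"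
   using cellular_domination[OF fC] by blast
  obtain j where "tgt f = (sd_family ^^ j) (std_simplex n)" using o(2) unfolding std_objects_def by blast
  then have "f \<odot> g \<in> elem_selection_comps (std_simplex n)" using g(3) comps_shift by metis
  \<comment> \<open>The source of \<open>g\<close> is an iterated subdivision of the target of
    \<open>f\<close>, so \<open>g\<close> stays among standard objects.\<close>
  moreover have "src g \<in> std_objects n" unfolding g(4) by (rule std_sd[OF o(2)])
  moreover have "tgt g \<in> std_objects n" using g(2) o(1) by (simp add: composable_def)
  ultimately show ?thesis using g(1,2) unfolding C_std_def by blast
 qed
 have C: "g \<odot> f \<in> C_std n" if "g \<in> C_std n" "f \<in> C_std n" "composable g f" for f g :: "'a vertex arrow"
  using that C_star_comp[of g n f] unfolding C_std_def by (simp add: arrow_comp_def)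
 \<comment> \<open>The set of cellular arrows itself witnesses membership in the domination
   closure.\<close>
 have "dominating (S_star n) (C_star n :: 'a vertex arrow set)"
  unfolding dominating_def
 proof (intro conjI ballI impI)
  fix f g :: "'a vertex arrow" assume "f \<in> S_star n" "g \<in> C_star n" "composable g f"
  then show "g \<odot> f \<in> C_star n" using 1 C_star_comp by blast
 next
  fix f :: "'a vertex arrow" assume "f \<in> C_star n"
  from 5[OF this] show "\<exists>g\<in>C_star n. composable f g & f \<odot> g \<in> S_star n"
   unfolding S_star_def using comps_selections by blast
 qed
 moreover have "(C_star n :: 'a vertex arrow set) <= R_star n" unfolding C_star_def by blast
 ultimately have 3: "(C_star n :: 'a vertex arrow set) <= dom_closure (R_star n) (S_star n)" unfolding dom_closure_def by blast
 have "dominating (S_std n) (C_std n :: 'a vertex arrow set)"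
  unfolding dominating_def
 proof (intro conjI ballI impI)
  fix f g :: "'a vertex arrow" assume "f \<in> S_std n" "g \<in> C_std n" "composable g f"
  then show "g \<odot> f \<in> C_std n" using 2 C by blast
 next
  fix f :: "'a vertex arrow" assume "f \<in> C_std n"
  from 6[OF this] show "\<exists>g\<in>C_std n. composable f g & f \<odot> g \<in> S_std n"
   unfolding S_std_def using comps_selections by blast
 qed
 moreover have "(C_std n :: 'a vertex arrow set) <= R_std n" unfolding C_std_def R_std_def C_star_def by blast
 ultimately have 4: "(C_std n :: 'a vertex arrow set) <= dom_closure (R_std n) (S_std n)" unfolding dom_closure_def by blast
 show ?thesis using 1 2 3 4 5 6 by blast
qed

end
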